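(* Let $s>2$, $p\in\mathbb{N}$ and $\alpha\in\mathbb{R}$. For every $\phi\in H^s(\mathbb{R}^2)$ there exist $T>0$, depending only on $\|\phi\|_s$, and a unique $$u\in C([0,T],H^s(\mathbb{R}^2))\cap C^1([0,T],H^{s-2}(\mathbb{R}^2))$$ solution to the Cauchy problem $$\begin{cases} u_t+\mathcal H\partial_x^2u+\alpha\,\mathcal H\partial_y^2u+u^pu_x=0,\\ u(0)=\phi.\end{cases}$$ Furthermore, the map $\phi\mapsto u$ from $H^s(\mathbb{R}^2)$ to $C([0,T],H^s(\mathbb{R}^2))$ is continuous.
   Context: Functions are real-valued and $\mathbb{N}=\{1,2,3,\dots\}$. $H^s(\mathbb{R}^2)$ is the Sobolev space of order $s$ with norm $\|f\|_s^2=\int_{\mathbb{R}^2}(1+\xi^2+\eta^2)^s|\widehat f(\xi,\eta)|^2\,d\xi\,d\eta$. $\mathcal H$ is the Hilbert transform in the variable $x$, i.e. the Fourier multiplier $\widehat{\mathcal H f}(\xi,\eta)=i\,\mathrm{sgn}(\xi)\widehat f(\xi,\eta)$, where $\widehat f(\xi,\eta)=\frac1{2\pi}\int f(x,y)e^{-i(x\xi+y\eta)}\,dx\,dy$. The equation is understood as an identity in $H^{s-2}(\mathbb{R}^2)$ for each $t\in[0,T]$. Continuity of $\phi\mapsto u$ is understood in the following sense: if $\phi_n\to\phi$ in $H^s$, then $T>0$ can be chosen so that the solution $u$ with data $\phi$ and the solutions $u_n$ with data $\phi_n$ (for $n$ large) all exist on $[0,T]$, and $\sup_{t\in[0,T]}\|u_n(t)-u(t)\|_s\to0$.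 *)

theory Defs
  imports "HOL-Analysis.Analysis"
begin

type_synonym plane = "real \<times> real"

(* Elements of L^2 and H^s are handled through Borel representatives, so identities between
   them are identities almost everywhere with respect to lborel. *)

definition square_integrable :: "(plane \<Rightarrow> 'b::{real_normed_vector, second_countable_topology}) \<Rightarrow> bool"
  where "square_integrable f \<longleftrightarrow>
    f \<in> borel_measurable lborel \<and> integrable lborel (\<lambda>z. (norm (f z))\<^sup>2)"

definition fourier_integral :: "(plane \<Rightarrow> real) \<Rightarrow> plane \<Rightarrow> complex"
  where "fourier_integral f \<zeta> =
    complex_of_real (1 / (2 * pi)) *
      (LINT z|lborel. complex_of_real (f z) *
         exp (- \<i> * complex_of_real (fst z * fst \<zeta> + snd z * snd \<zeta>)))"

(* Fourier transform on L^2: the defining integral converges only for integrable functions, so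
   the transform is the L^2-limit of the transforms of the truncations to balls. The mean square
   distance is a nonnegative integral, hence infinite where the difference is not in L^2. *)

definition has_fourier_transform :: "(plane \<Rightarrow> real) \<Rightarrow> (plane \<Rightarrow> complex) \<Rightarrow> bool"
  where "has_fourier_transform f g \<longleftrightarrow>
    square_integrable f \<and> square_integrable g \<and>
    (\<lambda>n::nat. \<integral>\<^sup>+\<zeta>. ennreal
        ((cmod (fourier_integral (\<lambda>z. indicator (cball 0 (real n)) z * f z) \<zeta> - g \<zeta>))\<^sup>2)
        \<partial>lborel) \<longlonglongrightarrow> 0"

(* By Plancherel's theorem a transform exists for every f in L^2, and it is unique almost
   everywhere. *)

definition fourier :: "(plane \<Rightarrow> real) \<Rightarrow> plane \<Rightarrow> complex"
  where "fourier f = (SOME g. has_fourier_transform f g)"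

definition sobolev_density :: "real \<Rightarrow> (plane \<Rightarrow> real) \<Rightarrow> plane \<Rightarrow> real"
  where "sobolev_density s f \<zeta> =
    (1 + (fst \<zeta>)\<^sup>2 + (snd \<zeta>)\<^sup>2) powr s * (cmod (fourier f \<zeta>))\<^sup>2"

(* The real-valued Sobolev space for orders s >= 0 only, where H^s is contained in L^2; elements
   of negative order need not be functions. *)

definition sobolev_space :: "real \<Rightarrow> (plane \<Rightarrow> real) set"
  where "sobolev_space s = {f. square_integrable f \<and> integrable lborel (sobolev_density s f)}"

definition sobolev_norm :: "real \<Rightarrow> (plane \<Rightarrow> real) \<Rightarrow> real"
  where "sobolev_norm s f = sqrt (LINT \<zeta>|lborel. sobolev_density s f \<zeta>)"

definition is_hilbert_transform :: "(plane \<Rightarrow> real) \<Rightarrow> (plane \<Rightarrow> real) \<Rightarrow> bool"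
  where "is_hilbert_transform f g \<longleftrightarrow>
    square_integrable f \<and> square_integrable g \<and>
    (AE \<zeta> in lborel. fourier g \<zeta> = \<i> * complex_of_real (sgn (fst \<zeta>)) * fourier f \<zeta>)"

primrec C_k :: "nat \<Rightarrow> (plane \<Rightarrow> real) \<Rightarrow> bool"
  where
    "C_k 0 f \<longleftrightarrow> continuous_on UNIV f"
  | "C_k (Suc k) f \<longleftrightarrow>
      (\<forall>z. f differentiable (at z)) \<and> (\<forall>v. C_k k (\<lambda>z. frechet_derivative f (at z) v))"

definition test_function :: "(plane \<Rightarrow> real) \<Rightarrow> bool"
  where "test_function \<psi> \<longleftrightarrow> (\<forall>k. C_k k \<psi>) \<and> compact (closure {z. \<psi> z \<noteq> 0})"

(* g is the distributional derivative of f in the direction e, both being in L^2;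
   e = (1, 0) gives the x-derivative and e = (0, 1) the y-derivative. *)

definition is_weak_derivative :: "plane \<Rightarrow> (plane \<Rightarrow> real) \<Rightarrow> (plane \<Rightarrow> real) \<Rightarrow> bool"
  where "is_weak_derivative e f g \<longleftrightarrow>
    square_integrable f \<and> square_integrable g \<and>
    (\<forall>\<psi>. test_function \<psi> \<longrightarrow>
      (LINT z|lborel. f z * frechet_derivative \<psi> (at z) e) = - (LINT z|lborel. g z * \<psi> z))"

definition sobolev_continuous :: "real \<Rightarrow> real \<Rightarrow> (real \<Rightarrow> plane \<Rightarrow> real) \<Rightarrow> bool"
  where "sobolev_continuous s T u \<longleftrightarrow>
    (\<forall>t\<in>{0..T}. u t \<in> sobolev_space s \<and>
      ((\<lambda>r. sobolev_norm s (\<lambda>z. u r z - u t z)) \<longlongrightarrow> 0) (at t within {0..T}))"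

(* u is in C^1([0,T], H^s) with time derivative u'; the derivative is one-sided at 0 and T. *)

definition sobolev_C1 ::
    "real \<Rightarrow> real \<Rightarrow> (real \<Rightarrow> plane \<Rightarrow> real) \<Rightarrow> (real \<Rightarrow> plane \<Rightarrow> real) \<Rightarrow> bool"
  where "sobolev_C1 s T u u' \<longleftrightarrow>
    sobolev_continuous s T u \<and> sobolev_continuous s T u' \<and>
    (\<forall>t\<in>{0..T}.
      ((\<lambda>r. sobolev_norm s (\<lambda>z. (u r z - u t z) / (r - t) - u' t z)) \<longlongrightarrow> 0)
        (at t within {0..T}))"

(* w' + H w_xx + \<alpha> H w_yy + w^p w_x = 0 as an identity in H^s, for a fixed time. The summand w'
   is the time derivative. *)

definition equation_holds ::
    "real \<Rightarrow> nat \<Rightarrow> real \<Rightarrow> (plane \<Rightarrow> real) \<Rightarrow> (plane \<Rightarrow> real) \<Rightarrow> bool"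
  where "equation_holds s p \<alpha> w w' \<longleftrightarrow>
    (\<exists>wx wxx wy wyy Hwxx Hwyy.
      is_weak_derivative (1, 0) w wx \<and> is_weak_derivative (1, 0) wx wxx \<and>
      is_weak_derivative (0, 1) w wy \<and> is_weak_derivative (0, 1) wy wyy \<and>
      is_hilbert_transform wxx Hwxx \<and> is_hilbert_transform wyy Hwyy \<and>
      w' \<in> sobolev_space s \<and> Hwxx \<in> sobolev_space s \<and> Hwyy \<in> sobolev_space s \<and>
      (\<lambda>z. w z ^ p * wx z) \<in> sobolev_space s \<and>
      (AE z in lborel. w' z + Hwxx z + \<alpha> * Hwyy z + w z ^ p * wx z = 0))"

definition is_solution ::
    "real \<Rightarrow> nat \<Rightarrow> real \<Rightarrow> real \<Rightarrow> (plane \<Rightarrow> real) \<Rightarrow> (real \<Rightarrow> plane \<Rightarrow> real) \<Rightarrow> bool"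
  where "is_solution s p \<alpha> T \<phi> u \<longleftrightarrow>
    sobolev_continuous s T u \<and>
    (\<exists>u'. sobolev_C1 (s - 2) T u u' \<and>
      (\<forall>t\<in>{0..T}. equation_holds (s - 2) p \<alpha> (u t) (u' t))) \<and>
    (AE z in lborel. u 0 z = \<phi> z)"

definition is_unique_solution ::
    "real \<Rightarrow> nat \<Rightarrow> real \<Rightarrow> real \<Rightarrow> (plane \<Rightarrow> real) \<Rightarrow> (real \<Rightarrow> plane \<Rightarrow> real) \<Rightarrow> bool"
  where "is_unique_solution s p \<alpha> T \<phi> u \<longleftrightarrow>
    is_solution s p \<alpha> T \<phi> u \<and>
    (\<forall>v. is_solution s p \<alpha> T \<phi> v \<longrightarrow> (\<forall>t\<in>{0..T}. AE z in lborel. v t z = u t z))"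

end

theory Submission
  imports Defs "HOL-Probability.Probability"
begin

text \<open>The whole analysis takes place in frequency space, where the equation reads
  \<open>v' = i \<omega> v - N v\<close> with a real symbol \<open>\<omega>\<close> and a convolution operator \<open>N\<close>. The linear part
  is skew, so it drops out of every energy estimate. Since \<open>s - 1 > 1\<close>, the functions \<open>u\<close> and
  \<open>u\<^sub>x\<close> have integrable transforms; with a commutator estimate this gives
  \<open>\<bar>\<langle>W N v, W v\<rangle>\<bar> \<le> K \<parallel>v\<parallel>\<^sub>s\<^sup>p \<parallel>W v\<parallel>\<^sup>2\<close> for the weight of \<open>H\<^sup>s\<close> and, with the same \<open>K\<close>,
  for a family of weights \<open>W\<^sub>R\<close> that agree with it at frequencies beyond \<open>R\<close> and are small below.
  Cutting off the frequencies leaves an ordinary differential equation with a locally Lipschitz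
  right-hand side. Its solutions exist for a time depending on \<open>\<parallel>\<phi>\<parallel>\<^sub>s\<close> only and converge in \<open>L\<^sup>2\<close>,
  by the energy estimate for differences. The weights \<open>W\<^sub>R\<close> show that the part of the solution at high
  frequencies is small in \<open>H\<^sup>s\<close> uniformly in time and in the data, and this turns \<open>L\<^sup>2\<close> continuity,
  in time and with respect to the data, into \<open>H\<^sup>s\<close> continuity.\<close>

text \<open>The obstacle is the loss of derivatives: u^p u_x lies in H^(s - 1), and the linear
  group, an isometry of each H^s, regains nothing. A sharp cut-off at R would have no useful
  commutator with multiplication. The factor \<open>min 1 (r / R)\<close> in the weights grows so
  slowly that doubling and commutator constants are the same for every R. The constants 2 and ln 4
  belong together: on the time interval chosen squared norms grow by a factor of at most 4, norms by
  at most 2, so data in the ball of radius r stay in the ball of radius 2 r, for all weights at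
  once. H^s enters only through weights on the single real Hilbert space \<open>G\<close>. The
  definitions of the statement are translated into this form at the end, which takes Plancherel's
  theorem, inversion on L^2 and the uniqueness of weak derivatives.\<close>

abbreviation bmeas :: "('a::topological_space \<Rightarrow> 'b::topological_space) \<Rightarrow> bool"
  where "bmeas f \<equiv> f \<in> borel_measurable borel"

section \<open>Norm bounds and convolutions\<close>

lemma nn_integral_lborel_shift:
  fixes f :: "'a::euclidean_space \<Rightarrow> ennreal"
  assumes [measurable]: "bmeas f"
  shows "(\<integral>\<^sup>+x. f (a + x) \<partial>lborel) = (\<integral>\<^sup>+x. f x \<partial>lborel)"
proof -
  have "(\<integral>\<^sup>+x. f x \<partial>lborel) = (\<integral>\<^sup>+x. f x \<partial>(distr lborel borel ((+) a)))"
    by (simp add: lborel_distr_plus)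
  also have "\<dots> = (\<integral>\<^sup>+x. f (a + x) \<partial>lborel)" by (subst nn_integral_distr) auto
  finally show ?thesis by simp
qed

lemma lborel_distr_reflect:
  fixes a :: "'a::euclidean_space"
  shows "distr lborel borel (\<lambda>x. a - x) = lborel"
proof -
  show ?thesis using lborel_affine[of "-1" a] by (simp add: density_1)
qed

lemma nn_integral_lborel_reflect:
  fixes f :: "'a::euclidean_space \<Rightarrow> ennreal"
  assumes [measurable]: "bmeas f"
  shows "(\<integral>\<^sup>+x. f (a - x) \<partial>lborel) = (\<integral>\<^sup>+x. f x \<partial>lborel)"
proof -
  have "(\<integral>\<^sup>+x. f x \<partial>lborel) = (\<integral>\<^sup>+x. f x \<partial>(distr lborel borel (\<lambda>x. a - x)))"
    by (simp add: lborel_distr_reflect)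
  also have "\<dots> = (\<integral>\<^sup>+x. f (a - x) \<partial>lborel)" by (subst nn_integral_distr) auto
  finally show ?thesis by simp
qed

lemma integral_lborel_reflect:
  fixes f :: "'a::euclidean_space \<Rightarrow> 'b::{banach,second_countable_topology}"
  assumes [measurable]: "bmeas f"
  shows "(LINT x|lborel. f (a - x)) = (LINT x|lborel. f x)"
proof -
  have "(LINT x|lborel. f x) = (LINT x|(distr lborel borel (\<lambda>x. a - x)). f x)"
    by (simp add: lborel_distr_reflect)
  also have "\<dots> = (LINT x|lborel. f (a - x))" by (subst integral_distr) auto
  finally show ?thesis by simp
qed

lemma integrable_lborel_reflect:
  fixes f :: "'a::euclidean_space \<Rightarrow> 'b::{banach,second_countable_topology}"
  assumes "integrable lborel f"
  shows "integrable lborel (\<lambda>x. f (a - x))"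
proof -
  have [measurable]: "bmeas f" using assms by auto
  have "integrable (distr lborel borel (\<lambda>x. a - x)) f" using assms by (simp add: lborel_distr_reflect)
  then show ?thesis by (subst (asm) integrable_distr_eq) auto
qed

lemma integral_lborel_shift:
  fixes f :: "'a::euclidean_space \<Rightarrow> 'b::{banach,second_countable_topology}"
  assumes [measurable]: "bmeas f"
  shows "(LINT x|lborel. f (a + x)) = (LINT x|lborel. f x)"
proof -
  have "(LINT x|lborel. f x) = (LINT x|(distr lborel borel ((+) a)). f x)"
    by (simp add: lborel_distr_plus)
  also have "\<dots> = (LINT x|lborel. f (a + x))" by (subst integral_distr) auto
  finally show ?thesis by simp
qed

lemma integrable_lborel_shift:
  fixes f :: "'a::euclidean_space \<Rightarrow> 'b::{banach,second_countable_topology}"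
  assumes "integrable lborel f"
  shows "integrable lborel (\<lambda>x. f (a + x))"
proof -
  have [measurable]: "bmeas f" using assms by auto
  have "integrable (distr lborel borel ((+) a)) f" using assms by (simp add: lborel_distr_plus)
  then show ?thesis by (subst (asm) integrable_distr_eq) auto
qed

lemma nn_integral_fubini_lborel:
  fixes f :: "'a::euclidean_space \<Rightarrow> 'b::euclidean_space \<Rightarrow> ennreal"
  assumes "case_prod f \<in> borel_measurable (borel \<Otimes>\<^sub>M borel)"
  shows "(\<integral>\<^sup>+x. \<integral>\<^sup>+y. f x y \<partial>lborel \<partial>lborel) = (\<integral>\<^sup>+y. \<integral>\<^sup>+x. f x y \<partial>lborel \<partial>lborel)"
proof -
  show ?thesis
    by (rule lborel_pair.Fubini'[symmetric])
     (use assms in \<open>simp cong: measurable_cong_sets add: sets_pair_measure_cong[OF sets_lborel sets_lborel]\<close>)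
qed

lemma cnj_borel_measurable [measurable]: "bmeas cnj"
  by (intro borel_measurable_continuous_onI continuous_intros)

lemma ennreal_le_of_power2_le:
  assumes "x\<^sup>2 \<le> ennreal (c\<^sup>2)" "0 \<le> c"
  shows "x \<le> ennreal c"
proof (cases x)
  case (real r)
  then have "ennreal (r\<^sup>2) \<le> ennreal (c\<^sup>2)" using assms by (simp add: ennreal_power)
  then have "r\<^sup>2 \<le> c\<^sup>2" by (simp add: ennreal_le_iff)
  then show ?thesis using real assms by (auto intro!: ennreal_leI power2_le_imp_le)
next
  case top
  then show ?thesis using assms by (simp add: power2_eq_square ennreal_mult_top top_unique)
qed

section \<open>Bounds in L^1 and L^2 for functions with values in [0, \<infinity>], and Young's
  inequality\<close>

definition l1n :: "(plane \<Rightarrow> ennreal) \<Rightarrow> real \<Rightarrow> bool"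
  where "l1n \<alpha> A \<longleftrightarrow> bmeas \<alpha> \<and> 0 \<le> A \<and> (\<integral>\<^sup>+z. \<alpha> z \<partial>lborel) \<le> ennreal A"

definition l2n :: "(plane \<Rightarrow> ennreal) \<Rightarrow> real \<Rightarrow> bool"
  where "l2n \<alpha> A \<longleftrightarrow> bmeas \<alpha> \<and> 0 \<le> A \<and> (\<integral>\<^sup>+z. (\<alpha> z)\<^sup>2 \<partial>lborel) \<le> ennreal (A\<^sup>2)"

text \<open>Values in [0, \<infinity>] make this convolution total, so that Young's inequality has
  no integrability side conditions; \<open>conv_le_nc\<close> carries it over to complex
  functions.\<close>

definition nc :: "(plane \<Rightarrow> ennreal) \<Rightarrow> (plane \<Rightarrow> ennreal) \<Rightarrow> plane \<Rightarrow> ennreal"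
  where "nc \<alpha> \<beta> \<zeta> = (\<integral>\<^sup>+\<eta>. \<alpha> (\<zeta> - \<eta>) * \<beta> \<eta> \<partial>lborel)"

lemma l1nD [dest]: "l1n \<alpha> A \<Longrightarrow> bmeas \<alpha>" "l1n \<alpha> A \<Longrightarrow> 0 \<le> A"
  by (auto simp: l1n_def)
lemma l2nD [dest]: "l2n \<alpha> A \<Longrightarrow> bmeas \<alpha>" "l2n \<alpha> A \<Longrightarrow> 0 \<le> A"
  by (auto simp: l2n_def)

lemma nc_measurable [measurable]:
  assumes [measurable]: "bmeas \<alpha>" "bmeas \<beta>"
  shows "bmeas (nc \<alpha> \<beta>)"
proof -
  have "bmeas (\<lambda>\<zeta>. (\<integral>\<^sup>+\<eta>. \<alpha> (\<zeta> - \<eta>) * \<beta> \<eta> \<partial>lborel))"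
    by (rule lborel.borel_measurable_nn_integral) measurable
  then show ?thesis by (simp add: nc_def[abs_def])
qed

lemma nc_commute:
  assumes [measurable]: "bmeas \<alpha>" "bmeas \<beta>"
  shows "nc \<alpha> \<beta> = nc \<beta> \<alpha>"
proof
  fix \<zeta>
  have "nc \<alpha> \<beta> \<zeta> = (\<integral>\<^sup>+\<eta>. (\<lambda>x. \<alpha> x * \<beta> (\<zeta> - x)) (\<zeta> - \<eta>) \<partial>lborel)" by (simp add: nc_def)
  also have "\<dots> = nc \<beta> \<alpha> \<zeta>"
    by (subst nn_integral_lborel_reflect) (auto simp: nc_def mult.commute)
  finally show "nc \<alpha> \<beta> \<zeta> = nc \<beta> \<alpha> \<zeta>" .
qed

lemma nn_integral_nc:
  assumes [measurable]: "bmeas \<alpha>" "bmeas \<beta>"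
  shows "(\<integral>\<^sup>+\<zeta>. nc \<alpha> \<beta> \<zeta> \<partial>lborel) = (\<integral>\<^sup>+z. \<alpha> z \<partial>lborel) * (\<integral>\<^sup>+z. \<beta> z \<partial>lborel)"
proof -
  have "(\<integral>\<^sup>+\<zeta>. nc \<alpha> \<beta> \<zeta> \<partial>lborel) = (\<integral>\<^sup>+\<eta>. (\<integral>\<^sup>+\<zeta>. \<alpha> (\<zeta> - \<eta>) * \<beta> \<eta> \<partial>lborel) \<partial>lborel)"
    unfolding nc_def by (rule nn_integral_fubini_lborel) measurable
  also have "\<dots> = (\<integral>\<^sup>+\<eta>. (\<integral>\<^sup>+\<zeta>. \<alpha> (- \<eta> + \<zeta>) \<partial>lborel) * \<beta> \<eta> \<partial>lborel)"
    by (simp add: nn_integral_multc)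
  also have "\<dots> = (\<integral>\<^sup>+\<eta>. (\<integral>\<^sup>+\<zeta>. \<alpha> \<zeta> \<partial>lborel) * \<beta> \<eta> \<partial>lborel)"
    by (subst nn_integral_lborel_shift) auto
  also have "\<dots> = (\<integral>\<^sup>+z. \<alpha> z \<partial>lborel) * (\<integral>\<^sup>+z. \<beta> z \<partial>lborel)" by (simp add: nn_integral_cmult)
  finally show ?thesis .
qed

text \<open>Cauchy-Schwarz for 1 and \<beta> with respect to the measure with density
  \<open>\<alpha> (\<zeta> - \<eta>)\<close>. Integration in \<zeta> then gives Young's inequality
  for L^1 with L^2 (\<open>l2n_nc\<close>).\<close>

lemma nc_power2_le:
  assumes [measurable]: "bmeas \<alpha>" "bmeas \<beta>"
  shows "(nc \<alpha> \<beta> \<zeta>)\<^sup>2 \<le> (\<integral>\<^sup>+z. \<alpha> z \<partial>lborel) * nc \<alpha> (\<lambda>z. (\<beta> z)\<^sup>2) \<zeta>"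
proof -
  let ?M = "density lborel (\<lambda>\<eta>. \<alpha> (\<zeta> - \<eta>))"
  have "(nc \<alpha> \<beta> \<zeta>)\<^sup>2 = (\<integral>\<^sup>+\<eta>. 1 * \<beta> \<eta> \<partial>?M)\<^sup>2" by (simp add: nc_def nn_integral_density)
  also have "\<dots> \<le> (\<integral>\<^sup>+\<eta>. 1\<^sup>2 \<partial>?M) * (\<integral>\<^sup>+\<eta>. (\<beta> \<eta>)\<^sup>2 \<partial>?M)"
    by (rule Cauchy_Schwarz_nn_integral) auto
  also have "(\<integral>\<^sup>+\<eta>. 1\<^sup>2 \<partial>?M) = (\<integral>\<^sup>+\<eta>. \<alpha> (\<zeta> - \<eta>) \<partial>lborel)"
    by (subst nn_integral_density) (auto simp: power2_eq_square)
  also have "\<dots> = (\<integral>\<^sup>+z. \<alpha> z \<partial>lborel)" by (rule nn_integral_lborel_reflect) simp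
  also have "(\<integral>\<^sup>+\<eta>. (\<beta> \<eta>)\<^sup>2 \<partial>?M) = nc \<alpha> (\<lambda>z. (\<beta> z)\<^sup>2) \<zeta>"
    by (subst nn_integral_density) (auto simp: nc_def)
  finally show ?thesis .
qed

lemma l1n_nc: assumes "l1n \<alpha> A" "l1n \<beta> B" shows "l1n (nc \<alpha> \<beta>) (A * B)"
proof -
  have [measurable]: "bmeas \<alpha>" "bmeas \<beta>" using assms by auto
  have "(\<integral>\<^sup>+\<zeta>. nc \<alpha> \<beta> \<zeta> \<partial>lborel) \<le> ennreal A * ennreal B"
    using assms by (simp add: nn_integral_nc l1n_def mult_mono)
  also have "\<dots> = ennreal (A * B)" using assms by (auto simp: ennreal_mult l1n_def)
  finally show ?thesis using assms by (auto simp: l1n_def)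
qed

lemma l2n_nc: assumes "l1n \<alpha> A" "l2n \<beta> B" shows "l2n (nc \<alpha> \<beta>) (A * B)"
proof -
  have [measurable]: "bmeas \<alpha>" "bmeas \<beta>" using assms by auto
  have "(\<integral>\<^sup>+\<zeta>. (nc \<alpha> \<beta> \<zeta>)\<^sup>2 \<partial>lborel) \<le> (\<integral>\<^sup>+\<zeta>. (\<integral>\<^sup>+z. \<alpha> z \<partial>lborel) * nc \<alpha> (\<lambda>z. (\<beta> z)\<^sup>2) \<zeta> \<partial>lborel)"
    by (intro nn_integral_mono nc_power2_le) auto
  also have "\<dots> = (\<integral>\<^sup>+z. \<alpha> z \<partial>lborel) * ((\<integral>\<^sup>+z. \<alpha> z \<partial>lborel) * (\<integral>\<^sup>+z. (\<beta> z)\<^sup>2 \<partial>lborel))"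
    by (simp add: nn_integral_cmult nn_integral_nc)
  also have "\<dots> \<le> ennreal A * (ennreal A * ennreal (B\<^sup>2))"
    using assms by (intro mult_mono) (auto simp: l1n_def l2n_def)
  also have "\<dots> = ennreal ((A * B)\<^sup>2)"
    using assms by (subst ennreal_mult[symmetric], auto simp: l1n_def l2n_def)+ (auto simp: power2_eq_square ac_simps)
  finally show ?thesis using assms by (auto simp: l1n_def l2n_def)
qed

lemma l2n_nc': assumes "l2n \<alpha> A" "l1n \<beta> B" shows "l2n (nc \<alpha> \<beta>) (A * B)"
  using l2n_nc[OF assms(2,1)] assms by (subst nc_commute) (auto simp: mult.commute)

lemma l1n_mono:
  assumes "l1n \<beta> B" "bmeas \<alpha>" "AE z in lborel. \<alpha> z \<le> \<beta> z" "B \<le> B'"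
  shows "l1n \<alpha> B'"
proof -
  have "(\<integral>\<^sup>+z. \<alpha> z \<partial>lborel) \<le> (\<integral>\<^sup>+z. \<beta> z \<partial>lborel)"
    using assms(3) by (rule nn_integral_mono_AE)
  also have "\<dots> \<le> ennreal B'" using assms(1,4) by (auto simp: l1n_def intro: order_trans ennreal_leI)
  finally show ?thesis using assms by (auto simp: l1n_def)
qed

lemma l2n_mono:
  assumes "l2n \<beta> B" "bmeas \<alpha>" "AE z in lborel. \<alpha> z \<le> \<beta> z" "B \<le> B'"
  shows "l2n \<alpha> B'"
proof -
  have "(\<integral>\<^sup>+z. (\<alpha> z)\<^sup>2 \<partial>lborel) \<le> (\<integral>\<^sup>+z. (\<beta> z)\<^sup>2 \<partial>lborel)"
    using assms(3) by (intro nn_integral_mono_AE) (auto elim!: eventually_mono intro: power_mono)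
  also have "\<dots> \<le> ennreal (B'\<^sup>2)" using assms(1,4)
    by (auto simp: l2n_def intro!: order_trans[OF _ ennreal_leI[OF power_mono[of B B']]])
  finally show ?thesis using assms by (auto simp: l2n_def)
qed

lemma l2n_pair:
  assumes "l2n \<alpha> A" "l2n \<beta> B"
  shows "(\<integral>\<^sup>+z. \<alpha> z * \<beta> z \<partial>lborel) \<le> ennreal (A * B)"
proof (rule ennreal_le_of_power2_le)
  have [measurable]: "bmeas \<alpha>" "bmeas \<beta>" using assms by auto
  have "(\<integral>\<^sup>+z. \<alpha> z * \<beta> z \<partial>lborel)\<^sup>2 \<le> (\<integral>\<^sup>+z. (\<alpha> z)\<^sup>2 \<partial>lborel) * (\<integral>\<^sup>+z. (\<beta> z)\<^sup>2 \<partial>lborel)"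
    by (rule Cauchy_Schwarz_nn_integral) auto
  also have "\<dots> \<le> ennreal (A\<^sup>2) * ennreal (B\<^sup>2)"
    using assms by (intro mult_mono) (auto simp: l2n_def)
  also have "\<dots> = ennreal ((A * B)\<^sup>2)" by (simp add: ennreal_mult[symmetric] power_mult_distrib)
  finally show "(\<integral>\<^sup>+z. \<alpha> z * \<beta> z \<partial>lborel)\<^sup>2 \<le> ennreal ((A * B)\<^sup>2)" .
qed (use assms in \<open>auto simp: l2n_def\<close>)

lemma l1n_prod: "l2n \<alpha> A \<Longrightarrow> l2n \<beta> B \<Longrightarrow> l1n (\<lambda>z. \<alpha> z * \<beta> z) (A * B)"
  using l2n_pair[of \<alpha> A \<beta> B] by (auto simp: l1n_def l2n_def)

lemma l2n_add: assumes "l2n \<alpha> A" "l2n \<beta> B" shows "l2n (\<lambda>z. \<alpha> z + \<beta> z) (A + B)"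
proof -
  have [measurable]: "bmeas \<alpha>" "bmeas \<beta>" using assms by auto
  have AB: "0 \<le> A" "0 \<le> B" using assms by auto
  have "(\<integral>\<^sup>+z. (\<alpha> z + \<beta> z)\<^sup>2 \<partial>lborel) = (\<integral>\<^sup>+z. (\<alpha> z)\<^sup>2 + (2 * (\<alpha> z * \<beta> z) + (\<beta> z)\<^sup>2) \<partial>lborel)"
    by (intro nn_integral_cong) (simp add: power2_eq_square ring_distribs ac_simps mult_2 flip: mult_2)
  also have "\<dots> = (\<integral>\<^sup>+z. (\<alpha> z)\<^sup>2 \<partial>lborel) + (2 * (\<integral>\<^sup>+z. \<alpha> z * \<beta> z \<partial>lborel) + (\<integral>\<^sup>+z. (\<beta> z)\<^sup>2 \<partial>lborel))"
    by (simp add: nn_integral_add nn_integral_cmult)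
  also have "\<dots> \<le> ennreal (A\<^sup>2) + (2 * ennreal (A * B) + ennreal (B\<^sup>2))"
    using assms l2n_pair[OF assms] by (intro add_mono mult_left_mono) (auto simp: l2n_def)
  also have "2 * ennreal (A * B) = ennreal (2 * (A * B))" using AB by (simp add: ennreal_mult)
  also have "ennreal (A\<^sup>2) + (ennreal (2 * (A * B)) + ennreal (B\<^sup>2)) = ennreal ((A + B)\<^sup>2)"
    using AB by (simp add: ennreal_plus[symmetric] power2_eq_square algebra_simps del: ennreal_plus)
  finally show ?thesis using assms AB by (auto simp: l2n_def)
qed

lemma l2n_cmult: assumes "l2n \<alpha> A" "0 \<le> c" shows "l2n (\<lambda>z. ennreal c * \<alpha> z) (c * A)"
proof -
  have [measurable]: "bmeas \<alpha>" using assms by auto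
  have "(\<integral>\<^sup>+z. (ennreal c * \<alpha> z)\<^sup>2 \<partial>lborel) = ennreal (c\<^sup>2) * (\<integral>\<^sup>+z. (\<alpha> z)\<^sup>2 \<partial>lborel)"
    using assms by (simp add: power_mult_distrib nn_integral_cmult ennreal_power)
  also have "\<dots> \<le> ennreal (c\<^sup>2) * ennreal (A\<^sup>2)" using assms by (auto simp: l2n_def intro: mult_left_mono)
  also have "\<dots> = ennreal ((c * A)\<^sup>2)" by (simp add: ennreal_mult[symmetric] power_mult_distrib)
  finally show ?thesis using assms by (auto simp: l2n_def)
qed

text \<open>The real number in \<open>l1b\<close>, \<open>l2b\<close> and later \<open>hb\<close> is an upper bound for the norm, not the norm itself;
  finiteness of the norm is part of the statement.\<close>

definition l1b :: "(plane \<Rightarrow> complex) \<Rightarrow> real \<Rightarrow> bool"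
  where "l1b f A \<longleftrightarrow> bmeas f \<and> l1n (\<lambda>z. ennreal (cmod (f z))) A"

definition l2b :: "(plane \<Rightarrow> complex) \<Rightarrow> real \<Rightarrow> bool"
  where "l2b f A \<longleftrightarrow> bmeas f \<and> l2n (\<lambda>z. ennreal (cmod (f z))) A"

lemma l1b_measurable: "l1b f A \<Longrightarrow> bmeas f" by (auto simp: l1b_def)
lemma l2b_measurable: "l2b f A \<Longrightarrow> bmeas f" by (auto simp: l2b_def)
lemma l1b_nonneg: "l1b f A \<Longrightarrow> 0 \<le> A" by (auto simp: l1b_def)
lemma l2b_nonneg: "l2b f A \<Longrightarrow> 0 \<le> A" by (auto simp: l2b_def)
lemma l1b_n: "l1b f A \<Longrightarrow> l1n (\<lambda>z. ennreal (cmod (f z))) A" by (auto simp: l1b_def)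
lemma l2b_n: "l2b f A \<Longrightarrow> l2n (\<lambda>z. ennreal (cmod (f z))) A" by (auto simp: l2b_def)

lemma l1b_mono:
  assumes "l1b g B" "bmeas f" "AE z in lborel. cmod (f z) \<le> cmod (g z)" "B \<le> B'"
  shows "l1b f B'"
  using assms(3) by (auto simp: l1b_def assms(2) intro!: l1n_mono[OF l1b_n[OF assms(1)] _ _ assms(4)] measurable_compose[OF assms(2)] elim!: eventually_mono intro: ennreal_leI)

lemma l2b_mono:
  assumes "l2b g B" "bmeas f" "AE z in lborel. cmod (f z) \<le> cmod (g z)" "B \<le> B'"
  shows "l2b f B'"
  using assms(3) by (auto simp: l2b_def assms(2) intro!: l2n_mono[OF l2b_n[OF assms(1)] _ _ assms(4)] measurable_compose[OF assms(2)] elim!: eventually_mono intro: ennreal_leI)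

lemma l1b_integrable: "l1b f A \<Longrightarrow> integrable lborel f"
  by (rule integrableI_bounded) (auto simp: l1b_def l1n_def intro: le_less_trans)

lemma l1b_integral_le: assumes "l1b f A" shows "cmod (LINT z|lborel. f z) \<le> A"
proof -
  have "ennreal (cmod (LINT z|lborel. f z)) \<le> (\<integral>\<^sup>+z. ennreal (cmod (f z)) \<partial>lborel)"
    by (rule integral_norm_bound_ennreal) (rule l1b_integrable[OF assms])
  also have "\<dots> \<le> ennreal A" using assms by (auto simp: l1b_def l1n_def)
  finally show ?thesis using l1b_nonneg[OF assms] by (simp add: ennreal_le_iff)
qed

lemma l1bI_integrable: "integrable lborel f \<Longrightarrow> l1b f (LINT z|lborel. cmod (f z))"
  by (auto simp: l1b_def l1n_def nn_integral_eq_integral)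

lemma l2b_iff:
  "l2b f A \<longleftrightarrow> bmeas f \<and> 0 \<le> A \<and> integrable lborel (\<lambda>z. (cmod (f z))\<^sup>2)
     \<and> (LINT z|lborel. (cmod (f z))\<^sup>2) \<le> A\<^sup>2"
proof (cases "bmeas f")
  case [measurable]: True
  have eq: "(\<integral>\<^sup>+z. (ennreal (cmod (f z)))\<^sup>2 \<partial>lborel) = (\<integral>\<^sup>+z. ennreal ((cmod (f z))\<^sup>2) \<partial>lborel)"
    by (simp add: ennreal_power)
  show ?thesis
  proof
    assume *: "l2b f A"
    then have le: "(\<integral>\<^sup>+z. ennreal ((cmod (f z))\<^sup>2) \<partial>lborel) \<le> ennreal (A\<^sup>2)" using eq by (auto simp: l2b_def l2n_def)
    then have i: "integrable lborel (\<lambda>z. (cmod (f z))\<^sup>2)"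
      by (intro integrableI_bounded) (auto intro: le_less_trans)
    show "bmeas f \<and> 0 \<le> A \<and> integrable lborel (\<lambda>z. (cmod (f z))\<^sup>2)
     \<and> (LINT z|lborel. (cmod (f z))\<^sup>2) \<le> A\<^sup>2"
      using le i * by (auto simp: nn_integral_eq_integral l2b_def ennreal_le_iff)
  next
    assume "bmeas f \<and> 0 \<le> A \<and> integrable lborel (\<lambda>z. (cmod (f z))\<^sup>2)
     \<and> (LINT z|lborel. (cmod (f z))\<^sup>2) \<le> A\<^sup>2"
    then show "l2b f A" using eq by (auto simp: l2b_def l2n_def nn_integral_eq_integral intro: ennreal_leI)
  qed
qed (simp add: l2b_def)

lemma l2b_add: assumes "l2b f A" "l2b g B" shows "l2b (\<lambda>z. f z + g z) (A + B)"
proof -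
  have [measurable]: "bmeas f" "bmeas g" using assms by (auto simp: l2b_def)
  have "l2n (\<lambda>z. ennreal (cmod (f z + g z))) (A + B)"
    by (rule l2n_mono[OF l2n_add[OF l2b_n l2b_n, OF assms]]) (auto simp: ennreal_plus[symmetric] norm_triangle_ineq simp del: ennreal_plus)
  then show ?thesis by (simp add: l2b_def)
qed

lemma l2b_uminus: "l2b f A \<Longrightarrow> l2b (\<lambda>z. - f z) A" by (simp add: l2b_def)

lemma l2b_diff: "l2b f A \<Longrightarrow> l2b g B \<Longrightarrow> l2b (\<lambda>z. f z - g z) (A + B)"
  using l2b_add[of f A "\<lambda>z. - g z" B] by (simp add: l2b_uminus)

lemma l2b_cmult: assumes "l2b f A" shows "l2b (\<lambda>z. c * f z) (cmod c * A)"
  using assms l2n_cmult[OF l2b_n[OF assms], of "cmod c"] by (auto simp: l2b_def norm_mult ennreal_mult)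

lemma l1b_prod:
  assumes "l2b f A" "l2b g B" shows "l1b (\<lambda>z. f z * g z) (A * B)"
  using assms l1n_prod[OF l2b_n l2b_n, OF assms] by (auto simp: l1b_def l2b_def norm_mult ennreal_mult)

lemma l2b_cnj: "l2b f A \<Longrightarrow> l2b (\<lambda>z. cnj (f z)) A"
  by (auto simp: l2b_def)

section \<open>Convolution of complex functions\<close>

definition conv :: "(plane \<Rightarrow> complex) \<Rightarrow> (plane \<Rightarrow> complex) \<Rightarrow> plane \<Rightarrow> complex"
  where "conv f g \<zeta> = (LINT \<eta>|lborel. f (\<zeta> - \<eta>) * g \<eta>)"

lemma conv_measurable [measurable]:
  assumes [measurable]: "bmeas f" "bmeas g"
  shows "bmeas (conv f g)"
proof -
  have "bmeas (\<lambda>\<zeta>. (LINT \<eta>|lborel. f (\<zeta> - \<eta>) * g \<eta>))"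
    by (rule lborel.borel_measurable_lebesgue_integral) measurable
  then show ?thesis by (simp add: conv_def[abs_def])
qed

abbreviation nm :: "(plane \<Rightarrow> complex) \<Rightarrow> plane \<Rightarrow> ennreal" where "nm f \<equiv> \<lambda>z. ennreal (cmod (f z))"

text \<open>Valid at every point: where the integrand is not integrable, the Bochner integral is 0
  by convention.\<close>

lemma conv_le_nc: "ennreal (cmod (conv f g \<zeta>)) \<le> nc (nm f) (nm g) \<zeta>"
proof (cases "integrable lborel (\<lambda>\<eta>. f (\<zeta> - \<eta>) * g \<eta>)")
  case True
  then have "ennreal (cmod (conv f g \<zeta>)) \<le> (\<integral>\<^sup>+\<eta>. ennreal (cmod (f (\<zeta> - \<eta>) * g \<eta>)) \<partial>lborel)"
    unfolding conv_def by (rule integral_norm_bound_ennreal)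
  then show ?thesis by (simp add: nc_def norm_mult ennreal_mult)
qed (simp add: conv_def not_integrable_integral_eq)

lemma l1b_conv: assumes "l1b f A" "l1b g B" shows "l1b (conv f g) (A * B)"
proof -
  have [measurable]: "bmeas f" "bmeas g" using assms by (auto simp: l1b_def)
  have "l1n (nm (conv f g)) (A * B)"
    by (rule l1n_mono[OF l1n_nc[OF l1b_n l1b_n, OF assms]]) (auto simp: conv_le_nc)
  then show ?thesis by (simp add: l1b_def)
qed

lemma l2b_conv: assumes "l1b f A" "l2b g B" shows "l2b (conv f g) (A * B)"
proof -
  have [measurable]: "bmeas f" "bmeas g" using assms by (auto simp: l1b_def l2b_def)
  have "l2n (nm (conv f g)) (A * B)"
    by (rule l2n_mono[OF l2n_nc[OF l1b_n l2b_n, OF assms]]) (auto simp: conv_le_nc)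
  then show ?thesis by (simp add: l2b_def)
qed

lemma l2b_reflect:
  assumes "l2b f A" shows "l2b (\<lambda>\<eta>. f (\<zeta> - \<eta>)) A"
proof -
  have [measurable]: "bmeas f" using assms by (auto simp: l2b_def)
  have "(\<integral>\<^sup>+z. (ennreal (cmod (f (\<zeta> - z))))\<^sup>2 \<partial>lborel) = (\<integral>\<^sup>+z. (ennreal (cmod (f z)))\<^sup>2 \<partial>lborel)"
    by (rule nn_integral_lborel_reflect[of "\<lambda>z. (ennreal (cmod (f z)))\<^sup>2"]) measurable
  then show ?thesis using assms by (auto simp: l2b_def l2n_def)
qed

lemma conv_integrable:
  assumes "l2b f A" "l2b g B" shows "integrable lborel (\<lambda>\<eta>. f (\<zeta> - \<eta>) * g \<eta>)"
  using l1b_integrable[OF l1b_prod[OF l2b_reflect[OF assms(1)] assms(2)]] .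

lemma conv_commute:
  assumes [measurable]: "bmeas f" "bmeas g"
  shows "conv f g = conv g f"
proof
  fix \<zeta>
  have "conv f g \<zeta> = (LINT \<eta>|lborel. (\<lambda>x. f x * g (\<zeta> - x)) (\<zeta> - \<eta>))" by (simp add: conv_def)
  also have "\<dots> = conv g f \<zeta>"
    by (subst integral_lborel_reflect) (auto simp: conv_def mult.commute)
  finally show "conv f g \<zeta> = conv g f \<zeta>" .
qed

definition hermitian :: "(plane \<Rightarrow> complex) \<Rightarrow> bool"
  where "hermitian f \<longleftrightarrow> (\<forall>\<zeta>. f (- \<zeta>) = cnj (f \<zeta>))"

lemma hermitianD: "hermitian f \<Longrightarrow> f (- \<zeta>) = cnj (f \<zeta>)"
  unfolding hermitian_def by blast

lemma hermitianI: "(\<And>\<zeta>. f (- \<zeta>) = cnj (f \<zeta>)) \<Longrightarrow> hermitian f"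
  unfolding hermitian_def by blast

lemma Re_mult_cnj: "Re (a * cnj a) = (cmod a)\<^sup>2"
  by (simp add: complex_mult_cnj cmod_power2)

lemma hermitian_conv:
  assumes [measurable]: "bmeas f" "bmeas g"
    and "hermitian f" "hermitian g"
  shows "hermitian (conv f g)"
  unfolding hermitian_def
proof
  fix \<zeta>
  let ?F = "\<lambda>\<eta>. f (\<zeta> - \<eta>) * g \<eta>"
  have "cnj (conv f g \<zeta>) = (LINT \<eta>|lborel. cnj (?F \<eta>))"
    unfolding conv_def using Bochner_Integration.integral_cnj[of lborel ?F] by (rule sym)
  also have "(LINT \<eta>|lborel. cnj (?F \<eta>)) = (LINT \<eta>|lborel. (\<lambda>\<eta>. f (- \<zeta> - \<eta>) * g \<eta>) (0 - \<eta>))"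
  proof (rule Bochner_Integration.integral_cong[OF refl])
    fix \<eta>
    have "f (- \<zeta> - - \<eta>) = cnj (f (\<zeta> - \<eta>))"
      using assms(3)[unfolded hermitian_def, rule_format, of "\<zeta> - \<eta>"] by (simp add: algebra_simps)
    moreover have "g (- \<eta>) = cnj (g \<eta>)" using assms(4) unfolding hermitian_def by blast
    ultimately show "cnj (?F \<eta>) = (\<lambda>\<eta>. f (- \<zeta> - \<eta>) * g \<eta>) (0 - \<eta>)" by simp
  qed
  also have "\<dots> = conv f g (- \<zeta>)" by (subst integral_lborel_reflect) (auto simp: conv_def)
  finally show "conv f g (- \<zeta>) = cnj (conv f g \<zeta>)" by simp
qed

section \<open>The Hilbert space of transforms of real functions\<close>

text \<open>A rapidly converging subsequence converges almost everywhere, and Fatou's lemma along it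
  gives convergence in mean square of the whole sequence. Needed for the completeness of
  \<open>G\<close> and again for the surjectivity of \<open>FT\<close>.\<close>

lemma riesz_fischer:
  fixes f :: "nat \<Rightarrow> 'a \<Rightarrow> 'b::{banach,second_countable_topology}"
  assumes [measurable]: "\<And>n. f n \<in> borel_measurable M"
    and C: "\<And>e::real. 0 < e \<Longrightarrow> \<exists>N. \<forall>m\<ge>N. \<forall>n\<ge>N. (\<integral>\<^sup>+z. ennreal ((norm (f m z - f n z))\<^sup>2) \<partial>M) \<le> ennreal e"
  obtains g where "g \<in> borel_measurable M"
    "(\<lambda>n. \<integral>\<^sup>+z. ennreal ((norm (f n z - g z))\<^sup>2) \<partial>M) \<longlonglongrightarrow> 0"
proof -
  have "\<exists>N. \<forall>k. \<forall>m\<ge>N k. \<forall>n\<ge>N k. (\<integral>\<^sup>+z. ennreal ((norm (f m z - f n z))\<^sup>2) \<partial>M) \<le> ennreal ((1/4)^k)"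
    by (intro choice allI C) simp
  then obtain N where N: "\<And>k m n. N k \<le> m \<Longrightarrow> N k \<le> n \<Longrightarrow>
      (\<integral>\<^sup>+z. ennreal ((norm (f m z - f n z))\<^sup>2) \<partial>M) \<le> ennreal ((1/4)^k)" by blast
  \<comment> \<open>The sum over i \<le> k puts \<open>r k\<close> beyond \<open>N k\<close>; the
    summand k makes r strictly increasing.\<close>
  define r where "r k = (\<Sum>i\<le>k. N i) + k" for k
  have rN: "N k \<le> r k" for k
    unfolding r_def by (rule trans_le_add1) (rule member_le_sum, auto)
  have r_Suc: "r k < r (Suc k)" for k by (simp add: r_def)
  have r_mono: "strict_mono r" using r_Suc by (simp add: strict_mono_Suc_iff)
  \<comment> \<open>Consecutive terms have squared distance at most 4^-k, so the sum of
    \<open>2^k * (d k z)\<^sup>2\<close> over k still has finite integral and is finite almost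
    everywhere.\<close>
  define d where "d k z = norm (f (r (Suc k)) z - f (r k) z)" for k z
  have [measurable]: "d k \<in> borel_measurable M" for k unfolding d_def by measurable
  have "(\<integral>\<^sup>+z. (\<Sum>k. ennreal (2^k * (d k z)\<^sup>2)) \<partial>M) = (\<Sum>k. \<integral>\<^sup>+z. ennreal (2^k * (d k z)\<^sup>2) \<partial>M)"
    by (rule nn_integral_suminf) measurable
  also have "\<dots> \<le> (\<Sum>k. ennreal ((1/2)^k))"
  proof (intro suminf_le)
    fix k
    have "(\<integral>\<^sup>+z. ennreal (2^k * (d k z)\<^sup>2) \<partial>M) = ennreal (2^k) * (\<integral>\<^sup>+z. ennreal ((d k z)\<^sup>2) \<partial>M)"
      by (subst nn_integral_cmult[symmetric]) (auto simp: ennreal_mult)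
    also have "\<dots> \<le> ennreal (2^k) * ennreal ((1/4)^k)"
      unfolding d_def using rN[of k] r_Suc[of k] by (intro mult_left_mono N) auto
    also have "\<dots> = ennreal ((1/2)^k)"
      by (subst ennreal_mult[symmetric]) (auto simp: power_mult_distrib[symmetric])
    finally show "(\<integral>\<^sup>+z. ennreal (2^k * (d k z)\<^sup>2) \<partial>M) \<le> ennreal ((1/2)^k)" .
  qed auto
  also have "\<dots> = ennreal (\<Sum>k. (1/2)^k)" by (rule suminf_ennreal2) (auto intro: summable_geometric)
  also have "\<dots> < \<infinity>" by simp
  finally have "AE z in M. (\<Sum>k. ennreal (2^k * (d k z)\<^sup>2)) \<noteq> \<infinity>"
    by (intro nn_integral_noteq_infinite) auto
  then have conv: "AE z in M. convergent (\<lambda>n. f (r n) z)"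
  proof eventually_elim
    case (elim z)
    have s: "summable (\<lambda>k. 2^k * (d k z)\<^sup>2)"
      by (rule summable_suminf_not_top) (use elim in auto)
    have "summable (\<lambda>k. d k z)"
    proof (rule summable_comparison_test'[OF summable_add[OF summable_geometric[of "1/2::real"] s]])
      fix k :: nat
      have sq: "sqrt (2^k) * sqrt (2^k) = 2^k" by simp
      \<comment> \<open>Completing the square bounds 2 d by 2^-k + 2^k d^2; this is how square
        summability with the weight 2^k yields plain summability.\<close>
      have "0 \<le> (1 / sqrt (2^k) - sqrt (2^k) * d k z)\<^sup>2" by simp
      also have "\<dots> = (1/2)^k + 2^k * (d k z)\<^sup>2 - 2 * d k z"
        by (simp add: power2_eq_square algebra_simps power_divide)
      finally have "2 * d k z \<le> (1/2)^k + 2^k * (d k z)\<^sup>2" by simp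
      moreover have "0 \<le> d k z" by (simp add: d_def)
      ultimately show "norm (d k z) \<le> (1/2)^k + 2^k * (d k z)\<^sup>2" by simp
    qed simp
    then have "summable (\<lambda>k. f (r (Suc k)) z - f (r k) z)"
      unfolding d_def by (rule summable_norm_cancel)
    then have "convergent (\<lambda>n. \<Sum>k<n. f (r (Suc k)) z - f (r k) z)"
      by (simp add: summable_iff_convergent)
    then have "convergent (\<lambda>n. f (r n) z - f (r 0) z)"
      by (simp add: sum_lessThan_telescope[where f="\<lambda>k. f (r k) z"])
    then have "convergent (\<lambda>n. (f (r n) z - f (r 0) z) + f (r 0) z)"
      by (intro convergent_add convergent_const)
    then show ?case by simp
  qed
  define g where "g z = lim (\<lambda>n. f (r n) z)" for z
  have [measurable]: "g \<in> borel_measurable M" unfolding g_def by measurable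
  have lim: "AE z in M. (\<lambda>n. f (r n) z) \<longlonglongrightarrow> g z"
    using conv by eventually_elim (simp add: g_def convergent_LIMSEQ_iff)
  have "(\<lambda>n. \<integral>\<^sup>+z. ennreal ((norm (f n z - g z))\<^sup>2) \<partial>M) \<longlonglongrightarrow> 0"
  proof (rule tendsto_zero_ennreal)
    fix e :: real assume e: "0 < e"
    obtain K where K: "\<And>m n. K \<le> m \<Longrightarrow> K \<le> n \<Longrightarrow> (\<integral>\<^sup>+z. ennreal ((norm (f m z - f n z))\<^sup>2) \<partial>M) \<le> ennreal (e/2)"
      using C[of "e/2"] e by auto
    have rge: "k \<le> r k" for k by (rule seq_suble[OF r_mono])
    have "(\<integral>\<^sup>+z. ennreal ((norm (f n z - g z))\<^sup>2) \<partial>M) < ennreal e" if n: "K \<le> n" for n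
    proof -
      have "(\<integral>\<^sup>+z. ennreal ((norm (f n z - g z))\<^sup>2) \<partial>M) =
          (\<integral>\<^sup>+z. liminf (\<lambda>k. ennreal ((norm (f n z - f (r k) z))\<^sup>2)) \<partial>M)"
        using lim
      proof (intro nn_integral_cong_AE, eventually_elim)
        case (elim z)
        have "(\<lambda>k. ennreal ((norm (f n z - f (r k) z))\<^sup>2)) \<longlonglongrightarrow> ennreal ((norm (f n z - g z))\<^sup>2)"
          by (intro tendsto_intros tendsto_ennrealI elim)
        from lim_imp_Liminf[OF trivial_limit_sequentially this] show ?case by (rule sym)
      qed
      also have "\<dots> \<le> liminf (\<lambda>k. \<integral>\<^sup>+z. ennreal ((norm (f n z - f (r k) z))\<^sup>2) \<partial>M)"
        by (rule nn_integral_liminf) measurable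
      also have "\<dots> \<le> limsup (\<lambda>k. \<integral>\<^sup>+z. ennreal ((norm (f n z - f (r k) z))\<^sup>2) \<partial>M)"
        by (rule Liminf_le_Limsup) simp
      also have "\<dots> \<le> ennreal (e/2)"
        by (rule Limsup_bounded) (use rge n in \<open>auto simp: eventually_sequentially intro!: exI[of _ K] K intro: order_trans\<close>)
      also have "\<dots> < ennreal e" using e by (auto simp: ennreal_less_iff)
      finally show ?thesis .
    qed
    then show "\<forall>\<^sub>F n in sequentially. (\<integral>\<^sup>+z. ennreal ((norm (f n z - g z))\<^sup>2) \<partial>M) < ennreal e"
      by (auto simp: eventually_sequentially)
  qed
  then show ?thesis by (rule that[rotated]) measurable
qed

text \<open>Real-valued functions have Hermitian transforms. Choosing representatives that are Hermitian
  at every point, and not only almost everywhere, keeps the algebra free of null sets.\<close>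

definition hl2 :: "(plane \<Rightarrow> complex) \<Rightarrow> bool"
  where "hl2 f \<longleftrightarrow> bmeas f \<and> hermitian f \<and> integrable lborel (\<lambda>z. (cmod (f z))\<^sup>2)"

text \<open>Reflexive on \<open>hl2\<close> only; as the quotient is partial, its classes consist of
  Hermitian square integrable functions and nothing else.\<close>

definition hrel :: "(plane \<Rightarrow> complex) \<Rightarrow> (plane \<Rightarrow> complex) \<Rightarrow> bool"
  where "hrel f g \<longleftrightarrow> hl2 f \<and> hl2 g \<and> (AE z in lborel. f z = g z)"

quotient_type G = "plane \<Rightarrow> complex" / partial: hrel
proof (rule part_equivpI)
  show "\<exists>x. hrel x x" by (rule exI[of _ "\<lambda>_. 0"]) (simp add: hrel_def hl2_def hermitian_def)
  show "symp hrel" by (auto simp: symp_def hrel_def elim: eventually_mono)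
  show "transp hrel" by (auto simp: transp_def hrel_def elim: eventually_elim2)
qed

lemma l2b_self:
  "bmeas f \<Longrightarrow> integrable lborel (\<lambda>z. (cmod (f z))\<^sup>2) \<Longrightarrow>
    l2b f (sqrt (LINT z|lborel. (cmod (f z))\<^sup>2))"
  by (simp add: l2b_iff)

lemma hl2_l2b: "hl2 f \<longleftrightarrow> hermitian f \<and> (\<exists>A. l2b f A)"
  using l2b_self[of f] unfolding hl2_def l2b_iff by blast

lemma hl2_rep: "hl2 (rep_G x)"
  using Quotient_rep_reflp[OF Quotient_G] by (auto simp: hrel_def)

lemma rep_abs: "hl2 f \<Longrightarrow> AE z in lborel. rep_G (abs_G f) z = f z"
  using Quotient_rep_abs[OF Quotient_G] by (auto simp: hrel_def)

lemma G_eqI: assumes "AE z in lborel. rep_G x z = rep_G y z" shows "x = y"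
proof -
  have "hrel (rep_G x) (rep_G y)" using assms by (simp add: hrel_def hl2_rep)
  then show ?thesis using Quotient_rel_rep[OF Quotient_G] by blast
qed

lemma rep_measurable [measurable]: "bmeas (rep_G x)"
  using hl2_rep by (auto simp: hl2_def)

lemma hermitian_rep: "hermitian (rep_G x)"
  using hl2_rep by (auto simp: hl2_def)

lemma rep_integrable: "integrable lborel (\<lambda>z. (cmod (rep_G x z))\<^sup>2)"
  using hl2_rep by (auto simp: hl2_def)

lemma hermitian_add: "hermitian f \<Longrightarrow> hermitian g \<Longrightarrow> hermitian (\<lambda>z. f z + g z)"
  and hermitian_diff: "hermitian f \<Longrightarrow> hermitian g \<Longrightarrow> hermitian (\<lambda>z. f z - g z)"
  and hermitian_mult: "hermitian f \<Longrightarrow> hermitian g \<Longrightarrow> hermitian (\<lambda>z. f z * g z)"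
  and hermitian_uminus: "hermitian f \<Longrightarrow> hermitian (\<lambda>z. - f z)"
  and hermitian_of_real: "hermitian (\<lambda>z. complex_of_real c)"
  by (auto simp: hermitian_def)

lemma hl2_add: "hl2 f \<Longrightarrow> hl2 g \<Longrightarrow> hl2 (\<lambda>z. f z + g z)"
  unfolding hl2_l2b by (blast intro: hermitian_add l2b_add)

lemma hl2_uminus: "hl2 f \<Longrightarrow> hl2 (\<lambda>z. - f z)"
  unfolding hl2_l2b by (blast intro: hermitian_uminus l2b_uminus)

lemma hl2_diff: "hl2 f \<Longrightarrow> hl2 g \<Longrightarrow> hl2 (\<lambda>z. f z - g z)"
  unfolding hl2_l2b by (blast intro: hermitian_diff l2b_diff)

lemma hl2_cmult: "hl2 f \<Longrightarrow> hl2 (\<lambda>z. complex_of_real c * f z)"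
  unfolding hl2_l2b by (blast intro: hermitian_mult[OF hermitian_of_real] l2b_cmult)

lemma hl2_zero: "hl2 (\<lambda>z. 0)"
  by (simp add: hl2_def hermitian_def)

lemma integrable_Re_pair:
  assumes "l2b f A" "l2b g B"
  shows "integrable lborel (\<lambda>z. Re (f z * cnj (g z)))"
  using l1b_integrable[OF l1b_prod[OF assms(1) l2b_cnj[OF assms(2)]]] by (rule integrable_Re)

lemma rep_l2b_ex: "\<exists>A. l2b (rep_G x) A"
  using hl2_rep by (auto simp: hl2_l2b)

lemma integrable_rep_pair: "integrable lborel (\<lambda>z. Re (rep_G x z * cnj (rep_G y z)))"
  using rep_l2b_ex[of x] rep_l2b_ex[of y] integrable_Re_pair by blast

text \<open>The scalars are real because multiplication by \<i> destroys Hermitian symmetry. The L^2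
  pairing of two Hermitian functions is a real number, so the inner product is the usual
  one.\<close>

instantiation G :: real_inner
begin

definition zero_G :: G where "0 = abs_G (\<lambda>z. 0)"
definition plus_G :: "G \<Rightarrow> G \<Rightarrow> G" where "x + y = abs_G (\<lambda>z. rep_G x z + rep_G y z)"
definition minus_G :: "G \<Rightarrow> G \<Rightarrow> G" where "x - y = abs_G (\<lambda>z. rep_G x z - rep_G y z)"
definition uminus_G :: "G \<Rightarrow> G" where "- x = abs_G (\<lambda>z. - rep_G x z)"
definition scaleR_G :: "real \<Rightarrow> G \<Rightarrow> G" where "c *\<^sub>R x = abs_G (\<lambda>z. complex_of_real c * rep_G x z)"
definition inner_G :: "G \<Rightarrow> G \<Rightarrow> real" where "x \<bullet> y = (LINT z|lborel. Re (rep_G x z * cnj (rep_G y z)))"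
definition norm_G :: "G \<Rightarrow> real" where "norm (x :: G) = sqrt (x \<bullet> x)"
definition dist_G :: "G \<Rightarrow> G \<Rightarrow> real" where "dist (x :: G) y = norm (x - y)"
definition sgn_G :: "G \<Rightarrow> G" where "sgn (x :: G) = inverse (norm x) *\<^sub>R x"
definition uniformity_G :: "(G \<times> G) filter" where "(uniformity :: (G \<times> G) filter) = (INF e\<in>{0 <..}. principal {(x, y). dist x y < e})"
definition open_G :: "G set \<Rightarrow> bool"
  where "open (U :: G set) = (\<forall>x\<in>U. eventually (\<lambda>(x', y). x' = x \<longrightarrow> y \<in> U) uniformity)"

lemma rep_zero: "AE z in lborel. rep_G 0 z = 0"
  unfolding zero_G_def by (rule rep_abs[OF hl2_zero])
lemma rep_add: "AE z in lborel. rep_G (x + y) z = rep_G x z + rep_G y z"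
  unfolding plus_G_def by (intro rep_abs hl2_add hl2_rep)
lemma rep_diff: "AE z in lborel. rep_G (x - y) z = rep_G x z - rep_G y z"
  unfolding minus_G_def by (intro rep_abs hl2_diff hl2_rep)
lemma rep_uminus: "AE z in lborel. rep_G (- x) z = - rep_G x z"
  unfolding uminus_G_def by (intro rep_abs hl2_uminus hl2_rep)
lemma rep_scaleR: "AE z in lborel. rep_G (c *\<^sub>R x) z = complex_of_real c * rep_G x z"
  unfolding scaleR_G_def by (intro rep_abs hl2_cmult hl2_rep)

instance
proof
  fix x y z :: G and a b :: real
  show "dist x y = norm (x - y)" by (simp add: dist_G_def)
  show "x + y + z = x + (y + z)"
    using rep_add[of "x + y" z] rep_add[of x y] rep_add[of x "y + z"] rep_add[of y z]
    by (intro G_eqI, eventually_elim) simp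
  show "x + y = y + x"
    using rep_add[of x y] rep_add[of y x] by (intro G_eqI, eventually_elim) simp
  show "0 + x = x" using rep_add[of 0 x] rep_zero by (intro G_eqI, eventually_elim) simp
  show "- x + x = 0" using rep_add[of "- x" x] rep_uminus[of x] rep_zero by (intro G_eqI, eventually_elim) simp
  show "x - y = x + - y" using rep_diff[of x y] rep_add[of x "- y"] rep_uminus[of y] by (intro G_eqI, eventually_elim) simp
  show "a *\<^sub>R (x + y) = a *\<^sub>R x + a *\<^sub>R y"
    using rep_scaleR[of a "x + y"] rep_add[of x y] rep_add[of "a *\<^sub>R x" "a *\<^sub>R y"] rep_scaleR[of a x] rep_scaleR[of a y]
    by (intro G_eqI, eventually_elim) (simp add: algebra_simps)
  show "(a + b) *\<^sub>R x = a *\<^sub>R x + b *\<^sub>R x"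
    using rep_scaleR[of "a + b" x] rep_add[of "a *\<^sub>R x" "b *\<^sub>R x"] rep_scaleR[of a x] rep_scaleR[of b x]
    by (intro G_eqI, eventually_elim) (simp add: algebra_simps)
  show "a *\<^sub>R b *\<^sub>R x = (a * b) *\<^sub>R x"
    using rep_scaleR[of a "b *\<^sub>R x"] rep_scaleR[of b x] rep_scaleR[of "a * b" x]
    by (intro G_eqI, eventually_elim) simp
  show "1 *\<^sub>R x = x" using rep_scaleR[of 1 x] by (intro G_eqI, eventually_elim) simp
  show "sgn x = inverse (norm x) *\<^sub>R x" by (rule sgn_G_def)
  show "uniformity = (INF e\<in>{0 <..}. principal {(x, y :: G). dist x y < e})" by (rule uniformity_G_def)
  show "open U = (\<forall>x\<in>U. \<forall>\<^sub>F (x', y) in uniformity. x' = x \<longrightarrow> y \<in> U)" for U :: "G set"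
    by (rule open_G_def)
  show "x \<bullet> y = y \<bullet> x" by (simp add: inner_G_def algebra_simps)
  have "(x + y) \<bullet> z = (LINT w|lborel. Re (rep_G x w * cnj (rep_G z w)) + Re (rep_G y w * cnj (rep_G z w)))"
    unfolding inner_G_def using rep_add[of x y]
    by (intro integral_cong_AE) (auto elim!: eventually_mono simp: algebra_simps)
  then show "(x + y) \<bullet> z = x \<bullet> z + y \<bullet> z"
    by (simp only: inner_G_def Bochner_Integration.integral_add[OF integrable_rep_pair integrable_rep_pair])
  have "(a *\<^sub>R x) \<bullet> y = (LINT w|lborel. a * Re (rep_G x w * cnj (rep_G y w)))"
    unfolding inner_G_def using rep_scaleR[of a x]
    by (intro integral_cong_AE) (auto elim!: eventually_mono simp: algebra_simps)
  then show "(a *\<^sub>R x) \<bullet> y = a * (x \<bullet> y)" by (simp only: inner_G_def integral_mult_right_zero)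
  have sq: "x \<bullet> x = (LINT w|lborel. (cmod (rep_G x w))\<^sup>2)"
    unfolding inner_G_def Re_mult_cnj ..
  show "0 \<le> x \<bullet> x" unfolding sq by (rule integral_nonneg_AE) simp
  show "(x \<bullet> x = 0) = (x = 0)"
  proof
    assume "x \<bullet> x = 0"
    then have "AE w in lborel. (cmod (rep_G x w))\<^sup>2 = 0"
      unfolding sq by (subst (asm) integral_nonneg_eq_0_iff_AE) (auto simp: rep_integrable)
    then show "x = 0" using rep_zero by (intro G_eqI, eventually_elim) simp
  next
    assume "x = 0"
    then have "x \<bullet> x = (LINT w|(lborel :: plane measure). 0)"
      unfolding sq using rep_zero by (intro integral_cong_AE) (auto elim: eventually_mono)
    then show "x \<bullet> x = 0" by simp
  qed
  show "norm x = sqrt (x \<bullet> x)" by (rule norm_G_def)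
qed

end

lemma norm_G_power2: "(norm (x :: G))\<^sup>2 = (LINT w|lborel. (cmod (rep_G x w))\<^sup>2)"
  unfolding power2_norm_eq_inner[of x] inner_G_def Re_mult_cnj ..

lemma l2b_rep_iff: "l2b (rep_G x) A \<longleftrightarrow> norm x \<le> A"
proof -
  have "l2b (rep_G x) A \<longleftrightarrow> 0 \<le> A \<and> (norm x)\<^sup>2 \<le> A\<^sup>2"
    by (simp add: l2b_iff rep_integrable norm_G_power2)
  also have "\<dots> \<longleftrightarrow> norm x \<le> A"
    by (metis abs_le_square_iff abs_norm_cancel abs_of_nonneg norm_ge_zero order_trans)
  finally show ?thesis .
qed

lemma l2b_AE: "l2b f A \<Longrightarrow> bmeas g \<Longrightarrow> AE z in lborel. g z = f z \<Longrightarrow> l2b g A"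
  by (rule l2b_mono[where B'=A]) (auto elim: eventually_mono)

lemma l2b_cong_AE:
  "bmeas f \<Longrightarrow> bmeas g \<Longrightarrow> AE z in lborel. f z = g z \<Longrightarrow> l2b f A \<longleftrightarrow> l2b g A"
  using l2b_AE[of f A g] l2b_AE[of g A f] by (auto simp: eq_commute)

lemma norm_abs_le: assumes "l2b f A" "hermitian f" shows "norm (abs_G f) \<le> A"
proof -
  have "hl2 f" using assms by (auto simp: hl2_l2b)
  then have "l2b (rep_G (abs_G f)) A" using rep_abs by (intro l2b_AE[OF assms(1)]) auto
  then show ?thesis by (simp add: l2b_rep_iff)
qed

lemma nn_integral_rep_diff:
  "(\<integral>\<^sup>+z. ennreal ((norm (rep_G x z - rep_G y z))\<^sup>2) \<partial>lborel) = ennreal ((norm (x - y))\<^sup>2)"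
proof -
  have "(\<integral>\<^sup>+z. ennreal ((norm (rep_G x z - rep_G y z))\<^sup>2) \<partial>lborel)
      = (\<integral>\<^sup>+z. ennreal ((norm (rep_G (x - y) z))\<^sup>2) \<partial>lborel)"
    using rep_diff[of x y] by (intro nn_integral_cong_AE) (auto elim: eventually_mono)
  then show ?thesis by (simp add: nn_integral_eq_integral rep_integrable norm_G_power2)
qed

text \<open>The projection onto Hermitian functions. An L^2 limit of Hermitian functions is
  Hermitian almost everywhere; the projection restores the symmetry at every point, as
  \<open>hl2\<close> demands.\<close>

definition herm_part :: "(plane \<Rightarrow> complex) \<Rightarrow> plane \<Rightarrow> complex"
  where "herm_part g z = (1/2) * (g z + cnj (g (- z)))"

lemma hermitian_herm_part: "hermitian (herm_part g)"
  by (simp add: hermitian_def herm_part_def add.commute)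

lemma herm_part_measurable [measurable]:
  assumes [measurable]: "bmeas g" shows "bmeas (herm_part g)"
proof -
  have "bmeas (\<lambda>z. g (- z))" by (rule measurable_compose[of uminus borel borel]) auto
  from measurable_compose[OF this cnj_borel_measurable]
  show ?thesis unfolding herm_part_def[abs_def] by (intro borel_measurable_times borel_measurable_add) auto
qed

text \<open>The difference on the left is the mean of \<open>f - g\<close> and its conjugate
  reflection, which have the same norm, and squaring is convex.\<close>

lemma nn_integral_herm_part:
  assumes [measurable]: "bmeas g" "bmeas f" and f: "hermitian f"
  shows "(\<integral>\<^sup>+z. ennreal ((cmod (f z - herm_part g z))\<^sup>2) \<partial>lborel) \<le> (\<integral>\<^sup>+z. ennreal ((cmod (f z - g z))\<^sup>2) \<partial>lborel)"
proof -
  have pt: "(cmod (f z - herm_part g z))\<^sup>2 \<le> (1/2) * (cmod (f z - g z))\<^sup>2 + (1/2) * (cmod (f (0 - z) - g (0 - z)))\<^sup>2" for z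
  proof -
    have "f z - herm_part g z = ((f z - g z) + cnj (f (-z) - g (-z))) / 2"
      using hermitianD[OF f, of z] by (simp add: herm_part_def field_simps)
    then have "cmod (f z - herm_part g z) = cmod ((f z - g z) + cnj (f (-z) - g (-z))) / 2"
      by (simp only: norm_divide norm_numeral)
    also have "\<dots> \<le> (cmod (f z - g z) + cmod (f (-z) - g (-z))) / 2"
      using norm_triangle_ineq[of "f z - g z" "cnj (f (-z) - g (-z))"] unfolding complex_mod_cnj by (rule divide_right_mono) simp
    finally have "cmod (f z - herm_part g z) \<le> (cmod (f z - g z) + cmod (f (-z) - g (-z))) / 2" .
    then have "(cmod (f z - herm_part g z))\<^sup>2 \<le> ((cmod (f z - g z) + cmod (f (-z) - g (-z))) / 2)\<^sup>2"
      by (intro power_mono) auto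
    also have "\<dots> \<le> (1/2) * (cmod (f z - g z))\<^sup>2 + (1/2) * (cmod (f (-z) - g (-z)))\<^sup>2"
      using zero_le_power2[of "cmod (f z - g z) - cmod (f (-z) - g (-z))"]
      by (simp add: power2_eq_square field_simps)
    finally show ?thesis by simp
  qed
  have "(\<integral>\<^sup>+z. ennreal ((cmod (f z - herm_part g z))\<^sup>2) \<partial>lborel)
      \<le> (\<integral>\<^sup>+z. ennreal (1/2) * ennreal ((cmod (f z - g z))\<^sup>2) + ennreal (1/2) * ennreal ((cmod (f (0 - z) - g (0 - z)))\<^sup>2) \<partial>lborel)"
  proof (rule nn_integral_mono)
    fix z
    have e: "ennreal (c * a + c * b) = ennreal c * ennreal a + ennreal c * ennreal b" if "0 \<le> a" "0 \<le> b" "0 \<le> c" for a b c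
      using that by (simp add: ennreal_mult)
    show "ennreal ((cmod (f z - herm_part g z))\<^sup>2) \<le> ennreal (1/2) * ennreal ((cmod (f z - g z))\<^sup>2) + ennreal (1/2) * ennreal ((cmod (f (0 - z) - g (0 - z)))\<^sup>2)"
      using pt[of z] by (subst e[symmetric]) (auto intro!: ennreal_leI simp del: ennreal_plus)
  qed
  also have "\<dots> = ennreal (1/2) * (\<integral>\<^sup>+z. ennreal ((cmod (f z - g z))\<^sup>2) \<partial>lborel)
      + ennreal (1/2) * (\<integral>\<^sup>+z. ennreal ((cmod (f (0 - z) - g (0 - z)))\<^sup>2) \<partial>lborel)"
  proof -
    have [measurable]: "bmeas (\<lambda>z. f (0 - z))" "bmeas (\<lambda>z. g (0 - z))"
      by (auto intro!: measurable_compose[of "\<lambda>z. 0 - z" borel borel])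
    have m1: "(\<lambda>z. ennreal ((cmod (f z - g z))\<^sup>2)) \<in> borel_measurable lborel"
      and m2: "(\<lambda>z. ennreal ((cmod (f (0 - z) - g (0 - z)))\<^sup>2)) \<in> borel_measurable lborel" by measurable
    have cm: "(\<lambda>z. ennreal (1/2) * h z) \<in> borel_measurable lborel" if "h \<in> borel_measurable lborel" for h :: "plane \<Rightarrow> ennreal"
      using that by simp
    show ?thesis unfolding nn_integral_add[OF cm[OF m1] cm[OF m2]] nn_integral_cmult[OF m1] nn_integral_cmult[OF m2] ..
  qed
  also have "(\<integral>\<^sup>+z. ennreal ((cmod (f (0 - z) - g (0 - z)))\<^sup>2) \<partial>lborel) = (\<integral>\<^sup>+z. ennreal ((cmod (f z - g z))\<^sup>2) \<partial>lborel)"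
    by (rule nn_integral_lborel_reflect[of "\<lambda>z. ennreal ((cmod (f z - g z))\<^sup>2)" 0]) measurable
  also have "ennreal (1/2) * x + ennreal (1/2) * x = x" for x
  proof -
    have "ennreal (1/2) + ennreal (1/2) = ennreal (1/2 + 1/2)" by (rule ennreal_plus[symmetric]) auto
    then have h: "ennreal (1/2) + ennreal (1/2) = 1" by simp
    show ?thesis by (simp only: distrib_right[symmetric] h mult_1)
  qed
  finally show ?thesis .
qed

instance G :: banach
proof
  fix X :: "nat \<Rightarrow> G" assume X: "Cauchy X"
  obtain g where [measurable]: "g \<in> borel_measurable lborel"
    and g: "(\<lambda>n. \<integral>\<^sup>+z. ennreal ((norm (rep_G (X n) z - g z))\<^sup>2) \<partial>lborel) \<longlonglongrightarrow> 0"
  proof (rule riesz_fischer[of "\<lambda>n. rep_G (X n)" lborel])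
    fix e :: real assume e: "0 < e"
    then obtain N where N: "\<And>m n. m \<ge> N \<Longrightarrow> n \<ge> N \<Longrightarrow> norm (X m - X n) < sqrt e"
      using X[unfolded Cauchy_def dist_norm, rule_format, of "sqrt e"] by auto
    have "(norm (X m - X n))\<^sup>2 \<le> e" if "m \<ge> N" "n \<ge> N" for m n
      using power_mono[OF less_imp_le[OF N[OF that]], of 2] e by simp
    then show "\<exists>N. \<forall>m\<ge>N. \<forall>n\<ge>N. (\<integral>\<^sup>+z. ennreal ((norm (rep_G (X m) z - rep_G (X n) z))\<^sup>2) \<partial>lborel) \<le> ennreal e"
      unfolding nn_integral_rep_diff by (intro exI[of _ N]) (auto intro: ennreal_leI)
  qed auto
  have [measurable]: "bmeas g" by simp
  define h where "h = herm_part g"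
  have [measurable]: "bmeas h" unfolding h_def by simp
  have h: "(\<lambda>n. \<integral>\<^sup>+z. ennreal ((norm (rep_G (X n) z - h z))\<^sup>2) \<partial>lborel) \<longlonglongrightarrow> 0"
    by (rule tendsto_sandwich[OF _ _ tendsto_const g])
       (auto simp: h_def intro!: always_eventually nn_integral_herm_part hermitian_rep)
  have "\<exists>n. (\<integral>\<^sup>+z. ennreal ((norm (rep_G (X n) z - h z))\<^sup>2) \<partial>lborel) < 1"
    using order_tendstoD(2)[OF h, of 1] by (auto dest: eventually_happens)
  then obtain n where n: "(\<integral>\<^sup>+z. ennreal ((norm (rep_G (X n) z - h z))\<^sup>2) \<partial>lborel) < 1" by blast
  have "integrable lborel (\<lambda>z. (cmod (rep_G (X n) z - h z))\<^sup>2)"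
    using less_trans[OF n, of \<infinity>] by (intro integrableI_bounded) auto
  then have "l2b (\<lambda>z. rep_G (X n) z - (rep_G (X n) z - h z))
      (norm (X n) + sqrt (LINT z|lborel. (cmod (rep_G (X n) z - h z))\<^sup>2))"
    by (intro l2b_diff l2b_self) (auto simp: l2b_rep_iff)
  then have hl: "hl2 h" by (auto simp: hl2_l2b h_def hermitian_herm_part)
  have "(\<lambda>n. ennreal ((norm (X n - abs_G h))\<^sup>2)) \<longlonglongrightarrow> 0"
  proof -
    have "(\<integral>\<^sup>+z. ennreal ((norm (rep_G (X n) z - h z))\<^sup>2) \<partial>lborel) = ennreal ((norm (X n - abs_G h))\<^sup>2)" for n
      unfolding nn_integral_rep_diff[symmetric] using rep_abs[OF hl]
      by (intro nn_integral_cong_AE) (auto elim: eventually_mono)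
    with h show ?thesis by simp
  qed
  then have "(\<lambda>n. (norm (X n - abs_G h))\<^sup>2) \<longlonglongrightarrow> 0"
    by (subst (asm) ennreal_0[symmetric]) (simp del: ennreal_0 add: tendsto_ennreal_iff)
  then have "(\<lambda>n. sqrt ((norm (X n - abs_G h))\<^sup>2)) \<longlonglongrightarrow> sqrt 0" by (rule tendsto_real_sqrt)
  then have "X \<longlonglongrightarrow> abs_G h" by (simp add: tendsto_norm_zero_iff LIM_zero_iff)
  then show "convergent X" by (auto simp: convergent_def)
qed

section \<open>Fourier multipliers on \<open>G\<close>\<close>

definition gdom :: "(plane \<Rightarrow> complex) \<Rightarrow> G \<Rightarrow> bool"
  where "gdom m x \<longleftrightarrow> (\<exists>A. l2b (\<lambda>z. m z * rep_G x z) A)"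

text \<open>Meaningful for Hermitian m and x in \<open>gdom m\<close>; otherwise
  \<open>abs_G\<close> may be applied outside \<open>hl2\<close>, where its value is
  unspecified.\<close>

definition mul :: "(plane \<Rightarrow> complex) \<Rightarrow> G \<Rightarrow> G"
  where "mul m x = abs_G (\<lambda>z. m z * rep_G x z)"

lemma gdomI: "l2b (\<lambda>z. m z * rep_G x z) A \<Longrightarrow> gdom m x" by (auto simp: gdom_def)

lemma hl2_mul: "hermitian m \<Longrightarrow> gdom m x \<Longrightarrow> hl2 (\<lambda>z. m z * rep_G x z)"
  by (auto simp: gdom_def hl2_l2b intro: hermitian_mult hermitian_rep)

lemma rep_mul: "hermitian m \<Longrightarrow> gdom m x \<Longrightarrow> AE z in lborel. rep_G (mul m x) z = m z * rep_G x z"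
  unfolding mul_def by (intro rep_abs hl2_mul)

lemma l2b_mul_iff:
  assumes "hermitian m" "gdom m x" "bmeas m"
  shows "l2b (\<lambda>z. m z * rep_G x z) A \<longleftrightarrow> norm (mul m x) \<le> A"
proof -
  have [measurable]: "bmeas m" by fact
  have "l2b (\<lambda>z. m z * rep_G x z) A \<longleftrightarrow> l2b (rep_G (mul m x)) A"
    using rep_mul[OF assms(1,2)] by (intro l2b_cong_AE) (auto elim: eventually_mono)
  then show ?thesis by (simp add: l2b_rep_iff)
qed

lemma norm_mul_le: "hermitian m \<Longrightarrow> l2b (\<lambda>z. m z * rep_G x z) A \<Longrightarrow> norm (mul m x) \<le> A"
  unfolding mul_def by (rule norm_abs_le) (auto intro: hermitian_mult hermitian_rep)

lemma gdom_mono: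
  assumes "gdom k x" "bmeas m" "\<And>z. cmod (m z) \<le> C * cmod (k z)"
  shows "gdom m x"
proof -
  have [measurable]: "bmeas m" by fact
  obtain A where A: "l2b (\<lambda>z. k z * rep_G x z) A" using assms(1) by (auto simp: gdom_def)
  have "cmod (m z) \<le> \<bar>C\<bar> * cmod (k z)" for z
    using assms(3)[of z] by (rule order_trans) (auto intro: mult_right_mono)
  then have "cmod (m z) * cmod (rep_G x z) \<le> \<bar>C\<bar> * cmod (k z) * cmod (rep_G x z)" for z
    by (intro mult_right_mono) auto
  then have "l2b (\<lambda>z. m z * rep_G x z) (\<bar>C\<bar> * A)"
    by (intro l2b_mono[OF l2b_cmult[OF A, of "complex_of_real \<bar>C\<bar>"]]) (auto simp: norm_mult mult.assoc)
  then show ?thesis by (rule gdomI)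
qed

lemma gdom_bounded:
  assumes "bmeas m" "\<And>z. cmod (m z) \<le> C"
  shows "gdom m x"
proof (rule gdom_mono[of "\<lambda>_. 1" x m C])
  show "gdom (\<lambda>_. 1) x" using l2b_rep_iff[of x "norm x"] by (auto simp: gdom_def)
qed (use assms in auto)

lemma gdom_add: assumes [measurable]: "bmeas m" and "gdom m x" "gdom m y" shows "gdom m (x + y)"
proof -
  obtain A B where "l2b (\<lambda>z. m z * rep_G x z) A" "l2b (\<lambda>z. m z * rep_G y z) B" using assms by (auto simp: gdom_def)
  from l2b_add[OF this] have "l2b (\<lambda>z. m z * rep_G (x + y) z) (A + B)"
    by (rule l2b_AE) (use rep_add[of x y] in \<open>auto elim!: eventually_mono simp: algebra_simps\<close>)
  then show ?thesis by (rule gdomI)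
qed

lemma gdom_scaleR: assumes [measurable]: "bmeas m" and "gdom m x" shows "gdom m (c *\<^sub>R x)"
proof -
  obtain A where "l2b (\<lambda>z. m z * rep_G x z) A" using assms by (auto simp: gdom_def)
  from l2b_cmult[OF this, of "complex_of_real c"] have "l2b (\<lambda>z. m z * rep_G (c *\<^sub>R x) z) (cmod c * A)"
    by (rule l2b_AE) (use rep_scaleR[of c x] in \<open>auto elim!: eventually_mono simp: algebra_simps\<close>)
  then show ?thesis by (rule gdomI)
qed

lemma mul_add:
  assumes "hermitian m" "bmeas m" "gdom m x" "gdom m y"
  shows "mul m (x + y) = mul m x + mul m y"
  using rep_mul[OF assms(1) gdom_add[OF assms(2-4)]] rep_mul[OF assms(1,3)] rep_mul[OF assms(1,4)] rep_add[of x y] rep_add[of "mul m x" "mul m y"]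
  by (intro G_eqI, eventually_elim) (simp add: algebra_simps)

lemma mul_scaleR:
  assumes "hermitian m" "bmeas m" "gdom m x"
  shows "mul m (c *\<^sub>R x) = c *\<^sub>R mul m x"
  using rep_mul[OF assms(1) gdom_scaleR[OF assms(2,3)], of c] rep_mul[OF assms(1,3)] rep_scaleR[of c x] rep_scaleR[of c "mul m x"]
  by (intro G_eqI, eventually_elim) (simp add: algebra_simps)

lemma mul_diff:
  assumes "hermitian m" "bmeas m" "gdom m x" "gdom m y"
  shows "mul m (x - y) = mul m x - mul m y"
  using mul_add[OF assms(1,2,3) gdom_scaleR[OF assms(2,4)], of "-1"] mul_scaleR[OF assms(1,2,4), of "-1"] by simp

lemma bounded_linear_mul:
  assumes "hermitian m" "bmeas m" "\<And>z. cmod (m z) \<le> C"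
  shows "bounded_linear (mul m)" "norm (mul m x) \<le> C * norm x"
proof -
  have d: "gdom m x" for x using assms(2,3) by (rule gdom_bounded)
  show n: "norm (mul m x) \<le> C * norm x" for x
  proof (rule norm_mul_le[OF assms(1)])
    have C: "0 \<le> C" using assms(3)[of 0] norm_ge_zero order_trans by blast
    have [measurable]: "bmeas m" by fact
    have "l2b (rep_G x) (norm x)" by (simp add: l2b_rep_iff)
    from l2b_cmult[OF this, of "complex_of_real C"] show "l2b (\<lambda>z. m z * rep_G x z) (C * norm x)"
      by (rule l2b_mono) (use C assms(3) in \<open>auto intro!: always_eventually mult_right_mono simp: norm_mult simp del: split_paired_All\<close>)
  qed
  show "bounded_linear (mul m)"
    by (rule bounded_linear_intro[where K=C]) (auto simp: mul_add mul_scaleR d assms n mult.commute)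
qed

section \<open>Weights\<close>

definition jb :: "plane \<Rightarrow> real"
  where "jb z = sqrt (1 + (fst z)\<^sup>2 + (snd z)\<^sup>2)"

text \<open>As a norm on \<open>real \<times> plane\<close> the bracket satisfies the triangle
  inequality, whence the Lipschitz constant 1 in \<open>jb_lip\<close>.\<close>

lemma jb_eq_norm: "jb z = norm (1::real, z)"
  by (cases z) (simp add: jb_def norm_Pair add.assoc)

lemma jb_ge1 [simp]: "1 \<le> jb z"
  by (simp add: jb_def)
lemma jb_pos [simp]: "0 < jb z" and jb_nonneg [simp]: "0 \<le> jb z"
  using jb_ge1[of z] by (auto simp del: jb_ge1)

lemma jb_neq0 [simp]: "jb z \<noteq> 0"
  using jb_pos[of z] by linarith

lemma norm_le_jb: "norm z \<le> jb z"
  unfolding jb_eq_norm using norm_snd_le[of z "1::real"] by simp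

lemma fst_le_jb: "\<bar>fst z\<bar> \<le> jb z"
  using norm_fst_le[of "fst z" "snd z"] norm_le_jb[of z] by simp

lemma jb_lip: "\<bar>jb a - jb b\<bar> \<le> norm (a - b)"
  unfolding jb_eq_norm using norm_triangle_ineq3[of "(1::real, a)" "(1::real, b)"]
  by (simp add: norm_Pair)

lemma jb_add: "jb (a + b) \<le> jb a + jb b"
  using jb_lip[of "a + b" a] norm_le_jb[of b] by simp

lemma jb_minus [simp]: "jb (- z) = jb z"
  by (simp add: jb_def)

lemma jb_measurable [measurable]: "bmeas jb"
  unfolding jb_def[abs_def] by (intro borel_measurable_continuous_onI continuous_intros)

definition wt :: "real \<Rightarrow> plane \<Rightarrow> real" where "wt \<sigma> z = jb z powr \<sigma>"

text \<open>\<open>wR s R\<close> agrees with \<open>wt s\<close> where \<open>jb z \<ge> R\<close> and tends to 0 pointwise as \<open>R \<rightarrow> \<infinity>\<close>.\<close>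

definition gw :: "real \<Rightarrow> real \<Rightarrow> real \<Rightarrow> real"
  where "gw s R r = r powr s * min 1 (r / R)"

definition wR :: "real \<Rightarrow> real \<Rightarrow> plane \<Rightarrow> real"
  where "wR s R z = gw s R (jb z)"

abbreviation l2w :: "real \<Rightarrow> real \<Rightarrow> (plane \<Rightarrow> complex) \<Rightarrow> real \<Rightarrow> bool"
  where "l2w s R f \<equiv> l2b (\<lambda>z. of_real (wR s R z) * f z)"

lemma wt_measurable [measurable]: "bmeas (wt \<sigma>)"
  unfolding wt_def[abs_def] by measurable
lemma wR_measurable [measurable]: "bmeas (wR s R)"
  unfolding wR_def[abs_def] gw_def by measurable

lemma wt_nonneg [simp]: "0 \<le> wt \<sigma> z" and wt_pos [simp]: "0 < wt \<sigma> z"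
  by (simp_all add: wt_def)
lemma wt_minus [simp]: "wt \<sigma> (- z) = wt \<sigma> z" by (simp add: wt_def)
lemma wR_minus [simp]: "wR s R (- z) = wR s R z" by (simp add: wR_def)
lemma wt_mono: "\<sigma> \<le> \<rho> \<Longrightarrow> wt \<sigma> z \<le> wt \<rho> z"
  by (auto simp: wt_def intro: powr_mono)
lemma wt_add: "wt (\<sigma> + \<rho>) z = wt \<sigma> z * wt \<rho> z"
  by (simp add: wt_def powr_add)
lemma wt_0 [simp]: "wt 0 z = 1" by (simp add: wt_def)
lemma wt_1: "wt 1 z = jb z" by (simp add: wt_def)
lemma wR_1: "wR s 1 z = wt s z" by (simp add: wR_def wt_def gw_def)
lemma wR_nonneg: "1 \<le> R \<Longrightarrow> 0 \<le> wR s R z" by (simp add: wR_def gw_def)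
lemma wR_le_wt: "1 \<le> R \<Longrightarrow> wR s R z \<le> wt s z"
  by (auto simp: wR_def wt_def gw_def mult_le_cancel_left2)
lemma wR_eq_wt: "1 \<le> R \<Longrightarrow> R \<le> jb z \<Longrightarrow> wR s R z = wt s z"
  by (simp add: wR_def wt_def gw_def)
lemma wt_le_R: "0 \<le> \<sigma> \<Longrightarrow> jb z \<le> R \<Longrightarrow> wt \<sigma> z \<le> R powr \<sigma>"
  unfolding wt_def by (rule powr_mono2) auto

text \<open>Bernoulli's inequality for real exponents: on (0, 1] the function x^\<sigma> - \<sigma>
  x has derivative \<sigma> (x^(\<sigma> - 1) - 1) \<le> 0.\<close>

lemma one_minus_powr_le:
  fixes x \<sigma> :: real assumes "1 \<le> \<sigma>" "0 < x" "x \<le> 1"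
  shows "1 - x powr \<sigma> \<le> \<sigma> * (1 - x)"
proof -
  let ?f = "\<lambda>x. x powr \<sigma> - \<sigma> * x"
  have "?f 1 \<le> ?f x"
  proof (rule DERIV_nonpos_imp_nonincreasing[OF assms(3)])
    fix y assume y: "x \<le> y" "y \<le> 1"
    have "y powr (\<sigma> - 1) \<le> 1 powr (\<sigma> - 1)" using y assms by (intro powr_mono2) auto
    then have "\<sigma> * y powr (\<sigma> - 1) - \<sigma> \<le> 0" using assms by simp
    moreover have "(?f has_real_derivative \<sigma> * y powr (\<sigma> - 1) - \<sigma>) (at y)"
      using y assms by (auto intro!: derivative_eq_intros)
    ultimately show "\<exists>d. (?f has_real_derivative d) (at y) \<and> d \<le> 0" by blast
  qed
  then show ?thesis by (simp add: algebra_simps)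
qed

context
  fixes s R :: real assumes s: "1 \<le> s" and R: "1 \<le> R"
begin

lemma gw_nonneg: "0 \<le> r \<Longrightarrow> 0 \<le> gw s R r"
  using R by (simp add: gw_def)

lemma gw_mono: "0 < a \<Longrightarrow> a \<le> b \<Longrightarrow> gw s R a \<le> gw s R b"
  unfolding gw_def using s R by (intro mult_mono powr_mono2 min.mono divide_right_mono) auto

lemma gw_div_mono: assumes "0 < a" "a \<le> b" shows "gw s R a / a \<le> gw s R b / b"
proof -
  have e: "gw s R r / r = r powr (s - 1) * min 1 (r / R)" if "0 < r" for r
    using that by (simp add: gw_def powr_diff)
  have "a powr (s - 1) * min 1 (a / R) \<le> b powr (s - 1) * min 1 (b / R)"
    using assms s R by (intro mult_mono powr_mono2 min.mono divide_right_mono) auto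
  then show ?thesis using assms by (simp add: e)
qed

text \<open>The profile grows at most like r^(s + 1): the power contributes s and
  \<open>min 1 (r / R)\<close> at most 1, whatever R is. The constants for \<open>wR\<close> derive
  from this bound, hence do not depend on R.\<close>

lemma gw_scale_ge: assumes "0 < a" "0 < x" "x \<le> 1" shows "x powr (s + 1) * gw s R a \<le> gw s R (x * a)"
proof -
  have "x * min 1 (a / R) = min x (x * a / R)" using assms by (simp add: min_mult_distrib_left)
  also have "\<dots> \<le> min 1 (x * a / R)" using assms by (intro min.mono) auto
  finally have "x * min 1 (a / R) \<le> min 1 (x * a / R)" .
  then have "x powr s * a powr s * (x * min 1 (a / R)) \<le> x powr s * a powr s * min 1 (x * a / R)"
    by (intro mult_left_mono) auto
  then show ?thesis using assms by (simp add: gw_def powr_add powr_mult ac_simps)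
qed

text \<open>Scaling by x = b / a combined with Bernoulli's inequality for the exponent s + 1. It
  takes the place of the mean value theorem, as the profile has a corner at r = R.\<close>

lemma gw_diff: assumes "0 < b" "b \<le> a" shows "gw s R a - gw s R b \<le> (s + 1) * (a - b) * (gw s R a / a)"
proof -
  have "(b / a) powr (s + 1) * gw s R a \<le> gw s R b"
    using gw_scale_ge[of a "b / a"] assms by simp
  then have "gw s R a - gw s R b \<le> (1 - (b / a) powr (s + 1)) * gw s R a" by (simp add: algebra_simps)
  also have "\<dots> \<le> ((s + 1) * (1 - b / a)) * gw s R a"
    using assms s by (intro mult_right_mono one_minus_powr_le gw_nonneg) auto
  also have "\<dots> = (s + 1) * (a - b) * (gw s R a / a)" using assms by (simp add: field_simps)
  finally show ?thesis .
qed

lemma gw_double: assumes "0 < r" shows "gw s R (2 * r) \<le> 2 powr (s + 1) * gw s R r"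
proof -
  have "(1/2) powr (s + 1) * gw s R (2 * r) \<le> gw s R r"
    using gw_scale_ge[of "2 * r" "1/2"] assms by simp
  then show ?thesis by (simp add: powr_divide field_simps)
qed

lemma wR_subadd: "wR s R (a + b) \<le> 2 powr (s + 1) * (wR s R a + wR s R b)"
proof -
  define m where "m = max (jb a) (jb b)"
  have m: "0 < m" by (simp add: m_def less_max_iff_disj)
  have "jb (a + b) \<le> 2 * m" using jb_add[of a b] by (simp add: m_def)
  then have "wR s R (a + b) \<le> gw s R (2 * m)" unfolding wR_def by (intro gw_mono) auto
  also have "\<dots> \<le> 2 powr (s + 1) * gw s R m" by (rule gw_double[OF m])
  also have "gw s R m \<le> wR s R a + wR s R b"
    using wR_nonneg[OF R, of s a] wR_nonneg[OF R, of s b] by (auto simp: m_def max_def wR_def)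
  finally show ?thesis by simp
qed

text \<open>The difference of the weights is one power of the bracket smaller, paid for by norm (a -
  b). Since \<open>gw s R r / r\<close> increases with r, the larger of \<open>jb a\<close> and
  \<open>jb b\<close> may be replaced by twice the larger of \<open>jb (a - b)\<close> and
  \<open>jb b\<close>. Applied to a product, norm (a - b) becomes a derivative of the multiplier,
  and 1 / jb absorbs the derivative of the other factor.\<close>

lemma wR_commutator:
  "\<bar>wR s R a - wR s R b\<bar> \<le> (s + 1) * 2 powr (s + 1) * norm (a - b) * (wR s R (a - b) / jb (a - b) + wR s R b / jb b)"
proof -
  define M where "M = max (jb a) (jb b)"
  define m where "m = max (jb (a - b)) (jb b)"
  have M: "0 < M" by (simp add: M_def less_max_iff_disj)
  have m: "0 < m" by (simp add: m_def less_max_iff_disj)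
  have Mm: "M \<le> 2 * m" using jb_add[of "a - b" b] jb_nonneg[of b] by (auto simp: M_def m_def max_def simp del: jb_nonneg)
  have "\<bar>wR s R a - wR s R b\<bar> \<le> (s + 1) * \<bar>jb a - jb b\<bar> * (gw s R M / M)"
  proof (cases "jb a \<le> jb b")
    case True
    then show ?thesis using gw_diff[of "jb a" "jb b"] gw_mono[of "jb a" "jb b"] by (simp add: wR_def M_def)
  next
    case False
    then show ?thesis using gw_diff[of "jb b" "jb a"] gw_mono[of "jb b" "jb a"] by (simp add: wR_def M_def max_def)
  qed
  also have "\<dots> \<le> (s + 1) * norm (a - b) * (gw s R (2 * m) / (2 * m))"
    using s M m gw_nonneg[of M] gw_nonneg[of "2 * m"] by (intro mult_mono jb_lip gw_div_mono Mm) (auto intro!: divide_nonneg_pos)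
  also have "gw s R (2 * m) / (2 * m) \<le> 2 powr (s + 1) * gw s R m / (2 * m)"
    using gw_double[OF m] m by (intro divide_right_mono) auto
  also have "\<dots> \<le> 2 powr (s + 1) * (gw s R m / m)"
    using m gw_nonneg[of m] by (simp add: field_simps)
  also have "gw s R m / m \<le> wR s R (a - b) / jb (a - b) + wR s R b / jb b"
    using divide_nonneg_pos[OF wR_nonneg[OF R, of s "a - b"] jb_pos[of "a - b"]] divide_nonneg_pos[OF wR_nonneg[OF R, of s b] jb_pos[of b]]
    by (auto simp: m_def max_def wR_def)
  finally have "\<bar>wR s R a - wR s R b\<bar> \<le> (s + 1) * (norm (a - b) * (2 powr (s + 1) * (wR s R (a - b) / jb (a - b) + wR s R b / jb b)))"
    using s by (simp add: mult_left_mono mult.assoc)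
  then show ?thesis by (simp add: ac_simps)
qed

end

section \<open>Products measured by almost subadditive weights\<close>

definition tame :: "(plane \<Rightarrow> real) \<Rightarrow> real \<Rightarrow> bool"
  where "tame W C \<longleftrightarrow> bmeas W \<and> (\<forall>z. 0 \<le> W z) \<and> 0 \<le> C \<and> (\<forall>a b. W (a + b) \<le> C * (W a + W b))"

lemma tame_wR: "1 \<le> s \<Longrightarrow> 1 \<le> R \<Longrightarrow> tame (wR s R) (2 powr (s + 1))"
  by (simp add: tame_def wR_subadd wR_nonneg)

lemma tame_wt: assumes "0 \<le> \<sigma>" shows "tame (wt \<sigma>) (2 powr \<sigma>)"
proof -
  have "wt \<sigma> (a + b) \<le> 2 powr \<sigma> * (wt \<sigma> a + wt \<sigma> b)" for a b
  proof -
    define m where "m = max (jb a) (jb b)"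
    have m: "0 < m" by (simp add: m_def less_max_iff_disj)
    have "jb (a + b) \<le> 2 * m" using jb_add[of a b] by (simp add: m_def)
    then have "wt \<sigma> (a + b) \<le> (2 * m) powr \<sigma>" unfolding wt_def using assms by (intro powr_mono2) auto
    also have "\<dots> = 2 powr \<sigma> * m powr \<sigma>" using m by (simp add: powr_mult)
    also have "m powr \<sigma> \<le> wt \<sigma> a + wt \<sigma> b" by (auto simp: m_def max_def wt_def)
    finally show ?thesis by simp
  qed
  then show ?thesis by (simp add: tame_def)
qed

text \<open>Writing \<zeta> = (\<zeta> - \<eta>) + \<eta> puts the weight on one factor while the
  other is measured in L^1; each of the two terms is then an instance of Young's inequality.\<close>

lemma l2b_tame_conv:
  assumes W: "tame W C"
    and f: "l2b (\<lambda>z. of_real (W z) * f z) A" "l1b f A1" and g: "l2b (\<lambda>z. of_real (W z) * g z) B" "l1b g B1"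
  shows "l2b (\<lambda>z. of_real (W z) * conv f g z) (C * (A * B1 + A1 * B))"
proof -
  have [measurable]: "bmeas f" "bmeas g" "bmeas W"
    using assms by (auto simp: l1b_def tame_def)
  have C: "0 \<le> C" and Wnn: "0 \<le> W z" for z using W unfolding tame_def by blast+
  let ?Wf = "nm (\<lambda>z. of_real (W z) * f z)" and ?Wg = "nm (\<lambda>z. of_real (W z) * g z)"
  have "l2n (\<lambda>z. ennreal C * (nc ?Wf (nm g) z + nc (nm f) ?Wg z)) (C * (A * B1 + A1 * B))"
    using assms by (intro l2n_cmult l2n_add l2n_nc' l2n_nc l2b_n l1b_n C)
  then have "l2n (nm (\<lambda>z. of_real (W z) * conv f g z)) (C * (A * B1 + A1 * B))"
  proof (rule l2n_mono)
    have "ennreal (cmod (of_real (W \<zeta>) * conv f g \<zeta>)) \<le> ennreal C * (nc ?Wf (nm g) \<zeta> + nc (nm f) ?Wg \<zeta>)" for \<zeta>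
    proof -
      have "ennreal (cmod (of_real (W \<zeta>) * conv f g \<zeta>)) \<le> ennreal (W \<zeta>) * nc (nm f) (nm g) \<zeta>"
        using Wnn by (simp add: norm_mult ennreal_mult mult_left_mono conv_le_nc)
      also have "\<dots> = (\<integral>\<^sup>+\<eta>. ennreal (W \<zeta>) * (nm f (\<zeta> - \<eta>) * nm g \<eta>) \<partial>lborel)"
        unfolding nc_def by (rule nn_integral_cmult[symmetric]) measurable
      also have "\<dots> \<le> (\<integral>\<^sup>+\<eta>. ennreal C * (?Wf (\<zeta> - \<eta>) * nm g \<eta> + nm f (\<zeta> - \<eta>) * ?Wg \<eta>) \<partial>lborel)"
      proof (rule nn_integral_mono)
        fix \<eta>
        have "W ((\<zeta> - \<eta>) + \<eta>) \<le> C * (W (\<zeta> - \<eta>) + W \<eta>)" using W unfolding tame_def by blast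
        then have "W \<zeta> * (cmod (f (\<zeta> - \<eta>)) * cmod (g \<eta>)) \<le> C * (W (\<zeta> - \<eta>) + W \<eta>) * (cmod (f (\<zeta> - \<eta>)) * cmod (g \<eta>))"
          by (intro mult_right_mono) auto
        then have "ennreal (W \<zeta> * (cmod (f (\<zeta> - \<eta>)) * cmod (g \<eta>))) \<le>
          ennreal (C * (W (\<zeta> - \<eta>) * cmod (f (\<zeta> - \<eta>)) * cmod (g \<eta>) + cmod (f (\<zeta> - \<eta>)) * (W \<eta> * cmod (g \<eta>))))"
          by (intro ennreal_leI) (simp add: algebra_simps)
        then show "ennreal (W \<zeta>) * (nm f (\<zeta> - \<eta>) * nm g \<eta>) \<le> ennreal C * (?Wf (\<zeta> - \<eta>) * nm g \<eta> + nm f (\<zeta> - \<eta>) * ?Wg \<eta>)"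
          using Wnn C by (simp add: norm_mult ennreal_mult)
      qed
      also have "\<dots> = ennreal C * (nc ?Wf (nm g) \<zeta> + nc (nm f) ?Wg \<zeta>)"
        unfolding nc_def by (subst nn_integral_cmult) (auto simp: nn_integral_add)
      finally show ?thesis .
    qed
    then show "AE z in lborel. nm (\<lambda>z. of_real (W z) * conv f g z) z \<le> ennreal C * (nc ?Wf (nm g) z + nc (nm f) ?Wg z)" by simp
  qed auto
  then show ?thesis by (simp add: l2b_def)
qed

section \<open>Integrability of negative powers of the bracket and the Sobolev embedding\<close>

lemma nn_integral_one_plus_square:
  fixes \<tau> :: real assumes "1 < \<tau>"
  shows "(\<integral>\<^sup>+x. ennreal ((1 + x\<^sup>2) powr (-\<tau>/2)) \<partial>lborel) < \<infinity>"
proof -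
  let ?h = "\<lambda>x::real. (1 + x\<^sup>2) powr (-\<tau>/2)"
  let ?p = "\<lambda>x::real. indicator {1..} x * x powr (-\<tau>)"
  have hi: "((\<lambda>x. x powr (-\<tau>)) has_integral -(1 powr (-\<tau> + 1)) / (-\<tau> + 1)) {1..}"
    by (rule has_integral_powr_to_inf) (use assms in auto)
  have p: "(\<integral>\<^sup>+x. ennreal (?p x) \<partial>lborel) = ennreal (-(1 powr (-\<tau> + 1)) / (-\<tau> + 1))"
    by (rule nn_integral_has_integral_lebesgue[OF _ hi]) simp
  have pm: "(\<integral>\<^sup>+x. ennreal (?p (0 - x)) \<partial>lborel) = (\<integral>\<^sup>+x. ennreal (?p x) \<partial>lborel)"
    by (rule nn_integral_lborel_reflect[of "\<lambda>x. ennreal (?p x)"]) measurable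
  have pt: "?h x \<le> indicator {-1..1} x + (?p x + ?p (0 - x))" for x
  proof (cases "\<bar>x\<bar> \<le> 1")
    case True
    have "?h x \<le> 1 powr (-\<tau>/2)" using assms by (intro powr_mono2') auto
    moreover have "indicator {-1..1} x = (1::real)" using True by (auto simp: indicator_def)
    ultimately show ?thesis by (auto intro: add_increasing2)
  next
    case False
    have "?h x \<le> (\<bar>x\<bar>\<^sup>2) powr (-\<tau>/2)" using assms False by (intro powr_mono2') auto
    also have "\<bar>x\<bar>\<^sup>2 = \<bar>x\<bar> powr 2" using False by simp
    also have "(\<bar>x\<bar> powr 2) powr (-\<tau>/2) = \<bar>x\<bar> powr (-\<tau>)" by (subst powr_powr) simp
    also have "\<dots> = ?p x + ?p (0 - x)" using False by (auto simp: indicator_def abs_if split: if_splits)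
    finally show ?thesis by (simp add: indicator_def)
  qed
  have "(\<integral>\<^sup>+x. ennreal (?h x) \<partial>lborel) \<le> (\<integral>\<^sup>+x. indicator {-1..1} x + (ennreal (?p x) + ennreal (?p (0 - x))) \<partial>lborel)"
  proof (rule nn_integral_mono)
    fix x
    have "ennreal (?h x) \<le> ennreal (indicator {-1..1} x + (?p x + ?p (0 - x)))" by (intro ennreal_leI pt)
    also have "\<dots> = indicator {-1..1} x + (ennreal (?p x) + ennreal (?p (0 - x)))"
      by (simp add: add_nonneg_nonneg ennreal_indicator[symmetric])
    finally show "ennreal (?h x) \<le> indicator {-1..1} x + (ennreal (?p x) + ennreal (?p (0 - x)))" .
  qed
  also have "\<dots> = (\<integral>\<^sup>+x. indicator {-1..1} x \<partial>(lborel::real measure)) + ((\<integral>\<^sup>+x. ennreal (?p x) \<partial>lborel) + (\<integral>\<^sup>+x. ennreal (?p (0 - x)) \<partial>lborel))"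
    by (simp add: nn_integral_add)
  also have "\<dots> < \<infinity>" unfolding pm p by (simp add: ennreal_add_eq_top less_top)
  finally show ?thesis .
qed

lemma nn_integral_plane:
  fixes f :: "plane \<Rightarrow> ennreal" assumes [measurable]: "bmeas f"
  shows "(\<integral>\<^sup>+z. f z \<partial>lborel) = (\<integral>\<^sup>+x. \<integral>\<^sup>+y. f (x, y) \<partial>lborel \<partial>lborel)"
proof -
  have "(\<integral>\<^sup>+z. f z \<partial>lborel) = (\<integral>\<^sup>+z. f z \<partial>(lborel \<Otimes>\<^sub>M lborel))" by (simp add: lborel_prod)
  also have "\<dots> = (\<integral>\<^sup>+x. \<integral>\<^sup>+y. f (x, y) \<partial>lborel \<partial>lborel)"
    by (rule lborel.nn_integral_fst[symmetric]) (simp add: lborel_prod)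
  finally show ?thesis .
qed

text \<open>By (1 + x^2) (1 + y^2) \<le> (1 + x^2 + y^2)^2 the integral is dominated by a product of
  two integrals over the line. The threshold 1 for \<rho> is half the dimension.\<close>

lemma nn_integral_jb:
  assumes "1 < \<rho>" shows "(\<integral>\<^sup>+z. ennreal (jb z powr (- 2 * \<rho>)) \<partial>lborel) < \<infinity>"
proof -
  let ?h = "\<lambda>x::real. (1 + x\<^sup>2) powr (-\<rho>/2)"
  have pt: "jb (x, y) powr (- 2 * \<rho>) \<le> ?h x * ?h y" for x y
  proof -
    have "jb (x, y) powr (-2 * \<rho>) = (jb (x, y) powr 4) powr (-\<rho>/2)" by (subst powr_powr) simp
    also have "\<dots> \<le> ((1 + x\<^sup>2) * (1 + y\<^sup>2)) powr (-\<rho>/2)"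
    proof (rule powr_mono2')
      have "jb (x, y) powr 4 = ((jb (x, y))\<^sup>2)\<^sup>2" by (simp flip: power_mult)
      also have "\<dots> = (1 + x\<^sup>2 + y\<^sup>2)\<^sup>2" by (simp add: jb_def)
      finally have "jb (x, y) powr 4 = (1 + x\<^sup>2 + y\<^sup>2)\<^sup>2" .
      moreover have "(1 + x\<^sup>2) * (1 + y\<^sup>2) \<le> (1 + x\<^sup>2 + y\<^sup>2) * (1 + x\<^sup>2 + y\<^sup>2)"
        by (intro mult_mono) auto
      ultimately show "(1 + x\<^sup>2) * (1 + y\<^sup>2) \<le> jb (x, y) powr 4" by (simp add: power2_eq_square)
    qed (use assms in \<open>auto intro!: mult_pos_pos add_pos_nonneg\<close>)
    also have "\<dots> = ?h x * ?h y" by (simp add: powr_mult add_nonneg_nonneg)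
    finally show ?thesis .
  qed
  have "(\<integral>\<^sup>+z. ennreal (jb z powr (- 2 * \<rho>)) \<partial>lborel) = (\<integral>\<^sup>+x. \<integral>\<^sup>+y. ennreal (jb (x, y) powr (- 2 * \<rho>)) \<partial>lborel \<partial>lborel)"
    by (rule nn_integral_plane) measurable
  also have "\<dots> \<le> (\<integral>\<^sup>+x. \<integral>\<^sup>+y. ennreal (?h x) * ennreal (?h y) \<partial>lborel \<partial>lborel)"
    by (intro nn_integral_mono) (simp only: ennreal_mult[symmetric] powr_ge_zero ennreal_leI[OF pt])
  also have "\<dots> = (\<integral>\<^sup>+x. ennreal (?h x) \<partial>lborel) * (\<integral>\<^sup>+x. ennreal (?h x) \<partial>lborel)"
    by (simp add: nn_integral_cmult nn_integral_multc)
  also have "\<dots> < \<infinity>" using nn_integral_one_plus_square[OF assms] by (simp add: ennreal_mult_less_top)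
  finally show ?thesis .
qed

text \<open>The Sobolev constant: the L^2 norm of \<open>wt (-\<rho>)\<close>, by which
  Cauchy-Schwarz bounds the L^1 norm of a transform. For \<rho> \<le> 1 the integral is infinite and
  \<open>enn2real\<close> returns 0.\<close>

definition cS :: "real \<Rightarrow> real"
  where "cS \<rho> = sqrt (enn2real (\<integral>\<^sup>+z. ennreal (jb z powr (- 2 * \<rho>)) \<partial>lborel))"

lemma cS_nonneg [simp]: "0 \<le> cS \<rho>" by (simp add: cS_def)

lemma l2b_wt_neg: assumes "1 < \<rho>" shows "l2b (\<lambda>z. of_real (wt (-\<rho>) z)) (cS \<rho>)"
proof -
  have "(\<integral>\<^sup>+z. (nm (\<lambda>z. of_real (wt (-\<rho>) z)) z)\<^sup>2 \<partial>lborel) = (\<integral>\<^sup>+z. ennreal (jb z powr (- 2 * \<rho>)) \<partial>lborel)"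
  proof (rule nn_integral_cong)
    fix z
    have "(cmod (of_real (wt (-\<rho>) z)))\<^sup>2 = jb z powr (- 2 * \<rho>)"
      by (simp add: power2_eq_square wt_def flip: powr_add)
    then show "(nm (\<lambda>z. of_real (wt (-\<rho>) z)) z)\<^sup>2 = ennreal (jb z powr (- 2 * \<rho>))"
      by (simp only: ennreal_power norm_ge_zero)
  qed
  also have "\<dots> = ennreal ((cS \<rho>)\<^sup>2)"
    using nn_integral_jb[OF assms] by (simp add: cS_def ennreal_enn2real_if less_top)
  finally show ?thesis by (simp add: l2b_def l2n_def)
qed

lemma l1b_of_weighted:
  assumes "1 < \<rho>" "l2b (\<lambda>z. of_real (wt \<rho> z) * f z) A" "bmeas f"
  shows "l1b f (cS \<rho> * A)"
proof (rule l1b_mono[OF l1b_prod[OF l2b_wt_neg[OF assms(1)] assms(2)] assms(3)])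
  have "complex_of_real (wt (-\<rho>) z) * (complex_of_real (wt \<rho> z) * f z) = f z" for z
  proof -
    have "wt (-\<rho>) z * wt \<rho> z = 1" using wt_add[of "-\<rho>" \<rho> z] by simp
    then show ?thesis by (simp only: mult.assoc[symmetric] of_real_mult[symmetric]) simp
  qed
  then show "AE z in lborel. cmod (f z) \<le> cmod (complex_of_real (wt (-\<rho>) z) * (complex_of_real (wt \<rho> z) * f z))" by (simp only: order_refl eventually_True)
qed simp

section \<open>The nonlinearity in frequency space\<close>

lemma fst_plane_measurable [measurable]: "bmeas (fst :: plane \<Rightarrow> real)"
  and snd_plane_measurable [measurable]: "bmeas (snd :: plane \<Rightarrow> real)"
  by (intro borel_measurable_continuous_onI continuous_intros)+

lemma Re_of_real_mult: "Re (complex_of_real c * z) = c * Re z"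
  by simp

lemma l2b_scale_le:
  assumes "l2b f A" "cmod c \<le> 1" shows "l2b (\<lambda>z. c * f z) A"
proof (rule l2b_mono[OF assms(1)])
  show "bmeas (\<lambda>z. c * f z)" using l2b_measurable[OF assms(1)] by simp
  show "AE z in lborel. cmod (c * f z) \<le> cmod (f z)"
    using assms(2) by (auto simp: norm_mult intro!: always_eventually mult_left_le_one_le)
qed simp

lemma l2b_pair_le:
  assumes "l2b u A" "l2b v B"
  shows "\<bar>LINT z|lborel. Re (u z * cnj (v z))\<bar> \<le> A * B"
proof -
  have l: "l1b (\<lambda>z. u z * cnj (v z)) (A * B)" by (intro l1b_prod l2b_cnj assms)
  have "(LINT z|lborel. Re (u z * cnj (v z))) = Re (LINT z|lborel. u z * cnj (v z))"
    by (rule integral_Re[OF l1b_integrable[OF l]])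
  also have "\<bar>\<dots>\<bar> \<le> cmod (LINT z|lborel. u z * cnj (v z))" by (rule abs_Re_le_cmod)
  also have "\<dots> \<le> A * B" by (rule l1b_integral_le[OF l])
  finally show ?thesis .
qed

text \<open>On the Fourier side, membership in the closed ball of radius A of H^\<sigma>.\<close>

definition hb :: "real \<Rightarrow> (plane \<Rightarrow> complex) \<Rightarrow> real \<Rightarrow> bool"
  where "hb \<sigma> f A \<longleftrightarrow> bmeas f \<and> l2b (\<lambda>z. of_real (wt \<sigma> z) * f z) A"

lemma hb_measurable: "hb \<sigma> f A \<Longrightarrow> bmeas f" by (simp add: hb_def)
lemma hb_nonneg: "hb \<sigma> f A \<Longrightarrow> 0 \<le> A" by (auto simp: hb_def dest: l2b_nonneg)
lemma hb_l2b: "hb \<sigma> f A \<Longrightarrow> l2b (\<lambda>z. of_real (wt \<sigma> z) * f z) A" by (simp add: hb_def)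
lemma hb_0: "hb 0 f A \<longleftrightarrow> l2b f A" by (auto simp: hb_def l2b_measurable)

lemma hb_dominated:
  assumes "hb \<sigma> f A" "bmeas g" "\<And>z. wt \<rho> z * cmod (g z) \<le> wt \<sigma> z * cmod (f z)" "A \<le> B"
  shows "hb \<rho> g B"
  unfolding hb_def
proof
  have [measurable]: "bmeas g" by fact
  show "l2b (\<lambda>z. of_real (wt \<rho> z) * g z) B"
    using assms(3) by (intro l2b_mono[OF hb_l2b[OF assms(1)] _ _ assms(4)]) (auto simp: norm_mult)
qed fact

lemma hb_mono: assumes "hb \<rho> f A" "\<sigma> \<le> \<rho>" "A \<le> B" shows "hb \<sigma> f B"
  using assms by (intro hb_dominated[OF assms(1) hb_measurable[OF assms(1)]]) (auto intro: mult_right_mono wt_mono)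

lemma hb_add: "hb \<sigma> f A \<Longrightarrow> hb \<sigma> g B \<Longrightarrow> hb \<sigma> (\<lambda>z. f z + g z) (A + B)"
  unfolding hb_def using l2b_add[of "\<lambda>z. of_real (wt \<sigma> z) * f z" A "\<lambda>z. of_real (wt \<sigma> z) * g z" B]
  by (auto simp: distrib_left)

lemma hb_scale_le: "hb \<sigma> f A \<Longrightarrow> cmod c \<le> 1 \<Longrightarrow> hb \<sigma> (\<lambda>z. c * f z) A"
  unfolding hb_def using l2b_scale_le[of "\<lambda>z. of_real (wt \<sigma> z) * f z" A c]
  by (auto simp: mult.left_commute)

lemma hb_diff: "hb \<sigma> f A \<Longrightarrow> hb \<sigma> g B \<Longrightarrow> hb \<sigma> (\<lambda>z. f z - g z) (A + B)"
  using hb_add[of \<sigma> f A "\<lambda>z. -1 * g z" B] hb_scale_le[of \<sigma> g B "-1"] by simp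

lemma hb_l1b: "1 < \<rho> \<Longrightarrow> hb \<rho> f A \<Longrightarrow> l1b f (cS \<rho> * A)"
  by (auto simp: hb_def intro: l1b_of_weighted)

definition kc :: "real \<Rightarrow> real \<Rightarrow> real" where "kc \<sigma> \<rho> = 2 powr \<sigma> * (cS \<sigma> + cS \<rho>)"

lemma kc_nonneg [simp]: "0 \<le> kc \<sigma> \<rho>" by (simp add: kc_def)

text \<open>For \<sigma> = 0 Young's inequality is enough. Otherwise the weight can fall on g, and
  then d must be integrable, which \<sigma> > 1 ensures. The sum in \<open>kc\<close> lets one
  constant serve both cases.\<close>

lemma hb_conv:
  assumes "hb \<rho> g A" "hb \<sigma> d D" "1 < \<rho>" "\<sigma> = 0 \<or> 1 < \<sigma>" "\<sigma> \<le> \<rho>"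
  shows "hb \<sigma> (conv g d) (kc \<sigma> \<rho> * A * D)"
proof -
  have [measurable]: "bmeas g" "bmeas d"
    using assms by (auto dest: hb_measurable)
  have g1: "l1b g (cS \<rho> * A)" by (rule hb_l1b[OF assms(3,1)])
  have nn: "0 \<le> A" "0 \<le> D" using assms by (auto dest: hb_nonneg)
  show ?thesis using assms(4)
  proof
    assume [simp]: "\<sigma> = 0"
    have "l2b (conv g d) ((cS \<rho> * A) * D)" using assms(2) g1 by (intro l2b_conv) (simp_all add: hb_0)
    then have "hb 0 (conv g d) ((cS \<rho> * A) * D)" by (simp add: hb_0)
    then have "hb 0 (conv g d) (kc 0 \<rho> * A * D)"
      by (rule hb_mono) (use nn in \<open>auto simp: kc_def intro!: mult_right_mono\<close>)
    then show ?thesis by simp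
  next
    assume \<sigma>: "1 < \<sigma>"
    have gA: "l2b (\<lambda>z. of_real (wt \<sigma> z) * g z) A"
      using hb_mono[OF assms(1,5) order_refl] by (simp add: hb_def)
    have "l2b (\<lambda>z. of_real (wt \<sigma> z) * conv g d z) (2 powr \<sigma> * (A * (cS \<sigma> * D) + (cS \<rho> * A) * D))"
      by (rule l2b_tame_conv[OF tame_wt gA g1 hb_l2b[OF assms(2)] hb_l1b[OF \<sigma> assms(2)]]) (use \<sigma> in simp)
    then show ?thesis by (simp add: hb_def kc_def algebra_simps)
  qed
qed

lemma hb_conv':
  assumes "hb \<rho> g A" "hb \<sigma> d D" "1 < \<rho>" "\<sigma> = 0 \<or> 1 < \<sigma>" "\<sigma> \<le> \<rho>"
  shows "hb \<sigma> (conv d g) (kc \<sigma> \<rho> * A * D)"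
  using hb_conv[OF assms] assms(1,2) by (subst conv_commute) (auto dest: hb_measurable)

section \<open>The transform of the nonlinearity and its Sobolev bounds\<close>

definition dx :: "(plane \<Rightarrow> complex) \<Rightarrow> plane \<Rightarrow> complex"
  where "dx f \<zeta> = \<i> * of_real (fst \<zeta>) * f \<zeta>"

lemma dx_measurable [measurable]:
  assumes v: "bmeas v" shows "bmeas (dx v)"
proof -
  have "bmeas (\<lambda>\<zeta>::plane. \<i> * complex_of_real (fst \<zeta>))"
    by (intro borel_measurable_continuous_onI continuous_intros)
  from borel_measurable_times[OF this v] show ?thesis by (simp add: dx_def[abs_def])
qed

lemma dx_diff: "dx (\<lambda>z. f z - g z) = (\<lambda>z. dx f z - dx g z)"
  by (simp add: dx_def fun_eq_iff algebra_simps)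

lemma hermitian_dx: "hermitian f \<Longrightarrow> hermitian (dx f)"
  by (intro hermitianI) (simp add: dx_def hermitianD)

lemma hb_dx: assumes "hb s f A" shows "hb (s - 1) (dx f) A"
proof (rule hb_dominated[OF assms])
  fix z
  have "wt (s - 1) z * cmod (dx f z) \<le> wt (s - 1) z * (jb z * cmod (f z))"
    by (auto simp: dx_def norm_mult intro!: mult_left_mono mult_right_mono fst_le_jb)
  also have "wt (s - 1) z * (jb z * cmod (f z)) = wt s z * cmod (f z)"
    using wt_add[of "s - 1" 1 z] by (simp add: wt_1 mult.assoc)
  finally show "wt (s - 1) z * cmod (dx f z) \<le> wt s z * cmod (f z)" .
qed (use hb_measurable[OF assms] in auto)

text \<open>Here s > 2 enters: after one derivative the index s - 1 still exceeds 1, half the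
  dimension.\<close>

lemma l1b_jb: assumes "hb s f A" "2 < s" shows "l1b (\<lambda>z. of_real (jb z) * f z) (cS (s - 1) * A)"
proof (rule hb_l1b)
  have [measurable]: "bmeas f" using assms by (auto dest: hb_measurable)
  show "hb (s - 1) (\<lambda>z. of_real (jb z) * f z) A"
  proof (rule hb_dominated[OF assms(1)])
    show "wt (s - 1) z * cmod (of_real (jb z) * f z) \<le> wt s z * cmod (f z)" for z
      using wt_add[of "s - 1" 1 z] by (simp add: wt_1 mult.assoc norm_mult)
  qed auto
qed (use assms in auto)

text \<open>\<open>pw v k\<close> is the transform of \<open>u ^ (k + 1)\<close>, not of \<open>u ^ k\<close>, as \<open>u ^ 0\<close> is not in \<open>L\<^sup>2\<close>;
  accordingly \<open>nl p v\<close> is the transform of \<open>u ^ p\<close> times \<open>u\<^sub>x\<close> only for \<open>p \<ge> 1\<close>.\<close>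

primrec pw :: "(plane \<Rightarrow> complex) \<Rightarrow> nat \<Rightarrow> plane \<Rightarrow> complex" where
  "pw v 0 = v"
| "pw v (Suc k) = (\<lambda>\<zeta>. of_real (1 / (2 * pi)) * conv v (pw v k) \<zeta>)"

definition nl :: "nat \<Rightarrow> (plane \<Rightarrow> complex) \<Rightarrow> plane \<Rightarrow> complex"
  where "nl p v \<zeta> = of_real (1 / (2 * pi)) * conv (pw v (p - 1)) (dx v) \<zeta>"

lemma inv_2pi_le: "cmod (of_real (1 / (2 * pi))) \<le> 1"
  using pi_gt3 by (simp add: norm_divide)

lemma pw_measurable [measurable]: "bmeas v \<Longrightarrow> pw v k \<in> borel_measurable borel"
  by (induction k) auto

lemma nl_measurable [measurable]: "bmeas v \<Longrightarrow> nl p v \<in> borel_measurable borel"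
  unfolding nl_def[abs_def]
  by (intro borel_measurable_times borel_measurable_const conv_measurable pw_measurable dx_measurable)

lemma hermitian_pw: "bmeas v \<Longrightarrow> hermitian v \<Longrightarrow> hermitian (pw v k)"
  by (induction k) (auto simp del: of_real_divide intro!: hermitian_mult[OF hermitian_of_real] hermitian_conv)

lemma hermitian_nl: "bmeas v \<Longrightarrow> hermitian v \<Longrightarrow> hermitian (nl p v)"
  unfolding nl_def[abs_def] by (intro hermitian_mult[OF hermitian_of_real] hermitian_conv hermitian_pw hermitian_dx) auto

lemma conv_diff_eq:
  assumes "l2b f A" "l2b g B" "l2b p C" "l2b q D"
  shows "conv f p \<zeta> - conv g q \<zeta> = conv (\<lambda>z. f z - g z) p \<zeta> + conv g (\<lambda>z. p z - q z) \<zeta>"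
proof -
  have 1: "conv (\<lambda>z. f z - g z) p \<zeta> = conv f p \<zeta> - conv g p \<zeta>"
    unfolding conv_def using conv_integrable[OF assms(1,3)] conv_integrable[OF assms(2,3)]
    by (subst Bochner_Integration.integral_diff[symmetric]) (auto simp: algebra_simps)
  have 2: "conv g (\<lambda>z. p z - q z) \<zeta> = conv g p \<zeta> - conv g q \<zeta>"
    unfolding conv_def using conv_integrable[OF assms(2,3)] conv_integrable[OF assms(2,4)]
    by (subst Bochner_Integration.integral_diff[symmetric]) (auto simp: algebra_simps)
  show ?thesis by (simp add: 1 2)
qed

lemma hb_imp_l2b: "hb \<sigma> f A \<Longrightarrow> 0 \<le> \<sigma> \<Longrightarrow> l2b f A"
  using hb_mono[of \<sigma> f A 0 A] by (simp add: hb_0)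

lemma pw_hb:
  assumes "2 < s" shows "\<exists>E\<ge>0. \<forall>f A. hb s f A \<longrightarrow> hb s (pw f k) (E * A ^ (k + 1))"
proof (induction k)
  case 0 then show ?case by (intro exI[of _ 1]) auto
next
  case (Suc k)
  then obtain E where E: "0 \<le> E" "\<And>f A. hb s f A \<Longrightarrow> hb s (pw f k) (E * A ^ (k + 1))" by blast
  show ?case
  proof (intro exI[of _ "kc s s * E"] conjI allI impI)
    fix f A assume f: "hb s f A"
    have "hb s (conv f (pw f k)) (kc s s * A * (E * A ^ (k + 1)))"
      using assms by (intro hb_conv[OF f E(2)[OF f]]) auto
    from hb_scale_le[OF this inv_2pi_le] show "hb s (pw f (Suc k)) (kc s s * E * A ^ (Suc k + 1))"
      by (simp add: ac_simps)
  qed (use E in simp)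
qed

text \<open>The constants of \<open>pw_tame\<close>: a further factor turns c into C (1 + c), since
  the weight falls on the new factor or on the power already formed.\<close>

primrec pcc :: "real \<Rightarrow> nat \<Rightarrow> real" where
  "pcc C 0 = 1" | "pcc C (Suc k) = C * (1 + pcc C k)"

lemma pcc_nonneg: "0 \<le> C \<Longrightarrow> 0 \<le> pcc C k" by (induction k) auto

lemma l1b_scale_le: assumes "l1b f A" "cmod c \<le> 1" shows "l1b (\<lambda>z. c * f z) A"
proof (rule l1b_mono[OF assms(1)])
  show "bmeas (\<lambda>z. c * f z)" using l1b_measurable[OF assms(1)] by simp
  show "AE z in lborel. cmod (c * f z) \<le> cmod (f z)"
    using assms(2) by (auto simp: norm_mult intro!: always_eventually mult_left_le_one_le)
qed simp

lemma pw_l1b: assumes "l1b f B" shows "l1b (pw f k) (B ^ (k + 1))"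
proof (induction k)
  case (Suc k)
  from l1b_scale_le[OF l1b_conv[OF assms Suc] inv_2pi_le] show ?case by simp
qed (use assms in simp)

text \<open>Linear in the weighted bound D, all other factors being measured by the unweighted L^1
  bound B. This makes the energy estimate for \<open>wR s R\<close> quadratic in D, so that small
  tails stay small.\<close>

lemma pw_tame:
  assumes W: "tame W C" and f: "l2b (\<lambda>z. of_real (W z) * f z) D" "l1b f B"
  shows "l2b (\<lambda>z. of_real (W z) * pw f k z) (pcc C k * D * B ^ k)"
proof (induction k)
  case (Suc k)
  have "l2b (\<lambda>z. of_real (1 / (2 * pi)) * (of_real (W z) * conv f (pw f k) z)) (C * (D * B ^ (k + 1) + B * (pcc C k * D * B ^ k)))"
    by (intro l2b_scale_le inv_2pi_le l2b_tame_conv[OF W f(1,2) Suc] pw_l1b f)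
  then show ?case by (simp add: algebra_simps del: of_real_divide)
qed (use assms in simp)

text \<open>Two norms at once: the functions are bounded in H^s, their difference in H^\<sigma>. The
  case \<sigma> = 0 serves the L^2 energy estimate, \<sigma> = s the continuity of the time
  derivative.\<close>

lemma pw_diff:
  assumes "2 < s" "\<sigma> = 0 \<or> 1 < \<sigma>" "\<sigma> \<le> s"
  shows "\<exists>E\<ge>0. \<forall>f g A D. hb s f A \<longrightarrow> hb s g A \<longrightarrow> hb \<sigma> (\<lambda>z. f z - g z) D \<longrightarrow>
     hb \<sigma> (\<lambda>z. pw f k z - pw g k z) (E * A ^ k * D)"
proof (induction k)
  case 0 then show ?case by (intro exI[of _ 1]) auto
next
  case (Suc k)
  then obtain E where E0: "0 \<le> E \<and> (\<forall>f g A D. hb s f A \<longrightarrow> hb s g A \<longrightarrow> hb \<sigma> (\<lambda>z. f z - g z) D \<longrightarrow>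
     hb \<sigma> (\<lambda>z. pw f k z - pw g k z) (E * A ^ k * D))" by (elim exE)
  note E = E0[THEN conjunct1] E0[THEN conjunct2, rule_format]
  obtain E1 where E1: "0 \<le> E1" "\<And>f A. hb s f A \<Longrightarrow> hb s (pw f k) (E1 * A ^ (k + 1))"
    using pw_hb[OF assms(1), of k] by blast
  show ?case
  proof (intro exI[of _ "kc \<sigma> s * E1 + kc \<sigma> s * E"] conjI allI impI)
    fix f g A D assume f: "hb s f A" and g: "hb s g A" and d: "hb \<sigma> (\<lambda>z. f z - g z) D"
    have "hb \<sigma> (conv (\<lambda>z. f z - g z) (pw f k)) (kc \<sigma> s * (E1 * A ^ (k + 1)) * D)"
      using assms by (intro hb_conv'[OF E1(2)[OF f] d]) auto
    moreover have "hb \<sigma> (conv g (\<lambda>z. pw f k z - pw g k z)) (kc \<sigma> s * A * (E * A ^ k * D))"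
      using assms by (intro hb_conv[OF g E(2)[OF f g d]]) auto
    ultimately have h: "hb \<sigma> (\<lambda>z. of_real (1 / (2 * pi)) * (conv (\<lambda>z. f z - g z) (pw f k) z + conv g (\<lambda>z. pw f k z - pw g k z) z))
       (kc \<sigma> s * (E1 * A ^ (k + 1)) * D + kc \<sigma> s * A * (E * A ^ k * D))"
      by (intro hb_scale_le[OF _ inv_2pi_le] hb_add)
    have s0: "0 \<le> s" using assms by simp
    have "pw f (Suc k) z - pw g (Suc k) z = of_real (1 / (2 * pi)) * (conv (\<lambda>z. f z - g z) (pw f k) z + conv g (\<lambda>z. pw f k z - pw g k z) z)" for z
      using conv_diff_eq[OF hb_imp_l2b[OF f s0] hb_imp_l2b[OF g s0] hb_imp_l2b[OF E1(2)[OF f] s0] hb_imp_l2b[OF E1(2)[OF g] s0], of z]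
      by (simp only: pw.simps right_diff_distrib[symmetric])
    then have "(\<lambda>z. pw f (Suc k) z - pw g (Suc k) z) = (\<lambda>z. of_real (1 / (2 * pi)) * (conv (\<lambda>z. f z - g z) (pw f k) z + conv g (\<lambda>z. pw f k z - pw g k z) z))"
      by (rule ext)
    from h[folded this] show "hb \<sigma> (\<lambda>z. pw f (Suc k) z - pw g (Suc k) z) ((kc \<sigma> s * E1 + kc \<sigma> s * E) * A ^ Suc k * D)"
      by (rule hb_mono) (simp_all add: algebra_simps)
  qed (use E E1 in simp)
qed

lemma nl_hb:
  assumes "2 < s" "1 \<le> p" shows "\<exists>E\<ge>0. \<forall>f A. hb s f A \<longrightarrow> hb (s - 1) (nl p f) (E * A ^ (p + 1))"
proof -
  obtain E where E: "0 \<le> E" "\<And>f A. hb s f A \<Longrightarrow> hb s (pw f (p - 1)) (E * A ^ (p - 1 + 1))"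
    using pw_hb[OF assms(1), of "p - 1"] by blast
  show ?thesis
  proof (intro exI[of _ "kc (s - 1) s * E"] conjI allI impI)
    fix f A assume f: "hb s f A"
    have "hb (s - 1) (conv (pw f (p - 1)) (dx f)) (kc (s - 1) s * (E * A ^ (p - 1 + 1)) * A)"
      using assms by (intro hb_conv[OF E(2)[OF f] hb_dx[OF f]]) auto
    from hb_scale_le[OF this inv_2pi_le] show "hb (s - 1) (nl p f) (kc (s - 1) s * E * A ^ (p + 1))"
      using assms(2) by (simp add: nl_def[abs_def] ac_simps del: of_real_divide)
  qed (use E in simp)
qed

text \<open>Split so that the derivative of the difference meets a multiplier formed from f alone.
  That term is tamed by skew-symmetry; in the other one the derivative is on g and its size
  suffices.\<close>

lemma nl_diff_eq:
  assumes "2 < s" "hb s f A" "hb s g B"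
  shows "nl p f z - nl p g z = of_real (1 / (2 * pi)) *
     (conv (pw f (p - 1)) (dx (\<lambda>z. f z - g z)) z + conv (\<lambda>z. pw f (p - 1) z - pw g (p - 1) z) (dx g) z)"
proof -
  obtain E where E: "0 \<le> E" "\<And>f A. hb s f A \<Longrightarrow> hb s (pw f (p - 1)) (E * A ^ (p - 1 + 1))"
    using pw_hb[OF assms(1), of "p - 1"] by blast
  have s0: "0 \<le> s" "0 \<le> s - 1" using assms by simp_all
  have m: "bmeas f" "bmeas g" using assms by (auto dest: hb_measurable)
  have *: "conv (dx f) (pw f (p - 1)) z - conv (dx g) (pw g (p - 1)) z =
      conv (\<lambda>z. dx f z - dx g z) (pw f (p - 1)) z + conv (dx g) (\<lambda>z. pw f (p - 1) z - pw g (p - 1) z) z"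
    by (rule conv_diff_eq[OF hb_imp_l2b[OF hb_dx[OF assms(2)] s0(2)] hb_imp_l2b[OF hb_dx[OF assms(3)] s0(2)]
       hb_imp_l2b[OF E(2)[OF assms(2)] s0(1)] hb_imp_l2b[OF E(2)[OF assms(3)] s0(1)]])
  then have "conv (pw f (p - 1)) (dx f) z - conv (pw g (p - 1)) (dx g) z =
      conv (pw f (p - 1)) (\<lambda>z. dx f z - dx g z) z + conv (\<lambda>z. pw f (p - 1) z - pw g (p - 1) z) (dx g) z"
  proof -
    have mm: "bmeas (pw f (p - 1))" "bmeas (pw g (p - 1))" "bmeas (dx f)"
      "bmeas (dx g)" using m by (auto intro: pw_measurable dx_measurable)
    have c: "conv (dx f) (pw f (p - 1)) = conv (pw f (p - 1)) (dx f)" "conv (dx g) (pw g (p - 1)) = conv (pw g (p - 1)) (dx g)"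
      "conv (\<lambda>z. dx f z - dx g z) (pw f (p - 1)) = conv (pw f (p - 1)) (\<lambda>z. dx f z - dx g z)"
      "conv (dx g) (\<lambda>z. pw f (p - 1) z - pw g (p - 1) z) = conv (\<lambda>z. pw f (p - 1) z - pw g (p - 1) z) (dx g)"
      using mm by (auto intro!: conv_commute)
    from * show ?thesis unfolding c .
  qed
  then show ?thesis by (simp only: nl_def right_diff_distrib[symmetric] dx_diff)
qed

lemma nl_diff_hb:
  assumes "2 < s" "1 \<le> p"
  shows "\<exists>E\<ge>0. \<forall>f g A D. hb s f A \<longrightarrow> hb s g A \<longrightarrow> hb s (\<lambda>z. f z - g z) D \<longrightarrow>
     hb (s - 1) (\<lambda>z. nl p f z - nl p g z) (E * A ^ p * D)"
proof -
  obtain E1 where E1: "0 \<le> E1" "\<And>f A. hb s f A \<Longrightarrow> hb s (pw f (p - 1)) (E1 * A ^ (p - 1 + 1))"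
    using pw_hb[OF assms(1), of "p - 1"] by blast
  have "s = 0 \<or> 1 < s" using assms by simp
  from pw_diff[OF assms(1) this order_refl, of "p - 1"]
  obtain E where E0: "0 \<le> E \<and> (\<forall>f g A D. hb s f A \<longrightarrow> hb s g A \<longrightarrow> hb s (\<lambda>z. f z - g z) D \<longrightarrow>
     hb s (\<lambda>z. pw f (p - 1) z - pw g (p - 1) z) (E * A ^ (p - 1) * D))" by (elim exE)
  note E = E0[THEN conjunct1] E0[THEN conjunct2, rule_format]
  have pA: "A ^ p = A * A ^ (p - 1)" for A :: real using assms(2) by (cases p) auto
  show ?thesis
  proof (intro exI[of _ "kc (s - 1) s * E1 + kc (s - 1) s * E"] conjI allI impI)
    fix f g A D assume f: "hb s f A" and g: "hb s g A" and d: "hb s (\<lambda>z. f z - g z) D"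
    have "hb (s - 1) (conv (pw f (p - 1)) (dx (\<lambda>z. f z - g z))) (kc (s - 1) s * (E1 * A ^ (p - 1 + 1)) * D)"
      using assms by (intro hb_conv[OF E1(2)[OF f] hb_dx[OF d]]) auto
    moreover have "hb (s - 1) (conv (\<lambda>z. pw f (p - 1) z - pw g (p - 1) z) (dx g)) (kc (s - 1) s * (E * A ^ (p - 1) * D) * A)"
      using assms by (intro hb_conv[OF E(2)[OF f g d] hb_dx[OF g]]) auto
    ultimately have h: "hb (s - 1) (\<lambda>z. nl p f z - nl p g z)
       (kc (s - 1) s * (E1 * A ^ (p - 1 + 1)) * D + kc (s - 1) s * (E * A ^ (p - 1) * D) * A)"
      unfolding nl_diff_eq[OF assms(1) f g] by (intro hb_scale_le[OF _ inv_2pi_le] hb_add)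
    then show "hb (s - 1) (\<lambda>z. nl p f z - nl p g z) ((kc (s - 1) s * E1 + kc (s - 1) s * E) * A ^ p * D)"
      by (rule hb_mono) (simp_all add: algebra_simps pA)
  qed (use E E1 in simp)
qed

text \<open>The first bound contains the derivative D' of the difference and gives the Lipschitz
  property of the truncated field. The other two are the ingredients of \<open>l2_energy\<close> and
  are free of D'.\<close>

lemma nl_diff_l2b:
  assumes "2 < s" "1 \<le> p"
  shows "\<exists>E\<ge>0. \<forall>f g A D D'. hb s f A \<longrightarrow> hb s g A \<longrightarrow> l2b (\<lambda>z. f z - g z) D \<longrightarrow> l2b (dx (\<lambda>z. f z - g z)) D' \<longrightarrow>
     l2b (\<lambda>z. nl p f z - nl p g z) (E * A ^ p * (D + D'))
     \<and> l2b (conv (\<lambda>z. pw f (p - 1) z - pw g (p - 1) z) (dx g)) (E * A ^ p * D)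
     \<and> l1b (\<lambda>z. of_real (jb z) * pw f (p - 1) z) (E * A ^ p)"
proof -
  obtain E1 where E1: "0 \<le> E1" "\<And>f A. hb s f A \<Longrightarrow> hb s (pw f (p - 1)) (E1 * A ^ (p - 1 + 1))"
    using pw_hb[OF assms(1), of "p - 1"] by blast
  have "(0::real) = 0 \<or> 1 < (0::real)" "0 \<le> s" using assms by simp_all
  from pw_diff[OF assms(1) this, of "p - 1"]
  obtain E where E0: "0 \<le> E \<and> (\<forall>f g A D. hb s f A \<longrightarrow> hb s g A \<longrightarrow> hb 0 (\<lambda>z. f z - g z) D \<longrightarrow>
     hb 0 (\<lambda>z. pw f (p - 1) z - pw g (p - 1) z) (E * A ^ (p - 1) * D))" by (elim exE)
  note E = E0[THEN conjunct1] E0[THEN conjunct2, rule_format]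
  have pA: "A ^ p = A * A ^ (p - 1)" for A :: real using assms(2) by (cases p) auto
  let ?K = "kc 0 s * E1 + kc 0 (s - 1) * E + cS (s - 1) * E1"
  show ?thesis
  proof (intro exI[of _ ?K] conjI allI impI)
    fix f g A D D' assume f: "hb s f A" and g: "hb s g A" and d: "l2b (\<lambda>z. f z - g z) D" and d': "l2b (dx (\<lambda>z. f z - g z)) D'"
    have A: "0 \<le> A" and D: "0 \<le> D" and D': "0 \<le> D'" using hb_nonneg[OF f] l2b_nonneg[OF d] l2b_nonneg[OF d'] by auto
    have "hb 0 (conv (pw f (p - 1)) (dx (\<lambda>z. f z - g z))) (kc 0 s * (E1 * A ^ (p - 1 + 1)) * D')"
      using assms d' by (intro hb_conv[OF E1(2)[OF f]]) (auto simp: hb_0)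
    then have 1: "l2b (conv (pw f (p - 1)) (dx (\<lambda>z. f z - g z))) (kc 0 s * E1 * A ^ p * D')"
      by (simp add: hb_0 pA ac_simps)
    have "hb 0 (conv (\<lambda>z. pw f (p - 1) z - pw g (p - 1) z) (dx g)) (kc 0 (s - 1) * A * (E * A ^ (p - 1) * D))"
      using assms d by (intro hb_conv'[OF hb_dx[OF g] E(2)[OF f g]]) (auto simp: hb_0)
    then have 2: "l2b (conv (\<lambda>z. pw f (p - 1) z - pw g (p - 1) z) (dx g)) (kc 0 (s - 1) * E * A ^ p * D)"
      by (simp add: hb_0 pA ac_simps)
    have le: "kc 0 (s - 1) * E \<le> ?K" "kc 0 s * E1 \<le> ?K" "cS (s - 1) * E1 \<le> ?K" using E(1) E1(1) by (auto intro: add_increasing add_increasing2)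
    have K0: "0 \<le> ?K" using E(1) E1(1) by simp
    show "l2b (conv (\<lambda>z. pw f (p - 1) z - pw g (p - 1) z) (dx g)) (?K * A ^ p * D)"
      by (rule l2b_mono[OF 2 l2b_measurable[OF 2]]) (use A D in \<open>auto intro!: mult_right_mono le(1)\<close>)
    have "l2b (\<lambda>z. nl p f z - nl p g z) (kc 0 s * E1 * A ^ p * D' + kc 0 (s - 1) * E * A ^ p * D)"
      unfolding nl_diff_eq[OF assms(1) f g] by (intro l2b_scale_le[OF _ inv_2pi_le] l2b_add 1 2)
    then show "l2b (\<lambda>z. nl p f z - nl p g z) (?K * A ^ p * (D + D'))"
    proof (rule l2b_mono)
      have "kc 0 s * E1 * A ^ p * D' \<le> ?K * A ^ p * D'" "kc 0 (s - 1) * E * A ^ p * D \<le> ?K * A ^ p * D"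
        using A D D' by (auto intro!: mult_right_mono le)
      then show "kc 0 s * E1 * A ^ p * D' + kc 0 (s - 1) * E * A ^ p * D \<le> ?K * A ^ p * (D + D')"
        by (simp only: distrib_left)
    qed (use hb_measurable[OF f] hb_measurable[OF g] in auto)
    have "l1b (\<lambda>z. of_real (jb z) * pw f (p - 1) z) (cS (s - 1) * (E1 * A ^ (p - 1 + 1)))"
      by (rule l1b_jb[OF E1(2)[OF f] assms(1)])
    then show "l1b (\<lambda>z. of_real (jb z) * pw f (p - 1) z) (?K * A ^ p)"
    proof (rule l1b_mono)
      show "cS (s - 1) * (E1 * A ^ (p - 1 + 1)) \<le> ?K * A ^ p"
        using mult_right_mono[OF le(3), of "A ^ p"] A by (simp add: pA ac_simps)
    qed (use hb_measurable[OF f] in auto)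
  qed (use E E1 in simp)
qed

section \<open>Energy estimates\<close>

lemma l1b_fst_le: assumes "l1b (\<lambda>z. of_real (jb z) * a z) A" "bmeas a"
  shows "l1b (\<lambda>z. of_real (fst z) * a z) A" "l1b (\<lambda>z. of_real (norm z) * a z) A" "l1b a A"
proof -
  have [measurable]: "bmeas a" by fact
  show "l1b (\<lambda>z. of_real (fst z) * a z) A"
    by (rule l1b_mono[OF assms(1)]) (auto simp: norm_mult simp del: split_paired_All intro!: always_eventually mult_right_mono fst_le_jb)
  show "l1b (\<lambda>z. of_real (norm z) * a z) A"
    by (rule l1b_mono[OF assms(1)]) (auto simp: norm_mult simp del: split_paired_All intro!: always_eventually mult_right_mono norm_le_jb)
  show "l1b a A"
    by (rule l1b_mono[OF assms(1)]) (auto simp: norm_mult simp del: split_paired_All intro!: always_eventually mult_le_cancel_right1[THEN iffD2])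
qed

text \<open>Multiplication by a real function is symmetric and \<open>\<partial>\<^sub>x\<close> is skew, so in the pairing
  the derivative falls on the multiplier. On the Fourier side this is the symmetrisation
  of the kernel under \<open>\<zeta> \<leftrightarrow> \<eta>\<close>.\<close>

lemma convective_pairing_le:
  assumes a: "hermitian a" "l1b a A" "l1b (\<lambda>z. of_real (fst z) * a z) A'"
    and d: "l2b d D" "l2b (dx d) D'"
  shows "\<bar>LINT \<zeta>|lborel. Re (conv a (dx d) \<zeta> * cnj (d \<zeta>))\<bar> \<le> A' * D\<^sup>2"
proof -
  have [measurable]: "bmeas a" "bmeas d"
    using a d by (auto dest: l1b_measurable l2b_measurable)
  \<comment> \<open>The kernel of the pairing as a double integral. The bound D' gives its absolute
    convergence, which justifies exchanging the variables; the cancellation below keeps D' out of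
    the estimate.\<close>
  define K where "K = (\<lambda>(\<zeta>, \<eta>). a (\<zeta> - \<eta>) * dx d \<eta> * cnj (d \<zeta>))"
  have Km: "K \<in> borel_measurable (borel \<Otimes>\<^sub>M borel)" unfolding K_def by measurable
  have Km' [measurable]: "K \<in> borel_measurable (lborel \<Otimes>\<^sub>M lborel)"
    using Km by (simp cong: measurable_cong_sets add: sets_pair_measure_cong[OF sets_lborel sets_lborel])
  have "(\<integral>\<^sup>+x. ennreal (norm (K x)) \<partial>(lborel \<Otimes>\<^sub>M lborel)) = (\<integral>\<^sup>+\<zeta>. \<integral>\<^sup>+\<eta>. ennreal (norm (K (\<zeta>, \<eta>))) \<partial>lborel \<partial>lborel)"
    by (rule lborel.nn_integral_fst[symmetric]) measurable
  also have "\<dots> = (\<integral>\<^sup>+\<zeta>. nc (nm a) (nm (dx d)) \<zeta> * nm d \<zeta> \<partial>lborel)"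
    by (intro nn_integral_cong) (simp add: nc_def K_def norm_mult ennreal_mult nn_integral_multc)
  also have "\<dots> \<le> ennreal ((A * D') * D)"
    by (intro l2n_pair l2n_nc l2b_n l1b_n a d)
  finally have Ki: "integrable (lborel \<Otimes>\<^sub>M lborel) K"
    by (intro integrableI_bounded) (auto intro: le_less_trans)
  define I where "I = integral\<^sup>L (lborel \<Otimes>\<^sub>M lborel) K"
  have i1: "(LINT \<zeta>|lborel. conv a (dx d) \<zeta> * cnj (d \<zeta>)) = I"
    unfolding I_def lborel_pair.integral_fst'[OF Ki, symmetric] by (simp add: conv_def K_def)
  have cp: "integrable lborel (\<lambda>\<zeta>. conv a (dx d) \<zeta> * cnj (d \<zeta>))"
    by (rule l1b_integrable[OF l1b_prod[OF l2b_conv[OF a(2) d(2)] l2b_cnj[OF d(1)]]])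
  define K' where "K' = (\<lambda>(\<zeta>, \<eta>). K (\<eta>, \<zeta>))"
  have K'i: "integrable (lborel \<Otimes>\<^sub>M lborel) K'"
    unfolding K'_def using lborel_pair.integrable_product_swap[OF Ki] by simp
  have I': "I = integral\<^sup>L (lborel \<Otimes>\<^sub>M lborel) K'"
    unfolding K'_def I_def by (rule lborel_pair.integral_product_swap[symmetric]) measurable
  \<comment> \<open>Twice the real part of I. Conjugating and exchanging the variables turns the
    factor \<open>\<i> * fst \<eta>\<close> of the derivative into
    \<open>- \<i> * fst \<zeta>\<close>, so the sum carries \<open>fst (\<zeta> - \<eta>)\<close>, a
    derivative of the multiplier.\<close>
  have "I + cnj I = integral\<^sup>L (lborel \<Otimes>\<^sub>M lborel) (\<lambda>x. K x + cnj (K' x))"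
    using Ki K'i by (subst Bochner_Integration.integral_add) (auto simp: I' I_def[symmetric] simp flip: I')
  then have "cmod (I + cnj I) = cmod (integral\<^sup>L (lborel \<Otimes>\<^sub>M lborel) (\<lambda>x. K x + cnj (K' x)))" by simp
  also have "ennreal \<dots> \<le> (\<integral>\<^sup>+x. ennreal (norm (K x + cnj (K' x))) \<partial>(lborel \<Otimes>\<^sub>M lborel))"
    using Ki K'i by (intro integral_norm_bound_ennreal) auto
  also have "\<dots> = (\<integral>\<^sup>+\<zeta>. \<integral>\<^sup>+\<eta>. ennreal (norm (K (\<zeta>, \<eta>) + cnj (K' (\<zeta>, \<eta>)))) \<partial>lborel \<partial>lborel)"
    using K'i by (intro lborel.nn_integral_fst[symmetric]) (auto dest!: borel_measurable_integrable)
  also have "\<dots> = (\<integral>\<^sup>+\<zeta>. \<integral>\<^sup>+\<eta>. nm (\<lambda>z. of_real (fst z) * a z) (\<zeta> - \<eta>) * nm d \<eta> * nm d \<zeta> \<partial>lborel \<partial>lborel)"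
  proof (intro nn_integral_cong)
    fix \<zeta> \<eta> :: plane
    have "a (\<eta> - \<zeta>) = cnj (a (\<zeta> - \<eta>))" using hermitianD[OF a(1), of "\<zeta> - \<eta>"] by simp
    then have "K (\<zeta>, \<eta>) + cnj (K' (\<zeta>, \<eta>)) = - \<i> * (of_real (fst (\<zeta> - \<eta>)) * a (\<zeta> - \<eta>)) * d \<eta> * cnj (d \<zeta>)"
      by (simp add: K_def K'_def dx_def algebra_simps)
    then show "ennreal (norm (K (\<zeta>, \<eta>) + cnj (K' (\<zeta>, \<eta>)))) = nm (\<lambda>z. of_real (fst z) * a z) (\<zeta> - \<eta>) * nm d \<eta> * nm d \<zeta>"
      by (simp only: norm_mult ennreal_mult norm_ge_zero complex_mod_cnj norm_minus_cancel norm_ii mult_1 mult_nonneg_nonneg)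
  qed
  also have "\<dots> = (\<integral>\<^sup>+\<zeta>. nc (nm (\<lambda>z. of_real (fst z) * a z)) (nm d) \<zeta> * nm d \<zeta> \<partial>lborel)"
    by (intro nn_integral_cong) (simp add: nc_def nn_integral_multc)
  also have "\<dots> \<le> ennreal ((A' * D) * D)"
    by (intro l2n_pair l2n_nc l2b_n l1b_n a d)
  finally have "cmod (I + cnj I) \<le> A' * D * D"
    using l1b_nonneg[OF a(3)] l2b_nonneg[OF d(1)] by (subst (asm) ennreal_le_iff) auto
  moreover have "I + cnj I = of_real (2 * Re I)" by (rule complex_add_cnj)
  ultimately have "2 * \<bar>Re I\<bar> \<le> A' * D * D" by (simp only: norm_of_real abs_mult abs_numeral)
  moreover have "(LINT \<zeta>|lborel. Re (conv a (dx d) \<zeta> * cnj (d \<zeta>))) = Re I"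
    unfolding i1[symmetric] by (rule integral_Re[OF cp])
  moreover have "0 \<le> A' * D\<^sup>2" using l1b_nonneg[OF a(3)] by simp
  ultimately show ?thesis by (simp add: power2_eq_square mult.assoc)
qed

text \<open>No derivative of the difference remains on the right, though the nonlinearity contains
  one. Uniqueness, convergence of the truncations and continuous dependence in L^2 all rest on
  this.\<close>

lemma l2_energy:
  assumes "2 < s" "1 \<le> p"
  shows "\<exists>K\<ge>0. \<forall>f g A D. hermitian f \<longrightarrow> hermitian g \<longrightarrow> hb s f A \<longrightarrow> hb s g A \<longrightarrow> l2b (\<lambda>z. f z - g z) D \<longrightarrow>
    \<bar>LINT z|lborel. Re ((nl p f z - nl p g z) * cnj (f z - g z))\<bar> \<le> K * A ^ p * D\<^sup>2"
proof -
  obtain E where E0: "0 \<le> E \<and> (\<forall>f g A D D'. hb s f A \<longrightarrow> hb s g A \<longrightarrow> l2b (\<lambda>z. f z - g z) D \<longrightarrow> l2b (dx (\<lambda>z. f z - g z)) D' \<longrightarrow>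
     l2b (\<lambda>z. nl p f z - nl p g z) (E * A ^ p * (D + D'))
     \<and> l2b (conv (\<lambda>z. pw f (p - 1) z - pw g (p - 1) z) (dx g)) (E * A ^ p * D)
     \<and> l1b (\<lambda>z. of_real (jb z) * pw f (p - 1) z) (E * A ^ p))"
    using nl_diff_l2b[OF assms] by (elim exE)
  show ?thesis
  proof (intro exI[of _ "2 * E"] conjI allI impI)
    fix f g A D
    assume h: "hermitian f" "hermitian g" and f: "hb s f A" and g: "hb s g A" and d: "l2b (\<lambda>z. f z - g z) D"
    have [measurable]: "bmeas f" "bmeas g" using f g by (auto dest: hb_measurable)
    have A: "0 \<le> A" and D: "0 \<le> D" using hb_nonneg[OF f] l2b_nonneg[OF d] by auto
    have d': "l2b (dx (\<lambda>z. f z - g z)) (A + A)"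
      by (rule hb_imp_l2b[OF hb_dx[OF hb_diff[OF f g]]]) (use assms in simp)
    have E1: "l2b (conv (\<lambda>z. pw f (p - 1) z - pw g (p - 1) z) (dx g)) (E * A ^ p * D)"
      and E2: "l1b (\<lambda>z. of_real (jb z) * pw f (p - 1) z) (E * A ^ p)"
      using E0 f g d d' by blast+
    have am: "bmeas (pw f (p - 1))" by (intro pw_measurable) simp
    let ?d = "\<lambda>z. f z - g z" and ?c = "complex_of_real (1 / (2 * pi))"
    let ?u = "conv (pw f (p - 1)) (dx ?d)" and ?v = "conv (\<lambda>z. pw f (p - 1) z - pw g (p - 1) z) (dx g)"
    have 1: "\<bar>LINT z|lborel. Re (?u z * cnj (?d z))\<bar> \<le> (E * A ^ p) * D\<^sup>2"
      by (rule convective_pairing_le[OF hermitian_pw l1b_fst_le(3)[OF E2 am] l1b_fst_le(1)[OF E2 am] d d']) (use h in auto)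
    have 2: "\<bar>LINT z|lborel. Re (?v z * cnj (?d z))\<bar> \<le> (E * A ^ p * D) * D"
      by (rule l2b_pair_le[OF E1 d])
    have i1: "integrable lborel (\<lambda>z. Re (?u z * cnj (?d z)))"
      by (rule integrable_Re_pair[OF l2b_conv[OF l1b_fst_le(3)[OF E2 am] d'] d])
    have i2: "integrable lborel (\<lambda>z. Re (?v z * cnj (?d z)))"
      by (rule integrable_Re_pair[OF E1 d])
    have pt: "Re ((nl p f z - nl p g z) * cnj (?d z)) = (1 / (2 * pi)) * (Re (?u z * cnj (?d z)) + Re (?v z * cnj (?d z)))" for z
    proof -
      have "Re ((?c * (?u z + ?v z)) * cnj (?d z)) = (1 / (2 * pi)) * (Re (?u z * cnj (?d z)) + Re (?v z * cnj (?d z)))"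
        by (simp only: mult.assoc Re_of_real_mult) (simp only: distrib_right plus_complex.sel)
      then show ?thesis by (simp only: nl_diff_eq[OF assms(1) f g])
    qed
    have eq: "(LINT z|lborel. Re ((nl p f z - nl p g z) * cnj (?d z))) =
        (1 / (2 * pi)) * ((LINT z|lborel. Re (?u z * cnj (?d z))) + (LINT z|lborel. Re (?v z * cnj (?d z))))"
      unfolding pt by (simp only: integral_mult_right_zero Bochner_Integration.integral_add[OF i1 i2])
    have "\<bar>(LINT z|lborel. Re ((nl p f z - nl p g z) * cnj (?d z)))\<bar> = (1 / (2 * pi)) * \<bar>(LINT z|lborel. Re (?u z * cnj (?d z))) + (LINT z|lborel. Re (?v z * cnj (?d z)))\<bar>"
      unfolding eq abs_mult by simp
    also have "\<dots> \<le> 1 * ((E * A ^ p) * D\<^sup>2 + (E * A ^ p * D) * D)"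
    proof (rule mult_mono)
      show "1 / (2 * pi) \<le> 1" using pi_gt3 by simp
      have t: "\<bar>I1 + I2\<bar> \<le> B1 + B2" if "\<bar>I1\<bar> \<le> B1" "\<bar>I2\<bar> \<le> B2" for I1 I2 B1 B2 :: real
        using that by linarith
      from t[OF 1 2] show "\<bar>(LINT z|lborel. Re (?u z * cnj (?d z))) + (LINT z|lborel. Re (?v z * cnj (?d z)))\<bar> \<le> (E * A ^ p) * D\<^sup>2 + (E * A ^ p * D) * D" .
    qed simp_all
    finally show "\<bar>LINT z|lborel. Re ((nl p f z - nl p g z) * cnj (f z - g z))\<bar> \<le> 2 * E * A ^ p * D\<^sup>2"
      by (simp add: power2_eq_square algebra_simps)
  qed (use E0 in simp)
qed

text \<open>The constant does not depend on the parameter \<open>R\<close> of the weight; this uniformity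
  controls the tails of the solution at high frequency.\<close>

lemma weighted_energy:
  assumes "2 < s" "1 \<le> p"
  shows "\<exists>K\<ge>0. \<forall>R f A D D'. 1 \<le> R \<longrightarrow> hermitian f \<longrightarrow> hb s f A \<longrightarrow> l2w s R f D \<longrightarrow>
    l2b (dx (\<lambda>z. of_real (wR s R z) * f z)) D' \<longrightarrow>
    \<bar>LINT z|lborel. Re ((of_real (wR s R z) * nl p f z) * cnj (of_real (wR s R z) * f z))\<bar> \<le> K * A ^ p * D\<^sup>2"
proof -
  obtain E1 where E1: "0 \<le> E1" "\<And>f A. hb s f A \<Longrightarrow> hb s (pw f (p - 1)) (E1 * A ^ (p - 1 + 1))"
    using pw_hb[OF assms(1), of "p - 1"] by blast
  define q where "q = p - 1"
  have q: "p = Suc q" using assms by (simp add: q_def)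
  define C where "C = (s + 1) * 2 powr (s + 1)"
  define P where "P = pcc (2 powr (s + 1)) q"
  have C: "0 \<le> C" and P: "0 \<le> P" using assms by (auto simp: C_def P_def intro: pcc_nonneg)
  \<comment> \<open>The first summand bounds the skew pairing, the other two the two halves of the
    commutator \<open>rem\<close>.\<close>
  define K where "K = cS (s - 1) * E1 + C * (P * (cS s) ^ q * cS (s - 1) + cS (s - 1) * E1)"
  show ?thesis
  proof (intro exI[of _ K] conjI allI impI)
    show "0 \<le> K" using C P E1 by (simp add: K_def)
    fix R f A D D'
    assume R: "1 \<le> R" and h: "hermitian f" and f: "hb s f A"
      and Wf: "l2w s R f D" and Wf': "l2b (dx (\<lambda>z. of_real (wR s R z) * f z)) D'"
    have s1: "1 \<le> s" using assms by simp
    have [measurable]: "bmeas f" using f by (auto dest: hb_measurable)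
    have A: "0 \<le> A" and D: "0 \<le> D" using hb_nonneg[OF f] l2b_nonneg[OF Wf] by auto
    define a where "a = pw f q"
    define W where "W = wR s R"
    have am [measurable]: "bmeas a" unfolding a_def by (intro pw_measurable) simp
    have Wm [measurable]: "bmeas W" by (simp add: W_def)
    have Wnn: "0 \<le> W z" for z using R by (simp add: W_def wR_nonneg)
    have ha: "hb s a (E1 * A ^ (q + 1))" using E1(2)[OF f] by (simp add: a_def q)
    have aj: "l1b (\<lambda>z. of_real (jb z) * a z) (cS (s - 1) * (E1 * A ^ (q + 1)))" by (rule l1b_jb[OF ha assms(1)])
    have f1: "l1b f (cS s * A)" using assms by (intro hb_l1b f) auto
    have Wa: "l2b (\<lambda>z. of_real (W z) * a z) (P * D * (cS s * A) ^ q)"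
      unfolding W_def a_def P_def by (rule pw_tame[OF tame_wR[OF s1 R] Wf f1])
    have df1: "l1b (dx f) (cS (s - 1) * A)" using assms by (intro hb_l1b hb_dx f) auto
    have df2: "l2b (dx f) A" using assms by (intro hb_imp_l2b[OF hb_dx[OF f]]) auto
    have a2: "l2b a (E1 * A ^ (q + 1))" using assms by (intro hb_imp_l2b[OF ha]) auto
    have dW: "dx (\<lambda>z. of_real (W z) * f z) = (\<lambda>z. of_real (W z) * dx f z)"
      by (simp add: dx_def fun_eq_iff)
    \<comment> \<open>The commutator of W with convolution by a, applied to \<open>dx f\<close>; W
      and \<open>dx\<close> commute, both being multipliers.\<close>
    define rem where "rem \<zeta> = of_real (W \<zeta>) * conv a (dx f) \<zeta> - conv a (dx (\<lambda>z. of_real (W z) * f z)) \<zeta>" for \<zeta>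
    have rem_m [measurable]: "bmeas rem"
      unfolding rem_def[abs_def] dW
      by (intro borel_measurable_diff borel_measurable_times conv_measurable am dx_measurable) auto
    have rem_le: "nm rem \<zeta> \<le> ennreal C * (nc (nm (\<lambda>z. of_real (W z) * a z)) (nm (dx f)) \<zeta>
        + nc (nm (\<lambda>z. of_real (norm z) * a z)) (nm (\<lambda>z. of_real (W z) * f z)) \<zeta>)" for \<zeta>
    proof -
      have i1: "integrable lborel (\<lambda>\<eta>. a (\<zeta> - \<eta>) * dx f \<eta>)" by (rule conv_integrable[OF a2 df2])
      have i2: "integrable lborel (\<lambda>\<eta>. a (\<zeta> - \<eta>) * dx (\<lambda>z. of_real (W z) * f z) \<eta>)"
        by (rule conv_integrable[OF a2 Wf'[folded W_def]])
      have e: "rem \<zeta> = (LINT \<eta>|lborel. of_real (W \<zeta>) * (a (\<zeta> - \<eta>) * dx f \<eta>) - a (\<zeta> - \<eta>) * dx (\<lambda>z. of_real (W z) * f z) \<eta>)"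
        unfolding rem_def conv_def using i1 i2 by (subst Bochner_Integration.integral_diff) auto
      have "nm rem \<zeta> \<le> (\<integral>\<^sup>+\<eta>. ennreal (cmod (of_real (W \<zeta>) * (a (\<zeta> - \<eta>) * dx f \<eta>) - a (\<zeta> - \<eta>) * dx (\<lambda>z. of_real (W z) * f z) \<eta>)) \<partial>lborel)"
        unfolding e using i1 i2 by (intro integral_norm_bound_ennreal) auto
      also have "\<dots> \<le> (\<integral>\<^sup>+\<eta>. ennreal C * (nm (\<lambda>z. of_real (W z) * a z) (\<zeta> - \<eta>) * nm (dx f) \<eta>
          + nm (\<lambda>z. of_real (norm z) * a z) (\<zeta> - \<eta>) * nm (\<lambda>z. of_real (W z) * f z) \<eta>) \<partial>lborel)"
      proof (rule nn_integral_mono)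
        fix \<eta>
        let ?x = "cmod (a (\<zeta> - \<eta>))"
        have "cmod (of_real (W \<zeta>) * (a (\<zeta> - \<eta>) * dx f \<eta>) - a (\<zeta> - \<eta>) * dx (\<lambda>z. of_real (W z) * f z) \<eta>)
           = cmod (of_real (W \<zeta> - W \<eta>) * a (\<zeta> - \<eta>) * dx f \<eta>)"
          unfolding dW by (simp add: algebra_simps)
        also have "\<dots> = \<bar>W \<zeta> - W \<eta>\<bar> * (?x * cmod (dx f \<eta>))" by (simp add: norm_mult mult.assoc flip: of_real_diff)
        also have "\<dots> \<le> (C * norm (\<zeta> - \<eta>) * (W (\<zeta> - \<eta>) / jb (\<zeta> - \<eta>) + W \<eta> / jb \<eta>)) * (?x * cmod (dx f \<eta>))"
          using wR_commutator[OF s1 R, of \<zeta> \<eta>] by (intro mult_right_mono) (auto simp: C_def W_def)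
        also have "\<dots> = C * ((norm (\<zeta> - \<eta>) / jb (\<zeta> - \<eta>)) * (W (\<zeta> - \<eta>) * ?x * cmod (dx f \<eta>))
             + (cmod (dx f \<eta>) / jb \<eta>) * (norm (\<zeta> - \<eta>) * ?x * W \<eta>))"
          by (simp add: field_simps)
        \<comment> \<open>In the first term the factor norm (\<zeta> - \<eta>) cancels the bracket
          in the denominator; in the second the bracket absorbs the derivative of f.\<close>
        also have "\<dots> \<le> C * (1 * (W (\<zeta> - \<eta>) * ?x * cmod (dx f \<eta>)) + cmod (f \<eta>) * (norm (\<zeta> - \<eta>) * ?x * W \<eta>))"
        proof (intro mult_left_mono add_mono mult_right_mono C)
          show "norm (\<zeta> - \<eta>) / jb (\<zeta> - \<eta>) \<le> 1" using norm_le_jb[of "\<zeta> - \<eta>"] by simp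
          have "cmod (dx f \<eta>) \<le> jb \<eta> * cmod (f \<eta>)"
            by (auto simp: dx_def norm_mult intro!: mult_right_mono fst_le_jb)
          then show "cmod (dx f \<eta>) / jb \<eta> \<le> cmod (f \<eta>)" by (simp add: divide_le_eq mult.commute)
        qed (auto simp: Wnn)
        finally have "cmod (of_real (W \<zeta>) * (a (\<zeta> - \<eta>) * dx f \<eta>) - a (\<zeta> - \<eta>) * dx (\<lambda>z. of_real (W z) * f z) \<eta>)
          \<le> C * (W (\<zeta> - \<eta>) * ?x * cmod (dx f \<eta>) + norm (\<zeta> - \<eta>) * ?x * (W \<eta> * cmod (f \<eta>)))"
          by (simp add: algebra_simps)
        from ennreal_leI[OF this]
        show "ennreal (cmod (of_real (W \<zeta>) * (a (\<zeta> - \<eta>) * dx f \<eta>) - a (\<zeta> - \<eta>) * dx (\<lambda>z. of_real (W z) * f z) \<eta>))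
           \<le> ennreal C * (nm (\<lambda>z. of_real (W z) * a z) (\<zeta> - \<eta>) * nm (dx f) \<eta>
          + nm (\<lambda>z. of_real (norm z) * a z) (\<zeta> - \<eta>) * nm (\<lambda>z. of_real (W z) * f z) \<eta>)"
          using C Wnn by (simp add: norm_mult ennreal_mult)
      qed
      also have "\<dots> = ennreal C * (nc (nm (\<lambda>z. of_real (W z) * a z)) (nm (dx f)) \<zeta>
        + nc (nm (\<lambda>z. of_real (norm z) * a z)) (nm (\<lambda>z. of_real (W z) * f z)) \<zeta>)"
        unfolding nc_def by (subst nn_integral_cmult) (auto simp: nn_integral_add)
      finally show ?thesis .
    qed
    define B where "B = C * ((P * D * (cS s * A) ^ q) * (cS (s - 1) * A) + (cS (s - 1) * (E1 * A ^ (q + 1))) * D)"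
    have "l2n (\<lambda>\<zeta>. ennreal C * (nc (nm (\<lambda>z. of_real (W z) * a z)) (nm (dx f)) \<zeta>
        + nc (nm (\<lambda>z. of_real (norm z) * a z)) (nm (\<lambda>z. of_real (W z) * f z)) \<zeta>)) B"
      unfolding B_def using Wf[folded W_def]
      by (intro l2n_cmult l2n_add l2n_nc' l2n_nc l2b_n l1b_n C Wa df1 l1b_fst_le(2)[OF aj am])
    then have "l2n (nm rem) B" by (rule l2n_mono) (auto simp: rem_le simp del: split_paired_All)
    then have rem: "l2b rem B" by (simp add: l2b_def)
    let ?d = "\<lambda>z. of_real (W z) * f z" and ?c = "complex_of_real (1 / (2 * pi))"
    let ?u = "conv a (dx ?d)"
    note Wf = Wf[folded W_def] and Wf' = Wf'[folded W_def]
    have a1: "l1b a (cS (s - 1) * (E1 * A ^ (q + 1)))" by (rule l1b_fst_le(3)[OF aj am])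
    have 1: "\<bar>LINT z|lborel. Re (?u z * cnj (?d z))\<bar> \<le> (cS (s - 1) * (E1 * A ^ (q + 1))) * D\<^sup>2"
      by (rule convective_pairing_le[OF _ a1 l1b_fst_le(1)[OF aj am] Wf Wf']) (use h in \<open>auto simp: a_def intro: hermitian_pw\<close>)
    have 2: "\<bar>LINT z|lborel. Re (rem z * cnj (?d z))\<bar> \<le> B * D"
      by (rule l2b_pair_le[OF rem Wf])
    have i1: "integrable lborel (\<lambda>z. Re (?u z * cnj (?d z)))"
      by (rule integrable_Re_pair[OF l2b_conv[OF a1 Wf'] Wf])
    have i2: "integrable lborel (\<lambda>z. Re (rem z * cnj (?d z)))"
      by (rule integrable_Re_pair[OF rem Wf])
    have pt: "Re ((of_real (W z) * nl p f z) * cnj (?d z)) = (1 / (2 * pi)) * (Re (?u z * cnj (?d z)) + Re (rem z * cnj (?d z)))" for z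
    proof -
      have "of_real (W z) * nl p f z = ?c * (?u z + rem z)"
        by (simp add: rem_def nl_def a_def q)
      moreover have "Re ((?c * (?u z + rem z)) * cnj (?d z)) = (1 / (2 * pi)) * (Re (?u z * cnj (?d z)) + Re (rem z * cnj (?d z)))"
        by (simp only: mult.assoc Re_of_real_mult) (simp only: distrib_right plus_complex.sel)
      ultimately show ?thesis by (simp only:)
    qed
    have eq: "(LINT z|lborel. Re ((of_real (W z) * nl p f z) * cnj (?d z))) =
        (1 / (2 * pi)) * ((LINT z|lborel. Re (?u z * cnj (?d z))) + (LINT z|lborel. Re (rem z * cnj (?d z))))"
      unfolding pt by (simp only: integral_mult_right_zero Bochner_Integration.integral_add[OF i1 i2])
    have "\<bar>(LINT z|lborel. Re ((of_real (W z) * nl p f z) * cnj (?d z)))\<bar> = (1 / (2 * pi)) * \<bar>(LINT z|lborel. Re (?u z * cnj (?d z))) + (LINT z|lborel. Re (rem z * cnj (?d z)))\<bar>"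
      unfolding eq abs_mult by simp
    also have "\<dots> \<le> 1 * ((cS (s - 1) * (E1 * A ^ (q + 1))) * D\<^sup>2 + B * D)"
    proof (rule mult_mono)
      show "1 / (2 * pi) \<le> 1" using pi_gt3 by simp
      have t: "\<bar>I1 + I2\<bar> \<le> B1 + B2" if "\<bar>I1\<bar> \<le> B1" "\<bar>I2\<bar> \<le> B2" for I1 I2 B1 B2 :: real
        using that by linarith
      from t[OF 1 2] show "\<bar>(LINT z|lborel. Re (?u z * cnj (?d z))) + (LINT z|lborel. Re (rem z * cnj (?d z)))\<bar> \<le> (cS (s - 1) * (E1 * A ^ (q + 1))) * D\<^sup>2 + B * D" .
    qed simp_all
    also have "\<dots> = K * A ^ p * D\<^sup>2"
      by (simp add: K_def B_def q power2_eq_square power_mult_distrib algebra_simps)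
    finally show "\<bar>LINT z|lborel. Re ((of_real (wR s R z) * nl p f z) * cnj (of_real (wR s R z) * f z))\<bar> \<le> K * A ^ p * D\<^sup>2"
      by (simp only: W_def)
  qed
qed

section \<open>Differential equations in a Hilbert space\<close>

text \<open>The function q exp (- K t) - e t is nonincreasing, as exp (- K t) \<le> 1. Derivatives
  are taken within [0, T], hence one-sided at the ends.\<close>

lemma gronwall_real:
  fixes q q' :: "real \<Rightarrow> real"
  assumes t: "t \<in> {0..T}"
    and d: "\<And>t. t \<in> {0..T} \<Longrightarrow> (q has_real_derivative q' t) (at t within {0..T})"
    and b: "\<And>t. t \<in> {0..T} \<Longrightarrow> q' t \<le> K * q t + e"
    and K: "0 \<le> K" "0 \<le> e"
  shows "q t \<le> (q 0 + e * t) * exp (K * t)"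
proof -
  let ?f = "\<lambda>t. q t * exp (- K * t) - e * t"
  have "?f t \<le> ?f 0"
  proof (cases "t = 0")
    case False
    then have t0: "0 < t" using t by simp
    have "\<exists>x\<in>{0<..<t}. ?f t - ?f 0 = (t - 0) * ((q' x - K * q x) * exp (- K * x) - e)"
    proof (rule mvt_simple[OF t0, where f' = "\<lambda>x h. h * ((q' x - K * q x) * exp (- K * x) - e)"])
      fix x assume x: "0 \<le> x" "x \<le> t"
      then have "x \<in> {0..T}" using t by simp
      from DERIV_subset[OF d[OF this], of "{0..t}"] have dq: "(q has_real_derivative q' x) (at x within {0..t})" using t by auto
      have "(?f has_real_derivative (q' x - K * q x) * exp (- K * x) - e) (at x within {0..t})"
        by (rule derivative_eq_intros dq refl | simp add: algebra_simps)+
      then show "(?f has_derivative (\<lambda>h. h * ((q' x - K * q x) * exp (- K * x) - e))) (at x within {0..t})"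
        by (simp add: has_field_derivative_def mult_commute_abs)
    qed
    then obtain x where x: "0 < x" "x < t" and fx: "?f t - ?f 0 = (t - 0) * ((q' x - K * q x) * exp (- K * x) - e)"
      by auto
    have "(q' x - K * q x) * exp (- K * x) \<le> e * exp (- K * x)"
      using b[of x] x t by (intro mult_right_mono) auto
    also have "\<dots> \<le> e * 1" using K x by (intro mult_left_mono) auto
    finally have "(q' x - K * q x) * exp (- K * x) - e \<le> 0" by simp
    then have "?f t - ?f 0 \<le> 0" unfolding fx using t0 by (intro mult_nonneg_nonpos) auto
    then show ?thesis by simp
  qed simp
  then have "q t * exp (- K * t) \<le> q 0 + e * t" by simp
  then have "q t * exp (- K * t) * exp (K * t) \<le> (q 0 + e * t) * exp (K * t)" by (rule mult_right_mono) simp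
  then show ?thesis by (simp add: mult.assoc flip: exp_add)
qed

lemma has_real_derivative_norm_power2:
  fixes f :: "real \<Rightarrow> 'a::real_inner"
  assumes "(f has_vector_derivative f') (at t within S)"
  shows "((\<lambda>t. (norm (f t))\<^sup>2) has_real_derivative 2 * (f t \<bullet> f')) (at t within S)"
proof -
  have "((\<lambda>t. f t \<bullet> f t) has_vector_derivative f t \<bullet> f' + f' \<bullet> f t) (at t within S)"
    using bounded_bilinear.has_vector_derivative[OF bounded_bilinear_inner assms assms] .
  then show ?thesis
    by (simp add: power2_norm_eq_inner inner_commute has_real_derivative_iff_has_vector_derivative)
qed

text \<open>With the exponential weight exp (- 2 L t) Picard iteration is a contraction with factor
  1/2 on all of [0, T], which avoids joining solutions on short intervals.\<close>

lemma lipschitz_ode: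
  fixes F :: "'a::banach \<Rightarrow> 'a"
  assumes lip: "\<And>x y. norm (F x - F y) \<le> L * norm (x - y)" and L: "0 < L" and T: "0 \<le> T"
  shows "\<exists>u. u 0 = x0 \<and> (\<forall>t\<in>{0..T}. (u has_vector_derivative F (u t)) (at t within {0..T}))"
proof -
  \<comment> \<open>Clamping time to [0, T] extends functions to the whole line, the domain of the
    type of bounded continuous functions.\<close>
  define c where "c t = max 0 (min T t)" for t :: real
  have c: "0 \<le> c t" "c t \<le> T" for t using T by (auto simp: c_def)
  have c_id: "c t = t" if "t \<in> {0..T}" for t using that by (auto simp: c_def)
  have c_cont: "continuous_on UNIV c" unfolding c_def by (intro continuous_intros)
  define l where "l = 2 * L"
  have Fc: "continuous_on UNIV F"
  proof (rule lipschitz_on_continuous_on[of L])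
    show "L-lipschitz_on UNIV F" using lip L by (auto intro!: lipschitz_onI simp: dist_norm)
  qed
  \<comment> \<open>The iteration acts on v(\<tau>) = exp (- l \<tau>) u(\<tau>), so the exponential
    is undone before F is applied.\<close>
  define g where "g v \<tau> = F (exp (l * \<tau>) *\<^sub>R apply_bcontfun v \<tau>)" for v :: "real \<Rightarrow>\<^sub>C 'a" and \<tau>
  have vc: "continuous_on S (apply_bcontfun v)" for v :: "real \<Rightarrow>\<^sub>C 'a" and S
    by (rule continuous_on_subset[of UNIV]) (auto intro: continuous_intros)
  have gc: "continuous_on S (g v)" for v S
    unfolding g_def by (rule continuous_on_compose2[OF Fc]) (auto intro!: continuous_intros vc)
  define h where "h v t = x0 + integral {0..t} (g v)" for v t
  have hd: "(h v has_vector_derivative g v t) (at t within {0..T})" if "t \<in> {0..T}" for v t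
    unfolding h_def using integral_has_vector_derivative[OF gc that] by (auto intro!: derivative_eq_intros)
  have hc: "continuous_on {0..T} (h v)" for v
    by (rule continuous_on_vector_derivative[OF hd])
  define \<Phi> where "\<Phi> v t = exp (- l * c t) *\<^sub>R h v (c t)" for v t
  have \<Phi>b: "\<Phi> v \<in> bcontfun" for v
  proof -
    have "compact (h v ` {0..T})" by (intro compact_continuous_image hc compact_Icc)
    then obtain B where B: "\<And>t. t \<in> {0..T} \<Longrightarrow> norm (h v t) \<le> B" "0 < B"
      by (metis (no_types, lifting) bounded_pos compact_imp_bounded image_eqI)
    have "norm (\<Phi> v t) \<le> B" for t
    proof -
      have "norm (\<Phi> v t) \<le> 1 * norm (h v (c t))" unfolding \<Phi>_def norm_scaleR using c L by (intro mult_right_mono) (auto simp: l_def)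
      then show ?thesis using B(1)[of "c t"] c by auto
    qed
    moreover have "continuous_on UNIV (\<Phi> v)" unfolding \<Phi>_def
      by (intro continuous_intros continuous_on_compose2[OF hc] c_cont) (use c in auto)
    ultimately show ?thesis by (rule bcontfun_normI[rotated])
  qed
  define \<Psi> where "\<Psi> v = Bcontfun (\<Phi> v)" for v
  have \<Psi>: "apply_bcontfun (\<Psi> v) = \<Phi> v" for v
    unfolding \<Psi>_def by (rule Bcontfun_inverse[OF \<Phi>b])
  have "dist (\<Psi> v) (\<Psi> w) \<le> 1/2 * dist v w" for v w
  proof (rule dist_bound)
    fix t
    define \<tau> where "\<tau> = c t"
    have \<tau>: "0 \<le> \<tau>" "\<tau> \<le> T" using c by (auto simp: \<tau>_def)
    have gi: "g v integrable_on {0..\<tau>}" for v by (intro integrable_continuous_real gc)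
    have ei: "((\<lambda>r. L * dist v w * exp (l * r)) has_integral (L * dist v w / l) * exp (l * \<tau>) - (L * dist v w / l) * exp (l * 0)) {0..\<tau>}"
      by (rule fundamental_theorem_of_calculus[OF \<tau>(1)])
        (use L in \<open>auto simp: l_def has_real_derivative_iff_has_vector_derivative[symmetric] intro!: derivative_eq_intros\<close>)
    have "norm (integral {0..\<tau>} (\<lambda>r. g v r - g w r)) \<le> integral {0..\<tau>} (\<lambda>r. L * dist v w * exp (l * r))"
    proof (rule integral_norm_bound_integral)
      fix r
      have "norm (g v r - g w r) \<le> L * norm (exp (l * r) *\<^sub>R v r - exp (l * r) *\<^sub>R w r)"
        unfolding g_def by (rule lip)
      also have "\<dots> = L * (exp (l * r) * dist (v r) (w r))"
        by (simp add: dist_norm flip: scaleR_diff_right)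
      also have "\<dots> \<le> L * (exp (l * r) * dist v w)"
        using L by (intro mult_left_mono dist_bounded) auto
      finally show "norm (g v r - g w r) \<le> L * dist v w * exp (l * r)" by (simp add: ac_simps)
    qed (use gi ei in \<open>auto intro: integrable_diff has_integral_integrable\<close>)
    also have "\<dots> \<le> (L * dist v w / l) * exp (l * \<tau>)"
      unfolding integral_unique[OF ei] using L by (simp add: l_def)
    also have "\<dots> = 1/2 * dist v w * exp (l * \<tau>)" using L by (simp add: l_def)
    finally have n: "norm (h v \<tau> - h w \<tau>) \<le> 1/2 * dist v w * exp (l * \<tau>)"
      using gi by (simp add: h_def Henstock_Kurzweil_Integration.integral_diff)
    have "dist (\<Phi> v t) (\<Phi> w t) = exp (- l * \<tau>) * norm (h v \<tau> - h w \<tau>)"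
      by (simp add: \<Phi>_def \<tau>_def dist_norm flip: scaleR_diff_right)
    also have "\<dots> \<le> exp (- l * \<tau>) * (1/2 * dist v w * exp (l * \<tau>))"
      by (intro mult_left_mono n) simp
    also have "\<dots> = 1/2 * dist v w * exp (- l * \<tau> + l * \<tau>)" by (simp only: exp_add) simp
    finally show "dist (apply_bcontfun (\<Psi> v) t) (apply_bcontfun (\<Psi> w) t) \<le> 1/2 * dist v w"
      by (simp add: \<Psi>)
  qed
  then have "\<exists>!v. \<Psi> v = v" by (intro banach_fix_type[of "1/2"]) auto
  then obtain v where v: "\<Psi> v = v" by blast
  have hv: "h v t = exp (l * t) *\<^sub>R apply_bcontfun v t" if "t \<in> {0..T}" for t
  proof -
    have "apply_bcontfun v t = \<Phi> v t" using \<Psi>[of v] v by simp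
    then show ?thesis by (simp add: \<Phi>_def c_id[OF that] flip: exp_add)
  qed
  have "(h v has_vector_derivative F (h v t)) (at t within {0..T})" if "t \<in> {0..T}" for t
    using hd[OF that, of v] by (simp add: g_def hv[OF that])
  moreover have "h v 0 = x0" by (simp add: h_def)
  ultimately show ?thesis by blast
qed

text \<open>The radial retraction onto the ball of radius \<rho>. Changing the vector at a fixed
  factor and then the factor costs norm (y - z) each.\<close>

lemma radial_lipschitz:
  fixes y z :: "'a::real_normed_vector"
  assumes "0 < \<rho>"
  shows "norm ((\<rho> / max \<rho> (norm y)) *\<^sub>R y - (\<rho> / max \<rho> (norm z)) *\<^sub>R z) \<le> 2 * norm (y - z)"
proof -
  define a b where "a = max \<rho> (norm y)" and "b = max \<rho> (norm z)"
  have ab: "\<rho> \<le> a" "\<rho> \<le> b" "norm z \<le> b" "0 < a" "0 < b" using assms by (auto simp: a_def b_def)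
  have "\<bar>b - a\<bar> \<le> \<bar>norm z - norm y\<bar>" by (auto simp: a_def b_def max_def)
  also have "\<dots> \<le> norm (y - z)" using norm_triangle_ineq3[of z y] by (simp add: norm_minus_commute)
  finally have d: "\<bar>b - a\<bar> \<le> norm (y - z)" .
  have "(\<rho> / a) *\<^sub>R y - (\<rho> / b) *\<^sub>R z = (\<rho> / a) *\<^sub>R (y - z) + (\<rho> / a - \<rho> / b) *\<^sub>R z"
    by (simp add: algebra_simps)
  then have "norm ((\<rho> / a) *\<^sub>R y - (\<rho> / b) *\<^sub>R z) \<le> norm ((\<rho> / a) *\<^sub>R (y - z)) + norm ((\<rho> / a - \<rho> / b) *\<^sub>R z)"
    by (simp only: norm_triangle_ineq)
  also have "norm ((\<rho> / a) *\<^sub>R (y - z)) \<le> 1 * norm (y - z)"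
    unfolding norm_scaleR using ab assms by (intro mult_right_mono) auto
  also have "norm ((\<rho> / a - \<rho> / b) *\<^sub>R z) = (\<rho> / a) * (norm z / b) * \<bar>b - a\<bar>"
  proof -
    have "\<rho> / a - \<rho> / b = (\<rho> / (a * b)) * (b - a)" using ab by (simp add: field_simps)
    then show ?thesis using ab assms by (simp add: abs_mult)
  qed
  also have "\<dots> \<le> 1 * 1 * norm (y - z)"
    using ab assms d by (intro mult_mono) auto
  finally show ?thesis by (simp add: a_def b_def)
qed

section \<open>Frequency truncation\<close>

definition cut :: "real \<Rightarrow> plane \<Rightarrow> real" where "cut n z = (if jb z \<le> n then 1 else 0)"
text \<open>The Hilbert transform of the second x-derivative has the symbol - \<i> sgn \<xi>
  \<xi>^2; moved to the right-hand side the linear terms give + \<i> \<open>om\<close>. Being real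
  and odd, \<open>om\<close> yields a skew and Hermitian multiplier.\<close>

definition om :: "real \<Rightarrow> plane \<Rightarrow> real" where "om \<alpha> z = sgn (fst z) * ((fst z)\<^sup>2 + \<alpha> * (snd z)\<^sup>2)"

lemma cut_measurable [measurable]: "bmeas (cut n)"
  unfolding cut_def[abs_def] by measurable
lemma cut_minus [simp]: "cut n (- z) = cut n z" by (simp add: cut_def)
lemma cut_nonneg [simp]: "0 \<le> cut n z" and cut_le1 [simp]: "cut n z \<le> 1" by (auto simp: cut_def)
lemma cut_cut [simp]: "cut n z * cut n z = cut n z" by (simp add: cut_def)
lemma om_measurable [measurable]: "bmeas (om \<alpha>)"
proof -
  have [measurable]: "bmeas (\<lambda>z::plane. sgn (fst z))"
    unfolding sgn_if by measurable
  have [measurable]: "bmeas (\<lambda>z::plane. (fst z)\<^sup>2 + \<alpha> * (snd z)\<^sup>2)"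
    by (intro borel_measurable_continuous_onI continuous_intros)
  show ?thesis unfolding om_def[abs_def] by measurable
qed

lemma om_minus [simp]: "om \<alpha> (- z) = - om \<alpha> z" by (simp add: om_def sgn_minus)

lemma wt_2: "wt 2 z = 1 + (fst z)\<^sup>2 + (snd z)\<^sup>2"
proof -
  have "wt 2 z = (jb z)\<^sup>2" by (simp add: wt_def)
  then show ?thesis by (simp add: jb_def)
qed

lemma om_le: "\<bar>om \<alpha> z\<bar> \<le> (1 + \<bar>\<alpha>\<bar>) * wt 2 z"
proof -
  have "\<bar>om \<alpha> z\<bar> \<le> \<bar>(fst z)\<^sup>2 + \<alpha> * (snd z)\<^sup>2\<bar>" by (auto simp: om_def abs_mult sgn_if)
  also have "\<dots> \<le> (fst z)\<^sup>2 + \<bar>\<alpha>\<bar> * (snd z)\<^sup>2" by (rule order_trans[OF abs_triangle_ineq]) (simp add: abs_mult)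
  also have "\<dots> \<le> (1 + \<bar>\<alpha>\<bar>) * wt 2 z" by (simp add: wt_2 algebra_simps)
  finally show ?thesis .
qed

lemma hermitian_real: "(\<And>z. W (- z) = W z) \<Longrightarrow> hermitian (\<lambda>z. complex_of_real (W z))"
  by (intro hermitianI) simp

lemma hermitian_imag: "(\<And>z. W (- z) = - W z) \<Longrightarrow> hermitian (\<lambda>z. \<i> * complex_of_real (W z))"
  by (intro hermitianI) simp

lemma hb_cong_AE:
  assumes "bmeas f" "bmeas g" "AE z in lborel. f z = g z"
  shows "hb \<sigma> f A \<longleftrightarrow> hb \<sigma> g A"
proof -
  have [measurable]: "bmeas f" "bmeas g" by fact+
  have "l2b (\<lambda>z. of_real (wt \<sigma> z) * f z) A \<longleftrightarrow> l2b (\<lambda>z. of_real (wt \<sigma> z) * g z) A"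
    using assms(3) by (intro l2b_cong_AE) (auto elim: eventually_mono)
  then show ?thesis by (simp add: hb_def)
qed

lemma inner_G_AE:
  assumes "AE z in lborel. rep_G x z = f z" "AE z in lborel. rep_G y z = g z"
    "bmeas f" "bmeas g"
  shows "x \<bullet> y = (LINT z|lborel. Re (f z * cnj (g z)))"
proof -
  have [measurable]: "bmeas f" "bmeas g" by fact+
  show ?thesis unfolding inner_G_def
    using assms(1,2) by (intro integral_cong_AE) (auto elim: eventually_elim2)
qed

lemma l2b_rep_AE:
  assumes "AE z in lborel. rep_G x z = f z" "bmeas f"
  shows "l2b f A \<longleftrightarrow> norm x \<le> A"
  using l2b_cong_AE[OF rep_measurable assms(2,1)] by (simp add: l2b_rep_iff)

lemma l2b_rep_diff: "l2b (\<lambda>z. rep_G x z - rep_G y z) A \<longleftrightarrow> norm (x - y) \<le> A"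
  by (rule l2b_rep_AE[OF rep_diff]) measurable

lemma Re_skew: "Re (f * cnj (\<i> * complex_of_real c * f)) = 0"
  by (simp add: algebra_simps)

definition Pn :: "real \<Rightarrow> G \<Rightarrow> G" where "Pn n = mul (\<lambda>z. of_real (cut n z))"

text \<open>Truncation makes a multiplier bounded that is bounded on bounded sets of frequencies
  only. The symbol, the weights and the Bessel potential are all treated through this.\<close>

lemma cut_mult:
  assumes "bmeas m" "hermitian m" "\<And>z. jb z \<le> n \<Longrightarrow> cmod (m z) \<le> C" "0 \<le> C"
  shows "hermitian (\<lambda>z. m z * of_real (cut n z))" "bmeas (\<lambda>z. m z * of_real (cut n z))"
    "cmod (m z * of_real (cut n z)) \<le> C" "gdom (\<lambda>z. m z * of_real (cut n z)) x"
    "bounded_linear (mul (\<lambda>z. m z * of_real (cut n z)))"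
    "AE z in lborel. rep_G (mul (\<lambda>z. m z * of_real (cut n z)) x) z = m z * of_real (cut n z) * rep_G x z"
proof -
  have [measurable]: "bmeas m" by fact
  show h: "hermitian (\<lambda>z. m z * of_real (cut n z))" by (intro hermitian_mult assms hermitian_real) simp
  show m: "bmeas (\<lambda>z. m z * of_real (cut n z))" by measurable
  have b: "cmod (m z * of_real (cut n z)) \<le> C" for z using assms(3)[of z] assms(4) by (simp add: cut_def)
  show "cmod (m z * of_real (cut n z)) \<le> C" by (rule b)
  show g: "gdom (\<lambda>z. m z * of_real (cut n z)) x" by (rule gdom_bounded[OF m b])
  show "bounded_linear (mul (\<lambda>z. m z * of_real (cut n z)))" by (rule bounded_linear_mul[OF h m b])
  show "AE z in lborel. rep_G (mul (\<lambda>z. m z * of_real (cut n z)) x) z = m z * of_real (cut n z) * rep_G x z"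
    by (rule rep_mul[OF h g])
qed

lemma rep_Pn: "AE z in lborel. rep_G (Pn n x) z = of_real (cut n z) * rep_G x z"
  and bounded_linear_Pn: "bounded_linear (Pn n)"
  and Pn_norm_le: "norm (Pn n x) \<le> norm x"
proof -
  have h: "hermitian (\<lambda>z. complex_of_real (cut n z))" by (rule hermitian_real) simp
  have m: "bmeas (\<lambda>z. complex_of_real (cut n z))" by measurable
  have b: "cmod (complex_of_real (cut n z)) \<le> 1" for z by simp
  show "AE z in lborel. rep_G (Pn n x) z = of_real (cut n z) * rep_G x z"
    unfolding Pn_def by (rule rep_mul[OF h gdom_bounded[OF m b]])
  show "bounded_linear (Pn n)" unfolding Pn_def by (rule bounded_linear_mul[OF h m b])
  show "norm (Pn n x) \<le> norm x" unfolding Pn_def using bounded_linear_mul(2)[OF h m b] by simp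
qed

definition mA :: "real \<Rightarrow> real \<Rightarrow> G \<Rightarrow> G"
  where "mA \<alpha> n = mul (\<lambda>z. (\<i> * of_real (om \<alpha> z)) * of_real (cut n z))"

definition mW :: "real \<Rightarrow> real \<Rightarrow> real \<Rightarrow> G \<Rightarrow> G"
  where "mW s R n = mul (\<lambda>z. of_real (wR s R z) * of_real (cut n z))"

lemma rep_mA: "AE z in lborel. rep_G (mA \<alpha> n x) z = \<i> * of_real (om \<alpha> z) * of_real (cut n z) * rep_G x z"
  and bounded_linear_mA: "bounded_linear (mA \<alpha> n)"
proof -
  have h: "hermitian (\<lambda>z. \<i> * complex_of_real (om \<alpha> z))" by (rule hermitian_imag) simp
  have m: "bmeas (\<lambda>z. \<i> * complex_of_real (om \<alpha> z))" by measurable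
  have b: "cmod (\<i> * complex_of_real (om \<alpha> z)) \<le> (1 + \<bar>\<alpha>\<bar>) * n powr 2" if "jb z \<le> n" for z
    using om_le[of \<alpha> z] wt_le_R[OF _ that, of 2] mult_left_mono[of "wt 2 z" "n powr 2" "1 + \<bar>\<alpha>\<bar>"] by (simp add: norm_mult)
  have C: "0 \<le> (1 + \<bar>\<alpha>\<bar>) * n powr 2" by simp
  note cm = cut_mult[OF m h b C]
  show "AE z in lborel. rep_G (mA \<alpha> n x) z = \<i> * of_real (om \<alpha> z) * of_real (cut n z) * rep_G x z"
    unfolding mA_def by (rule cm(6))
  show "bounded_linear (mA \<alpha> n)" unfolding mA_def by (rule cm(5))
qed

lemma
  assumes s: "0 \<le> s" and R: "1 \<le> R"
  shows rep_mW: "AE z in lborel. rep_G (mW s R n x) z = of_real (wR s R z) * of_real (cut n z) * rep_G x z"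
    and bounded_linear_mW: "bounded_linear (mW s R n)"
    and mW_norm_le: "norm (mW s R n x) \<le> n powr s * norm x"
proof -
  have h: "hermitian (\<lambda>z. complex_of_real (wR s R z))" by (rule hermitian_real) simp
  have m: "bmeas (\<lambda>z. complex_of_real (wR s R z))" by measurable
  have b: "cmod (complex_of_real (wR s R z)) \<le> n powr s" if "jb z \<le> n" for z
    using wt_le_R[OF s that] wR_le_wt[OF R, of s z] wR_nonneg[OF R, of s z] by simp
  have C: "0 \<le> n powr s" by simp
  note cm = cut_mult[OF m h b C]
  show "AE z in lborel. rep_G (mW s R n x) z = of_real (wR s R z) * of_real (cut n z) * rep_G x z"
    unfolding mW_def by (rule cm(6))
  show "bounded_linear (mW s R n)" unfolding mW_def by (rule cm(5))
  show "norm (mW s R n x) \<le> n powr s * norm x"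
    unfolding mW_def by (rule bounded_linear_mul(2)[OF cm(1,2,3)])
qed

definition NL :: "nat \<Rightarrow> G \<Rightarrow> G" where "NL p x = abs_G (nl p (rep_G x))"

section \<open>The truncated vector field\<close>

context
  fixes s \<alpha> :: real and p :: nat
  assumes s2: "2 < s" and p1: "1 \<le> p"
begin

lemma rep_NL: assumes "hb s (rep_G x) A" shows "AE z in lborel. rep_G (NL p x) z = nl p (rep_G x) z"
proof -
  obtain E where "\<forall>f A. hb s f A \<longrightarrow> hb (s - 1) (nl p f) (E * A ^ (p + 1))" using nl_hb[OF s2 p1] by blast
  then have "hb (s - 1) (nl p (rep_G x)) (E * A ^ (p + 1))" using assms by blast
  then have "l2b (nl p (rep_G x)) (E * A ^ (p + 1))" by (rule hb_imp_l2b) (use s2 in simp)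
  then have "hl2 (nl p (rep_G x))" by (auto simp: hl2_l2b intro: hermitian_nl hermitian_rep)
  then show ?thesis unfolding NL_def by (rule rep_abs)
qed

text \<open>With R = 1 the weight is that of H^s; on truncated functions the H^s norm is thus the
  norm of the image under a bounded operator.\<close>

lemma hb_Pn_iff: "hb s (rep_G (Pn n x)) A \<longleftrightarrow> norm (mW s 1 n x) \<le> A"
proof -
  have "hb s (rep_G (Pn n x)) A \<longleftrightarrow> l2b (\<lambda>z. of_real (wt s z) * rep_G (Pn n x) z) A"
    by (simp add: hb_def)
  also have "\<dots> \<longleftrightarrow> norm (mW s 1 n x) \<le> A"
  proof (rule l2b_rep_AE)
    have "0 \<le> s" using s2 by simp
    from rep_mW[OF this order_refl, of n x] rep_Pn[of n x]
    show "AE z in lborel. rep_G (mW s 1 n x) z = of_real (wt s z) * rep_G (Pn n x) z"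
      by eventually_elim (simp add: wR_1)
  qed measurable
  finally show ?thesis .
qed

text \<open>Retracting the argument of the nonlinearity to a ball of \<open>H\<^sup>s\<close> makes the truncated vector field
  globally Lipschitz; the energy estimate shows that solutions do not leave the ball.\<close>

definition ret :: "real \<Rightarrow> real \<Rightarrow> G \<Rightarrow> G"
  where "ret n \<rho> x = (\<rho> / max \<rho> (norm (mW s 1 n x))) *\<^sub>R x"

text \<open>Only the nonlinearity is evaluated at the retracted argument: the truncated linear part
  is a bounded operator already.\<close>

definition FG :: "real \<Rightarrow> real \<Rightarrow> G \<Rightarrow> G"
  where "FG n \<rho> x = mA \<alpha> n x - Pn n (NL p (Pn n (ret n \<rho> x)))"

lemma mW_ret: "mW s 1 n (ret n \<rho> x) = (\<rho> / max \<rho> (norm (mW s 1 n x))) *\<^sub>R mW s 1 n x"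
  using bounded_linear_mW[of s 1 n] s2 by (simp add: ret_def linear_simps)

lemma hb_ret: assumes "0 < \<rho>" shows "hb s (rep_G (Pn n (ret n \<rho> x))) \<rho>"
  unfolding hb_Pn_iff mW_ret using assms by (auto simp: max_def divide_simps)

text \<open>Bernstein's inequality: on truncated functions a derivative costs at most the factor
  n.\<close>

lemma dx_cut_le:
  assumes "l2b f D" "AE z in lborel. f z = of_real (cut n z) * h z" "0 \<le> n"
  shows "l2b (dx f) (n * D)"
proof -
  have fm: "bmeas f" using assms by (auto dest: l2b_measurable)
  have "l2b (\<lambda>z. of_real n * f z) (cmod (of_real n) * D)" by (rule l2b_cmult[OF assms(1)])
  then show ?thesis
  proof (rule l2b_mono)
    show "AE z in lborel. cmod (dx f z) \<le> cmod (of_real n * f z)"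
      using assms(2)
    proof eventually_elim
      case (elim z)
      show ?case
      proof (cases "jb z \<le> n")
        case True
        then show ?thesis using fst_le_jb[of z] assms(3) by (auto simp: dx_def norm_mult intro!: mult_right_mono)
      qed (use elim in \<open>simp add: cut_def dx_def\<close>)
    qed
  qed (use fm assms in \<open>auto intro: dx_measurable\<close>)
qed

text \<open>The constant L depends on n, through Bernstein's inequality and the norm of
  \<open>mW\<close>; it yields existence for each n and does not enter the limit.\<close>

lemma FG_lipschitz:
  assumes n: "1 \<le> n" and \<rho>: "0 < \<rho>"
  shows "\<exists>L>0. \<forall>x y. norm (FG n \<rho> x - FG n \<rho> y) \<le> L * norm (x - y)"
proof -
  obtain E where E0: "0 \<le> E" and E: "\<And>f g A D D'. hb s f A \<Longrightarrow> hb s g A \<Longrightarrow> l2b (\<lambda>z. f z - g z) D \<Longrightarrow> l2b (dx (\<lambda>z. f z - g z)) D' \<Longrightarrow>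
     l2b (\<lambda>z. nl p f z - nl p g z) (E * A ^ p * (D + D'))"
    using nl_diff_l2b[OF s2 p1] by (elim exE conjE) (rule that, assumption, blast)
  obtain LA where LA: "\<And>x. norm (mA \<alpha> n x) \<le> norm x * LA"
    using bounded_linear.bounded[OF bounded_linear_mA[of \<alpha> n]] by blast
  have LA0: "0 \<le> \<bar>LA\<bar>" by simp
  define z where "z x = Pn n (ret n \<rho> x)" for x
  have zl: "norm (z x - z y) \<le> 2 * n powr s * norm (x - y)" for x y
  proof -
    interpret P: bounded_linear "Pn n" by (rule bounded_linear_Pn)
    interpret M: bounded_linear "mW s 1 n" by (rule bounded_linear_mW) (use s2 in auto)
    have "norm (z x - z y) = norm (Pn n (ret n \<rho> x - ret n \<rho> y))" by (simp add: z_def P.diff)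
    also have "\<dots> \<le> norm (mW s 1 n (ret n \<rho> x - ret n \<rho> y))"
    proof -
      have "hb s (rep_G (Pn n (ret n \<rho> x - ret n \<rho> y))) (norm (mW s 1 n (ret n \<rho> x - ret n \<rho> y)))"
        by (simp add: hb_Pn_iff)
      then have "l2b (rep_G (Pn n (ret n \<rho> x - ret n \<rho> y))) (norm (mW s 1 n (ret n \<rho> x - ret n \<rho> y)))"
        by (rule hb_imp_l2b) (use s2 in simp)
      then show ?thesis by (simp add: l2b_rep_iff)
    qed
    also have "\<dots> \<le> 2 * norm (mW s 1 n x - mW s 1 n y)"
      unfolding M.diff mW_ret by (rule radial_lipschitz[OF \<rho>])
    also have "\<dots> \<le> 2 * (n powr s * norm (x - y))"
      unfolding M.diff[symmetric] using s2 by (intro mult_left_mono mW_norm_le) auto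
    finally show ?thesis by simp
  qed
  have NLl: "norm (NL p (z x) - NL p (z y)) \<le> E * \<rho> ^ p * (norm (z x - z y) + n * norm (z x - z y))" for x y
  proof -
    have hx: "hb s (rep_G (z x)) \<rho>" for x unfolding z_def by (rule hb_ret[OF \<rho>])
    have d: "l2b (\<lambda>w. rep_G (z x) w - rep_G (z y) w) (norm (z x - z y))" by (simp add: l2b_rep_diff)
    have "l2b (dx (\<lambda>w. rep_G (z x) w - rep_G (z y) w)) (n * norm (z x - z y))"
    proof (rule dx_cut_le[OF d])
      show "AE w in lborel. rep_G (z x) w - rep_G (z y) w = of_real (cut n w) * (rep_G (ret n \<rho> x) w - rep_G (ret n \<rho> y) w)"
        using rep_Pn[of n "ret n \<rho> x"] rep_Pn[of n "ret n \<rho> y"] unfolding z_def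
        by eventually_elim (simp add: algebra_simps)
    qed (use n in simp)
    from E[OF hx hx d this] have "l2b (\<lambda>w. nl p (rep_G (z x)) w - nl p (rep_G (z y)) w) (E * \<rho> ^ p * (norm (z x - z y) + n * norm (z x - z y)))" .
    moreover have "AE w in lborel. rep_G (NL p (z x) - NL p (z y)) w = nl p (rep_G (z x)) w - nl p (rep_G (z y)) w"
      using rep_diff[of "NL p (z x)" "NL p (z y)"] rep_NL[OF hx[of x]] rep_NL[OF hx[of y]] by eventually_elim simp
    ultimately show ?thesis by (subst (asm) l2b_rep_AE) auto
  qed
  let ?L = "\<bar>LA\<bar> + E * \<rho> ^ p * (1 + n) * (2 * n powr s) + 1"
  have "norm (FG n \<rho> x - FG n \<rho> y) \<le> ?L * norm (x - y)" for x y
  proof -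
    interpret P: bounded_linear "Pn n" by (rule bounded_linear_Pn)
    interpret A: bounded_linear "mA \<alpha> n" by (rule bounded_linear_mA)
    have "FG n \<rho> x - FG n \<rho> y = mA \<alpha> n (x - y) - Pn n (NL p (z x) - NL p (z y))"
      by (simp add: FG_def z_def A.diff P.diff)
    then have "norm (FG n \<rho> x - FG n \<rho> y) \<le> norm (mA \<alpha> n (x - y)) + norm (Pn n (NL p (z x) - NL p (z y)))"
      by (simp only: norm_triangle_ineq4)
    also have "norm (Pn n (NL p (z x) - NL p (z y))) \<le> norm (NL p (z x) - NL p (z y))" by (rule Pn_norm_le)
    also have "\<dots> \<le> E * \<rho> ^ p * (norm (z x - z y) + n * norm (z x - z y))" by (rule NLl)
    also have "\<dots> = E * \<rho> ^ p * (1 + n) * norm (z x - z y)" by (simp add: algebra_simps)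
    also have "\<dots> \<le> E * \<rho> ^ p * (1 + n) * (2 * n powr s * norm (x - y))"
      using E0 \<rho> n by (intro mult_left_mono zl) auto
    also have "norm (mA \<alpha> n (x - y)) \<le> norm (x - y) * \<bar>LA\<bar>"
      by (rule order_trans[OF LA mult_left_mono[OF abs_ge_self norm_ge_zero]])
    finally have "norm (FG n \<rho> x - FG n \<rho> y) \<le> norm (x - y) * \<bar>LA\<bar> + E * \<rho> ^ p * (1 + n) * (2 * n powr s * norm (x - y))" by simp
    also have "\<dots> \<le> ?L * norm (x - y)" by (simp add: algebra_simps)
    finally show ?thesis .
  qed
  moreover have "0 < ?L"
  proof -
    have "0 \<le> E * \<rho> ^ p * (1 + n) * (2 * n powr s)" using E0 \<rho> n by simp
    then show ?thesis using LA0 by linarith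
  qed
  ultimately show ?thesis by blast
qed

text \<open>The retraction multiplies u by a scalar in (0, 1] and can be absorbed, so the estimate
  holds for every truncated u, whether or not it lies in the ball.\<close>

lemma galerkin_energy:
  "\<exists>K\<ge>0. \<forall>n R \<rho> u. 1 \<le> n \<longrightarrow> 1 \<le> R \<longrightarrow> 0 < \<rho> \<longrightarrow> Pn n u = u \<longrightarrow>
     \<bar>mW s R n u \<bullet> mW s R n (FG n \<rho> u)\<bar> \<le> K * \<rho> ^ p * (norm (mW s R n u))\<^sup>2"
proof -
  obtain K where K0: "0 \<le> K \<and> (\<forall>R f A D D'. 1 \<le> R \<longrightarrow> hermitian f \<longrightarrow> hb s f A \<longrightarrow> l2w s R f D \<longrightarrow>
    l2b (dx (\<lambda>z. of_real (wR s R z) * f z)) D' \<longrightarrow>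
    \<bar>LINT z|lborel. Re ((of_real (wR s R z) * nl p f z) * cnj (of_real (wR s R z) * f z))\<bar> \<le> K * A ^ p * D\<^sup>2)"
    using weighted_energy[OF s2 p1] by (elim exE)
  note K = K0[THEN conjunct2, rule_format]
  show ?thesis
  proof (intro exI[of _ K] conjI allI impI)
    fix n R \<rho> :: real and u :: G assume n: "1 \<le> n" and R: "1 \<le> R" and \<rho>: "0 < \<rho>" and u: "Pn n u = u"
    have s0: "0 \<le> s" using s2 by simp
    \<comment> \<open>Pairing with u instead of \<kappa> u costs 1 / \<kappa>; the quadratic bound
      at \<kappa> u gives \<kappa>^2, so a factor \<kappa> \<le> 1 is left over.\<close>
    define \<kappa> where "\<kappa> = \<rho> / max \<rho> (norm (mW s 1 n u))"
    have \<kappa>: "0 < \<kappa>" "\<kappa> \<le> 1" using \<rho> by (auto simp: \<kappa>_def divide_simps max_def)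
    define z where "z = Pn n (ret n \<rho> u)"
    define f where "f = rep_G z"
    have [measurable]: "bmeas f" by (simp add: f_def)
    interpret P: bounded_linear "Pn n" by (rule bounded_linear_Pn)
    interpret M: bounded_linear "mW s R n" by (rule bounded_linear_mW[OF s0 R])
    have z: "z = \<kappa> *\<^sub>R u" by (simp add: z_def ret_def P.scaleR u \<kappa>_def)
    have hf: "hb s f \<rho>" unfolding f_def z_def by (rule hb_ret[OF \<rho>])
    have u_f: "AE w in lborel. rep_G u w = of_real (1 / \<kappa>) * f w"
      using rep_scaleR[of \<kappa> u] unfolding f_def z by eventually_elim (use \<kappa> in simp)
    have cutu: "AE w in lborel. of_real (cut n w) * rep_G u w = rep_G u w"
      using rep_Pn[of n u] unfolding u by (auto elim: eventually_mono)
    have cutf: "AE w in lborel. f w = of_real (cut n w) * f w"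
      using cutu u_f by eventually_elim (use \<kappa> in simp)
    have Mz: "AE w in lborel. rep_G (mW s R n z) w = of_real (wR s R w) * f w"
      using rep_mW[OF s0 R, of n z] cutf unfolding f_def[symmetric] by eventually_elim auto
    have Wf: "l2b (\<lambda>w. of_real (wR s R w) * f w) (norm (mW s R n z))"
      by (subst l2b_rep_AE[OF Mz]) auto
    have Wf': "l2b (dx (\<lambda>w. of_real (wR s R w) * f w)) (n * norm (mW s R n z))"
    proof (rule dx_cut_le[OF Wf])
      show "AE w in lborel. of_real (wR s R w) * f w = of_real (cut n w) * (of_real (wR s R w) * f w)"
        using cutf by eventually_elim simp
    qed (use n in simp)
    have en: "\<bar>LINT w|lborel. Re ((of_real (wR s R w) * nl p f w) * cnj (of_real (wR s R w) * f w))\<bar> \<le> K * \<rho> ^ p * (norm (mW s R n z))\<^sup>2"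
      by (rule K[OF R _ hf Wf Wf']) (simp add: f_def hermitian_rep)
    have FGu: "AE w in lborel. rep_G (mW s R n (FG n \<rho> u)) w = of_real (wR s R w) * of_real (cut n w) *
        (\<i> * of_real (om \<alpha> w) * of_real (cut n w) * rep_G u w - of_real (cut n w) * nl p f w)"
      using rep_mW[OF s0 R, of n "FG n \<rho> u"] rep_diff[of "mA \<alpha> n u" "Pn n (NL p z)"] rep_mA[of \<alpha> n u] rep_Pn[of n "NL p z"]
        rep_NL[OF hf[unfolded f_def]]
      unfolding FG_def z_def[symmetric] f_def[symmetric] by eventually_elim simp
    have "mW s R n u \<bullet> mW s R n (FG n \<rho> u) = (LINT w|lborel. Re ((of_real (wR s R w) * of_real (cut n w) * rep_G u w) *
       cnj (of_real (wR s R w) * of_real (cut n w) *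
        (\<i> * of_real (om \<alpha> w) * of_real (cut n w) * rep_G u w - of_real (cut n w) * nl p f w))))"
      by (rule inner_G_AE[OF rep_mW[OF s0 R] FGu]) measurable
    also have "\<dots> = (LINT w|lborel. (- 1 / \<kappa>) * Re ((of_real (wR s R w) * nl p f w) * cnj (of_real (wR s R w) * f w)))"
    proof (rule integral_cong_AE)
      show "AE w in lborel. Re ((of_real (wR s R w) * of_real (cut n w) * rep_G u w) *
       cnj (of_real (wR s R w) * of_real (cut n w) *
        (\<i> * of_real (om \<alpha> w) * of_real (cut n w) * rep_G u w - of_real (cut n w) * nl p f w)))
        = (- 1 / \<kappa>) * Re ((of_real (wR s R w) * nl p f w) * cnj (of_real (wR s R w) * f w))"
        using cutf u_f
      proof eventually_elim
        case (elim w)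
        show ?case
        proof (cases "jb w \<le> n")
          case True
          \<comment> \<open>The linear part pairs u with \<open>\<i> * om\<close> times u, whose
            real part vanishes (\<open>Re_skew\<close>); what is left is the pairing with the
            nonlinearity.\<close>
          have e: "of_real (wR s R w) * (of_real (1 / \<kappa>) * f w) * cnj (of_real (wR s R w) * (\<i> * of_real (om \<alpha> w) * (of_real (1 / \<kappa>) * f w) - nl p f w))
             = (of_real (wR s R w * wR s R w)) * ((of_real (1 / \<kappa>) * f w) * cnj (\<i> * of_real (om \<alpha> w) * (of_real (1 / \<kappa>) * f w)))
               - of_real (1 / \<kappa>) * (of_real (wR s R w) * f w * cnj (of_real (wR s R w) * nl p f w))"
            by (simp add: algebra_simps)
          have c: "Re (a * cnj b) = Re (b * cnj a)" for a b :: complex by (simp add: algebra_simps)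
          show ?thesis using True unfolding elim(2) cut_def
            by (simp only: if_True of_real_1 mult_1 mult_1_right e minus_complex.sel Re_of_real_mult Re_skew mult_zero_right)
              (simp add: c[of "complex_of_real (wR s R w) * f w"])
        next
          case False
          then show ?thesis using elim by (simp add: cut_def)
        qed
      qed
    qed measurable
    also have "\<dots> = (- 1 / \<kappa>) * (LINT w|lborel. Re ((of_real (wR s R w) * nl p f w) * cnj (of_real (wR s R w) * f w)))"
      by (rule integral_mult_right_zero)
    finally have eq: "mW s R n u \<bullet> mW s R n (FG n \<rho> u) = (- 1 / \<kappa>) * (LINT w|lborel. Re ((of_real (wR s R w) * nl p f w) * cnj (of_real (wR s R w) * f w)))" .
    have "\<bar>mW s R n u \<bullet> mW s R n (FG n \<rho> u)\<bar> = (1 / \<kappa>) * \<bar>LINT w|lborel. Re ((of_real (wR s R w) * nl p f w) * cnj (of_real (wR s R w) * f w))\<bar>"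
      unfolding eq abs_mult using \<kappa> by simp
    also have "\<dots> \<le> (1 / \<kappa>) * (K * \<rho> ^ p * (norm (mW s R n z))\<^sup>2)"
      using \<kappa> by (intro mult_left_mono en) auto
    also have "norm (mW s R n z) = \<kappa> * norm (mW s R n u)" using \<kappa> by (simp add: z M.scaleR)
    also have "(1 / \<kappa>) * (K * \<rho> ^ p * (\<kappa> * norm (mW s R n u))\<^sup>2) = \<kappa> * (K * \<rho> ^ p * (norm (mW s R n u))\<^sup>2)"
      using \<kappa> by (simp add: power2_eq_square)
    also have "\<dots> \<le> 1 * (K * \<rho> ^ p * (norm (mW s R n u))\<^sup>2)"
      using \<kappa> K0 \<rho> by (intro mult_right_mono) auto
    finally show "\<bar>mW s R n u \<bullet> mW s R n (FG n \<rho> u)\<bar> \<le> K * \<rho> ^ p * (norm (mW s R n u))\<^sup>2" by simp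
  qed (use K0 in simp)
qed

end

section \<open>Truncations, high-frequency tails and semicontinuity\<close>

lemma Pn_Pn: "Pn n (Pn n x) = Pn n x"
  using rep_Pn[of n "Pn n x"] rep_Pn[of n x]
  by (intro G_eqI, eventually_elim) (simp add: cut_def)

lemma Pn_mA: "Pn n (mA \<alpha> n x) = mA \<alpha> n x"
  using rep_Pn[of n "mA \<alpha> n x"] rep_mA[of \<alpha> n x]
  by (intro G_eqI, eventually_elim) (simp add: cut_def)

text \<open>Where c is nonzero the bracket exceeds n, so one power of it is worth a factor 1 /
  n.\<close>

lemma l2b_cut_tail:
  assumes "hb \<sigma> f A" "1 \<le> \<sigma>" "0 < n" and c: "bmeas c" "\<And>z. \<bar>c z\<bar> \<le> (if jb z \<le> n then 0 else 1)"
  shows "l2b (\<lambda>z. of_real (c z) * f z) (A / n)" "hb (\<sigma> - 1) (\<lambda>z. of_real (c z) * f z) (A / n)"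
proof -
  have [measurable]: "bmeas f" "bmeas c" using assms by (auto dest: hb_measurable)
  have A: "0 \<le> A" using assms by (auto dest: hb_nonneg)
  have "l2b (\<lambda>z. of_real (1 / n) * (of_real (wt \<sigma> z) * f z)) (cmod (of_real (1 / n)) * A)"
    by (intro l2b_cmult hb_l2b assms)
  then have *: "l2b (\<lambda>z. of_real (1 / n) * (of_real (wt \<sigma> z) * f z)) (A / n)" using assms by (simp add: norm_divide)
  have le: "wt (\<sigma> - 1) z * \<bar>c z\<bar> \<le> (1 / n) * wt \<sigma> z" for z
  proof (cases "jb z \<le> n")
    case True then show ?thesis using c(2)[of z] assms by simp
  next
    case False
    then have "\<bar>c z\<bar> \<le> 1" "1 \<le> jb z / n" using c(2)[of z] assms(3) by auto
    then have "\<bar>c z\<bar> \<le> jb z / n" by linarith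
    then have "wt (\<sigma> - 1) z * \<bar>c z\<bar> \<le> wt (\<sigma> - 1) z * (jb z / n)" by (rule mult_left_mono) simp
    then show ?thesis using wt_add[of "\<sigma> - 1" 1 z] by (simp add: wt_1)
  qed
  show 2: "hb (\<sigma> - 1) (\<lambda>z. of_real (c z) * f z) (A / n)"
    unfolding hb_def
  proof
    show "l2b (\<lambda>z. of_real (wt (\<sigma> - 1) z) * (of_real (c z) * f z)) (A / n)"
    proof (rule l2b_mono[OF *])
      show "AE z in lborel. cmod (of_real (wt (\<sigma> - 1) z) * (of_real (c z) * f z)) \<le> cmod (of_real (1 / n) * (of_real (wt \<sigma> z) * f z))"
        using mult_right_mono[OF le, of "cmod (f z)" z for z] assms(3)
        by (intro always_eventually allI) (simp add: norm_mult mult.assoc norm_divide)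
    qed auto
  qed measurable
  show "l2b (\<lambda>z. of_real (c z) * f z) (A / n)" by (rule hb_imp_l2b[OF 2]) (use assms in simp)
qed

text \<open>At frequencies below R the weight of H^s is at most R^s and the L^2 norm suffices;
  beyond R it coincides with \<open>wR s R\<close>.\<close>

lemma l2b_wR_tail:
  assumes "1 \<le> R" "l2w s R f D" "l2b f \<delta>" "0 \<le> s"
  shows "hb s f (R powr s * \<delta> + D)"
proof -
  have [measurable]: "bmeas f" using assms by (auto dest: l2b_measurable)
  have "l2b (\<lambda>z. of_real (R powr s) * f z) (cmod (of_real (R powr s)) * \<delta>)" by (rule l2b_cmult[OF assms(3)])
  then have "l2b (\<lambda>z. of_real (R powr s) * f z) (R powr s * \<delta>)" by simp
  from l2b_add[OF this assms(2)] have "l2b (\<lambda>z. of_real (R powr s + wR s R z) * f z) (R powr s * \<delta> + D)"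
    by (simp add: distrib_right)
  then have "l2b (\<lambda>z. of_real (wt s z) * f z) (R powr s * \<delta> + D)"
  proof (rule l2b_mono)
    have "wt s z \<le> R powr s + wR s R z" for z
      using wt_le_R[OF assms(4), of z R] wR_eq_wt[OF assms(1), of z s] wR_nonneg[OF assms(1), of s z]
      by (cases "jb z \<le> R") (auto intro: add_increasing2)
    then have "cmod (of_real (wt s z) * f z) \<le> cmod (of_real (R powr s + wR s R z) * f z)" for z
      using wR_nonneg[OF assms(1), of s z] unfolding norm_mult norm_of_real
      by (intro mult_right_mono) (auto simp: abs_of_nonneg add_nonneg_nonneg)
    then show "AE z in lborel. cmod (of_real (wt s z) * f z) \<le> cmod (of_real (R powr s + wR s R z) * f z)"
      by (intro always_eventually allI)
  qed auto
  then show ?thesis by (simp add: hb_def)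
qed

text \<open>Dominated convergence: as R \<rightarrow> \<infinity> the weights tend to 0 pointwise
  under the majorant \<open>wt s\<close>. The values R = k + 1 respect R \<ge> 1.\<close>

lemma wR_tail_small:
  assumes "hb s f A" "0 < e"
  shows "\<exists>R\<ge>1. l2w s R f e"
proof -
  have [measurable]: "bmeas f" using assms by (auto dest: hb_measurable)
  let ?g = "\<lambda>z. (wt s z * cmod (f z))\<^sup>2"
  have gi: "integrable lborel ?g"
    using hb_l2b[OF assms(1)] by (auto simp: l2b_iff norm_mult)
  let ?h = "\<lambda>k z. (wR s (real (Suc k)) z * cmod (f z))\<^sup>2"
  have hle: "?h k z \<le> ?g z" for k z
    by (intro power_mono mult_right_mono wR_le_wt mult_nonneg_nonneg wR_nonneg) auto
  have "(\<lambda>k. LINT z|lborel. ?h k z) \<longlonglongrightarrow> (LINT z|(lborel::plane measure). 0)"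
  proof (rule integral_dominated_convergence[where w="?g"])
    show "AE z in lborel. (\<lambda>k. ?h k z) \<longlonglongrightarrow> 0"
    proof (intro always_eventually allI)
      fix z
      have "(\<lambda>k. jb z / real (Suc k)) \<longlonglongrightarrow> 0"
        using tendsto_mult[OF tendsto_const[of "jb z"] LIMSEQ_inverse_real_of_nat] by (simp add: divide_inverse)
      from tendsto_min[OF tendsto_const[of 1] this] have "(\<lambda>k. min 1 (jb z / real (Suc k))) \<longlonglongrightarrow> 0" by simp
      from tendsto_power[OF tendsto_mult[OF tendsto_mult[OF tendsto_const[of "jb z powr s"] this] tendsto_const[of "cmod (f z)"]], of 2]
      show "(\<lambda>k. ?h k z) \<longlonglongrightarrow> 0" by (simp add: wR_def gw_def)
    qed
    show "AE z in lborel. norm (?h k z) \<le> ?g z" for k using hle by (intro always_eventually allI) simp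
  qed (use gi in measurable)
  then have "\<forall>\<^sub>F k in sequentially. (LINT z|lborel. ?h k z) < e\<^sup>2"
    using assms(2) by (intro order_tendstoD(2)) auto
  then obtain k where k: "(LINT z|lborel. ?h k z) < e\<^sup>2" by (auto dest: eventually_happens)
  have "integrable lborel (?h k)"
    by (rule Bochner_Integration.integrable_bound[OF gi]) (use hle in \<open>auto intro!: always_eventually simp del: split_paired_All\<close>)
  then have "l2b (\<lambda>z. of_real (wR s (real (Suc k)) z) * f z) e"
    using k assms(2) wR_nonneg[of "real (Suc k)"] by (auto simp: l2b_iff norm_mult power_mult_distrib simp del: of_nat_Suc)
  then show ?thesis by (intro exI[of _ "real (Suc k)"]) simp
qed

text \<open>Lower semicontinuity of a weighted norm under L^2 convergence. A weight set to 0 where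
  it exceeds j defines a bounded, hence continuous, multiplier; Fatou's lemma then lets j tend to
  infinity.\<close>

lemma l2b_lsc:
  assumes W: "bmeas W" "\<And>z. 0 \<le> W z" "\<And>z. W (- z) = W z"
    and lim: "X \<longlonglongrightarrow> x" and b: "\<And>k. l2b (\<lambda>z. of_real (W z) * rep_G (X k) z) A"
  shows "l2b (\<lambda>z. of_real (W z) * rep_G x z) A"
proof -
  have [measurable]: "bmeas W" by fact
  have A: "0 \<le> A" using b by (blast dest: l2b_nonneg)
  define m where "m j z = (if W z \<le> real j then W z else 0)" for j :: nat and z
  have [measurable]: "bmeas (m j)" for j unfolding m_def[abs_def] by measurable
  have h: "hermitian (\<lambda>z. complex_of_real (m j z))" for j by (rule hermitian_real) (simp add: m_def W(3))
  have mm: "bmeas (\<lambda>z. complex_of_real (m j z))" for j by measurable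
  have bd: "cmod (complex_of_real (m j z)) \<le> real j" for j z using W(2)[of z] by (simp add: m_def)
  have "l2b (\<lambda>z. of_real (m j z) * rep_G x z) A" for j
  proof -
    let ?M = "mul (\<lambda>z. complex_of_real (m j z))"
    have gd: "gdom (\<lambda>z. complex_of_real (m j z)) y" for y by (rule gdom_bounded[OF mm bd])
    have "(\<lambda>k. norm (?M (X k))) \<longlonglongrightarrow> norm (?M x)"
      by (intro tendsto_norm bounded_linear.tendsto[OF bounded_linear_mul(1)[OF h mm bd] lim])
    moreover have "norm (?M (X k)) \<le> A" for k
    proof (rule norm_mul_le[OF h])
      show "l2b (\<lambda>z. of_real (m j z) * rep_G (X k) z) A"
        by (rule l2b_mono[OF b[of k]]) (auto simp: m_def norm_mult W(2) intro!: always_eventually mult_nonneg_nonneg simp del: split_paired_All)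
    qed
    ultimately have "norm (?M x) \<le> A" by (intro LIMSEQ_le_const2[of _ "norm (?M x)"]) auto
    then show ?thesis by (simp add: l2b_mul_iff[OF h gd mm])
  qed
  then have mj: "(\<integral>\<^sup>+z. (nm (\<lambda>z. of_real (m j z) * rep_G x z) z)\<^sup>2 \<partial>lborel) \<le> ennreal (A\<^sup>2)" for j
    by (auto simp: l2b_def l2n_def)
  have "(\<integral>\<^sup>+z. (nm (\<lambda>z. of_real (W z) * rep_G x z) z)\<^sup>2 \<partial>lborel)
      = (\<integral>\<^sup>+z. liminf (\<lambda>j. (nm (\<lambda>z. of_real (m j z) * rep_G x z) z)\<^sup>2) \<partial>lborel)"
  proof (rule nn_integral_cong)
    fix z
    obtain J where J: "W z \<le> real J" using real_arch_simple by blast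
    have "\<forall>\<^sub>F j in sequentially. (nm (\<lambda>z. of_real (m j z) * rep_G x z) z)\<^sup>2 = (nm (\<lambda>z. of_real (W z) * rep_G x z) z)\<^sup>2"
      using eventually_ge_at_top[of J] by eventually_elim (use J in \<open>auto simp: m_def\<close>)
    then have "(\<lambda>j. (nm (\<lambda>z. of_real (m j z) * rep_G x z) z)\<^sup>2) \<longlonglongrightarrow> (nm (\<lambda>z. of_real (W z) * rep_G x z) z)\<^sup>2"
      by (rule tendsto_eventually)
    from lim_imp_Liminf[OF trivial_limit_sequentially this]
    show "(nm (\<lambda>z. of_real (W z) * rep_G x z) z)\<^sup>2 = liminf (\<lambda>j. (nm (\<lambda>z. of_real (m j z) * rep_G x z) z)\<^sup>2)" by (rule sym)
  qed
  also have "\<dots> \<le> liminf (\<lambda>j. \<integral>\<^sup>+z. (nm (\<lambda>z. of_real (m j z) * rep_G x z) z)\<^sup>2 \<partial>lborel)"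
    by (rule nn_integral_liminf) measurable
  also have "\<dots> \<le> limsup (\<lambda>j. \<integral>\<^sup>+z. (nm (\<lambda>z. of_real (m j z) * rep_G x z) z)\<^sup>2 \<partial>lborel)"
    by (rule Liminf_le_Limsup) simp
  also have "\<dots> \<le> ennreal (A\<^sup>2)" by (rule Limsup_bounded) (simp add: mj)
  finally show ?thesis using A by (simp add: l2b_def l2n_def)
qed

section \<open>Solutions of the truncated equations\<close>

context
  fixes s \<alpha> :: real and p :: nat
  assumes s2: "2 < s" and p1: "1 \<le> p"
begin

text \<open>The field is written without the retraction, which is the identity on the ball of radius
  2 r.\<close>

definition gsol :: "real \<Rightarrow> real \<Rightarrow> real \<Rightarrow> G \<Rightarrow> (real \<Rightarrow> G) \<Rightarrow> bool"
  where "gsol n T r x u \<longleftrightarrow> u 0 = Pn n x \<and> (\<forall>t\<in>{0..T}. Pn n (u t) = u t \<and> hb s (rep_G (u t)) (2 * r) \<and>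
     (u has_vector_derivative (mA \<alpha> n (u t) - Pn n (NL p (u t)))) (at t within {0..T}))"

lemma l2b_wR_Pn:
  assumes "Pn n u = u" "1 \<le> R"
  shows "l2w s R (rep_G u) A \<longleftrightarrow> norm (mW s R n u) \<le> A"
proof (rule l2b_rep_AE)
  have "0 \<le> s" using s2 by simp
  from rep_mW[OF this assms(2), of n u] rep_Pn[of n u]
  show "AE z in lborel. rep_G (mW s R n u) z = of_real (wR s R z) * rep_G u z"
    unfolding assms(1) by eventually_elim (simp add: cut_def split: if_splits)
qed measurable

text \<open>With the retraction to radius 2 r the energy estimate holds unconditionally, and a
  continuation argument is avoided. By Gronwall squared norms grow by at most exp (ln 4) = 4, so
  norms at most double and solutions with data of size r never leave the ball on which the
  retraction is the identity. The same factor 2 serves all weights \<open>wR s R\<close>.\<close>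

lemma galerkin_exists:
  "\<exists>K\<ge>0. \<forall>r T n x. 0 < r \<longrightarrow> 0 \<le> T \<longrightarrow> 2 * K * (2 * r) ^ p * T \<le> ln 4 \<longrightarrow> 1 \<le> n \<longrightarrow> hb s (rep_G x) r \<longrightarrow>
     (\<exists>u. gsol n T r x u \<and> (\<forall>t\<in>{0..T}. \<forall>R\<ge>1. \<forall>D. l2w s R (rep_G x) D \<longrightarrow>
       l2w s R (rep_G (u t)) (2 * D)))"
proof -
  obtain K where K0: "0 \<le> K" and K: "\<forall>n R \<rho> u. 1 \<le> n \<longrightarrow> 1 \<le> R \<longrightarrow> 0 < \<rho> \<longrightarrow> Pn n u = u \<longrightarrow>
     \<bar>mW s R n u \<bullet> mW s R n (FG s \<alpha> p n \<rho> u)\<bar> \<le> K * \<rho> ^ p * (norm (mW s R n u))\<^sup>2"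
    using galerkin_energy[OF s2 p1, of \<alpha>] by (elim exE conjE) (rule that)
  show ?thesis
  proof (intro exI[of _ K] conjI allI impI K0)
    fix r T n :: real and x :: G
    assume r: "0 < r" and T: "0 \<le> T" and KT: "2 * K * (2 * r) ^ p * T \<le> ln 4" and n: "1 \<le> n" and x: "hb s (rep_G x) r"
    define \<rho> where "\<rho> = 2 * r"
    have \<rho>: "0 < \<rho>" using r by (simp add: \<rho>_def)
    have s0: "0 \<le> s" using s2 by simp
    interpret P: bounded_linear "Pn n" by (rule bounded_linear_Pn)
    obtain L where L: "0 < L" "\<And>y z. norm (FG s \<alpha> p n \<rho> y - FG s \<alpha> p n \<rho> z) \<le> L * norm (y - z)"
      using FG_lipschitz[OF s2 p1 n \<rho>] by blast
    from lipschitz_ode[OF L(2,1) T, of "Pn n x"] obtain u where u0: "u 0 = Pn n x"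
      and u': "\<And>t. t \<in> {0..T} \<Longrightarrow> (u has_vector_derivative FG s \<alpha> p n \<rho> (u t)) (at t within {0..T})"
      by blast
    have PF: "Pn n (FG s \<alpha> p n \<rho> y) = FG s \<alpha> p n \<rho> y" for y
      by (simp add: FG_def[OF s2 p1] P.diff Pn_Pn Pn_mA)
    have Pu: "Pn n (u t) = u t" if t: "t \<in> {0..T}" for t
    proof -
      \<comment> \<open>The field takes values in the range of \<open>Pn n\<close>, so the part of u
        outside it is constant in time, and it is 0 initially.\<close>
      have "((\<lambda>t. u t - Pn n (u t)) has_vector_derivative 0) (at t within {0..T})" if "t \<in> {0..T}" for t
        using has_vector_derivative_diff[OF u'[OF that] P.has_vector_derivative[OF u'[OF that]]] by (simp add: PF)
      from has_vector_derivative_zero_constant[OF convex_real_interval(5) this]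
      obtain c where c: "\<And>t. t \<in> {0..T} \<Longrightarrow> u t - Pn n (u t) = c" by blast
      have "c = 0" using c[of 0] T by (simp add: u0 Pn_Pn)
      then show ?thesis using c[OF t] by simp
    qed
    have mono: "norm (mW s R n (u t)) \<le> 2 * norm (mW s R n (Pn n x))" if t: "t \<in> {0..T}" and R: "1 \<le> R" for t R
    proof -
      let ?q = "\<lambda>t. (norm (mW s R n (u t)))\<^sup>2"
      interpret M: bounded_linear "mW s R n" by (rule bounded_linear_mW[OF s0 R])
      have "?q t \<le> (?q 0 + 0 * t) * exp (2 * K * \<rho> ^ p * t)"
      proof (rule gronwall_real[OF t])
        show "(?q has_real_derivative 2 * (mW s R n (u t) \<bullet> mW s R n (FG s \<alpha> p n \<rho> (u t)))) (at t within {0..T})"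
          if "t \<in> {0..T}" for t
          by (rule has_real_derivative_norm_power2[OF M.has_vector_derivative[OF u'[OF that]]])
        show "2 * (mW s R n (u t) \<bullet> mW s R n (FG s \<alpha> p n \<rho> (u t))) \<le> 2 * K * \<rho> ^ p * ?q t + 0" if "t \<in> {0..T}" for t
          using K[rule_format, OF n R \<rho> Pu[OF that]] by linarith
        show "0 \<le> 2 * K * \<rho> ^ p" using K0 \<rho> by simp
      qed simp
      also have "\<dots> \<le> ?q 0 * 4"
      proof -
        have "2 * K * \<rho> ^ p * t \<le> 2 * K * \<rho> ^ p * T" using t K0 \<rho> by (intro mult_left_mono) auto
        also have "\<dots> \<le> ln 4" using KT unfolding \<rho>_def .
        finally have "exp (2 * K * \<rho> ^ p * t) \<le> exp (ln 4)" by (subst exp_le_cancel_iff)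
        then show ?thesis by (simp add: mult_left_mono)
      qed
      finally have "(norm (mW s R n (u t)))\<^sup>2 \<le> (2 * norm (mW s R n (Pn n x)))\<^sup>2" by (simp add: u0 power_mult_distrib)
      then show ?thesis by (rule power2_le_imp_le) simp
    qed
    have mW0: "norm (mW s R n (Pn n x)) \<le> D" if R: "1 \<le> R" and D: "l2w s R (rep_G x) D" for R D
    proof -
      have "AE z in lborel. rep_G (mW s R n (Pn n x)) z = of_real (cut n z) * (of_real (wR s R z) * rep_G x z)"
        using rep_mW[OF s0 R, of n "Pn n x"] rep_Pn[of n x] by eventually_elim (simp add: cut_def)
      moreover have "l2b (\<lambda>z. of_real (cut n z) * (of_real (wR s R z) * rep_G x z)) D"
        by (rule l2b_mono[OF D]) (auto simp: norm_mult intro!: always_eventually mult_left_le_one_le mult_nonneg_nonneg simp del: split_paired_All)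
      ultimately show ?thesis by (subst (asm) l2b_rep_AE) auto
    qed
    have wRb: "l2w s R (rep_G (u t)) (2 * D)"
      if t: "t \<in> {0..T}" and R: "1 \<le> R" and D: "l2w s R (rep_G x) D" for t R D
      unfolding l2b_wR_Pn[OF Pu[OF t] R] using mono[OF t R] mW0[OF R D] by simp
    have hbu: "hb s (rep_G (u t)) (2 * r)" if t: "t \<in> {0..T}" for t
      using wRb[OF t order_refl, of r] x by (simp add: wR_1 hb_def)
    have FGe: "FG s \<alpha> p n \<rho> (u t) = mA \<alpha> n (u t) - Pn n (NL p (u t))" if t: "t \<in> {0..T}" for t
    proof -
      have "norm (mW s 1 n (u t)) \<le> \<rho>"
        using hbu[OF t] l2b_wR_Pn[OF Pu[OF t] order_refl, of "2 * r"] by (simp add: hb_def wR_1 \<rho>_def)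
      then have "ret s n \<rho> (u t) = u t" using \<rho> by (simp add: ret_def[OF s2 p1] max_def)
      then show ?thesis by (simp add: FG_def[OF s2 p1] Pu[OF t])
    qed
    show "\<exists>u. gsol n T r x u \<and> (\<forall>t\<in>{0..T}. \<forall>R\<ge>1. \<forall>D. l2w s R (rep_G x) D \<longrightarrow>
       l2w s R (rep_G (u t)) (2 * D))"
      unfolding gsol_def using u0 Pu hbu u' FGe wRb by (intro exI[of _ u]) auto
  qed
qed

text \<open>Truncations at n and m differ in the initial value and in the nonlinearity at
  frequencies between n and m. Both differences are O(1/n) in L^2, since x and the nonlinearity have
  at least one derivative in L^2. The linear parts leave only \<open>\<i> * om\<close> times the
  difference, which is skew, as each solution is truncated already.\<close>

lemma galerkin_diff:
  assumes r: "0 < r" and T: "0 \<le> T"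
  shows "\<exists>C\<ge>0. \<forall>n m x u v. 1 \<le> n \<longrightarrow> n \<le> m \<longrightarrow> hb s (rep_G x) r \<longrightarrow> gsol n T r x u \<longrightarrow> gsol m T r x v \<longrightarrow>
     (\<forall>t\<in>{0..T}. (norm (u t - v t))\<^sup>2 \<le> C / n)"
proof -
  obtain K where K0: "0 \<le> K \<and> (\<forall>f g A D. hermitian f \<longrightarrow> hermitian g \<longrightarrow> hb s f A \<longrightarrow> hb s g A \<longrightarrow> l2b (\<lambda>z. f z - g z) D \<longrightarrow>
    \<bar>LINT z|lborel. Re ((nl p f z - nl p g z) * cnj (f z - g z))\<bar> \<le> K * A ^ p * D\<^sup>2)"
    using l2_energy[OF s2 p1] by (elim exE)
  note K = K0[THEN conjunct2, rule_format]
  obtain E where E0: "0 \<le> E" and E: "\<And>f A. hb s f A \<Longrightarrow> hb (s - 1) (nl p f) (E * A ^ (p + 1))"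
    using nl_hb[OF s2 p1] by blast
  define N where "N = E * (2 * r) ^ (p + 1)"
  have N: "0 \<le> N" using E0 r by (simp add: N_def)
  define K' where "K' = 2 * (K * (2 * r) ^ p)"
  have K': "0 \<le> K'" using K0 r by (simp add: K'_def)
  \<comment> \<open>Initially the squared distance is at most r^2 / n. The source term is 2 (N / n)
    (4 r), where N / n bounds the cut nonlinearity and 4 r the distance of the solutions.\<close>
  let ?C = "(r\<^sup>2 + 8 * r * N * T) * exp (K' * T)"
  show ?thesis
  proof (intro exI[of _ ?C] conjI allI impI ballI)
    show "0 \<le> ?C" using N r T by (intro mult_nonneg_nonneg add_nonneg_nonneg) auto
    fix n m :: real and x u v t
    assume n: "1 \<le> n" and nm: "n \<le> m" and x: "hb s (rep_G x) r" and u: "gsol n T r x u" and v: "gsol m T r x v" and t: "t \<in> {0..T}"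
    have s1: "1 \<le> s" "1 \<le> s - 1" using s2 by auto
    let ?q = "\<lambda>t. (norm (u t - v t))\<^sup>2"
    let ?du = "\<lambda>t. mA \<alpha> n (u t) - Pn n (NL p (u t))" and ?dv = "\<lambda>t. mA \<alpha> m (v t) - Pn m (NL p (v t))"
    have cm: "bmeas (\<lambda>z. cut m z - cut n z)" by measurable
    have cb: "\<bar>cut m z - cut n z\<bar> \<le> (if jb z \<le> n then 0 else 1)" for z using nm by (simp add: cut_def)
    have q0: "?q 0 \<le> r\<^sup>2 / n"
    proof -
      have "AE z in lborel. rep_G (v 0 - u 0) z = of_real (cut m z - cut n z) * rep_G x z"
        using rep_diff[of "v 0" "u 0"] rep_Pn[of n x] rep_Pn[of m x] u v unfolding gsol_def
        by (auto elim!: eventually_elim2 simp: algebra_simps)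
      moreover have "l2b (\<lambda>z. of_real (cut m z - cut n z) * rep_G x z) (r / n)"
        by (rule l2b_cut_tail(1)[OF x s1(1) _ cm cb]) (use n in simp)
      ultimately have "norm (v 0 - u 0) \<le> r / n" by (subst (asm) l2b_rep_AE) auto
      then have "?q 0 \<le> (r / n)\<^sup>2" by (subst norm_minus_commute) (intro power_mono, auto)
      also have "\<dots> = r\<^sup>2 / n * (1 / n)" by (simp add: power2_eq_square)
      also have "\<dots> \<le> r\<^sup>2 / n * 1" using n by (intro mult_left_mono) auto
      finally show ?thesis by simp
    qed
    have "?q t \<le> (?q 0 + 8 * r * N / n * t) * exp (K' * t)"
    proof (rule gronwall_real[OF t])
      fix t assume t: "t \<in> {0..T}"
      have Pu: "Pn n (u t) = u t" and Pv: "Pn m (v t) = v t" and hu: "hb s (rep_G (u t)) (2 * r)" and hv: "hb s (rep_G (v t)) (2 * r)"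
        and du: "(u has_vector_derivative ?du t) (at t within {0..T})" and dv: "(v has_vector_derivative ?dv t) (at t within {0..T})"
        using u v t unfolding gsol_def by auto
      show "(?q has_real_derivative 2 * ((u t - v t) \<bullet> (?du t - ?dv t))) (at t within {0..T})"
        by (rule has_real_derivative_norm_power2[OF has_vector_derivative_diff[OF du dv]])
      let ?f = "rep_G (u t)" and ?g = "rep_G (v t)"
      let ?d = "\<lambda>z. ?f z - ?g z"
      let ?e = "\<lambda>z. of_real (cut m z - cut n z) * nl p ?f z"
      have d2: "l2b ?d (norm (u t - v t))" by (simp add: l2b_rep_diff)
      have cu: "AE z in lborel. of_real (cut n z) * ?f z = ?f z" using rep_Pn[of n "u t"] unfolding Pu by (auto elim: eventually_mono)
      have cv: "AE z in lborel. of_real (cut m z) * ?g z = ?g z" using rep_Pn[of m "v t"] unfolding Pv by (auto elim: eventually_mono)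
      have nlu: "hb (s - 1) (nl p ?f) N" unfolding N_def by (rule E[OF hu])
      have nlv: "hb (s - 1) (nl p ?g) N" unfolding N_def by (rule E[OF hv])
      have e2: "l2b ?e (N / n)" by (rule l2b_cut_tail(1)[OF nlu s1(2) _ cm cb]) (use n in simp)
      have nl2: "l2b (\<lambda>z. nl p ?f z - nl p ?g z) (N + N)"
        by (rule hb_imp_l2b[OF hb_diff[OF nlu nlv]]) (use s2 in simp)
      have dd: "AE z in lborel. rep_G (?du t - ?dv t) z =
          (\<i> * of_real (om \<alpha> z) * of_real (cut n z) * ?f z - of_real (cut n z) * nl p ?f z)
          - (\<i> * of_real (om \<alpha> z) * of_real (cut m z) * ?g z - of_real (cut m z) * nl p ?g z)"
        using rep_diff[of "?du t" "?dv t"] rep_diff[of "mA \<alpha> n (u t)" "Pn n (NL p (u t))"] rep_diff[of "mA \<alpha> m (v t)" "Pn m (NL p (v t))"]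
          rep_mA[of \<alpha> n "u t"] rep_mA[of \<alpha> m "v t"] rep_Pn[of n "NL p (u t)"] rep_Pn[of m "NL p (v t)"] rep_NL[OF s2 p1 hu] rep_NL[OF s2 p1 hv]
        by eventually_elim simp
      have "(u t - v t) \<bullet> (?du t - ?dv t) = (LINT z|lborel. Re (?d z * cnj ((\<i> * of_real (om \<alpha> z) * of_real (cut n z) * ?f z - of_real (cut n z) * nl p ?f z)
          - (\<i> * of_real (om \<alpha> z) * of_real (cut m z) * ?g z - of_real (cut m z) * nl p ?g z))))"
        by (rule inner_G_AE[OF rep_diff dd]) measurable
      also have "\<dots> = (LINT z|lborel. Re (?e z * cnj (?d z)) - Re ((nl p ?f z - nl p ?g z) * cnj (?d z)))"
      proof (rule integral_cong_AE)
        show "AE z in lborel. Re (?d z * cnj ((\<i> * of_real (om \<alpha> z) * of_real (cut n z) * ?f z - of_real (cut n z) * nl p ?f z)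
          - (\<i> * of_real (om \<alpha> z) * of_real (cut m z) * ?g z - of_real (cut m z) * nl p ?g z)))
          = Re (?e z * cnj (?d z)) - Re ((nl p ?f z - nl p ?g z) * cnj (?d z))"
          using cu cv
        proof eventually_elim
          case (elim z)
          let ?I = "\<i> * complex_of_real (om \<alpha> z)"
          have c: "Re (a * cnj b) = Re (b * cnj a)" for a b :: complex by (simp add: algebra_simps)
          \<comment> \<open>The difference has frequencies up to m only, because n \<le> m.\<close>
          have dm: "of_real (cut m z) * ?d z = ?d z"
          proof (cases "jb z \<le> m")
            case False
            then have "\<not> jb z \<le> n" using nm by simp
            then show ?thesis using elim False by (simp add: cut_def)
          qed (simp add: cut_def)
          have "(?I * of_real (cut n z) * ?f z - of_real (cut n z) * nl p ?f z)
          - (?I * of_real (cut m z) * ?g z - of_real (cut m z) * nl p ?g z)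
           = ?I * (of_real (cut n z) * ?f z) - ?I * (of_real (cut m z) * ?g z) + ?e z - of_real (cut m z) * (nl p ?f z - nl p ?g z)"
            by (simp add: algebra_simps)
          also have "\<dots> = ?I * ?d z + ?e z - of_real (cut m z) * (nl p ?f z - nl p ?g z)"
            unfolding elim by (simp add: algebra_simps)
          finally have 1: "(?I * of_real (cut n z) * ?f z - of_real (cut n z) * nl p ?f z)
          - (?I * of_real (cut m z) * ?g z - of_real (cut m z) * nl p ?g z) = ?I * ?d z + ?e z - of_real (cut m z) * (nl p ?f z - nl p ?g z)" .
          have 2: "?d z * cnj (?I * ?d z + ?e z - of_real (cut m z) * (nl p ?f z - nl p ?g z))
            = ?d z * cnj (?I * ?d z) + ?d z * cnj (?e z) - (of_real (cut m z) * ?d z) * cnj (nl p ?f z - nl p ?g z)"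
            by (simp add: algebra_simps)
          show ?case unfolding 1 2 dm minus_complex.sel plus_complex.sel Re_skew
            using c[of "?d z" "?e z"] c[of "?d z" "nl p ?f z - nl p ?g z"] by (simp only: add_0)
        qed
      qed measurable
      also have "\<dots> = (LINT z|lborel. Re (?e z * cnj (?d z))) - (LINT z|lborel. Re ((nl p ?f z - nl p ?g z) * cnj (?d z)))"
        by (rule Bochner_Integration.integral_diff[OF integrable_Re_pair[OF e2 d2] integrable_Re_pair[OF nl2 d2]])
      finally have eq: "(u t - v t) \<bullet> (?du t - ?dv t) = (LINT z|lborel. Re (?e z * cnj (?d z))) - (LINT z|lborel. Re ((nl p ?f z - nl p ?g z) * cnj (?d z)))" .
      have b1: "\<bar>LINT z|lborel. Re (?e z * cnj (?d z))\<bar> \<le> (N / n) * norm (u t - v t)" by (rule l2b_pair_le[OF e2 d2])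
      have b2: "\<bar>LINT z|lborel. Re ((nl p ?f z - nl p ?g z) * cnj (?d z))\<bar> \<le> K * (2 * r) ^ p * (norm (u t - v t))\<^sup>2"
        by (rule K[OF hermitian_rep hermitian_rep hu hv d2])
      have "hb s ?d (2 * r + 2 * r)" by (rule hb_diff[OF hu hv])
      then have "norm (u t - v t) \<le> 4 * r"
        using hb_imp_l2b[of s ?d "2 * r + 2 * r"] s2 by (simp add: l2b_rep_diff)
      then have n4: "(N / n) * norm (u t - v t) \<le> (N / n) * (4 * r)" using N n by (intro mult_left_mono) auto
      have gen: "2 * (X - Y) \<le> 2 * B * Q + 8 * r * N / n" if "\<bar>X\<bar> \<le> M" "\<bar>Y\<bar> \<le> B * Q" "M \<le> (N / n) * (4 * r)" for X Y M B Q :: real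
      proof -
        have e: "2 * ((N / n) * (4 * r)) = 8 * r * N / n" by simp
        have "2 * M \<le> 8 * r * N / n" unfolding e[symmetric] using that(3) by (rule mult_left_mono) simp
        moreover have "2 * (X - Y) \<le> 2 * M + 2 * (B * Q)" using that(1,2) by (simp add: abs_le_iff)
        ultimately show ?thesis by (simp only: mult.assoc)
      qed
      show "2 * ((u t - v t) \<bullet> (?du t - ?dv t)) \<le> K' * ?q t + 8 * r * N / n"
        unfolding eq K'_def by (rule gen[OF b1 b2 n4])
    qed (use K' N r n in auto)
    also have "\<dots> \<le> (r\<^sup>2 / n + 8 * r * N / n * T) * exp (K' * T)"
      using q0 t N r n K' by (intro mult_mono add_mono mult_left_mono) (auto intro!: add_nonneg_nonneg mult_nonneg_nonneg mult_left_mono)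
    also have "\<dots> = ?C / n" using n by (simp add: field_simps)
    finally show "(norm (u t - v t))\<^sup>2 \<le> ?C / n" .
  qed
qed

end

section \<open>The limit equation and its flow in \<open>G\<close>\<close>

context
  fixes s \<alpha> :: real and p :: nat
  assumes s2: "2 < s" and p1: "1 \<le> p"
begin

definition vel :: "(plane \<Rightarrow> complex) \<Rightarrow> plane \<Rightarrow> complex"
  where "vel f z = \<i> * of_real (om \<alpha> z) * f z - nl p f z"

lemma vel_measurable [measurable]: "bmeas f \<Longrightarrow> vel f \<in> borel_measurable borel"
  unfolding vel_def[abs_def] by (intro borel_measurable_diff borel_measurable_times nl_measurable) auto

lemma hermitian_vel: "bmeas f \<Longrightarrow> hermitian f \<Longrightarrow> hermitian (vel f)"
  unfolding vel_def[abs_def]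
  by (intro hermitian_diff hermitian_mult hermitian_nl hermitian_imag) auto

lemma hb_om: assumes "hb s f A" shows "hb (s - 2) (\<lambda>z. \<i> * of_real (om \<alpha> z) * f z) ((1 + \<bar>\<alpha>\<bar>) * A)"
proof -
  have [measurable]: "bmeas f" using assms by (auto dest: hb_measurable)
  have "l2b (\<lambda>z. of_real (1 + \<bar>\<alpha>\<bar>) * (of_real (wt s z) * f z)) (cmod (of_real (1 + \<bar>\<alpha>\<bar>)) * A)"
    by (intro l2b_cmult hb_l2b assms)
  then have "l2b (\<lambda>z. of_real (1 + \<bar>\<alpha>\<bar>) * (of_real (wt s z) * f z)) ((1 + \<bar>\<alpha>\<bar>) * A)" by (simp only: norm_of_real) simp
  then have "l2b (\<lambda>z. of_real (wt (s - 2) z) * (\<i> * of_real (om \<alpha> z) * f z)) ((1 + \<bar>\<alpha>\<bar>) * A)"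
  proof (rule l2b_mono)
    have "wt (s - 2) z * (\<bar>om \<alpha> z\<bar> * cmod (f z)) \<le> (1 + \<bar>\<alpha>\<bar>) * (wt s z * cmod (f z))" for z
    proof -
      have "wt (s - 2) z * (\<bar>om \<alpha> z\<bar> * cmod (f z)) \<le> wt (s - 2) z * (((1 + \<bar>\<alpha>\<bar>) * wt 2 z) * cmod (f z))"
        by (intro mult_left_mono mult_right_mono om_le) auto
      also have "\<dots> = (1 + \<bar>\<alpha>\<bar>) * (wt s z * cmod (f z))"
        using wt_add[of "s - 2" 2 z] by simp
      finally show ?thesis .
    qed
    then have "cmod (of_real (wt (s - 2) z) * (\<i> * of_real (om \<alpha> z) * f z)) \<le> cmod (of_real (1 + \<bar>\<alpha>\<bar>) * (of_real (wt s z) * f z))" for z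
      unfolding norm_mult norm_of_real by simp
    then show "AE z in lborel. cmod (of_real (wt (s - 2) z) * (\<i> * of_real (om \<alpha> z) * f z)) \<le> cmod (of_real (1 + \<bar>\<alpha>\<bar>) * (of_real (wt s z) * f z))"
      by (intro always_eventually allI)
  qed auto
  then show ?thesis by (simp add: hb_def)
qed

lemma hb_vel: "\<exists>B\<ge>0. \<forall>f A. hb s f A \<longrightarrow> hb (s - 2) (vel f) (B * (A + A ^ (p + 1)))"
proof -
  obtain E where E0: "0 \<le> E" and E: "\<And>f A. hb s f A \<Longrightarrow> hb (s - 1) (nl p f) (E * A ^ (p + 1))"
    using nl_hb[OF s2 p1] by blast
  show ?thesis
  proof (intro exI[of _ "1 + \<bar>\<alpha>\<bar> + E"] conjI allI impI)
    fix f A assume f: "hb s f A"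
    have A: "0 \<le> A" using f by (rule hb_nonneg)
    have "hb (s - 2) (nl p f) (E * A ^ (p + 1))" by (rule hb_mono[OF E[OF f]]) auto
    from hb_diff[OF hb_om[OF f] this] show "hb (s - 2) (vel f) ((1 + \<bar>\<alpha>\<bar> + E) * (A + A ^ (p + 1)))"
      unfolding vel_def[abs_def]
    proof (rule hb_mono)
      have "0 \<le> \<bar>\<alpha>\<bar> * A ^ (p + 1) + A ^ (p + 1) + E * A" using A E0 by simp
      then show "(1 + \<bar>\<alpha>\<bar>) * A + E * A ^ (p + 1) \<le> (1 + \<bar>\<alpha>\<bar> + E) * (A + A ^ (p + 1))"
        by (simp only: distrib_left distrib_right mult_1)
    qed simp
  qed (use E0 in simp)
qed

lemma hb_vel_diff:
  assumes "0 \<le> A"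
  shows "\<exists>B\<ge>0. \<forall>f g D. hb s f A \<longrightarrow> hb s g A \<longrightarrow> hb s (\<lambda>z. f z - g z) D \<longrightarrow> hb (s - 2) (\<lambda>z. vel f z - vel g z) (B * D)"
proof -
  obtain E where E0: "0 \<le> E \<and> (\<forall>f g A D. hb s f A \<longrightarrow> hb s g A \<longrightarrow> hb s (\<lambda>z. f z - g z) D \<longrightarrow>
     hb (s - 1) (\<lambda>z. nl p f z - nl p g z) (E * A ^ p * D))"
    using nl_diff_hb[OF s2 p1] by (elim exE)
  note E = E0[THEN conjunct2, rule_format]
  show ?thesis
  proof (intro exI[of _ "1 + \<bar>\<alpha>\<bar> + E * A ^ p"] conjI allI impI)
    fix f g D assume f: "hb s f A" and g: "hb s g A" and d: "hb s (\<lambda>z. f z - g z) D"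
    have "hb (s - 2) (\<lambda>z. nl p f z - nl p g z) (E * A ^ p * D)" by (rule hb_mono[OF E[OF f g d]]) auto
    from hb_diff[OF hb_om[OF d] this]
    have "hb (s - 2) (\<lambda>z. \<i> * of_real (om \<alpha> z) * (f z - g z) - (nl p f z - nl p g z)) ((1 + \<bar>\<alpha>\<bar>) * D + E * A ^ p * D)" .
    moreover have "(\<lambda>z. \<i> * of_real (om \<alpha> z) * (f z - g z) - (nl p f z - nl p g z)) = (\<lambda>z. vel f z - vel g z)"
      by (simp add: vel_def fun_eq_iff algebra_simps)
    ultimately show "hb (s - 2) (\<lambda>z. vel f z - vel g z) ((1 + \<bar>\<alpha>\<bar> + E * A ^ p) * D)" by (simp add: distrib_right)
  qed (use E0 assms in simp)
qed

definition V :: "G \<Rightarrow> G" where "V x = abs_G (vel (rep_G x))"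

lemma rep_V: assumes "hb s (rep_G x) A" shows "AE z in lborel. rep_G (V x) z = vel (rep_G x) z"
proof -
  obtain B where "\<And>f A. hb s f A \<Longrightarrow> hb (s - 2) (vel f) (B * (A + A ^ (p + 1)))" using hb_vel by blast
  from hb_imp_l2b[OF this[OF assms]] s2 have "l2b (vel (rep_G x)) (B * (A + A ^ (p + 1)))" by simp
  then have "hl2 (vel (rep_G x))" by (auto simp: hl2_l2b intro: hermitian_vel hermitian_rep)
  then show ?thesis unfolding V_def by (rule rep_abs)
qed

text \<open>The Bessel potential (1 - \<Delta>)^(\<sigma>/2). Through it norms, limits and
  derivatives in H^\<sigma> become those of \<open>G\<close>, so H^\<sigma> gets by without a type
  of its own.\<close>

definition J :: "real \<Rightarrow> G \<Rightarrow> G" where "J \<sigma> = mul (\<lambda>z. of_real (wt \<sigma> z))"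

lemma J_hb:
  assumes "hb \<sigma> (rep_G x) A"
  shows "gdom (\<lambda>z. of_real (wt \<sigma> z)) x" "hb \<sigma> (rep_G x) B \<longleftrightarrow> norm (J \<sigma> x) \<le> B"
    "AE z in lborel. rep_G (J \<sigma> x) z = of_real (wt \<sigma> z) * rep_G x z"
proof -
  show g: "gdom (\<lambda>z. of_real (wt \<sigma> z)) x" using hb_l2b[OF assms] by (rule gdomI)
  have h: "hermitian (\<lambda>z. complex_of_real (wt \<sigma> z))" by (rule hermitian_real) simp
  show "hb \<sigma> (rep_G x) B \<longleftrightarrow> norm (J \<sigma> x) \<le> B"
    using l2b_mul_iff[OF h g, of B] by (simp add: hb_def J_def)
  show "AE z in lborel. rep_G (J \<sigma> x) z = of_real (wt \<sigma> z) * rep_G x z"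
    unfolding J_def by (rule rep_mul[OF h g])
qed

text \<open>The derivative is taken in L^2, a weaker sense than in the theorem. This is what the L^2
  energy estimate uses, and it covers arbitrary solutions as well as the constructed ones.\<close>

abbreviation solves :: "real \<Rightarrow> real \<Rightarrow> (real \<Rightarrow> G) \<Rightarrow> (real \<Rightarrow> G) \<Rightarrow> bool"
  where "solves A T u u' \<equiv> \<forall>t\<in>{0..T}. hb s (rep_G (u t)) A \<and> (u has_vector_derivative u' t) (at t within {0..T}) \<and>
    (AE z in lborel. rep_G (u' t) z = vel (rep_G (u t)) z)"

text \<open>The bound A may be any common bound in H^s, unrelated to the size of the data. Equal
  initial values give uniqueness.\<close>

lemma solution_diff:
  "\<exists>K\<ge>0. \<forall>A T u v u' v'.
    (solves A T u u') \<longrightarrow>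
    (solves A T v v') \<longrightarrow>
    (\<forall>t\<in>{0..T}. (norm (u t - v t))\<^sup>2 \<le> (norm (u 0 - v 0))\<^sup>2 * exp (K * A ^ p * t))"
proof -
  obtain K where K0: "0 \<le> K \<and> (\<forall>f g A D. hermitian f \<longrightarrow> hermitian g \<longrightarrow> hb s f A \<longrightarrow> hb s g A \<longrightarrow> l2b (\<lambda>z. f z - g z) D \<longrightarrow>
    \<bar>LINT z|lborel. Re ((nl p f z - nl p g z) * cnj (f z - g z))\<bar> \<le> K * A ^ p * D\<^sup>2)"
    using l2_energy[OF s2 p1] by (elim exE)
  note K = K0[THEN conjunct2, rule_format]
  show ?thesis
  proof (intro exI[of _ "2 * K"] conjI allI impI ballI)
    fix A T u v u' v' t
    assume u: "solves A T u u'"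
      and v: "solves A T v v'"
      and t: "t \<in> {0..T}"
    have A: "0 \<le> A" using u t by (auto dest: hb_nonneg)
    let ?q = "\<lambda>t. (norm (u t - v t))\<^sup>2"
    have "?q t \<le> (?q 0 + 0 * t) * exp (2 * K * A ^ p * t)"
    proof (rule gronwall_real[OF t])
      fix t assume t: "t \<in> {0..T}"
      have hu: "hb s (rep_G (u t)) A" and hv: "hb s (rep_G (v t)) A"
        and du: "(u has_vector_derivative u' t) (at t within {0..T})" and dv: "(v has_vector_derivative v' t) (at t within {0..T})"
        and ru: "AE z in lborel. rep_G (u' t) z = vel (rep_G (u t)) z" and rv: "AE z in lborel. rep_G (v' t) z = vel (rep_G (v t)) z"
        using u v t by auto
      show "(?q has_real_derivative 2 * ((u t - v t) \<bullet> (u' t - v' t))) (at t within {0..T})"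
        by (rule has_real_derivative_norm_power2[OF has_vector_derivative_diff[OF du dv]])
      let ?f = "rep_G (u t)" and ?g = "rep_G (v t)"
      let ?d = "\<lambda>z. ?f z - ?g z"
      have d2: "l2b ?d (norm (u t - v t))" by (simp add: l2b_rep_diff)
      have "AE z in lborel. rep_G (u' t - v' t) z = vel ?f z - vel ?g z"
        using rep_diff[of "u' t" "v' t"] ru rv by eventually_elim simp
      then have "(u t - v t) \<bullet> (u' t - v' t) = (LINT z|lborel. Re (?d z * cnj (vel ?f z - vel ?g z)))"
        by (intro inner_G_AE[OF rep_diff]) measurable
      also have "\<dots> = (LINT z|lborel. - Re ((nl p ?f z - nl p ?g z) * cnj (?d z)))"
      proof (rule Bochner_Integration.integral_cong[OF refl])
        fix z
        have e: "vel ?f z - vel ?g z = \<i> * of_real (om \<alpha> z) * ?d z - (nl p ?f z - nl p ?g z)"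
          by (simp add: vel_def algebra_simps)
        have e2: "?d z * cnj (\<i> * of_real (om \<alpha> z) * ?d z - (nl p ?f z - nl p ?g z)) =
            ?d z * cnj (\<i> * of_real (om \<alpha> z) * ?d z) - ?d z * cnj (nl p ?f z - nl p ?g z)"
          by (simp only: complex_cnj_diff right_diff_distrib)
        have c: "Re (a * cnj b) = Re (b * cnj a)" for a b :: complex by (simp add: algebra_simps)
        show "Re (?d z * cnj (vel ?f z - vel ?g z)) = - Re ((nl p ?f z - nl p ?g z) * cnj (?d z))"
          unfolding e e2 minus_complex.sel Re_skew using c[of "?d z" "nl p ?f z - nl p ?g z"] by (simp only: diff_0)
      qed
      also have "\<dots> = - (LINT z|lborel. Re ((nl p ?f z - nl p ?g z) * cnj (?d z)))" by (rule Bochner_Integration.integral_minus)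
      finally have eq: "(u t - v t) \<bullet> (u' t - v' t) = - (LINT z|lborel. Re ((nl p ?f z - nl p ?g z) * cnj (?d z)))" .
      show "2 * ((u t - v t) \<bullet> (u' t - v' t)) \<le> 2 * K * A ^ p * ?q t + 0"
        unfolding eq using K[OF hermitian_rep hermitian_rep hu hv d2] by linarith
    qed (use K0 A in auto)
    then show "?q t \<le> ?q 0 * exp (2 * K * A ^ p * t)" by simp
  qed (use K0 in simp)
qed

text \<open>The second condition controls the tails of the solution by those of its initial value;
  it yields continuity in \<open>H\<^sup>s\<close>.\<close>

definition flow :: "real \<Rightarrow> real \<Rightarrow> G \<Rightarrow> (real \<Rightarrow> G) \<Rightarrow> bool"
  where "flow T r x u \<longleftrightarrow> u 0 = x \<and> (\<forall>t\<in>{0..T}. hb s (rep_G (u t)) (2 * r) \<and>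
     (\<forall>R\<ge>1. \<forall>D. l2w s R (rep_G x) D \<longrightarrow> l2w s R (rep_G (u t)) (2 * D)) \<and>
     ((\<lambda>t. J (s - 2) (u t)) has_vector_derivative J (s - 2) (V (u t))) (at t within {0..T}))"

text \<open>The truncated solutions converge in L^2 uniformly in time; as their tails are uniformly
  small, they converge in H^s uniformly in time. Hence their time derivatives converge uniformly in
  H^(s - 2), and the limit may be differentiated.\<close>

lemma flow_exists:
  "\<exists>\<tau>. (\<forall>r>0. 0 < \<tau> r) \<and> (\<forall>r>0. \<forall>x. hb s (rep_G x) r \<longrightarrow> (\<exists>u. flow (\<tau> r) r x u))"
proof -
  obtain K where K0: "0 \<le> K" and K: "\<forall>r T n x. 0 < r \<longrightarrow> 0 \<le> T \<longrightarrow> 2 * K * (2 * r) ^ p * T \<le> ln 4 \<longrightarrow> 1 \<le> n \<longrightarrow> hb s (rep_G x) r \<longrightarrow>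
     (\<exists>u. gsol s \<alpha> p n T r x u \<and> (\<forall>t\<in>{0..T}. \<forall>R\<ge>1. \<forall>D. l2w s R (rep_G x) D \<longrightarrow>
       l2w s R (rep_G (u t)) (2 * D)))"
    using galerkin_exists[OF s2 p1, of \<alpha>] by (elim exE conjE) (rule that)
  \<comment> \<open>The summand 1 keeps the denominator positive when K = 0.\<close>
  define \<tau> where "\<tau> r = ln 4 / (2 * K * (2 * r) ^ p + 1)" for r
  have \<tau>: "0 < \<tau> r" "2 * K * (2 * r) ^ p * \<tau> r \<le> ln 4" if "0 < r" for r
  proof -
    have k: "0 \<le> 2 * K * (2 * r) ^ p" using K0 that by simp
    then have pos: "0 < 2 * K * (2 * r) ^ p + 1" by linarith
    show "0 < \<tau> r" unfolding \<tau>_def by (rule divide_pos_pos[OF _ pos]) simp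
    have gen: "k * (l / (k + 1)) \<le> l" if "0 \<le> k" "0 \<le> l" for k l :: real
      using that by (simp add: divide_simps) (simp add: algebra_simps)
    show "2 * K * (2 * r) ^ p * \<tau> r \<le> ln 4" unfolding \<tau>_def by (rule gen[OF k]) simp
  qed
  show ?thesis
  proof (intro exI[of _ \<tau>] conjI allI impI)
    fix r x assume r: "0 < r" and x: "hb s (rep_G x) r"
    define T where "T = \<tau> r"
    have T: "0 < T" "0 \<le> T" using \<tau>[OF r] by (auto simp: T_def)
    have s0: "0 \<le> s" "0 \<le> s - 2" using s2 by auto
    have "\<forall>k. \<exists>u. gsol s \<alpha> p (real (Suc k)) T r x u \<and> (\<forall>t\<in>{0..T}. \<forall>R\<ge>1. \<forall>D. l2w s R (rep_G x) D \<longrightarrow>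
       l2w s R (rep_G (u t)) (2 * D))"
    proof
      fix k
      have "2 * K * (2 * r) ^ p * T \<le> ln 4" unfolding T_def by (rule \<tau>(2)[OF r])
      from K[rule_format, OF r T(2) this _ x, of "real (Suc k)"]
      show "\<exists>u. gsol s \<alpha> p (real (Suc k)) T r x u \<and> (\<forall>t\<in>{0..T}. \<forall>R\<ge>1. \<forall>D. l2w s R (rep_G x) D \<longrightarrow>
       l2w s R (rep_G (u t)) (2 * D))" by simp
    qed
    from choice[OF this] obtain U where UU: "\<forall>k. gsol s \<alpha> p (real (Suc k)) T r x (U k) \<and> (\<forall>t\<in>{0..T}. \<forall>R\<ge>1. \<forall>D. l2w s R (rep_G x) D \<longrightarrow>
       l2w s R (rep_G (U k t)) (2 * D))" by (elim exE)
    have U: "gsol s \<alpha> p (real (Suc k)) T r x (U k)" for k using UU by blast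
    have UR: "l2w s R (rep_G (U k t)) (2 * D)"
      if "t \<in> {0..T}" "1 \<le> R" "l2w s R (rep_G x) D" for k t R D
      using UU[rule_format, of k, THEN conjunct2, rule_format, OF that] .
    have PU: "Pn (real (Suc k)) (U k t) = U k t" and hU: "hb s (rep_G (U k t)) (2 * r)"
      and dU: "(U k has_vector_derivative (mA \<alpha> (real (Suc k)) (U k t) - Pn (real (Suc k)) (NL p (U k t)))) (at t within {0..T})"
      if "t \<in> {0..T}" for k t using U[of k] that unfolding gsol_def[OF s2 p1] by auto
    obtain C where C0: "0 \<le> C" and C: "\<forall>n m x u v. 1 \<le> n \<longrightarrow> n \<le> m \<longrightarrow> hb s (rep_G x) r \<longrightarrow> gsol s \<alpha> p n T r x u \<longrightarrow> gsol s \<alpha> p m T r x v \<longrightarrow>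
     (\<forall>t\<in>{0..T}. (norm (u t - v t))\<^sup>2 \<le> C / n)"
      using galerkin_diff[OF s2 p1 r T(2), of \<alpha>] by (elim exE conjE) (rule that)
    have Cd: "(norm (U j t - U k t))\<^sup>2 \<le> C / real (Suc j)" if "t \<in> {0..T}" "j \<le> k" for j k t
      using C[rule_format, OF _ _ x U U that(1), of j k] that(2) by simp
    have C0lim: "\<exists>N. \<forall>j\<ge>N. C / real (Suc j) < e" if "0 < e" for e
    proof -
      have "(\<lambda>j. C / real (Suc j)) \<longlonglongrightarrow> 0"
        using tendsto_mult[OF tendsto_const[of C] LIMSEQ_inverse_real_of_nat] by (simp add: divide_inverse)
      from order_tendstoD(2)[OF this that] show ?thesis by (simp add: eventually_sequentially)
    qed
    have cvg: "convergent (\<lambda>k. U k t)" if t: "t \<in> {0..T}" for t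
    proof -
      have "Cauchy (\<lambda>k. U k t)"
      proof (rule CauchyI)
        fix e :: real assume e: "0 < e"
        from C0lim[OF zero_less_power[OF e, of 2]]
        obtain N where N: "\<forall>j\<ge>N. C / real (Suc j) < e\<^sup>2" by (elim exE)
        have less: "norm (U m t - U n t) < e" if "N \<le> m" "m \<le> n" for m n
        proof -
          have "(norm (U m t - U n t))\<^sup>2 < e\<^sup>2"
            using Cd[OF t that(2)] N[rule_format, OF that(1)] by (rule le_less_trans)
          then show ?thesis by (rule power2_less_imp_less) (use e in simp)
        qed
        have "norm (U m t - U n t) < e" if "N \<le> m" "N \<le> n" for m n
        proof (cases "m \<le> n")
          case True then show ?thesis using less that by blast
        next
          case False
          then have "norm (U n t - U m t) < e" using less[of n m] that by simp
          then show ?thesis by (simp only: norm_minus_commute)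
        qed
        then show "\<exists>M. \<forall>m\<ge>M. \<forall>n\<ge>M. norm (U m t - U n t) < e" by blast
      qed
      then show ?thesis by (rule Cauchy_convergent)
    qed
    define u where "u t = lim (\<lambda>k. U k t)" for t
    have lim: "(\<lambda>k. U k t) \<longlonglongrightarrow> u t" if "t \<in> {0..T}" for t
      unfolding u_def using cvg[OF that] by (simp add: convergent_LIMSEQ_iff)
    have ud: "(norm (U j t - u t))\<^sup>2 \<le> C / real (Suc j)" if t: "t \<in> {0..T}" for j t
    proof (rule LIMSEQ_le_const2)
      show "(\<lambda>k. (norm (U j t - U k t))\<^sup>2) \<longlonglongrightarrow> (norm (U j t - u t))\<^sup>2"
        by (intro tendsto_intros lim[OF t])
      show "\<exists>N. \<forall>n\<ge>N. (norm (U j t - U n t))\<^sup>2 \<le> C / real (Suc j)" using Cd[OF t] by blast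
    qed
    have uR: "l2w s R (rep_G (u t)) (2 * D)"
      if t: "t \<in> {0..T}" and R: "1 \<le> R" and D: "l2w s R (rep_G x) D" for t R D
      by (rule l2b_lsc[OF _ _ _ lim[OF t] UR[OF t R D]]) (auto simp: wR_nonneg[OF R] simp del: split_paired_All)
    have hu: "hb s (rep_G (u t)) (2 * r)" if t: "t \<in> {0..T}" for t
      using uR[OF t order_refl, of r] x by (simp add: wR_1 hb_def)
    \<comment> \<open>The tails of the two functions contribute 2 (e / 8) each, together e / 2;
      \<delta> is chosen so that the low frequencies contribute R^s \<delta> = e / 2.\<close>
    have unif: "\<exists>N. \<forall>k\<ge>N. \<forall>t\<in>{0..T}. hb s (\<lambda>z. rep_G (U k t) z - rep_G (u t) z) e" if e: "0 < e" for e
    proof -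
      have e8: "0 < e / 8" using e by simp
      from wR_tail_small[OF x e8]
      obtain R where R: "1 \<le> R" and Rt: "l2w s R (rep_G x) (e / 8)" by (elim exE conjE)
      define \<delta> where "\<delta> = e / (2 * R powr s)"
      have Rs: "0 < R powr s" using R by simp
      have \<delta>: "0 < \<delta>" unfolding \<delta>_def using e Rs by (intro divide_pos_pos mult_pos_pos) auto
      have R\<delta>: "R powr s * \<delta> + e / 2 = e" using Rs by (simp add: \<delta>_def)
      from C0lim[OF zero_less_power[OF \<delta>, of 2]]
      obtain N where N: "\<forall>j\<ge>N. C / real (Suc j) < \<delta>\<^sup>2" by (elim exE)
      have "hb s (\<lambda>z. rep_G (U k t) z - rep_G (u t) z) e" if k: "N \<le> k" and t: "t \<in> {0..T}" for k t
      proof -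
        have "(norm (U k t - u t))\<^sup>2 < \<delta>\<^sup>2" using ud[OF t] N[rule_format, OF k] by (rule le_less_trans)
        then have "norm (U k t - u t) \<le> \<delta>" using \<delta> by (rule power2_le_imp_le[OF less_imp_le less_imp_le])
        then have d: "l2b (\<lambda>z. rep_G (U k t) z - rep_G (u t) z) \<delta>" by (simp only: l2b_rep_diff)
        have "l2b (\<lambda>z. of_real (wR s R z) * rep_G (U k t) z - of_real (wR s R z) * rep_G (u t) z) (2 * (e / 8) + 2 * (e / 8))"
          by (rule l2b_diff[OF UR[OF t R Rt] uR[OF t R Rt]])
        then have "l2b (\<lambda>z. of_real (wR s R z) * (rep_G (U k t) z - rep_G (u t) z)) (2 * (e / 8) + 2 * (e / 8))"
          by (simp only: right_diff_distrib)
        moreover have "2 * (e / 8) + 2 * (e / 8) = e / 2" by simp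
        ultimately have w: "l2b (\<lambda>z. of_real (wR s R z) * (rep_G (U k t) z - rep_G (u t) z)) (e / 2)" by (simp only:)
        from l2b_wR_tail[OF R w d s0(1)] show ?thesis unfolding R\<delta> .
      qed
      then show ?thesis by blast
    qed
    obtain E where E0: "0 \<le> E" and E: "\<And>f A. hb s f A \<Longrightarrow> hb (s - 1) (nl p f) (E * A ^ (p + 1))"
      using nl_hb[OF s2 p1] by blast
    define N where "N = E * (2 * r) ^ (p + 1)"
    have r2: "0 \<le> 2 * r" using r by simp
    obtain B where B0: "0 \<le> B" and B: "\<forall>f g D. hb s f (2 * r) \<longrightarrow> hb s g (2 * r) \<longrightarrow> hb s (\<lambda>z. f z - g z) D \<longrightarrow> hb (s - 2) (\<lambda>z. vel f z - vel g z) (B * D)"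
      using hb_vel_diff[OF r2] by (elim exE conjE) (rule that)
    obtain B1 where B1: "\<And>f A. hb s f A \<Longrightarrow> hb (s - 2) (vel f) (B1 * (A + A ^ (p + 1)))" using hb_vel by blast
    let ?w = "s - 2"
    have hm: "hermitian (\<lambda>z. complex_of_real (wt ?w z))" by (rule hermitian_real) simp
    have wm: "bmeas (\<lambda>z. complex_of_real (wt ?w z))" by measurable
    \<comment> \<open>\<open>J\<close> is unbounded, but on functions truncated at k + 1 it agrees
      with the bounded operator \<open>Jk k\<close>, which commutes with differentiation in
      time.\<close>
    define Jk where "Jk k = mul (\<lambda>z. complex_of_real (wt ?w z) * of_real (cut (real (Suc k)) z))" for k
    have Jkb: "cmod (complex_of_real (wt ?w z)) \<le> real (Suc k) powr ?w" if "jb z \<le> real (Suc k)" for z k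
      using wt_le_R[OF s0(2) that] by simp
    have Jkr: "AE z in lborel. rep_G (Jk k y) z = of_real (wt ?w z) * of_real (cut (real (Suc k)) z) * rep_G y z"
      and Jkl: "bounded_linear (Jk k)" for k y
    proof -
      have c: "0 \<le> real (Suc k) powr ?w" by simp
      note cm = cut_mult[OF wm hm Jkb c]
      show "AE z in lborel. rep_G (Jk k y) z = of_real (wt ?w z) * of_real (cut (real (Suc k)) z) * rep_G y z"
        unfolding Jk_def by (rule cm(6))
      show "bounded_linear (Jk k)" unfolding Jk_def by (rule cm(5))
    qed
    let ?U' = "\<lambda>k t. mA \<alpha> (real (Suc k)) (U k t) - Pn (real (Suc k)) (NL p (U k t))"
    have hs2: "hb ?w (rep_G y) A" if "hb s (rep_G y) A" for y A by (rule hb_mono[OF that]) auto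
    have JU: "J ?w (U k t) = Jk k (U k t)" if t: "t \<in> {0..T}" for k t
      using J_hb(3)[OF hs2[OF hU[OF t, of k]]] Jkr[of k "U k t"] rep_Pn[of "real (Suc k)" "U k t"] unfolding PU[OF t]
      by (intro G_eqI, eventually_elim) (simp add: cut_def split: if_splits)
    have hV: "hb ?w (rep_G (V (u t))) (B1 * (2 * r + (2 * r) ^ (p + 1)))" if t: "t \<in> {0..T}" for t
      using B1[OF hu[OF t]] rep_V[OF hu[OF t]] by (subst hb_cong_AE[OF _ _ rep_V[OF hu[OF t]]]) auto
    \<comment> \<open>The truncated velocity differs from that of the limit by a Lipschitz term,
      controlled by convergence in H^s, and by the nonlinearity beyond frequency k + 1, which is at
      most N / (k + 1) in H^(s - 2).\<close>
    have der_conv: "\<forall>\<^sub>F k in sequentially. \<forall>t\<in>{0..T}. norm (Jk k (?U' k t) - J ?w (V (u t))) \<le> e" if e: "0 < e" for e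
    proof -
      define e1 where "e1 = e / (2 * (B + 1))"
      have e1: "0 < e1" "B * e1 \<le> e / 2" using e B0 by (auto simp: e1_def field_simps)
      obtain M where M: "\<And>k t. M \<le> k \<Longrightarrow> t \<in> {0..T} \<Longrightarrow> hb s (\<lambda>z. rep_G (U k t) z - rep_G (u t) z) e1"
        using unif[OF e1(1)] by blast
      have "(\<lambda>j. N / real (Suc j)) \<longlonglongrightarrow> 0"
        using tendsto_mult[OF tendsto_const[of N] LIMSEQ_inverse_real_of_nat] by (simp add: divide_inverse)
      from order_tendstoD(2)[OF this, of "e / 2"] e have "\<forall>\<^sub>F k in sequentially. N / real (Suc k) < e / 2" by simp
      then show ?thesis using eventually_ge_at_top[of M]
      proof eventually_elim
        case (elim k)
        show ?case
        proof
          fix t assume t: "t \<in> {0..T}"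
          let ?f = "rep_G (U k t)" and ?g = "rep_G (u t)" and ?n = "real (Suc k)"
          have nlu: "hb (s - 1) (nl p ?f) N" unfolding N_def by (rule E[OF hU[OF t]])
          have s11: "1 \<le> s - 1" using s2 by simp
          have "hb (s - 1 - 1) (\<lambda>z. of_real (1 - cut ?n z) * nl p ?f z) (N / ?n)"
            by (rule l2b_cut_tail(2)[OF nlu s11]) (auto simp: cut_def)
          then have t1: "hb ?w (\<lambda>z. of_real (1 - cut ?n z) * nl p ?f z) (N / ?n)" by simp
          have t2: "hb ?w (\<lambda>z. vel ?f z - vel ?g z) (B * e1)" by (rule B[rule_format, OF hU[OF t] hu[OF t] M[OF elim(2) t]])
          have hbt: "hb ?w (\<lambda>z. (vel ?f z - vel ?g z) + of_real (1 - cut ?n z) * nl p ?f z) e"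
            by (rule hb_mono[OF hb_add[OF t2 t1] order_refl]) (use e1(2) elim(1) in linarith)
          have "AE z in lborel. rep_G (Jk k (?U' k t) - J ?w (V (u t))) z = of_real (wt ?w z) * ((vel ?f z - vel ?g z) + of_real (1 - cut ?n z) * nl p ?f z)"
            using rep_diff[of "Jk k (?U' k t)" "J ?w (V (u t))"] Jkr[of k "?U' k t"] J_hb(3)[OF hV[OF t]] rep_V[OF hu[OF t]]
              rep_diff[of "mA \<alpha> ?n (U k t)" "Pn ?n (NL p (U k t))"] rep_mA[of \<alpha> ?n "U k t"] rep_Pn[of ?n "NL p (U k t)"] rep_NL[OF s2 p1 hU[OF t, of k]]
              rep_Pn[of ?n "U k t", unfolded PU[OF t]]
          proof eventually_elim
            case (elim z)
            have a: "of_real (cut ?n z) * ?f z = ?f z" using elim(9) by simp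
            have "rep_G (Jk k (?U' k t) - J ?w (V (u t))) z =
               of_real (wt ?w z) * of_real (cut ?n z) * (\<i> * of_real (om \<alpha> z) * of_real (cut ?n z) * ?f z - of_real (cut ?n z) * nl p ?f z) - of_real (wt ?w z) * vel ?g z"
              using elim(1-8) by (simp del: of_nat_Suc)
            also have "\<dots> = of_real (wt ?w z) * (\<i> * of_real (om \<alpha> z) * (of_real (cut ?n z * cut ?n z) * ?f z) - of_real (cut ?n z * cut ?n z) * nl p ?f z - vel ?g z)"
              by (simp only: of_real_mult) (simp add: algebra_simps)
            also have "\<dots> = of_real (wt ?w z) * ((vel ?f z - vel ?g z) + of_real (1 - cut ?n z) * nl p ?f z)"
              unfolding cut_cut a by (simp add: vel_def algebra_simps)
            finally show ?case .
          qed
          from l2b_rep_AE[OF this, of e] show "norm (Jk k (?U' k t) - J ?w (V (u t))) \<le> e"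
            using hbt by (simp add: hb_def)
        qed
      qed
    qed
    have J_conv: "(\<lambda>k. J ?w (U k t)) \<longlonglongrightarrow> J ?w (u t)" if t: "t \<in> {0..T}" for t
    proof (rule LIMSEQ_I)
      fix e :: real assume e: "0 < e"
      obtain M where M: "\<And>k t. M \<le> k \<Longrightarrow> t \<in> {0..T} \<Longrightarrow> hb s (\<lambda>z. rep_G (U k t) z - rep_G (u t) z) (e / 2)"
      proof -
        have "0 < e / 2" using e by simp
        from unif[OF this] that show ?thesis by blast
      qed
      show "\<exists>no. \<forall>n\<ge>no. norm (J ?w (U n t) - J ?w (u t)) < e"
      proof (intro exI[of _ M] allI impI)
        fix k assume k: "M \<le> k"
        have "hb ?w (\<lambda>z. rep_G (U k t) z - rep_G (u t) z) (e / 2)" by (rule hb_mono[OF M[OF k t]]) auto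
        then have l: "l2b (\<lambda>z. of_real (wt ?w z) * (rep_G (U k t) z - rep_G (u t) z)) (e / 2)" by (rule hb_l2b)
        have "AE z in lborel. rep_G (J ?w (U k t) - J ?w (u t)) z = of_real (wt ?w z) * (rep_G (U k t) z - rep_G (u t) z)"
          using rep_diff[of "J ?w (U k t)" "J ?w (u t)"] J_hb(3)[OF hs2[OF hU[OF t, of k]]] J_hb(3)[OF hs2[OF hu[OF t]]]
          by eventually_elim (simp add: algebra_simps)
        from l2b_rep_AE[OF this, of "e / 2"] l have "norm (J ?w (U k t) - J ?w (u t)) \<le> e / 2" by simp
        then show "norm (J ?w (U k t) - J ?w (u t)) < e" using e by simp
      qed
    qed
    have t0: "0 \<in> {0..T}" using T by simp
    \<comment> \<open>Convergence at the time 0 and uniform convergence of the derivatives give a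
      differentiable limit g; it agrees with the expected one by \<open>J_conv\<close>.\<close>
    have "\<exists>g. \<forall>t\<in>{0..T}. (\<lambda>k. J ?w (U k t)) \<longlonglongrightarrow> g t \<and> (g has_derivative (\<lambda>h. h *\<^sub>R J ?w (V (u t)))) (at t within {0..T})"
    proof (rule has_derivative_sequence[where f = "\<lambda>k t. J ?w (U k t)" and f' = "\<lambda>k t h. h *\<^sub>R Jk k (?U' k t)"
        and g' = "\<lambda>t h. h *\<^sub>R J ?w (V (u t))", OF convex_real_interval(5) _ _ t0 J_conv[OF t0]])
      fix k t assume t: "t \<in> {0..T}"
      have "((\<lambda>t. Jk k (U k t)) has_vector_derivative Jk k (?U' k t)) (at t within {0..T})"
        by (rule bounded_linear.has_vector_derivative[OF Jkl dU[OF t]])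
      then have "((\<lambda>t. J ?w (U k t)) has_vector_derivative Jk k (?U' k t)) (at t within {0..T})"
        by (rule has_vector_derivative_transform[OF t, rotated]) (simp add: JU)
      then show "((\<lambda>t. J ?w (U k t)) has_derivative (\<lambda>h. h *\<^sub>R Jk k (?U' k t))) (at t within {0..T})"
        by (simp add: has_vector_derivative_def)
    next
      fix e :: real assume e: "0 < e"
      from der_conv[OF e] show "\<forall>\<^sub>F k in sequentially. \<forall>t\<in>{0..T}. \<forall>h. norm (h *\<^sub>R Jk k (?U' k t) - h *\<^sub>R J ?w (V (u t))) \<le> e * norm h"
      proof eventually_elim
        case (elim k)
        show ?case
        proof (intro ballI allI)
          fix t h assume t: "t \<in> {0..T}"
          have "norm (h *\<^sub>R Jk k (?U' k t) - h *\<^sub>R J ?w (V (u t))) = \<bar>h\<bar> * norm (Jk k (?U' k t) - J ?w (V (u t)))"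
            by (simp only: scaleR_diff_right[symmetric] norm_scaleR)
          also have "\<dots> \<le> \<bar>h\<bar> * e" using elim t by (intro mult_left_mono) auto
          finally show "norm (h *\<^sub>R Jk k (?U' k t) - h *\<^sub>R J ?w (V (u t))) \<le> e * norm h" by (simp only: mult.commute real_norm_def)
        qed
      qed
    qed
    then obtain g where g: "\<And>t. t \<in> {0..T} \<Longrightarrow> (\<lambda>k. J ?w (U k t)) \<longlonglongrightarrow> g t"
      and g': "\<And>t. t \<in> {0..T} \<Longrightarrow> (g has_vector_derivative J ?w (V (u t))) (at t within {0..T})"
      unfolding has_vector_derivative_def by blast
    have gJ: "g t = J ?w (u t)" if "t \<in> {0..T}" for t by (rule LIMSEQ_unique[OF g[OF that] J_conv[OF that]])
    have du: "((\<lambda>t. J ?w (u t)) has_vector_derivative J ?w (V (u t))) (at t within {0..T})" if t: "t \<in> {0..T}" for t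
      by (rule has_vector_derivative_transform[OF t _ g'[OF t]]) (simp add: gJ)
    have u0: "u 0 = x"
    proof -
      have "AE z in lborel. rep_G (U k 0 - x) z = of_real (- (1 - cut (real (Suc k)) z)) * rep_G x z" for k
        using rep_diff[of "U k 0" x] rep_Pn[of "real (Suc k)" x] U[of k] unfolding gsol_def[OF s2 p1]
        by (auto elim!: eventually_elim2 simp: algebra_simps simp del: of_nat_Suc)
      moreover have "l2b (\<lambda>z. of_real (- (1 - cut (real (Suc k)) z)) * rep_G x z) (r / real (Suc k))" for k
        by (rule l2b_cut_tail(1)[OF x]) (use s2 in \<open>auto simp: cut_def\<close>)
      ultimately have "norm (U k 0 - x) \<le> r / real (Suc k)" for k
        using l2b_rep_AE[of "U k 0 - x" "\<lambda>z. of_real (- (1 - cut (real (Suc k)) z)) * rep_G x z"] by (auto dest: l2b_measurable)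
      moreover have "(\<lambda>j. r / real (Suc j)) \<longlonglongrightarrow> 0"
        using tendsto_mult[OF tendsto_const[of r] LIMSEQ_inverse_real_of_nat] by (simp add: divide_inverse)
      ultimately have "(\<lambda>k. U k 0 - x) \<longlonglongrightarrow> 0" by (intro Lim_null_comparison[of "\<lambda>k. U k 0 - x" "\<lambda>j. r / real (Suc j)"]) auto
      then have "(\<lambda>k. U k 0) \<longlonglongrightarrow> x" by (simp add: LIM_zero_iff)
      from LIMSEQ_unique[OF lim[OF t0] this] show ?thesis .
    qed
    show "\<exists>u. flow (\<tau> r) r x u"
      unfolding flow_def T_def[symmetric] using u0 hu uR du by (intro exI[of _ u]) auto
  qed (use \<tau> in auto)
qed

end

section \<open>Plancherel's theorem\<close>

definition ip :: "plane \<Rightarrow> plane \<Rightarrow> real" where "ip z w = fst z * fst w + snd z * snd w"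

lemma ip_simps: "ip (a + b) w = ip a w + ip b w" "ip (a - b) w = ip a w - ip b w" "ip (- a) w = - ip a w"
  "ip w (a + b) = ip w a + ip w b" "ip w (a - b) = ip w a - ip w b" "ip w (- a) = - ip w a"
  by (simp_all add: ip_def algebra_simps)

lemma ip_commute: "ip a b = ip b a" by (simp add: ip_def mult.commute)

lemma cis_measurable [measurable]: "bmeas cis"
  by (intro borel_measurable_continuous_onI continuous_intros)

lemma ip_continuous: "continuous_on UNIV (\<lambda>x. ip (fst x) (snd x))"
  unfolding ip_def by (intro continuous_intros)

lemma cis_ip_measurable_pair: "(\<lambda>x. cis (c * ip (fst x) (snd x))) \<in> borel_measurable (borel \<Otimes>\<^sub>M borel)"
  unfolding borel_prod by (intro borel_measurable_continuous_onI continuous_intros ip_continuous)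

lemma cis_ip_measurable [measurable]: "bmeas (\<lambda>z. cis (c * ip z w))" "bmeas (\<lambda>z. cis (c * ip w z))"
  "bmeas (\<lambda>z. cis (ip z w))" "bmeas (\<lambda>z. cis (ip w z))"
  "bmeas (\<lambda>z. cis (- ip z w))" "bmeas (\<lambda>z. cis (- ip w z))"
  unfolding ip_def by (intro borel_measurable_continuous_onI continuous_intros)+

text \<open>The factor -1 is written as a product so that the lemmas on
  \<open>cis (c * ip z w)\<close> apply with c = -1.\<close>

definition ft :: "(plane \<Rightarrow> complex) \<Rightarrow> plane \<Rightarrow> complex"
  where "ft f \<zeta> = of_real (1 / (2 * pi)) * (LINT z|lborel. f z * cis (- 1 * ip z \<zeta>))"

lemma l1b_mult_bounded:
  assumes "l1b f A" "bmeas k" "\<And>z. cmod (k z) \<le> 1"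
  shows "l1b (\<lambda>z. f z * k z) A"
proof (rule l1b_mono[OF assms(1)])
  show "bmeas (\<lambda>z. f z * k z)" using l1b_measurable[OF assms(1)] assms(2) by simp
  show "AE z in lborel. cmod (f z * k z) \<le> cmod (f z)"
    using assms(3) by (intro always_eventually allI) (simp add: norm_mult mult_left_le)
qed simp

lemma integrable_cis: "integrable lborel f \<Longrightarrow> integrable lborel (\<lambda>z. f z * cis (c * ip z w))"
  by (rule l1b_integrable[OF l1b_mult_bounded[OF l1bI_integrable]]) auto

lemma l1b_ex: "integrable lborel f \<longleftrightarrow> (\<exists>A. l1b f A)"
  using l1bI_integrable l1b_integrable by blast

lemma lborel_pair_measurable:
  "f \<in> borel_measurable (borel \<Otimes>\<^sub>M borel) \<Longrightarrow> f \<in> borel_measurable (lborel \<Otimes>\<^sub>M lborel)"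
  by (simp cong: measurable_cong_sets add: sets_pair_measure_cong[OF sets_lborel sets_lborel])

lemma fubini_pair:
  fixes K :: "plane \<times> plane \<Rightarrow> complex"
  assumes [measurable]: "K \<in> borel_measurable (lborel \<Otimes>\<^sub>M lborel)"
    and fin: "(\<integral>\<^sup>+z. \<integral>\<^sup>+w. ennreal (norm (K (z, w))) \<partial>lborel \<partial>lborel) < \<infinity>"
  shows "(LINT z|lborel. LINT w|lborel. K (z, w)) = (LINT w|lborel. LINT z|lborel. K (z, w))"
proof -
  have "(\<integral>\<^sup>+x. ennreal (norm (K x)) \<partial>(lborel \<Otimes>\<^sub>M lborel)) < \<infinity>"
    using fin by (subst lborel.nn_integral_fst[symmetric]) auto
  then have Ki: "integrable (lborel \<Otimes>\<^sub>M lborel) K" by (intro integrableI_bounded) auto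
  have "(LINT z|lborel. LINT w|lborel. K (z, w)) = integral\<^sup>L (lborel \<Otimes>\<^sub>M lborel) K" by (rule lborel_pair.integral_fst'[OF Ki])
  also have "\<dots> = (LINT w|lborel. LINT z|lborel. K (z, w))"
    using lborel_pair.integral_snd[of "\<lambda>z w. K (z, w)"] Ki by simp
  finally show ?thesis .
qed

lemma fubini_kernel:
  fixes f g :: "plane \<Rightarrow> complex"
  assumes f: "integrable lborel f" and g: "integrable lborel g"
    and k: "(\<lambda>x. k (fst x) (snd x)) \<in> borel_measurable (borel \<Otimes>\<^sub>M borel)" "\<And>z w. cmod (k z w) \<le> 1"
  shows "(LINT z|lborel. f z * (LINT w|lborel. g w * k z w)) = (LINT w|lborel. g w * (LINT z|lborel. f z * k z w))"
proof -
  have [measurable]: "bmeas f" "bmeas g" using f g by auto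
  define K where "K x = f (fst x) * g (snd x) * k (fst x) (snd x)" for x
  have Km [measurable]: "K \<in> borel_measurable (lborel \<Otimes>\<^sub>M lborel)"
    unfolding K_def by (rule lborel_pair_measurable) (intro borel_measurable_times k; measurable)
  have "(\<integral>\<^sup>+z. \<integral>\<^sup>+w. ennreal (norm (K (z, w))) \<partial>lborel \<partial>lborel) \<le> (\<integral>\<^sup>+z. \<integral>\<^sup>+w. ennreal (cmod (f z)) * ennreal (cmod (g w)) \<partial>lborel \<partial>lborel)"
  proof (intro nn_integral_mono)
    fix z w
    have "norm (K (z, w)) = cmod (f z) * cmod (g w) * cmod (k z w)" by (simp add: K_def norm_mult)
    also have "\<dots> \<le> cmod (f z) * cmod (g w) * 1" by (rule mult_left_mono[OF k(2)]) simp
    finally have "norm (K (z, w)) \<le> cmod (f z) * cmod (g w) * 1" .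
    then show "ennreal (norm (K (z, w))) \<le> ennreal (cmod (f z)) * ennreal (cmod (g w))"
      by (simp add: ennreal_mult[symmetric] ennreal_leI)
  qed
  also have "\<dots> = (\<integral>\<^sup>+z. ennreal (cmod (f z)) \<partial>lborel) * (\<integral>\<^sup>+w. ennreal (cmod (g w)) \<partial>lborel)"
    by (simp add: nn_integral_cmult nn_integral_multc)
  also have "\<dots> < \<infinity>"
    using f g by (simp add: nn_integral_eq_integral ennreal_mult_less_top)
  finally have fin: "(\<integral>\<^sup>+z. \<integral>\<^sup>+w. ennreal (norm (K (z, w))) \<partial>lborel \<partial>lborel) < \<infinity>" .
  have "(LINT z|lborel. f z * (LINT w|lborel. g w * k z w)) = (LINT z|lborel. LINT w|lborel. K (z, w))"
    by (simp add: K_def mult.assoc)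
  also have "\<dots> = (LINT w|lborel. LINT z|lborel. K (z, w))" by (rule fubini_pair[OF Km fin])
  also have "\<dots> = (LINT w|lborel. g w * (LINT z|lborel. f z * k z w))"
  proof -
    have "K (z, w) = g w * (f z * k z w)" for z w by (simp add: K_def)
    then show ?thesis by (simp only: integral_mult_right_zero)
  qed
  finally show ?thesis .
qed

lemma ft_measurable [measurable]:
  assumes [measurable]: "bmeas f" shows "bmeas (ft f)"
proof -
  have "(\<lambda>x. f (snd x) * cis (- 1 * ip (snd x) (fst x))) \<in> borel_measurable (borel \<Otimes>\<^sub>M borel)"
  proof (rule borel_measurable_times)
    show "(\<lambda>x. f (snd x)) \<in> borel_measurable ((borel :: plane measure) \<Otimes>\<^sub>M borel)" by measurable
    show "(\<lambda>x. cis (- 1 * ip (snd x) (fst x))) \<in> borel_measurable (borel \<Otimes>\<^sub>M borel)"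
      using cis_ip_measurable_pair[of "-1"] by (simp only: ip_commute)
  qed
  then have "case_prod (\<lambda>\<zeta> z. f z * cis (- 1 * ip z \<zeta>)) \<in> borel_measurable (borel \<Otimes>\<^sub>M lborel)"
    by (simp add: split_beta' cong: measurable_cong_sets add: sets_pair_measure_cong[OF _ sets_lborel])
  from lborel.borel_measurable_lebesgue_integral[OF this] show ?thesis
    unfolding ft_def[abs_def] by (intro borel_measurable_times) simp_all
qed

lemma ft_le: assumes "l1b f A" shows "cmod (ft f \<zeta>) \<le> A"
proof -
  have "cmod (LINT z|lborel. f z * cis (- 1 * ip z \<zeta>)) \<le> A"
    by (intro l1b_integral_le l1b_mult_bounded assms) auto
  moreover have "cmod (of_real (1 / (2 * pi))) \<le> 1" using pi_gt3 by (simp add: norm_divide)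
  ultimately show ?thesis unfolding ft_def norm_mult
    using mult_mono[of "cmod (of_real (1 / (2 * pi)))" 1 "cmod (LINT z|lborel. f z * cis (- 1 * ip z \<zeta>))" A] l1b_nonneg[OF assms] by simp
qed

lemma ft_mult_formula:
  assumes f: "integrable lborel f" and g: "integrable lborel g"
  shows "(LINT \<zeta>|lborel. ft f \<zeta> * g \<zeta>) = (LINT z|lborel. f z * ft g z)"
proof -
  have "(LINT z|lborel. f z * (LINT w|lborel. g w * cis (- 1 * ip z w))) = (LINT w|lborel. g w * (LINT z|lborel. f z * cis (- 1 * ip z w)))"
    by (rule fubini_kernel[OF f g cis_ip_measurable_pair]) simp
  then have "(LINT z|lborel. of_real (1 / (2 * pi)) * (f z * (LINT w|lborel. g w * cis (- 1 * ip w z)))) =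
      (LINT w|lborel. of_real (1 / (2 * pi)) * (g w * (LINT z|lborel. f z * cis (- 1 * ip z w))))"
    by (simp add: ip_commute del: of_real_divide)
  then show ?thesis by (simp only: ft_def ac_simps)
qed

section \<open>Gaussian regularisation of the transform\<close>

definition gs :: "real \<Rightarrow> plane \<Rightarrow> real" where "gs e z = exp (- (e / 2) * ((fst z)\<^sup>2 + (snd z)\<^sup>2))"

lemma gs_measurable [measurable]: "bmeas (gs e)"
  unfolding gs_def[abs_def] by (intro borel_measurable_continuous_onI continuous_intros)
lemma gs_pos [simp]: "0 < gs e z" and gs_nonneg [simp]: "0 \<le> gs e z" by (simp_all add: gs_def)
lemma gs_le1: "0 \<le> e \<Longrightarrow> gs e z \<le> 1" by (simp add: gs_def)

text \<open>Read off from the characteristic function of the standard normal distribution after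
  rescaling by sqrt e.\<close>

lemma gaussian_real:
  fixes e t :: real assumes e: "0 < e"
  shows "integrable lborel (\<lambda>x. complex_of_real (exp (- (e / 2) * x\<^sup>2)) * cis (x * t))"
    "(LINT x|lborel. complex_of_real (exp (- (e / 2) * x\<^sup>2)) * cis (x * t)) = of_real (sqrt (2 * pi / e) * exp (- (t\<^sup>2) / (2 * e)))"
proof -
  define \<sigma> where "\<sigma> = sqrt e"
  have \<sigma>: "0 < \<sigma>" "\<sigma>\<^sup>2 = e" using e by (auto simp: \<sigma>_def)
  let ?f = "\<lambda>x::real. std_normal_density x *\<^sub>R iexp ((t / \<sigma>) * x)"
  have fi: "integrable lborel ?f"
  proof (rule Bochner_Integration.integrable_bound)
    show "integrable lborel std_normal_density" by (rule integrable_normal_density) simp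
    show "AE x in lborel. norm (?f x) \<le> norm (std_normal_density x)" by (simp add: norm_mult normal_density_nonneg)
  qed measurable
  have "(LINT x|lborel. ?f x) = char std_normal_distribution (t / \<sigma>)"
    unfolding char_def by (subst integral_density) (auto simp: normal_density_nonneg)
  also have "\<dots> = of_real (exp (- (t\<^sup>2) / (2 * e)))"
    using \<sigma> by (simp add: char_std_normal_distribution power_divide)
  finally have I: "(LINT x|lborel. ?f x) = of_real (exp (- (t\<^sup>2) / (2 * e)))" .
  have eq: "?f (0 + \<sigma> * x) = of_real (1 / sqrt (2 * pi)) * (complex_of_real (exp (- (e / 2) * x\<^sup>2)) * cis (x * t))" for x
    using \<sigma> by (simp add: std_normal_density_def scaleR_conv_of_real power_mult_distrib cis_conv_exp mult.commute)
  have "(LINT x|lborel. ?f x) = \<bar>\<sigma>\<bar> *\<^sub>R (LINT x|lborel. ?f (0 + \<sigma> * x))"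
    using \<sigma> by (intro lborel_integral_real_affine) simp
  also have "\<dots> = of_real (\<sigma> / sqrt (2 * pi)) * (LINT x|lborel. complex_of_real (exp (- (e / 2) * x\<^sup>2)) * cis (x * t))"
    unfolding eq integral_mult_right_zero using \<sigma> by (simp add: scaleR_conv_of_real)
  finally have "of_real (\<sigma> / sqrt (2 * pi)) * (LINT x|lborel. complex_of_real (exp (- (e / 2) * x\<^sup>2)) * cis (x * t)) = of_real (exp (- (t\<^sup>2) / (2 * e)))"
    using I by simp
  then have "of_real (sqrt (2 * pi) / \<sigma>) * (of_real (\<sigma> / sqrt (2 * pi)) * (LINT x|lborel. complex_of_real (exp (- (e / 2) * x\<^sup>2)) * cis (x * t)))
      = of_real (sqrt (2 * pi) / \<sigma>) * of_real (exp (- (t\<^sup>2) / (2 * e)))" by simp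
  then show "(LINT x|lborel. complex_of_real (exp (- (e / 2) * x\<^sup>2)) * cis (x * t)) = of_real (sqrt (2 * pi / e) * exp (- (t\<^sup>2) / (2 * e)))"
    using \<sigma> by (simp add: real_sqrt_divide \<sigma>_def mult.assoc[symmetric])
  have "integrable lborel (\<lambda>x. ?f (0 + \<sigma> * x))" using \<sigma> fi by (subst lborel_integrable_real_affine_iff) auto
  then have "integrable lborel (\<lambda>x. complex_of_real (sqrt (2 * pi)) * ?f (0 + \<sigma> * x))"
    by (rule integrable_mult_right)
  moreover have "complex_of_real (sqrt (2 * pi)) * ?f (0 + \<sigma> * x) = complex_of_real (exp (- (e / 2) * x\<^sup>2)) * cis (x * t)" for x
    unfolding eq mult.assoc[symmetric] of_real_mult[symmetric] by simp
  ultimately show "integrable lborel (\<lambda>x. complex_of_real (exp (- (e / 2) * x\<^sup>2)) * cis (x * t))"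
    by (simp only:)
qed

lemma integral_plane_prod:
  fixes f g :: "real \<Rightarrow> complex"
  assumes f: "integrable lborel f" and g: "integrable lborel g"
  shows "integrable lborel (\<lambda>z. f (fst z) * g (snd z))"
    "(LINT z|lborel. f (fst z) * g (snd z)) = (LINT x|lborel. f x) * (LINT x|lborel. g x)"
proof -
  have [measurable]: "bmeas f" "bmeas g" using f g by auto
  let ?K = "\<lambda>z. f (fst z) * g (snd z)"
  have Km [measurable]: "?K \<in> borel_measurable (lborel \<Otimes>\<^sub>M lborel)" by measurable
  have "(\<integral>\<^sup>+x. ennreal (norm (?K x)) \<partial>(lborel \<Otimes>\<^sub>M lborel)) = (\<integral>\<^sup>+z. \<integral>\<^sup>+w. ennreal (norm (?K (z, w))) \<partial>lborel \<partial>lborel)"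
    by (rule lborel.nn_integral_fst[symmetric]) measurable
  also have "\<dots> = (\<integral>\<^sup>+z. ennreal (cmod (f z)) \<partial>lborel) * (\<integral>\<^sup>+w. ennreal (cmod (g w)) \<partial>lborel)"
    by (simp add: norm_mult ennreal_mult nn_integral_cmult nn_integral_multc)
  also have "\<dots> < \<infinity>"
    using f g by (simp add: nn_integral_eq_integral ennreal_mult_less_top)
  finally have Ki: "integrable (lborel \<Otimes>\<^sub>M lborel) ?K" by (intro integrableI_bounded) auto
  then show "integrable lborel ?K" by (simp add: lborel_prod)
  have "(LINT z|lborel. ?K z) = integral\<^sup>L (lborel \<Otimes>\<^sub>M lborel) ?K" by (simp add: lborel_prod)
  also have "\<dots> = (LINT z|lborel. LINT w|lborel. ?K (z, w))" by (rule lborel_pair.integral_fst'[OF Ki, symmetric])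
  also have "\<dots> = (LINT x|lborel. f x) * (LINT x|lborel. g x)" by simp
  finally show "(LINT z|lborel. ?K z) = (LINT x|lborel. f x) * (LINT x|lborel. g x)" .
qed

lemma gaussian_plane:
  assumes e: "0 < e"
  shows "integrable lborel (\<lambda>z. complex_of_real (gs e z) * cis (ip z w))"
    "(LINT z|lborel. complex_of_real (gs e z) * cis (ip z w)) = of_real (2 * pi / e * gs (1 / e) w)"
proof -
  have eq: "complex_of_real (gs e z) * cis (ip z w) =
      (complex_of_real (exp (- (e / 2) * (fst z)\<^sup>2)) * cis (fst z * fst w)) * (complex_of_real (exp (- (e / 2) * (snd z)\<^sup>2)) * cis (snd z * snd w))" for z
  proof -
    have "gs e z = exp (- (e / 2) * (fst z)\<^sup>2) * exp (- (e / 2) * (snd z)\<^sup>2)"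
      unfolding gs_def distrib_left exp_add ..
    moreover have "cis (ip z w) = cis (fst z * fst w) * cis (snd z * snd w)" by (simp add: ip_def cis_mult)
    ultimately show ?thesis by simp
  qed
  note I = integral_plane_prod[OF gaussian_real(1)[OF e] gaussian_real(1)[OF e], of "fst w" "snd w"]
  show "integrable lborel (\<lambda>z. complex_of_real (gs e z) * cis (ip z w))" unfolding eq by (rule I(1))
  have "(LINT z|lborel. complex_of_real (gs e z) * cis (ip z w)) = of_real (sqrt (2 * pi / e) * exp (- ((fst w)\<^sup>2) / (2 * e)) * (sqrt (2 * pi / e) * exp (- ((snd w)\<^sup>2) / (2 * e))))"
    unfolding eq I(2) gaussian_real(2)[OF e] by simp
  also have "sqrt (2 * pi / e) * exp (- ((fst w)\<^sup>2) / (2 * e)) * (sqrt (2 * pi / e) * exp (- ((snd w)\<^sup>2) / (2 * e)))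
     = (sqrt (2 * pi / e) * sqrt (2 * pi / e)) * (exp (- ((fst w)\<^sup>2) / (2 * e)) * exp (- ((snd w)\<^sup>2) / (2 * e)))"
    by (simp only: ac_simps)
  also have "\<dots> = 2 * pi / e * gs (1 / e) w"
  proof -
    have "sqrt (2 * pi / e) * sqrt (2 * pi / e) = 2 * pi / e" using e by (intro real_sqrt_mult_self[THEN trans]) simp
    moreover have "exp (- ((fst w)\<^sup>2) / (2 * e)) * exp (- ((snd w)\<^sup>2) / (2 * e)) = gs (1 / e) w"
      unfolding gs_def exp_add[symmetric] by (rule arg_cong[where f = exp]) (simp add: field_simps add_divide_distrib)
    ultimately show ?thesis by (simp only:)
  qed
  finally show "(LINT z|lborel. complex_of_real (gs e z) * cis (ip z w)) = of_real (2 * pi / e * gs (1 / e) w)" .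
qed

lemma gs_integrable: "0 < e \<Longrightarrow> integrable lborel (\<lambda>z. complex_of_real (gs e z))"
  using gaussian_plane(1)[of e 0] by (simp add: ip_def)

text \<open>The normal density of variance e in each coordinate, that is, the heat kernel at time e
  / 2; up to a constant it is the transform of \<open>gs e\<close>.\<close>

definition heat :: "real \<Rightarrow> plane \<Rightarrow> real" where "heat e w = 1 / (2 * pi * e) * gs (1 / e) w"

lemma heat_measurable [measurable]: "bmeas (heat e)"
  unfolding heat_def[abs_def] by measurable
lemma heat_nonneg: "0 < e \<Longrightarrow> 0 \<le> heat e w" by (simp add: heat_def)
lemma heat_integral: assumes "0 < e" shows "integrable lborel (heat e)" "(LINT w|lborel. heat e w) = 1"
proof -
  have "integrable lborel (\<lambda>z. complex_of_real (gs (1 / e) z))" by (rule gs_integrable) (use assms in simp)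
  then have i: "integrable lborel (gs (1 / e))" by (subst (asm) complex_of_real_integrable_eq)
  then show "integrable lborel (heat e)" unfolding heat_def[abs_def] by simp
  have "complex_of_real (LINT z|lborel. gs (1 / e) z) = of_real (2 * pi * e)"
    using gaussian_plane(2)[of "1 / e" 0] assms by (simp add: ip_def gs_def)
  then have "(LINT z|lborel. gs (1 / e) z) = 2 * pi * e" by (simp only: of_real_eq_iff)
  then show "(LINT w|lborel. heat e w) = 1" unfolding heat_def using assms by simp
qed

lemma l1b_heat: assumes "0 < e" shows "l1b (\<lambda>w. of_real (heat e w)) 1"
  using l1bI_integrable[of "\<lambda>w. complex_of_real (heat e w)"] heat_integral[OF assms] heat_nonneg[OF assms]
  by (simp add: complex_of_real_integrable_eq)

text \<open>Fourier inversion with a Gaussian convergence factor: the multiplication formula moves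
  the transform onto the Gaussian, whose transform is known.\<close>

lemma ft_gaussian_smoothing:
  assumes f: "integrable lborel f" and e: "0 < e"
  shows "(LINT \<zeta>|lborel. (ft f \<zeta> * of_real (gs e \<zeta>)) * cis (ip \<zeta> z0)) = of_real (2 * pi) * conv (\<lambda>w. of_real (heat e w)) f z0"
proof -
  let ?g = "\<lambda>\<zeta>. complex_of_real (gs e \<zeta>) * cis (ip \<zeta> z0)"
  have gi: "integrable lborel ?g" by (rule gaussian_plane(1)[OF e])
  have ftg: "ft ?g z = of_real (2 * pi) * of_real (heat e (z0 - z))" for z
  proof -
    have "?g \<zeta> * cis (- 1 * ip \<zeta> z) = complex_of_real (gs e \<zeta>) * cis (ip \<zeta> (z0 - z))" for \<zeta>
      by (simp add: mult.assoc cis_mult ip_simps)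
    then have "ft ?g z = of_real (1 / (2 * pi)) * of_real (2 * pi / e * gs (1 / e) (z0 - z))"
      unfolding ft_def by (simp only: gaussian_plane(2)[OF e])
    then show ?thesis by (simp add: heat_def field_simps)
  qed
  have "(LINT \<zeta>|lborel. (ft f \<zeta> * of_real (gs e \<zeta>)) * cis (ip \<zeta> z0)) = (LINT z|lborel. f z * ft ?g z)"
    using ft_mult_formula[OF f gi] by (simp add: mult.assoc)
  also have "\<dots> = (LINT z|lborel. of_real (2 * pi) * (of_real (heat e (z0 - z)) * f z))"
    unfolding ftg by (simp only: ac_simps)
  also have "\<dots> = of_real (2 * pi) * conv (\<lambda>w. of_real (heat e w)) f z0" by (simp add: conv_def)
  finally show ?thesis .
qed

lemma cnj_ft: "cnj (ft f \<zeta>) = of_real (1 / (2 * pi)) * (LINT z|lborel. cnj (f z) * cis (1 * ip z \<zeta>))"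
proof -
  have "cnj (LINT z|lborel. f z * cis (- 1 * ip z \<zeta>)) = (LINT z|lborel. cnj (f z * cis (- 1 * ip z \<zeta>)))"
    by (rule Bochner_Integration.integral_cnj[symmetric])
  then show ?thesis by (simp add: ft_def cis_cnj)
qed

text \<open>Plancherel's identity with a Gaussian factor, which makes the double integral converge
  absolutely while nothing is known yet about square integrability of the transform.\<close>

lemma ft_gaussian_energy:
  assumes f: "integrable lborel f" and e: "0 < e"
  shows "(LINT \<zeta>|lborel. of_real (gs e \<zeta>) * of_real ((cmod (ft f \<zeta>))\<^sup>2)) = (LINT z|lborel. conv (\<lambda>w. of_real (heat e w)) f z * cnj (f z))"
proof -
  obtain A where A: "l1b f A" using f l1b_ex by blast
  have [measurable]: "bmeas f" using f by auto
  let ?h = "\<lambda>\<zeta>. ft f \<zeta> * complex_of_real (gs e \<zeta>)"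
  have hi: "integrable lborel ?h"
  proof (rule Bochner_Integration.integrable_bound)
    show "integrable lborel (\<lambda>\<zeta>. of_real A * complex_of_real (gs e \<zeta>))" using gs_integrable[OF e] by simp
    show "AE \<zeta> in lborel. norm (?h \<zeta>) \<le> norm (of_real A * complex_of_real (gs e \<zeta>))"
      using ft_le[OF A] l1b_nonneg[OF A] by (intro always_eventually allI) (simp add: norm_mult mult_right_mono)
  qed measurable
  have fi: "integrable lborel (\<lambda>z. cnj (f z))" using f by simp
  have "(LINT \<zeta>|lborel. ?h \<zeta> * (LINT z|lborel. cnj (f z) * cis (1 * ip \<zeta> z))) = (LINT z|lborel. cnj (f z) * (LINT \<zeta>|lborel. ?h \<zeta> * cis (1 * ip \<zeta> z)))"
    by (rule fubini_kernel[OF hi fi cis_ip_measurable_pair]) simp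
  also have "\<dots> = (LINT z|lborel. of_real (2 * pi) * (conv (\<lambda>w. of_real (heat e w)) f z * cnj (f z)))"
    using ft_gaussian_smoothing[OF f e] by (simp add: ac_simps)
  finally have F: "(LINT \<zeta>|lborel. ?h \<zeta> * (LINT z|lborel. cnj (f z) * cis (1 * ip \<zeta> z))) = of_real (2 * pi) * (LINT z|lborel. conv (\<lambda>w. of_real (heat e w)) f z * cnj (f z))"
    by simp
  have "of_real (gs e \<zeta>) * of_real ((cmod (ft f \<zeta>))\<^sup>2) = of_real (1 / (2 * pi)) * (?h \<zeta> * (LINT z|lborel. cnj (f z) * cis (1 * ip \<zeta> z)))" for \<zeta>
  proof -
    have "complex_of_real ((cmod (ft f \<zeta>))\<^sup>2) = ft f \<zeta> * cnj (ft f \<zeta>)" by (rule complex_norm_square)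
    then show ?thesis unfolding cnj_ft by (simp add: ip_commute ac_simps)
  qed
  then have "(LINT \<zeta>|lborel. of_real (gs e \<zeta>) * of_real ((cmod (ft f \<zeta>))\<^sup>2)) = of_real (1 / (2 * pi)) * (of_real (2 * pi) * (LINT z|lborel. conv (\<lambda>w. of_real (heat e w)) f z * cnj (f z)))"
    using F by (simp only: integral_mult_right_zero)
  then show ?thesis by simp
qed

section \<open>Dense classes, translations and approximate identities in L^2\<close>

lemma integral_plane_scale:
  fixes f :: "plane \<Rightarrow> 'b::{banach,second_countable_topology}"
  assumes [measurable]: "bmeas f" and c: "0 < c"
  shows "(LINT w|lborel. f w) = c\<^sup>2 *\<^sub>R (LINT w|lborel. f (c *\<^sub>R w))"
proof -
  have eq: "(lborel :: plane measure) = density (distr lborel borel (\<lambda>x. 0 + c *\<^sub>R x)) (\<lambda>_. \<bar>c\<bar>^DIM(plane))"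
    by (rule lborel_affine) (use c in simp)
  have "(LINT w|lborel. f w) = (LINT w|density (distr lborel borel (\<lambda>x. 0 + c *\<^sub>R x)) (\<lambda>_. \<bar>c\<bar>^DIM(plane)). f w)"
    by (subst eq) (rule refl)
  also have "\<dots> = (LINT w|distr lborel borel (\<lambda>x. 0 + c *\<^sub>R x). \<bar>c\<bar>^DIM(plane) *\<^sub>R f w)"
    by (rule integral_density) auto
  also have "\<dots> = (LINT w|lborel. \<bar>c\<bar>^DIM(plane) *\<^sub>R f (0 + c *\<^sub>R w))"
    by (rule integral_distr) measurable
  also have "\<dots> = c\<^sup>2 *\<^sub>R (LINT w|lborel. f (c *\<^sub>R w))" using c by (simp add: power2_eq_square)
  finally show ?thesis .
qed

lemma integrable_cball_const: "integrable lborel (\<lambda>z::plane. indicator (cball 0 r) z *\<^sub>R (c::real))"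
proof -
  have "integrable lborel (indicator (cball 0 r) :: plane \<Rightarrow> real)"
    by (rule integrable_real_indicator[OF _ emeasure_lborel_cball_finite]) simp
  then show ?thesis by simp
qed

text \<open>Truncate d in size and in space. A measurable function is an almost everywhere limit of
  continuous ones, and after clipping these converge in L^2 by dominated convergence.\<close>

lemma continuous_dense_l2:
  assumes d: "l2b d A" and e: "0 < e"
  shows "\<exists>g K M. continuous_on UNIV g \<and> (\<forall>z. cmod (g z) \<le> M) \<and> (\<forall>z. K < norm z \<longrightarrow> g z = 0) \<and> l2b (\<lambda>z. d z - g z) e"
proof -
  have [measurable]: "bmeas d" using d by (rule l2b_measurable)
  have di: "integrable lborel (\<lambda>z. (cmod (d z))\<^sup>2)" using d by (simp add: l2b_iff)
  define dN where "dN N z = (if cmod (d z) \<le> real N \<and> norm z \<le> real N then d z else 0)" for N :: nat and z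
  have [measurable]: "bmeas (dN N)" for N unfolding dN_def[abs_def] by measurable
  have small: "\<exists>n. l2b (\<lambda>z. f z - h n z) \<delta>"
    if [measurable]: "bmeas f" "\<And>n. h n \<in> borel_measurable borel"
    and lim: "AE z in lborel. (\<lambda>n. h n z) \<longlonglongrightarrow> f z"
    and w: "integrable lborel w" "\<And>n. AE z in lborel. (cmod (f z - h n z))\<^sup>2 \<le> w z" and \<delta>: "0 < \<delta>"
    for f :: "plane \<Rightarrow> complex" and h :: "nat \<Rightarrow> plane \<Rightarrow> complex" and w :: "plane \<Rightarrow> real" and \<delta> :: real
  proof -
    have "(\<lambda>n. LINT z|lborel. (cmod (f z - h n z))\<^sup>2) \<longlonglongrightarrow> (LINT z|(lborel :: plane measure). 0)"
    proof (rule integral_dominated_convergence[where w = w])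
      show "AE z in lborel. (\<lambda>n. (cmod (f z - h n z))\<^sup>2) \<longlonglongrightarrow> 0"
        using lim
      proof eventually_elim
        case (elim z)
        have "(\<lambda>n. (cmod (f z - h n z))\<^sup>2) \<longlonglongrightarrow> (cmod (f z - f z))\<^sup>2" by (intro tendsto_intros elim)
        then show ?case by simp
      qed
      show "AE z in lborel. norm ((cmod (f z - h n z))\<^sup>2) \<le> w z" for n using w(2)[of n] by (auto elim: eventually_mono)
    qed (use w(1) in measurable)
    then have "\<forall>\<^sub>F n in sequentially. (LINT z|lborel. (cmod (f z - h n z))\<^sup>2) < \<delta>\<^sup>2"
      using \<delta> by (intro order_tendstoD(2)) auto
    then obtain n where n: "(LINT z|lborel. (cmod (f z - h n z))\<^sup>2) < \<delta>\<^sup>2" by (auto dest: eventually_happens)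
    have "integrable lborel (\<lambda>z. (cmod (f z - h n z))\<^sup>2)"
      by (rule Bochner_Integration.integrable_bound[OF w(1)]) (use w(2)[of n] in \<open>auto elim!: eventually_mono\<close>)
    then show ?thesis using n \<delta> by (intro exI[of _ n]) (simp add: l2b_iff)
  qed
  have "\<exists>N. l2b (\<lambda>z. d z - dN N z) (e / 2)"
  proof (rule small[where w = "\<lambda>z. (cmod (d z))\<^sup>2"])
    show "AE z in lborel. (\<lambda>n. dN n z) \<longlonglongrightarrow> d z"
    proof (intro always_eventually allI)
      fix z
      obtain n0 :: nat where n0: "max (cmod (d z)) (norm z) \<le> real n0" using real_arch_simple by blast
      have "\<forall>\<^sub>F n in sequentially. dN n z = d z"
        using eventually_ge_at_top[of n0] by eventually_elim (use n0 in \<open>auto simp: dN_def\<close>)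
      then show "(\<lambda>n. dN n z) \<longlonglongrightarrow> d z" by (rule tendsto_eventually)
    qed
    show "AE z in lborel. (cmod (d z - dN n z))\<^sup>2 \<le> (cmod (d z))\<^sup>2" for n
      by (intro always_eventually allI) (simp add: dN_def)
  qed (use di e in auto)
  then obtain N where N: "l2b (\<lambda>z. d z - dN N z) (e / 2)" by blast
  define M where "M = real N + 1"
  have M: "0 < M" "real N \<le> M" by (auto simp: M_def)
  have "dN N measurable_on UNIV"
    by (rule lebesgue_measurable_imp_measurable_on) (auto intro: measurable_completion)
  then obtain Z h where Z: "negligible Z" and hc: "\<And>n. continuous_on UNIV (h n)"
    and hl: "\<And>z. z \<notin> Z \<Longrightarrow> (\<lambda>n. h n z) \<longlonglongrightarrow> dN N z"
    unfolding measurable_on_def by auto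
  \<comment> \<open>Clipping to modulus M and the cut-off \<open>ct\<close> give the approximants a
    common integrable majorant. Neither changes \<open>dN N\<close>, which is bounded by M and
    vanishes where norm z > M.\<close>
  define cl where "cl w = (M / max M (cmod w)) *\<^sub>R w" for w :: complex
  have mx: "0 < max M (cmod w)" for w :: complex using M by (simp add: less_max_iff_disj)
  have clc: "continuous_on UNIV cl" unfolding cl_def
    by (intro continuous_intros) (use mx in \<open>auto simp: less_imp_neq[symmetric]\<close>)
  have cl_le: "cmod (cl w) \<le> M" for w
    using M mx[of w] by (auto simp: cl_def divide_simps max_def)
  have cl_id: "cl w = w" if "cmod w \<le> M" for w using that M by (simp add: cl_def max_def)
  define ct where "ct z = max 0 (min 1 (M + 1 - norm z))" for z :: plane
  have ct: "0 \<le> ct z" "ct z \<le> 1" for z by (auto simp: ct_def)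
  have ctc: "continuous_on UNIV ct" unfolding ct_def by (intro continuous_intros)
  define g where "g n z = ct z *\<^sub>R cl (h n z)" for n z
  have gc: "continuous_on UNIV (g n)" for n unfolding g_def
    by (intro continuous_intros ctc continuous_on_compose2[OF clc hc]) auto
  have [measurable]: "bmeas (g n)" for n using gc by (rule borel_measurable_continuous_onI)
  have gb: "cmod (g n z) \<le> M" for n z
    unfolding g_def norm_scaleR using ct[of z] cl_le[of "h n z"] M mult_mono[of "\<bar>ct z\<bar>" 1 "cmod (cl (h n z))" M] by simp
  have g0: "g n z = 0" if "M + 1 < norm z" for n z using that by (simp add: g_def ct_def)
  have dNb: "cmod (dN N z) \<le> M" and dN0: "M < norm z \<Longrightarrow> dN N z = 0" for z using M by (auto simp: dN_def)
  have "\<exists>n. l2b (\<lambda>z. dN N z - g n z) (e / 2)"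
  proof (rule small[where w = "\<lambda>z. indicator (cball 0 (M + 1)) z *\<^sub>R (2 * M)\<^sup>2"])
    have "Z \<in> null_sets lebesgue" using Z by (simp add: negligible_iff_null_sets)
    then have "AE z in lebesgue. z \<notin> Z" by (rule AE_not_in)
    then have "AE z in lebesgue. (\<lambda>n. g n z) \<longlonglongrightarrow> dN N z"
    proof eventually_elim
      case (elim z)
      have "(\<lambda>n. cl (h n z)) \<longlonglongrightarrow> cl (dN N z)"
        using continuous_on_tendsto_compose[OF clc hl[OF elim]] by simp
      then have "(\<lambda>n. g n z) \<longlonglongrightarrow> ct z *\<^sub>R cl (dN N z)" unfolding g_def by (intro tendsto_intros)
      also have "ct z *\<^sub>R cl (dN N z) = dN N z"
      proof (cases "norm z \<le> M")
        case True then show ?thesis by (simp add: cl_id[OF dNb] ct_def)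
      next
        case False then show ?thesis by (simp add: dN0 cl_def)
      qed
      finally show ?case .
    qed
    then show "AE z in lborel. (\<lambda>n. g n z) \<longlonglongrightarrow> dN N z" by (simp add: AE_completion_iff)
    show "integrable lborel (\<lambda>z::plane. indicator (cball 0 (M + 1)) z *\<^sub>R (2 * M)\<^sup>2)"
      by (rule integrable_cball_const)
    show "AE z in lborel. (cmod (dN N z - g n z))\<^sup>2 \<le> indicator (cball 0 (M + 1)) z *\<^sub>R (2 * M)\<^sup>2" for n
    proof (intro always_eventually allI)
      fix z
      show "(cmod (dN N z - g n z))\<^sup>2 \<le> indicator (cball 0 (M + 1)) z *\<^sub>R (2 * M)\<^sup>2"
      proof (cases "norm z \<le> M + 1")
        case True
        have "cmod (dN N z - g n z) \<le> 2 * M" using norm_triangle_ineq4[of "dN N z" "g n z"] dNb[of z] gb[of n z] by simp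
        then have "(cmod (dN N z - g n z))\<^sup>2 \<le> (2 * M)\<^sup>2" by (rule power_mono) simp
        then show ?thesis using True by simp
      qed (use M in \<open>simp add: g0 dN0\<close>)
    qed
  qed (use e in auto)
  then obtain n where n: "l2b (\<lambda>z. dN N z - g n z) (e / 2)" by blast
  from l2b_add[OF N n] have "l2b (\<lambda>z. d z - g n z) e" by simp
  then show ?thesis using gc gb g0 by blast
qed

text \<open>Translation is isometric on L^2, and it is continuous on continuous functions of bounded
  support, which are dense.\<close>

lemma l2_translation_continuous:
  assumes d: "l2b d A" and v: "v \<longlonglongrightarrow> 0" and e: "0 < e"
  shows "\<forall>\<^sub>F n in sequentially. l2b (\<lambda>z. d (z - v n) - d z) e"
proof -
  obtain g K M where gc: "continuous_on UNIV g" and gb: "\<And>z. cmod (g z) \<le> M" and g0: "\<And>z. K < norm z \<Longrightarrow> g z = 0"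
    and dg: "l2b (\<lambda>z. d z - g z) (e / 3)"
    using continuous_dense_l2[OF d, of "e / 3"] e by auto
  have [measurable]: "bmeas g" using gc by (rule borel_measurable_continuous_onI)
  have sh: "l2b (\<lambda>z. f (z - w)) B" if "l2b f B" for f w B
  proof -
    have [measurable]: "bmeas f" using that by (rule l2b_measurable)
    have "(\<integral>\<^sup>+z. (ennreal (cmod (f (- w + z))))\<^sup>2 \<partial>lborel) = (\<integral>\<^sup>+z. (ennreal (cmod (f z)))\<^sup>2 \<partial>lborel)"
      by (rule nn_integral_lborel_shift[of "\<lambda>z. (ennreal (cmod (f z)))\<^sup>2"]) measurable
    then show ?thesis using that by (simp add: l2b_def l2n_def)
  qed
  have M: "0 \<le> M" using gb[of 0] norm_ge_zero order_trans by blast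
  have vb: "\<forall>\<^sub>F n in sequentially. norm (v n) < 1" using tendstoD[OF v, of 1] by simp
  \<comment> \<open>The indicator discards the n with norm (v n) \<ge> 1, of which there are
    finitely many, so that all shifted supports lie in one ball.\<close>
  have "(\<lambda>n. LINT z|lborel. (indicator {n. norm (v n) < 1} n *\<^sub>R (cmod (g (z - v n) - g z))\<^sup>2)) \<longlonglongrightarrow> (LINT z|(lborel :: plane measure). 0)"
  proof (rule integral_dominated_convergence[where w = "\<lambda>z. indicator (cball 0 (K + 1)) z *\<^sub>R (2 * M)\<^sup>2"])
    show "AE z in lborel. (\<lambda>n. indicator {n. norm (v n) < 1} n *\<^sub>R (cmod (g (z - v n) - g z))\<^sup>2) \<longlonglongrightarrow> 0"
    proof (intro always_eventually allI)
      fix z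
      have "(\<lambda>n. z - v n) \<longlonglongrightarrow> z - 0" by (intro tendsto_intros v)
      then have "(\<lambda>n. g (z - v n)) \<longlonglongrightarrow> g z"
        using continuous_on_tendsto_compose[OF gc, of "\<lambda>n. z - v n" z] by simp
      then have "(\<lambda>n. (cmod (g (z - v n) - g z))\<^sup>2) \<longlonglongrightarrow> (cmod (g z - g z))\<^sup>2" by (intro tendsto_intros)
      then have "(\<lambda>n. (cmod (g (z - v n) - g z))\<^sup>2) \<longlonglongrightarrow> 0" by simp
      then show "(\<lambda>n. indicator {n. norm (v n) < 1} n *\<^sub>R (cmod (g (z - v n) - g z))\<^sup>2) \<longlonglongrightarrow> 0"
        by (rule Lim_null_comparison[rotated]) (auto simp: indicator_def intro!: always_eventually)
    qed
    show "integrable lborel (\<lambda>z::plane. indicator (cball 0 (K + 1)) z *\<^sub>R (2 * M)\<^sup>2)"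
      by (rule integrable_cball_const)
    show "AE z in lborel. norm (indicator {n. norm (v n) < 1} n *\<^sub>R (cmod (g (z - v n) - g z))\<^sup>2) \<le> indicator (cball 0 (K + 1)) z *\<^sub>R (2 * M)\<^sup>2" for n
    proof (intro always_eventually allI)
      fix z
      show "norm (indicator {n. norm (v n) < 1} n *\<^sub>R (cmod (g (z - v n) - g z))\<^sup>2) \<le> indicator (cball 0 (K + 1)) z *\<^sub>R (2 * M)\<^sup>2"
      proof (cases "norm (v n) < 1")
        case v1: True
        show ?thesis
        proof (cases "norm z \<le> K + 1")
          case True
          have "cmod (g (z - v n) - g z) \<le> 2 * M" using norm_triangle_ineq4[of "g (z - v n)" "g z"] gb[of z] gb[of "z - v n"] by simp
          then have "(cmod (g (z - v n) - g z))\<^sup>2 \<le> (2 * M)\<^sup>2" by (rule power_mono) simp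
          then show ?thesis using True v1 by simp
        next
          case False
          have "norm z \<le> norm (z - v n) + norm (v n)" using norm_triangle_ineq[of "z - v n" "v n"] by simp
          then have "K < norm (z - v n)" using v1 False by simp
          then show ?thesis using False by (simp add: g0)
        qed
      qed simp
    qed
  qed measurable
  then have "\<forall>\<^sub>F n in sequentially. (LINT z|lborel. (indicator {n. norm (v n) < 1} n *\<^sub>R (cmod (g (z - v n) - g z))\<^sup>2)) < (e / 3)\<^sup>2"
    using e by (intro order_tendstoD(2)) auto
  then show ?thesis using vb
  proof eventually_elim
    case (elim n)
    have gi: "l2b (\<lambda>z. g (z - v n) - g z) (e / 3)"
    proof -
      have "\<exists>B. l2b g B"
        using l2b_diff[OF d dg] by auto
      then obtain B where "l2b g B" ..
      from l2b_diff[OF sh[OF this] this] have "integrable lborel (\<lambda>z. (cmod (g (z - v n) - g z))\<^sup>2)" by (simp add: l2b_iff)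
      then show ?thesis using elim e by (simp add: l2b_iff)
    qed
    have "l2b (\<lambda>z. (d (z - v n) - g (z - v n)) - (d z - g z)) (e / 3 + e / 3)"
      by (rule l2b_diff[OF sh[OF dg] dg])
    from l2b_add[OF this gi] show "l2b (\<lambda>z. d (z - v n) - d z) e" by (simp add: algebra_simps)
  qed
qed

text \<open>Convolution with the heat kernel averages the correlation \<tau> of d with its
  translates, and \<tau> is bounded and continuous at 0. The parameter is a square so that dilation
  by 1 / (n + 1) turns the kernel into \<open>heat 1\<close>.\<close>

lemma heat_approx:
  assumes d: "l2b d D"
  shows "(\<lambda>n. LINT z|lborel. conv (\<lambda>w. of_real (heat ((1 / real (Suc n))\<^sup>2) w)) d z * cnj (d z)) \<longlonglongrightarrow> (LINT z|lborel. d z * cnj (d z))"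
proof -
  have [measurable]: "bmeas d" using d by (rule l2b_measurable)
  have sh: "l2b (\<lambda>z. d (z - w)) D" for w
  proof -
    have "(\<integral>\<^sup>+z. (ennreal (cmod (d (- w + z))))\<^sup>2 \<partial>lborel) = (\<integral>\<^sup>+z. (ennreal (cmod (d z)))\<^sup>2 \<partial>lborel)"
      by (rule nn_integral_lborel_shift[of "\<lambda>z. (ennreal (cmod (d z)))\<^sup>2"]) measurable
    then show ?thesis using d by (simp add: l2b_def l2n_def)
  qed
  define \<tau> where "\<tau> w = (LINT z|lborel. d (z - w) * cnj (d z))" for w
  have \<tau>m [measurable]: "bmeas \<tau>"
  proof -
    have "bmeas (\<lambda>w. (LINT z|lborel. d (z - w) * cnj (d z)))"
      by (rule lborel.borel_measurable_lebesgue_integral) measurable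
    then show ?thesis by (simp add: \<tau>_def[abs_def])
  qed
  have pr: "l1b (\<lambda>z. d (z - w) * cnj (d z)) (D * D)" for w by (intro l1b_prod sh l2b_cnj d)
  have \<tau>b: "cmod (\<tau> w) \<le> D * D" for w unfolding \<tau>_def by (rule l1b_integral_le[OF pr])
  have \<tau>c: "(\<lambda>n. \<tau> (v n)) \<longlonglongrightarrow> \<tau> 0" if v: "v \<longlonglongrightarrow> 0" for v
  proof (rule tendstoI)
    fix e :: real assume e: "0 < e"
    have D: "0 \<le> D" using d by (rule l2b_nonneg)
    define \<delta> where "\<delta> = e / (D + 1)"
    have \<delta>: "0 < \<delta>" using e D by (simp add: \<delta>_def)
    have \<delta>D: "\<delta> * D < e" using e D by (simp add: \<delta>_def field_simps)
    show "\<forall>\<^sub>F n in sequentially. dist (\<tau> (v n)) (\<tau> 0) < e"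
      using l2_translation_continuous[OF d v \<delta>]
    proof eventually_elim
      case (elim n)
      have "\<tau> (v n) - \<tau> 0 = (LINT z|lborel. (d (z - v n) - d z) * cnj (d z))"
        unfolding \<tau>_def using l1b_integrable[OF pr[of "v n"]] l1b_integrable[OF pr[of 0]]
        by (subst Bochner_Integration.integral_diff[symmetric]) (auto simp: left_diff_distrib)
      then have "cmod (\<tau> (v n) - \<tau> 0) \<le> \<delta> * D"
        using l1b_integral_le[OF l1b_prod[OF elim l2b_cnj[OF d]]] by simp
      then show ?case using \<delta>D by (simp add: dist_norm)
    qed
  qed
  have eq: "(LINT z|lborel. conv (\<lambda>w. of_real (heat e w)) d z * cnj (d z)) = (LINT w|lborel. of_real (heat e w) * \<tau> w)" if e: "0 < e" for e
  proof -
    let ?h = "\<lambda>w. complex_of_real (heat e w)"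
    define K where "K x = d (fst x - snd x) * ?h (snd x) * cnj (d (fst x))" for x
    have Km [measurable]: "K \<in> borel_measurable (lborel \<Otimes>\<^sub>M lborel)"
      unfolding K_def by (rule lborel_pair_measurable) measurable
    have "(\<integral>\<^sup>+z. \<integral>\<^sup>+w. ennreal (norm (K (z, w))) \<partial>lborel \<partial>lborel) = (\<integral>\<^sup>+z. nc (nm d) (nm ?h) z * nm d z \<partial>lborel)"
      by (intro nn_integral_cong) (simp add: nc_def K_def norm_mult ennreal_mult nn_integral_multc del: norm_of_real)
    also have "\<dots> \<le> ennreal ((D * 1) * D)"
      by (intro l2n_pair l2n_nc' l2b_n l1b_n d l1b_heat e)
    also have "\<dots> < \<infinity>" by simp
    finally have fin: "(\<integral>\<^sup>+z. \<integral>\<^sup>+w. ennreal (norm (K (z, w))) \<partial>lborel \<partial>lborel) < \<infinity>" .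
    have "(LINT z|lborel. conv ?h d z * cnj (d z)) = (LINT z|lborel. conv d ?h z * cnj (d z))"
      by (subst conv_commute) auto
    also have "\<dots> = (LINT z|lborel. LINT w|lborel. K (z, w))" by (simp add: conv_def K_def)
    also have "\<dots> = (LINT w|lborel. LINT z|lborel. K (z, w))" by (rule fubini_pair[OF Km fin])
    also have "\<dots> = (LINT w|lborel. ?h w * \<tau> w)"
    proof -
      have "K (z, w) = ?h w * (d (z - w) * cnj (d z))" for z w by (simp add: K_def)
      then show ?thesis by (simp only: integral_mult_right_zero \<tau>_def)
    qed
    finally show ?thesis .
  qed
  define c where "c n = 1 / real (Suc n)" for n
  have c: "0 < c n" for n by (simp add: c_def)
  have c0: "c \<longlonglongrightarrow> 0" unfolding c_def using LIMSEQ_inverse_real_of_nat by (simp add: divide_inverse)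
  have "(LINT w|lborel. of_real (heat ((c n)\<^sup>2) w) * \<tau> w) = (LINT v|lborel. of_real (heat 1 v) * \<tau> (c n *\<^sub>R v))" for n
  proof -
    have "heat ((c n)\<^sup>2) (c n *\<^sub>R v) = heat 1 v / (c n)\<^sup>2" for v
    proof -
      have "1 / (c n)\<^sup>2 / 2 * ((fst (c n *\<^sub>R v))\<^sup>2 + (snd (c n *\<^sub>R v))\<^sup>2) = 1 / 1 / 2 * ((fst v)\<^sup>2 + (snd v)\<^sup>2)"
        using c[of n] by (simp add: power_mult_distrib field_simps)
      then show ?thesis by (simp add: heat_def gs_def)
    qed
    then have h: "complex_of_real (heat ((c n)\<^sup>2) (c n *\<^sub>R v)) * \<tau> (c n *\<^sub>R v) = (1 / (c n)\<^sup>2) *\<^sub>R (complex_of_real (heat 1 v) * \<tau> (c n *\<^sub>R v))" for v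
      by (simp add: scaleR_conv_of_real del: split_paired_All)
    have "(LINT w|lborel. of_real (heat ((c n)\<^sup>2) w) * \<tau> w) = (c n)\<^sup>2 *\<^sub>R (LINT v|lborel. of_real (heat ((c n)\<^sup>2) (c n *\<^sub>R v)) * \<tau> (c n *\<^sub>R v))"
      by (rule integral_plane_scale[OF _ c]) measurable
    also have "\<dots> = ((c n)\<^sup>2 * (1 / (c n)\<^sup>2)) *\<^sub>R (LINT v|lborel. of_real (heat 1 v) * \<tau> (c n *\<^sub>R v))"
      unfolding h by (simp only: integral_scaleR_right scaleR_scaleR)
    finally show ?thesis using c[of n] by simp
  qed
  then have eq2: "(LINT z|lborel. conv (\<lambda>w. of_real (heat ((c n)\<^sup>2) w)) d z * cnj (d z)) = (LINT v|lborel. of_real (heat 1 v) * \<tau> (c n *\<^sub>R v))" for n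
    using eq[of "(c n)\<^sup>2"] c[of n] by simp
  have "(\<lambda>n. LINT v|lborel. of_real (heat 1 v) * \<tau> (c n *\<^sub>R v)) \<longlonglongrightarrow> (LINT v|lborel. of_real (heat 1 v) * \<tau> 0)"
  proof (rule integral_dominated_convergence[where w = "\<lambda>v. heat 1 v * (D * D)"])
    show "integrable lborel (\<lambda>v. heat 1 v * (D * D))" using heat_integral(1)[of 1] by simp
    show "AE v in lborel. (\<lambda>n. of_real (heat 1 v) * \<tau> (c n *\<^sub>R v)) \<longlonglongrightarrow> of_real (heat 1 v) * \<tau> 0"
    proof (intro always_eventually allI)
      fix v :: plane
      have "(\<lambda>n. c n *\<^sub>R v) \<longlonglongrightarrow> 0 *\<^sub>R v" by (intro tendsto_intros c0)
      then show "(\<lambda>n. of_real (heat 1 v) * \<tau> (c n *\<^sub>R v)) \<longlonglongrightarrow> of_real (heat 1 v) * \<tau> 0"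
        by (intro tendsto_mult tendsto_const \<tau>c) simp
    qed
    show "AE v in lborel. norm (of_real (heat 1 v) * \<tau> (c n *\<^sub>R v)) \<le> heat 1 v * (D * D)" for n
      using \<tau>b heat_nonneg[of 1] by (intro always_eventually allI) (simp add: norm_mult mult_left_mono)
  qed measurable
  also have "(LINT v|lborel. of_real (heat 1 v) * \<tau> 0) = \<tau> 0"
  proof -
    have "(LINT v|lborel. complex_of_real (heat 1 v) * \<tau> 0) = complex_of_real (LINT v|lborel. heat 1 v) * \<tau> 0"
      by (simp only: integral_mult_left_zero integral_complex_of_real)
    then show ?thesis using heat_integral(2)[of 1] by simp
  qed
  also have "\<tau> 0 = (LINT z|lborel. d z * cnj (d z))" by (simp add: \<tau>_def)
  finally have "(\<lambda>n. LINT z|lborel. conv (\<lambda>w. of_real (heat ((c n)\<^sup>2) w)) d z * cnj (d z)) \<longlonglongrightarrow> (LINT z|lborel. d z * cnj (d z))"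
    by (simp only: eq2)
  then show ?thesis by (simp only: c_def)
qed

text \<open>Fatou's lemma in the regularised identity gives square integrability of the transform;
  this supplies the majorant with which dominated convergence gives equality.\<close>

theorem plancherel:
  assumes f: "integrable lborel f" and f2: "l2b f A"
  shows "integrable lborel (\<lambda>\<zeta>. (cmod (ft f \<zeta>))\<^sup>2)" "(LINT \<zeta>|lborel. (cmod (ft f \<zeta>))\<^sup>2) = (LINT z|lborel. (cmod (f z))\<^sup>2)"
proof -
  have [measurable]: "bmeas f" using f by auto
  obtain B where B: "l1b f B" using f l1b_ex by blast
  define e where "e n = (1 / real (Suc n))\<^sup>2" for n
  have e: "0 < e n" for n by (simp add: e_def)
  have e0: "e \<longlonglongrightarrow> 0"
    using tendsto_power[OF LIMSEQ_inverse_real_of_nat, of 2] by (simp add: e_def[abs_def] divide_inverse)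
  let ?F = "\<lambda>n \<zeta>. gs (e n) \<zeta> * (cmod (ft f \<zeta>))\<^sup>2"
  have Fi: "integrable lborel (?F n)" for n
  proof (rule Bochner_Integration.integrable_bound)
    have "integrable lborel (gs (e n))" using gs_integrable[OF e[of n]] by (simp add: complex_of_real_integrable_eq)
    then show "integrable lborel (\<lambda>\<zeta>. gs (e n) \<zeta> * B\<^sup>2)" by simp
    show "AE \<zeta> in lborel. norm (?F n \<zeta>) \<le> norm (gs (e n) \<zeta> * B\<^sup>2)"
      using power_mono[OF ft_le[OF B] norm_ge_zero] by (intro always_eventually allI) (simp add: abs_mult mult_left_mono)
  qed measurable
  have lim: "(\<lambda>n. LINT \<zeta>|lborel. ?F n \<zeta>) \<longlonglongrightarrow> (LINT z|lborel. (cmod (f z))\<^sup>2)"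
  proof -
    have "(LINT z|lborel. conv (\<lambda>w. of_real (heat (e n) w)) f z * cnj (f z)) = complex_of_real (LINT \<zeta>|lborel. ?F n \<zeta>)" for n
      unfolding ft_gaussian_energy[OF f e[of n], symmetric] integral_complex_of_real[symmetric] by simp
    moreover have "(LINT z|lborel. f z * cnj (f z)) = complex_of_real (LINT z|lborel. (cmod (f z))\<^sup>2)"
      unfolding integral_complex_of_real[symmetric] complex_norm_square ..
    ultimately have "(\<lambda>n. complex_of_real (LINT \<zeta>|lborel. ?F n \<zeta>)) \<longlonglongrightarrow> complex_of_real (LINT z|lborel. (cmod (f z))\<^sup>2)"
      using heat_approx[OF f2] unfolding e_def by (simp only:)
    then show ?thesis by (simp only: tendsto_of_real_iff)
  qed
  have pt: "(\<lambda>n. ?F n \<zeta>) \<longlonglongrightarrow> (cmod (ft f \<zeta>))\<^sup>2" for \<zeta>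
  proof -
    have "(\<lambda>n. exp (- (e n / 2) * ((fst \<zeta>)\<^sup>2 + (snd \<zeta>)\<^sup>2)) * (cmod (ft f \<zeta>))\<^sup>2) \<longlonglongrightarrow> exp (- (0 / 2) * ((fst \<zeta>)\<^sup>2 + (snd \<zeta>)\<^sup>2)) * (cmod (ft f \<zeta>))\<^sup>2"
      by (intro tendsto_intros e0) simp
    then show ?thesis by (simp add: gs_def)
  qed
  have "(\<integral>\<^sup>+\<zeta>. ennreal ((cmod (ft f \<zeta>))\<^sup>2) \<partial>lborel) = (\<integral>\<^sup>+\<zeta>. liminf (\<lambda>n. ennreal (?F n \<zeta>)) \<partial>lborel)"
  proof (rule nn_integral_cong)
    fix \<zeta>
    show "ennreal ((cmod (ft f \<zeta>))\<^sup>2) = liminf (\<lambda>n. ennreal (?F n \<zeta>))"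
      by (rule lim_imp_Liminf[OF trivial_limit_sequentially tendsto_ennrealI[OF pt], symmetric])
  qed
  also have "\<dots> \<le> liminf (\<lambda>n. \<integral>\<^sup>+\<zeta>. ennreal (?F n \<zeta>) \<partial>lborel)" by (rule nn_integral_liminf) measurable
  also have "\<dots> = liminf (\<lambda>n. ennreal (LINT \<zeta>|lborel. ?F n \<zeta>))"
    using Fi by (simp add: nn_integral_eq_integral)
  also have "\<dots> = ennreal (LINT z|lborel. (cmod (f z))\<^sup>2)"
    by (rule lim_imp_Liminf[OF trivial_limit_sequentially tendsto_ennrealI[OF lim]])
  finally have le: "(\<integral>\<^sup>+\<zeta>. ennreal ((cmod (ft f \<zeta>))\<^sup>2) \<partial>lborel) \<le> ennreal (LINT z|lborel. (cmod (f z))\<^sup>2)" .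
  show i: "integrable lborel (\<lambda>\<zeta>. (cmod (ft f \<zeta>))\<^sup>2)"
    by (rule integrableI_bounded) (use le in \<open>auto intro: le_less_trans\<close>)
  have "(\<lambda>n. LINT \<zeta>|lborel. ?F n \<zeta>) \<longlonglongrightarrow> (LINT \<zeta>|lborel. (cmod (ft f \<zeta>))\<^sup>2)"
  proof (rule integral_dominated_convergence[where w = "\<lambda>\<zeta>. (cmod (ft f \<zeta>))\<^sup>2"])
    show "AE \<zeta> in lborel. (\<lambda>n. ?F n \<zeta>) \<longlonglongrightarrow> (cmod (ft f \<zeta>))\<^sup>2" using pt by (intro always_eventually allI)
    show "AE \<zeta> in lborel. norm (?F n \<zeta>) \<le> (cmod (ft f \<zeta>))\<^sup>2" for n
      using gs_le1[OF less_imp_le[OF e[of n]]] by (intro always_eventually allI) (simp add: abs_mult mult_left_le_one_le)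
  qed (use i in measurable)
  from LIMSEQ_unique[OF this lim] show "(LINT \<zeta>|lborel. (cmod (ft f \<zeta>))\<^sup>2) = (LINT z|lborel. (cmod (f z))\<^sup>2)" .
qed

lemma plancherel_l2b: assumes "integrable lborel f" "l2b f A" shows "l2b (ft f) A"
  using plancherel[OF assms] assms by (auto simp: l2b_iff)

section \<open>The Fourier transform of square integrable functions\<close>

abbreviation rl :: "(plane \<Rightarrow> real) \<Rightarrow> plane \<Rightarrow> complex" where "rl f \<equiv> \<lambda>z. complex_of_real (f z)"

lemma sqint_iff: "square_integrable (f :: plane \<Rightarrow> real) \<longleftrightarrow> bmeas f \<and> integrable lborel (\<lambda>z. (f z)\<^sup>2)"
  by (simp add: square_integrable_def)

lemma sqint_measurable: "square_integrable (f :: plane \<Rightarrow> real) \<Longrightarrow> bmeas f"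
  by (simp add: sqint_iff)

lemma l2b_rl: "l2b (rl f) A \<longleftrightarrow> square_integrable f \<and> 0 \<le> A \<and> (LINT z|lborel. (f z)\<^sup>2) \<le> A\<^sup>2"
  unfolding l2b_iff sqint_iff by (auto simp: borel_measurable_complex_iff)

lemma sqint_l2b: "square_integrable f \<longleftrightarrow> (\<exists>A. l2b (rl f) A)"
proof -
  have "l2b (rl f) (sqrt (LINT z|lborel. (f z)\<^sup>2))" if "square_integrable f" using that by (simp add: l2b_rl)
  then show ?thesis using l2b_rl by blast
qed

lemma sqint_add: "square_integrable f \<Longrightarrow> square_integrable g \<Longrightarrow> square_integrable (\<lambda>z. f z + g z :: real)"
  unfolding sqint_l2b using l2b_add[of "rl f" _ "rl g"] by fastforce

lemma sqint_cmult: "square_integrable f \<Longrightarrow> square_integrable (\<lambda>z. c * f z :: real)"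
  unfolding sqint_l2b using l2b_cmult[of "rl f" _ "complex_of_real c"] by fastforce

lemma sqint_diff: "square_integrable f \<Longrightarrow> square_integrable g \<Longrightarrow> square_integrable (\<lambda>z. f z - g z :: real)"
  using sqint_add[of f "\<lambda>z. -1 * g z"] sqint_cmult[of g "-1"] by simp

lemma sqint_cong_AE:
  assumes "square_integrable f" "bmeas g" "AE z in lborel. f z = (g z :: real)"
  shows "square_integrable g"
proof -
  have [measurable]: "bmeas f" "bmeas g" using assms by (auto simp: sqint_iff)
  have "integrable lborel (\<lambda>z. (g z)\<^sup>2) \<longleftrightarrow> integrable lborel (\<lambda>z. (f z)\<^sup>2)"
    using assms(3) by (intro integrable_cong_AE) (auto elim: eventually_mono)
  then show ?thesis using assms by (simp add: sqint_iff)
qed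

lemma sqint_prod_integrable: "square_integrable f \<Longrightarrow> square_integrable g \<Longrightarrow> integrable lborel (\<lambda>z. f z * g z :: real)"
proof -
  assume "square_integrable f" "square_integrable g"
  then obtain A B where "l2b (rl f) A" "l2b (rl g) B" unfolding sqint_l2b by blast
  from l1b_integrable[OF l1b_prod[OF this]] have "integrable lborel (rl (\<lambda>z. f z * g z))" by simp
  then show ?thesis by (simp only: complex_of_real_integrable_eq)
qed

definition trunc :: "nat \<Rightarrow> (plane \<Rightarrow> real) \<Rightarrow> plane \<Rightarrow> real"
  where "trunc n f z = indicator (cball 0 (real n)) z * f z"

lemma trunc_measurable [measurable]: "bmeas f \<Longrightarrow> trunc n f \<in> borel_measurable borel"
  unfolding trunc_def[abs_def] by (intro borel_measurable_times borel_measurable_indicator) auto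

lemma trunc_abs_le: "\<bar>trunc n f z\<bar> \<le> \<bar>f z\<bar>"
  by (simp add: trunc_def indicator_def)

lemma sqint_trunc: assumes "square_integrable f" shows "square_integrable (trunc n f)"
proof -
  have [measurable]: "bmeas f" using assms by (simp add: sqint_iff)
  have "integrable lborel (\<lambda>z. (trunc n f z)\<^sup>2)"
  proof (rule Bochner_Integration.integrable_bound)
    show "integrable lborel (\<lambda>z. (f z)\<^sup>2)" using assms by (simp add: sqint_iff)
    show "AE z in lborel. norm ((trunc n f z)\<^sup>2) \<le> norm ((f z)\<^sup>2)"
      using trunc_abs_le[of n f] by (intro always_eventually allI) (simp add: abs_le_square_iff[symmetric])
  qed measurable
  then show ?thesis by (simp add: sqint_iff)
qed

lemma integrable_trunc: assumes "square_integrable f" shows "integrable lborel (trunc n f)"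
proof -
  have "square_integrable (\<lambda>z::plane. indicator (cball 0 (real n)) z :: real)"
  proof -
    have "integrable lborel (\<lambda>z::plane. indicator (cball 0 (real n)) z *\<^sub>R (1::real))" by (rule integrable_cball_const)
    moreover have "(indicator (cball 0 (real n)) z :: real)\<^sup>2 = indicator (cball 0 (real n)) z *\<^sub>R (1::real)" for z :: plane
      by (simp add: indicator_def)
    ultimately show ?thesis by (simp add: sqint_iff)
  qed
  from sqint_prod_integrable[OF this assms] show ?thesis unfolding trunc_def[abs_def] .
qed

lemma fourier_integral_ft: "fourier_integral f = ft (rl f)"
proof -
  have e: "exp (- \<i> * complex_of_real x) = cis (- 1 * x)" for x by (simp add: cis_conv_exp)
  show ?thesis by (rule ext) (simp only: fourier_integral_def ft_def ip_def e)
qed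

lemma hermitian_ft: "hermitian (ft (rl f))"
proof (rule hermitianI)
  fix \<zeta>
  show "ft (rl f) (- \<zeta>) = cnj (ft (rl f) \<zeta>)" unfolding cnj_ft by (simp add: ft_def ip_simps)
qed

lemma ft_diff:
  assumes "integrable lborel f" "integrable lborel g"
  shows "ft (\<lambda>z. f z - g z) \<zeta> = ft f \<zeta> - ft g \<zeta>"
  unfolding ft_def left_diff_distrib using integrable_cis[OF assms(1), of "-1" \<zeta>] integrable_cis[OF assms(2), of "-1" \<zeta>]
  by (subst Bochner_Integration.integral_diff) (auto simp: right_diff_distrib)

lemma ft_add:
  assumes "integrable lborel f" "integrable lborel g"
  shows "ft (\<lambda>z. f z + g z) \<zeta> = ft f \<zeta> + ft g \<zeta>"
  unfolding ft_def distrib_right using integrable_cis[OF assms(1), of "-1" \<zeta>] integrable_cis[OF assms(2), of "-1" \<zeta>]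
  by (subst Bochner_Integration.integral_add) (auto simp: distrib_left)

lemma ft_cmult: "ft (\<lambda>z. c * f z) \<zeta> = c * ft f \<zeta>"
  unfolding ft_def mult.assoc integral_mult_right_zero by (simp add: ac_simps)

definition ftG :: "(plane \<Rightarrow> real) \<Rightarrow> G" where "ftG f = abs_G (ft (rl f))"

lemma rl_integrable: "integrable lborel f \<Longrightarrow> integrable lborel (rl f)"
  by (simp add: complex_of_real_integrable_eq)

lemma
  assumes f: "integrable lborel f" and f2: "square_integrable f"
  shows rep_ftG: "AE z in lborel. rep_G (ftG f) z = ft (rl f) z"
    and norm_ftG: "(norm (ftG f))\<^sup>2 = (LINT z|lborel. (f z)\<^sup>2)"
proof -
  obtain A where A: "l2b (rl f) A" using f2 by (auto simp: sqint_l2b)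
  note P = plancherel[OF rl_integrable[OF f] A]
  have fm: "bmeas f" using f by auto
  have rm: "bmeas (rl f)" using fm by simp
  have "hl2 (ft (rl f))" using P(1) hermitian_ft by (simp add: hl2_def ft_measurable[OF rm])
  from rep_abs[OF this] show r: "AE z in lborel. rep_G (ftG f) z = ft (rl f) z" unfolding ftG_def .
  have "(norm (ftG f))\<^sup>2 = (LINT z|lborel. (cmod (ft (rl f) z))\<^sup>2)"
    unfolding norm_G_power2
  proof (rule integral_cong_AE)
    show "(\<lambda>z. (cmod (ft (rl f) z))\<^sup>2) \<in> borel_measurable lborel" using ft_measurable[OF rm] by simp
    show "AE w in lborel. (cmod (rep_G (ftG f) w))\<^sup>2 = (cmod (ft (rl f) w))\<^sup>2" using r by (auto elim: eventually_mono)
  qed measurable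
  also have "\<dots> = (LINT z|lborel. (f z)\<^sup>2)" using P(2) by simp
  finally show "(norm (ftG f))\<^sup>2 = (LINT z|lborel. (f z)\<^sup>2)" .
qed

lemma ftG_diff:
  assumes "integrable lborel f" "integrable lborel g" "square_integrable f" "square_integrable g"
  shows "ftG (\<lambda>z. f z - g z) = ftG f - ftG g"
proof (rule G_eqI)
  have h: "ft (rl (\<lambda>z. f z - g z)) z = ft (rl f) z - ft (rl g) z" for z
    using ft_diff[OF rl_integrable[OF assms(1)] rl_integrable[OF assms(2)]] by simp
  from rep_ftG[OF Bochner_Integration.integrable_diff[OF assms(1,2)] sqint_diff[OF assms(3,4)]] rep_ftG[OF assms(1,3)] rep_ftG[OF assms(2,4)] rep_diff[of "ftG f" "ftG g"]
  show "AE z in lborel. rep_G (ftG (\<lambda>z. f z - g z)) z = rep_G (ftG f - ftG g) z"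
    by eventually_elim (simp only: h)
qed

lemma ftG_add:
  assumes "integrable lborel f" "integrable lborel g" "square_integrable f" "square_integrable g"
  shows "ftG (\<lambda>z. f z + g z) = ftG f + ftG g"
proof (rule G_eqI)
  have h: "ft (rl (\<lambda>z. f z + g z)) z = ft (rl f) z + ft (rl g) z" for z
    using ft_add[OF rl_integrable[OF assms(1)] rl_integrable[OF assms(2)]] by simp
  from rep_ftG[OF Bochner_Integration.integrable_add[OF assms(1,2)] sqint_add[OF assms(3,4)]] rep_ftG[OF assms(1,3)] rep_ftG[OF assms(2,4)] rep_add[of "ftG f" "ftG g"]
  show "AE z in lborel. rep_G (ftG (\<lambda>z. f z + g z)) z = rep_G (ftG f + ftG g) z"
    by eventually_elim (simp only: h)
qed

lemma ftG_cmult: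
  assumes "integrable lborel f" "square_integrable f"
  shows "ftG (\<lambda>z. c * f z) = c *\<^sub>R ftG f"
proof (rule G_eqI)
  have h: "ft (rl (\<lambda>z. c * f z)) z = of_real c * ft (rl f) z" for z
    using ft_cmult[of "of_real c" "rl f"] by simp
  have i: "integrable lborel (\<lambda>z. c * f z)" using assms(1) by simp
  from rep_ftG[OF i sqint_cmult[OF assms(2)]] rep_ftG[OF assms] rep_scaleR[of c "ftG f"]
  show "AE z in lborel. rep_G (ftG (\<lambda>z. c * f z)) z = rep_G (c *\<^sub>R ftG f) z" by eventually_elim (simp only: h)
qed

text \<open>The L^2 transform as an element of \<open>G\<close>, by the same truncations to balls as
  in \<open>has_fourier_transform\<close>. On functions that are also integrable it is given by the
  integral (\<open>FT_L1\<close>).\<close>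

definition FT :: "(plane \<Rightarrow> real) \<Rightarrow> G" where "FT f = lim (\<lambda>n. ftG (trunc n f))"

lemma trunc_l2_tendsto:
  assumes f: "square_integrable f"
  shows "(\<lambda>n. LINT z|lborel. (trunc n f z - f z)\<^sup>2) \<longlonglongrightarrow> 0"
proof -
  have [measurable]: "bmeas f" using f by (simp add: sqint_iff)
  have "(\<lambda>n. LINT z|lborel. (trunc n f z - f z)\<^sup>2) \<longlonglongrightarrow> (LINT z|(lborel :: plane measure). 0)"
  proof (rule integral_dominated_convergence[where w = "\<lambda>z. (f z)\<^sup>2"])
    show "integrable lborel (\<lambda>z. (f z)\<^sup>2)" using f by (simp add: sqint_iff)
    show "AE z in lborel. (\<lambda>n. (trunc n f z - f z)\<^sup>2) \<longlonglongrightarrow> 0"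
    proof (intro always_eventually allI)
      fix z :: plane
      obtain n0 :: nat where n0: "norm z \<le> real n0" using real_arch_simple by blast
      have "\<forall>\<^sub>F n in sequentially. (trunc n f z - f z)\<^sup>2 = 0"
        using eventually_ge_at_top[of n0] by eventually_elim (use n0 in \<open>auto simp: trunc_def\<close>)
      then show "(\<lambda>n. (trunc n f z - f z)\<^sup>2) \<longlonglongrightarrow> 0" by (rule tendsto_eventually)
    qed
    show "AE z in lborel. norm ((trunc n f z - f z)\<^sup>2) \<le> (f z)\<^sup>2" for n
      by (intro always_eventually allI) (simp add: trunc_def indicator_def)
  qed measurable
  then show ?thesis by simp
qed

lemma FT_lim: assumes f: "square_integrable f" shows "(\<lambda>n. ftG (trunc n f)) \<longlonglongrightarrow> FT f"
proof -
  have fm [measurable]: "bmeas f" using f by (simp add: sqint_iff)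
  have dist: "norm (ftG (trunc m f) - ftG (trunc n f)) \<le> sqrt (LINT z|lborel. (trunc m f z - f z)\<^sup>2) + sqrt (LINT z|lborel. (trunc n f z - f z)\<^sup>2)" for m n
  proof -
    let ?a = "\<lambda>n. sqrt (LINT z|lborel. (trunc n f z - f z)\<^sup>2)"
    have l: "l2b (rl (\<lambda>z. trunc n f z - f z)) (?a n)" for n
      unfolding l2b_rl using sqint_diff[OF sqint_trunc[OF f] f] by simp
    have "l2b (rl (\<lambda>z. trunc m f z - trunc n f z)) (?a m + ?a n)"
      using l2b_diff[OF l[of m] l[of n]] by simp
    then have "(LINT z|lborel. (trunc m f z - trunc n f z)\<^sup>2) \<le> (?a m + ?a n)\<^sup>2" unfolding l2b_rl by blast
    then have "(norm (ftG (trunc m f) - ftG (trunc n f)))\<^sup>2 \<le> (?a m + ?a n)\<^sup>2"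
      using norm_ftG[OF Bochner_Integration.integrable_diff[OF integrable_trunc[OF f] integrable_trunc[OF f]] sqint_diff[OF sqint_trunc[OF f] sqint_trunc[OF f]]]
      by (simp add: ftG_diff[OF integrable_trunc[OF f] integrable_trunc[OF f] sqint_trunc[OF f] sqint_trunc[OF f]])
    then show ?thesis by (rule power2_le_imp_le) (auto intro!: add_nonneg_nonneg real_sqrt_ge_zero integral_nonneg_AE)
  qed
  have s0: "(\<lambda>n. sqrt (LINT z|lborel. (trunc n f z - f z)\<^sup>2)) \<longlonglongrightarrow> 0"
    using tendsto_real_sqrt[OF trunc_l2_tendsto[OF f]] by simp
  have "Cauchy (\<lambda>n. ftG (trunc n f))"
  proof (rule CauchyI)
    fix e :: real assume e: "0 < e"
    have "0 < e / 2" using e by simp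
    from order_tendstoD(2)[OF s0 this] obtain N where N: "\<And>n. N \<le> n \<Longrightarrow> sqrt (LINT z|lborel. (trunc n f z - f z)\<^sup>2) < e / 2"
      unfolding eventually_sequentially by blast
    have "norm (ftG (trunc m f) - ftG (trunc n f)) < e" if "N \<le> m" "N \<le> n" for m n
      using dist[of m n] N[OF that(1)] N[OF that(2)] by linarith
    then show "\<exists>M. \<forall>m\<ge>M. \<forall>n\<ge>M. norm (ftG (trunc m f) - ftG (trunc n f)) < e" by blast
  qed
  then have "convergent (\<lambda>n. ftG (trunc n f))" by (rule Cauchy_convergent)
  then show ?thesis unfolding FT_def by (simp add: convergent_LIMSEQ_iff)
qed

lemma has_fourier_transform_FT: assumes f: "square_integrable f" shows "has_fourier_transform f (rep_G (FT f))"
proof -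
  have eq: "(\<integral>\<^sup>+\<zeta>. ennreal ((cmod (fourier_integral (\<lambda>z. indicator (cball 0 (real n)) z * f z) \<zeta> - rep_G (FT f) \<zeta>))\<^sup>2) \<partial>lborel)
     = ennreal ((norm (ftG (trunc n f) - FT f))\<^sup>2)" for n
    unfolding nn_integral_rep_diff[symmetric] fourier_integral_ft using rep_ftG[OF integrable_trunc[OF f, of n] sqint_trunc[OF f]]
    by (intro nn_integral_cong_AE) (auto elim!: eventually_mono simp: trunc_def[abs_def])
  have "(\<lambda>n. ennreal ((norm (ftG (trunc n f) - FT f))\<^sup>2)) \<longlonglongrightarrow> ennreal ((norm (FT f - FT f))\<^sup>2)"
    by (intro tendsto_ennrealI tendsto_intros FT_lim f)
  then show ?thesis unfolding has_fourier_transform_def eq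
    using f by (simp add: square_integrable_def rep_integrable)
qed

text \<open>\<open>fourier\<close> is defined by choice; this uniqueness is what determines its
  values almost everywhere.\<close>

lemma has_fourier_transform_unique:
  assumes g: "has_fourier_transform f g" shows "AE \<zeta> in lborel. g \<zeta> = rep_G (FT f) \<zeta>"
proof -
  have f: "square_integrable f" and [measurable]: "bmeas g"
    using g by (auto simp: has_fourier_transform_def square_integrable_def)
  let ?F = "\<lambda>n. fourier_integral (\<lambda>z. indicator (cball 0 (real n)) z * f z)"
  let ?r = "rep_G (FT f)"
  have Fm [measurable]: "bmeas (?F n)" for n
  proof -
    have "bmeas f" using f by (simp add: sqint_iff)
    then have "bmeas (rl (trunc n f))" by measurable
    then show ?thesis unfolding fourier_integral_ft trunc_def[abs_def] by (rule ft_measurable)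
  qed
  have 1: "(\<lambda>n. \<integral>\<^sup>+\<zeta>. ennreal ((cmod (?F n \<zeta> - g \<zeta>))\<^sup>2) \<partial>lborel) \<longlonglongrightarrow> 0"
    and 2: "(\<lambda>n. \<integral>\<^sup>+\<zeta>. ennreal ((cmod (?F n \<zeta> - ?r \<zeta>))\<^sup>2) \<partial>lborel) \<longlonglongrightarrow> 0"
    using g has_fourier_transform_FT[OF f] by (auto simp: has_fourier_transform_def)
  have le: "(\<integral>\<^sup>+\<zeta>. ennreal ((cmod (g \<zeta> - ?r \<zeta>))\<^sup>2) \<partial>lborel) \<le> 2 * (\<integral>\<^sup>+\<zeta>. ennreal ((cmod (?F n \<zeta> - g \<zeta>))\<^sup>2) \<partial>lborel)
     + 2 * (\<integral>\<^sup>+\<zeta>. ennreal ((cmod (?F n \<zeta> - ?r \<zeta>))\<^sup>2) \<partial>lborel)" for n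
  proof -
    have "(cmod (g \<zeta> - ?r \<zeta>))\<^sup>2 \<le> 2 * (cmod (?F n \<zeta> - g \<zeta>))\<^sup>2 + 2 * (cmod (?F n \<zeta> - ?r \<zeta>))\<^sup>2" for \<zeta>
    proof -
      have "cmod (g \<zeta> - ?r \<zeta>) \<le> cmod (?F n \<zeta> - g \<zeta>) + cmod (?F n \<zeta> - ?r \<zeta>)"
        using norm_triangle_ineq4[of "?F n \<zeta> - ?r \<zeta>" "?F n \<zeta> - g \<zeta>"] by simp
      then have "(cmod (g \<zeta> - ?r \<zeta>))\<^sup>2 \<le> (cmod (?F n \<zeta> - g \<zeta>) + cmod (?F n \<zeta> - ?r \<zeta>))\<^sup>2" by (rule power_mono) simp
      also have "\<dots> \<le> 2 * (cmod (?F n \<zeta> - g \<zeta>))\<^sup>2 + 2 * (cmod (?F n \<zeta> - ?r \<zeta>))\<^sup>2"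
        using zero_le_power2[of "cmod (?F n \<zeta> - g \<zeta>) - cmod (?F n \<zeta> - ?r \<zeta>)"] by (simp add: power2_eq_square algebra_simps)
      finally show ?thesis .
    qed
    then have "ennreal ((cmod (g \<zeta> - ?r \<zeta>))\<^sup>2) \<le> 2 * ennreal ((cmod (?F n \<zeta> - g \<zeta>))\<^sup>2) + 2 * ennreal ((cmod (?F n \<zeta> - ?r \<zeta>))\<^sup>2)" for \<zeta>
      using ennreal_leI[of "(cmod (g \<zeta> - ?r \<zeta>))\<^sup>2" "2 * (cmod (?F n \<zeta> - g \<zeta>))\<^sup>2 + 2 * (cmod (?F n \<zeta> - ?r \<zeta>))\<^sup>2"]
      by (simp add: ennreal_mult)
    then have "(\<integral>\<^sup>+\<zeta>. ennreal ((cmod (g \<zeta> - ?r \<zeta>))\<^sup>2) \<partial>lborel) \<le> (\<integral>\<^sup>+\<zeta>. 2 * ennreal ((cmod (?F n \<zeta> - g \<zeta>))\<^sup>2) + 2 * ennreal ((cmod (?F n \<zeta> - ?r \<zeta>))\<^sup>2) \<partial>lborel)"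
      by (intro nn_integral_mono)
    also have "\<dots> = 2 * (\<integral>\<^sup>+\<zeta>. ennreal ((cmod (?F n \<zeta> - g \<zeta>))\<^sup>2) \<partial>lborel) + 2 * (\<integral>\<^sup>+\<zeta>. ennreal ((cmod (?F n \<zeta> - ?r \<zeta>))\<^sup>2) \<partial>lborel)"
      by (simp add: nn_integral_add nn_integral_cmult)
    finally show ?thesis .
  qed
  have "(\<lambda>n. 2 * (\<integral>\<^sup>+\<zeta>. ennreal ((cmod (?F n \<zeta> - g \<zeta>))\<^sup>2) \<partial>lborel)
     + 2 * (\<integral>\<^sup>+\<zeta>. ennreal ((cmod (?F n \<zeta> - ?r \<zeta>))\<^sup>2) \<partial>lborel)) \<longlonglongrightarrow> 2 * 0 + 2 * 0"
    by (intro tendsto_add ennreal_tendsto_cmult 1 2) auto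
  then have "(\<integral>\<^sup>+\<zeta>. ennreal ((cmod (g \<zeta> - ?r \<zeta>))\<^sup>2) \<partial>lborel) \<le> 2 * 0 + 2 * 0"
    by (rule LIMSEQ_le_const) (use le in blast)
  then have "(\<integral>\<^sup>+\<zeta>. ennreal ((cmod (g \<zeta> - ?r \<zeta>))\<^sup>2) \<partial>lborel) = 0" by simp
  then have "AE \<zeta> in lborel. ennreal ((cmod (g \<zeta> - ?r \<zeta>))\<^sup>2) = 0" by (subst (asm) nn_integral_0_iff_AE) auto
  then show ?thesis by eventually_elim (simp add: ennreal_eq_0_iff)
qed

lemma fourier_FT: assumes "square_integrable f" shows "AE \<zeta> in lborel. fourier f \<zeta> = rep_G (FT f) \<zeta>"
proof (rule has_fourier_transform_unique)
  show "has_fourier_transform f (fourier f)" unfolding fourier_def using has_fourier_transform_FT[OF assms] by (rule someI[where P = "has_fourier_transform f"])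
qed

lemma fourier_measurable: assumes "square_integrable f" shows "bmeas (fourier f)"
proof -
  have "has_fourier_transform f (fourier f)" unfolding fourier_def using has_fourier_transform_FT[OF assms] by (rule someI[where P = "has_fourier_transform f"])
  then show ?thesis by (simp add: has_fourier_transform_def square_integrable_def)
qed

lemma FT_L1: assumes f: "integrable lborel f" and f2: "square_integrable f" shows "FT f = ftG f"
proof -
  have "(norm (ftG (trunc n f) - ftG f))\<^sup>2 = (LINT z|lborel. (trunc n f z - f z)\<^sup>2)" for n
    using norm_ftG[OF Bochner_Integration.integrable_diff[OF integrable_trunc[OF f2] f] sqint_diff[OF sqint_trunc[OF f2] f2]]
    by (simp add: ftG_diff[OF integrable_trunc[OF f2] f sqint_trunc[OF f2] f2])
  then have "(\<lambda>n. (norm (ftG (trunc n f) - ftG f))\<^sup>2) \<longlonglongrightarrow> 0" using trunc_l2_tendsto[OF f2] by simp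
  then have "(\<lambda>n. sqrt ((norm (ftG (trunc n f) - ftG f))\<^sup>2)) \<longlonglongrightarrow> sqrt 0" by (rule tendsto_real_sqrt)
  then have "(\<lambda>n. ftG (trunc n f)) \<longlonglongrightarrow> ftG f" by (simp add: tendsto_norm_zero_iff LIM_zero_iff)
  from LIMSEQ_unique[OF FT_lim[OF f2] this] show ?thesis .
qed

lemma trunc_add: "trunc n (\<lambda>z. f z + g z) = (\<lambda>z. trunc n f z + trunc n g z)"
  and trunc_cmult: "trunc n (\<lambda>z. c * f z) = (\<lambda>z. c * trunc n f z)"
  by (auto simp: trunc_def fun_eq_iff algebra_simps)

lemma FT_add: assumes "square_integrable f" "square_integrable g" shows "FT (\<lambda>z. f z + g z) = FT f + FT g"
proof -
  have "(\<lambda>n. ftG (trunc n f) + ftG (trunc n g)) \<longlonglongrightarrow> FT f + FT g" by (intro tendsto_intros FT_lim assms)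
  then have "(\<lambda>n. ftG (trunc n (\<lambda>z. f z + g z))) \<longlonglongrightarrow> FT f + FT g"
    unfolding trunc_add by (simp add: ftG_add integrable_trunc sqint_trunc assms)
  from LIMSEQ_unique[OF FT_lim[OF sqint_add[OF assms]] this] show ?thesis .
qed

lemma FT_cmult: assumes "square_integrable f" shows "FT (\<lambda>z. c * f z) = c *\<^sub>R FT f"
proof -
  have "(\<lambda>n. c *\<^sub>R ftG (trunc n f)) \<longlonglongrightarrow> c *\<^sub>R FT f" by (intro tendsto_intros FT_lim assms)
  then have "(\<lambda>n. ftG (trunc n (\<lambda>z. c * f z))) \<longlonglongrightarrow> c *\<^sub>R FT f"
    unfolding trunc_cmult by (simp add: ftG_cmult integrable_trunc sqint_trunc assms)
  from LIMSEQ_unique[OF FT_lim[OF sqint_cmult[OF assms]] this] show ?thesis .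
qed

lemma FT_diff: assumes "square_integrable f" "square_integrable g" shows "FT (\<lambda>z. f z - g z) = FT f - FT g"
  using FT_add[OF assms(1) sqint_cmult[OF assms(2), of "-1"]] FT_cmult[OF assms(2), of "-1"] by simp

lemma norm_FT: assumes f: "square_integrable f" shows "(norm (FT f))\<^sup>2 = (LINT z|lborel. (f z)\<^sup>2)"
proof -
  have fm [measurable]: "bmeas f" using f by (simp add: sqint_iff)
  have "(\<lambda>n. (norm (ftG (trunc n f)))\<^sup>2) \<longlonglongrightarrow> (norm (FT f))\<^sup>2" by (intro tendsto_intros FT_lim f)
  then have 1: "(\<lambda>n. LINT z|lborel. (trunc n f z)\<^sup>2) \<longlonglongrightarrow> (norm (FT f))\<^sup>2"
    by (simp add: norm_ftG integrable_trunc sqint_trunc f)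
  have "(\<lambda>n. LINT z|lborel. (trunc n f z)\<^sup>2) \<longlonglongrightarrow> (LINT z|lborel. (f z)\<^sup>2)"
  proof (rule integral_dominated_convergence[where w = "\<lambda>z. (f z)\<^sup>2"])
    show "integrable lborel (\<lambda>z. (f z)\<^sup>2)" using f by (simp add: sqint_iff)
    show "AE z in lborel. (\<lambda>n. (trunc n f z)\<^sup>2) \<longlonglongrightarrow> (f z)\<^sup>2"
    proof (intro always_eventually allI)
      fix z :: plane
      obtain n0 :: nat where n0: "norm z \<le> real n0" using real_arch_simple by blast
      have "\<forall>\<^sub>F n in sequentially. (trunc n f z)\<^sup>2 = (f z)\<^sup>2"
        using eventually_ge_at_top[of n0] by eventually_elim (use n0 in \<open>auto simp: trunc_def\<close>)
      then show "(\<lambda>n. (trunc n f z)\<^sup>2) \<longlonglongrightarrow> (f z)\<^sup>2" by (rule tendsto_eventually)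
    qed
    show "AE z in lborel. norm ((trunc n f z)\<^sup>2) \<le> (f z)\<^sup>2" for n
      by (intro always_eventually allI) (simp add: trunc_def indicator_def)
  qed measurable
  from LIMSEQ_unique[OF 1 this] show ?thesis .
qed

lemma FT_eq_iff: assumes "square_integrable f" "square_integrable g"
  shows "FT f = FT g \<longleftrightarrow> (AE z in lborel. f z = g z)"
proof -
  have [measurable]: "bmeas f" "bmeas g" using assms by (auto simp: sqint_iff)
  have d: "square_integrable (\<lambda>z. f z - g z)" by (rule sqint_diff[OF assms])
  have "FT f = FT g \<longleftrightarrow> (norm (FT (\<lambda>z. f z - g z)))\<^sup>2 = 0" by (simp add: FT_diff assms)
  also have "\<dots> \<longleftrightarrow> (AE z in lborel. (f z - g z)\<^sup>2 = 0)"
    unfolding norm_FT[OF d] using d by (intro integral_nonneg_eq_0_iff_AE) (auto simp: sqint_iff)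
  finally show ?thesis by simp
qed

text \<open>Polarisation of the isometry \<open>norm_FT\<close>.\<close>

lemma FT_inner: assumes "square_integrable f" "square_integrable g"
  shows "FT f \<bullet> FT g = (LINT z|lborel. f z * g z)"
proof -
  have 1: "(norm (FT f + FT g))\<^sup>2 = (LINT z|lborel. (f z + g z)\<^sup>2)"
    using norm_FT[OF sqint_add[OF assms]] by (simp add: FT_add assms)
  have i: "integrable lborel (\<lambda>z. (f z)\<^sup>2)" "integrable lborel (\<lambda>z. (g z)\<^sup>2)" "integrable lborel (\<lambda>z. f z * g z)"
    using assms by (auto simp: sqint_iff intro: sqint_prod_integrable)
  have "(\<lambda>z. (f z + g z)\<^sup>2) = (\<lambda>z. ((f z)\<^sup>2 + (g z)\<^sup>2) + 2 * (f z * g z))" by (simp add: fun_eq_iff power2_sum)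
  then have "(LINT z|lborel. (f z + g z)\<^sup>2) = (LINT z|lborel. (f z)\<^sup>2) + (LINT z|lborel. (g z)\<^sup>2) + 2 * (LINT z|lborel. f z * g z)"
    using i by simp
  then show ?thesis using 1 norm_FT[OF assms(1)] norm_FT[OF assms(2)]
    by (simp add: power2_norm_eq_inner inner_add_left inner_add_right inner_commute)
qed

section \<open>Convolution theorem and inversion\<close>

lemma conv_integral:
  assumes f: "integrable lborel f" and g: "integrable lborel g"
  shows "(LINT z|lborel. conv f g z) = (LINT z|lborel. f z) * (LINT z|lborel. g z)"
proof -
  have [measurable]: "bmeas f" "bmeas g" using f g by auto
  define K where "K x = f (fst x - snd x) * g (snd x)" for x
  have Km [measurable]: "K \<in> borel_measurable (lborel \<Otimes>\<^sub>M lborel)"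
  proof -
    have "(\<lambda>x. f (fst x - snd x)) \<in> borel_measurable (borel \<Otimes>\<^sub>M borel)" by measurable
    then show ?thesis unfolding K_def[abs_def] by (intro lborel_pair_measurable borel_measurable_times) measurable
  qed
  have "(\<integral>\<^sup>+z. \<integral>\<^sup>+w. ennreal (norm (K (z, w))) \<partial>lborel \<partial>lborel) = (\<integral>\<^sup>+z. nc (nm f) (nm g) z \<partial>lborel)"
    by (simp add: K_def nc_def norm_mult ennreal_mult)
  also have "\<dots> = (\<integral>\<^sup>+z. nm f z \<partial>lborel) * (\<integral>\<^sup>+z. nm g z \<partial>lborel)" by (rule nn_integral_nc) measurable
  also have "\<dots> < \<infinity>" using f g by (simp add: nn_integral_eq_integral ennreal_mult_less_top)
  finally have fin: "(\<integral>\<^sup>+z. \<integral>\<^sup>+w. ennreal (norm (K (z, w))) \<partial>lborel \<partial>lborel) < \<infinity>" .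
  have "(LINT z|lborel. conv f g z) = (LINT z|lborel. LINT w|lborel. K (z, w))" by (simp add: K_def conv_def)
  also have "\<dots> = (LINT w|lborel. LINT z|lborel. K (z, w))" by (rule fubini_pair[OF Km fin])
  also have "\<dots> = (LINT w|lborel. (LINT z|lborel. f z) * g w)"
  proof (rule Bochner_Integration.integral_cong[OF refl])
    fix w
    have "(LINT z|lborel. f (- w + z)) = (LINT z|lborel. f z)" by (rule integral_lborel_shift) measurable
    then show "(LINT z|lborel. K (z, w)) = (LINT z|lborel. f z) * g w" by (simp add: K_def)
  qed
  also have "\<dots> = (LINT z|lborel. f z) * (LINT z|lborel. g z)" by simp
  finally show ?thesis .
qed

text \<open>The factor 2 pi comes from the symmetric normalisation of the transform; it is why
  \<open>pw\<close> and \<open>nl\<close> divide each convolution by 2 pi.\<close>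

lemma ft_conv:
  assumes f: "integrable lborel f" and g: "integrable lborel g"
  shows "ft (conv f g) \<zeta> = of_real (2 * pi) * (ft f \<zeta> * ft g \<zeta>)"
proof -
  let ?F = "\<lambda>z. f z * cis (- 1 * ip z \<zeta>)" and ?G = "\<lambda>z. g z * cis (- 1 * ip z \<zeta>)"
  have "conv f g z * cis (- 1 * ip z \<zeta>) = conv ?F ?G z" for z
  proof -
    have e: "?F (z - w) * ?G w = (f (z - w) * g w) * cis (- 1 * ip z \<zeta>)" for w
    proof -
      have "cis (- 1 * ip (z - w) \<zeta>) * cis (- 1 * ip w \<zeta>) = cis (- 1 * ip z \<zeta>)" unfolding cis_mult ip_simps by simp
      moreover have "?F (z - w) * ?G w = (f (z - w) * g w) * (cis (- 1 * ip (z - w) \<zeta>) * cis (- 1 * ip w \<zeta>))"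
        by (simp only: mult.assoc mult.left_commute mult.commute)
      ultimately show ?thesis by (simp only:)
    qed
    show ?thesis unfolding conv_def e by (simp only: integral_mult_left_zero)
  qed
  then have "(LINT z|lborel. conv f g z * cis (- 1 * ip z \<zeta>)) = (LINT z|lborel. ?F z) * (LINT z|lborel. ?G z)"
    using conv_integral[OF integrable_cis[OF f] integrable_cis[OF g], of "-1" \<zeta> "-1" \<zeta>] by simp
  then have "ft (conv f g) \<zeta> = of_real (1 / (2 * pi)) * ((LINT z|lborel. ?F z) * (LINT z|lborel. ?G z))" by (simp only: ft_def)
  moreover have "c * (a * b) = inverse c * ((c * a) * (c * b))" if "c \<noteq> 0" for a b c :: complex using that by simp
  from this[of "of_real (1 / (2 * pi))"] have "of_real (1 / (2 * pi)) * (a * b) =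
      of_real (2 * pi) * ((of_real (1 / (2 * pi)) * a) * (of_real (1 / (2 * pi)) * b))" for a b :: complex by simp
  ultimately show ?thesis unfolding ft_def by (simp only:)
qed

text \<open>The inverse transform of an integrable function, obtained from the transform by
  reflection; for Hermitian r it is real (\<open>ft_hermitian_real\<close>).\<close>

definition phys :: "(plane \<Rightarrow> complex) \<Rightarrow> plane \<Rightarrow> real" where "phys r z = Re (ft r (- z))"

lemma ft_hermitian_real:
  assumes "hermitian r" "bmeas r" shows "ft r (- z) = of_real (phys r z)"
proof -
  have "cnj (ft r (- z)) = of_real (1 / (2 * pi)) * (LINT w|lborel. cnj (r w) * cis (1 * ip w (- z)))" by (rule cnj_ft)
  also have "(LINT w|lborel. cnj (r w) * cis (1 * ip w (- z))) = (LINT w|lborel. (\<lambda>w. r w * cis (- 1 * ip w (- z))) (0 - w))"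
    by (rule Bochner_Integration.integral_cong[OF refl]) (simp add: hermitianD[OF assms(1)] ip_simps)
  also have "\<dots> = (LINT w|lborel. r w * cis (- 1 * ip w (- z)))"
    by (rule integral_lborel_reflect) (use assms(2) in measurable)
  finally have "cnj (ft r (- z)) = ft r (- z)" unfolding ft_def .
  then have "ft r (- z) \<in> \<real>" by (simp only: Reals_cnj_iff)
  then show ?thesis unfolding phys_def by (rule of_real_Re[symmetric])
qed

lemma phys_measurable [measurable]: "bmeas r \<Longrightarrow> phys r \<in> borel_measurable borel"
proof -
  assume "bmeas r"
  then have "bmeas (ft r)" by (rule ft_measurable)
  then have "bmeas (\<lambda>z. ft r (- z))" by measurable
  then show ?thesis unfolding phys_def[abs_def] by measurable
qed

lemma phys_cong_AE:
  assumes "bmeas r" "bmeas r'" "AE z in lborel. r z = r' z" shows "phys r = phys r'"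
proof -
  have [measurable]: "bmeas r" "bmeas r'" by fact+
  have "ft r \<zeta> = ft r' \<zeta>" for \<zeta>
  proof -
    have "(LINT z|lborel. r z * cis (- 1 * ip z \<zeta>)) = (LINT z|lborel. r' z * cis (- 1 * ip z \<zeta>))"
      using assms(3) by (intro integral_cong_AE) (auto elim: eventually_mono)
    then show ?thesis by (simp only: ft_def)
  qed
  then show ?thesis by (simp add: phys_def[abs_def])
qed

lemma phys_conv:
  assumes "hermitian a" "hermitian b" "l1b a A" "l1b b B"
  shows "phys (\<lambda>\<zeta>. of_real (1 / (2 * pi)) * conv a b \<zeta>) z = phys a z * phys b z"
proof -
  have m: "bmeas a" "bmeas b" using assms by (auto dest: l1b_measurable)
  have "ft (\<lambda>\<zeta>. of_real (1 / (2 * pi)) * conv a b \<zeta>) (- z) = ft a (- z) * ft b (- z)"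
    unfolding ft_cmult ft_conv[OF l1b_integrable[OF assms(3)] l1b_integrable[OF assms(4)]] by simp
  also have "\<dots> = of_real (phys a z * phys b z)"
    using ft_hermitian_real[OF assms(1) m(1)] ft_hermitian_real[OF assms(2) m(2)] by simp
  finally show ?thesis unfolding phys_def[of "\<lambda>\<zeta>. of_real (1 / (2 * pi)) * conv a b \<zeta>"] by simp
qed

text \<open>Inversion in L^2 without a pointwise inversion formula. For f =
  \<open>phys (rep_G x)\<close> the multiplication formula gives \<open>FT f \<bullet> x\<close> =
  (norm x)^2, and by Plancherel \<open>FT f\<close> and x have the same norm; equality in
  Cauchy-Schwarz forces \<open>FT f = x\<close>.\<close>

lemma FT_phys:
  assumes "l1b (rep_G x) A"
  shows "square_integrable (phys (rep_G x))" "FT (phys (rep_G x)) = x"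
proof -
  let ?r = "rep_G x" and ?f = "phys (rep_G x)"
  have ri: "integrable lborel ?r" using assms by (rule l1b_integrable)
  have h: "ft ?r (- z) = of_real (?f z)" for z by (rule ft_hermitian_real[OF hermitian_rep rep_measurable])
  have l: "l2b ?r (norm x)" by (simp add: l2b_rep_iff)
  note P = plancherel[OF ri l]
  have fm [measurable]: "bmeas ?f" by simp
  have mm [measurable]: "bmeas (\<lambda>z. (cmod (ft ?r z))\<^sup>2)" using ft_measurable[OF rep_measurable, of x] by measurable
  have sq: "(?f z)\<^sup>2 = (\<lambda>z. (cmod (ft ?r z))\<^sup>2) (0 - z)" for z using h[of z] by simp
  show f2: "square_integrable ?f"
    unfolding sqint_iff sq using fm integrable_lborel_reflect[OF P(1), of 0] by simp
  have n: "(norm x)\<^sup>2 = (LINT z|lborel. (?f z)\<^sup>2)"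
    unfolding sq by (subst integral_lborel_reflect[OF mm]) (simp add: P(2) norm_G_power2)
  have pair: "ftG (trunc n ?f) \<bullet> x = (LINT z|lborel. trunc n ?f z * ?f z)" for n
  proof -
    let ?t = "trunc n ?f"
    have ti: "integrable lborel ?t" and t2: "square_integrable ?t" using f2 by (auto intro: integrable_trunc sqint_trunc)
    have tm: "bmeas (rl ?t)" using ti by auto
    have ci: "integrable lborel (\<lambda>\<zeta>. cnj (?r \<zeta>))" using ri by simp
    have g: "ft (\<lambda>\<zeta>. cnj (?r \<zeta>)) z = of_real (?f z)" for z
    proof -
      have "ft (\<lambda>\<zeta>. cnj (?r \<zeta>)) z = cnj (ft ?r (- z))"
        unfolding cnj_ft ip_simps by (simp add: ft_def)
      then show ?thesis by (simp add: h)
    qed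
    have "l1b (\<lambda>\<zeta>. ft (rl ?t) \<zeta> * cnj (?r \<zeta>)) (sqrt (LINT z|lborel. (?t z)\<^sup>2) * norm x)"
      by (intro l1b_prod l2b_cnj plancherel_l2b rl_integrable ti) (use t2 in \<open>auto simp: l2b_rl l2b_rep_iff\<close>)
    then have ii: "integrable lborel (\<lambda>\<zeta>. ft (rl ?t) \<zeta> * cnj (?r \<zeta>))" by (rule l1b_integrable)
    have "ftG ?t \<bullet> x = (LINT \<zeta>|lborel. Re (ft (rl ?t) \<zeta> * cnj (?r \<zeta>)))"
      by (rule inner_G_AE[OF rep_ftG[OF ti t2]]) (auto simp: ft_measurable[OF tm])
    also have "\<dots> = Re (LINT \<zeta>|lborel. ft (rl ?t) \<zeta> * cnj (?r \<zeta>))" by (rule integral_Re[OF ii])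
    also have "\<dots> = Re (LINT z|lborel. rl ?t z * ft (\<lambda>\<zeta>. cnj (?r \<zeta>)) z)"
      by (subst ft_mult_formula[OF rl_integrable[OF ti] ci]) (rule refl)
    also have "\<dots> = Re (of_real (LINT z|lborel. ?t z * ?f z))" unfolding g by (simp flip: of_real_mult)
    finally show ?thesis by simp
  qed
  have "(\<lambda>n. ftG (trunc n ?f) \<bullet> x) \<longlonglongrightarrow> FT ?f \<bullet> x" by (intro tendsto_intros FT_lim f2)
  then have 1: "(\<lambda>n. LINT z|lborel. trunc n ?f z * ?f z) \<longlonglongrightarrow> FT ?f \<bullet> x" unfolding pair .
  have 2: "(\<lambda>n. LINT z|lborel. trunc n ?f z * ?f z) \<longlonglongrightarrow> (LINT z|lborel. (?f z)\<^sup>2)"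
  proof (rule integral_dominated_convergence[where w = "\<lambda>z. (?f z)\<^sup>2"])
    show "integrable lborel (\<lambda>z. (?f z)\<^sup>2)" using f2 by (simp add: sqint_iff)
    show "AE z in lborel. (\<lambda>n. trunc n ?f z * ?f z) \<longlonglongrightarrow> (?f z)\<^sup>2"
    proof (intro always_eventually allI)
      fix z :: plane
      obtain n0 :: nat where n0: "norm z \<le> real n0" using real_arch_simple by blast
      have "\<forall>\<^sub>F n in sequentially. trunc n ?f z * ?f z = (?f z)\<^sup>2"
        using eventually_ge_at_top[of n0] by eventually_elim (use n0 in \<open>auto simp: trunc_def power2_eq_square\<close>)
      then show "(\<lambda>n. trunc n ?f z * ?f z) \<longlonglongrightarrow> (?f z)\<^sup>2" by (rule tendsto_eventually)
    qed
    show "AE z in lborel. norm (trunc n ?f z * ?f z) \<le> (?f z)\<^sup>2" for n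
      by (intro always_eventually allI) (simp add: trunc_def indicator_def power2_eq_square)
  qed measurable
  have "FT ?f \<bullet> x = (norm x)\<^sup>2" unfolding n by (rule LIMSEQ_unique[OF 1 2])
  moreover have "(norm (FT ?f))\<^sup>2 = (norm x)\<^sup>2" using norm_FT[OF f2] n by simp
  ultimately have "(norm (FT ?f - x))\<^sup>2 = 0"
    by (simp add: power2_norm_eq_inner inner_diff_left inner_diff_right inner_commute)
  then show "FT ?f = x" by simp
qed

lemma Pn_tendsto: "(\<lambda>n. Pn (real n) x) \<longlonglongrightarrow> x"
proof -
  have n: "(norm (Pn (real n) x - x))\<^sup>2 = (LINT z|lborel. (1 - cut (real n) z) * (cmod (rep_G x z))\<^sup>2)" for n
    unfolding norm_G_power2
  proof (rule integral_cong_AE)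
    show "AE z in lborel. (cmod (rep_G (Pn (real n) x - x) z))\<^sup>2 = (1 - cut (real n) z) * (cmod (rep_G x z))\<^sup>2"
      using rep_diff[of "Pn (real n) x" x] rep_Pn[of "real n" x] by eventually_elim (auto simp: cut_def)
  qed measurable
  have "(\<lambda>n. (norm (Pn (real n) x - x))\<^sup>2) \<longlonglongrightarrow> (LINT z|(lborel :: plane measure). 0)"
    unfolding n
  proof (rule integral_dominated_convergence[where w = "\<lambda>z. (cmod (rep_G x z))\<^sup>2"])
    show "integrable lborel (\<lambda>z. (cmod (rep_G x z))\<^sup>2)" by (rule rep_integrable)
    show "AE z in lborel. (\<lambda>n. (1 - cut (real n) z) * (cmod (rep_G x z))\<^sup>2) \<longlonglongrightarrow> 0"
    proof (intro always_eventually allI)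
      fix z :: plane
      obtain n0 :: nat where n0: "jb z \<le> real n0" using real_arch_simple by blast
      have "\<forall>\<^sub>F n in sequentially. (1 - cut (real n) z) * (cmod (rep_G x z))\<^sup>2 = 0"
        using eventually_ge_at_top[of n0] by eventually_elim (use n0 in \<open>auto simp: cut_def\<close>)
      then show "(\<lambda>n. (1 - cut (real n) z) * (cmod (rep_G x z))\<^sup>2) \<longlonglongrightarrow> 0" by (rule tendsto_eventually)
    qed
    show "AE z in lborel. norm ((1 - cut (real n) z) * (cmod (rep_G x z))\<^sup>2) \<le> (cmod (rep_G x z))\<^sup>2" for n
      by (intro always_eventually allI) (simp add: cut_def)
  qed measurable
  then have "(\<lambda>n. sqrt ((norm (Pn (real n) x - x))\<^sup>2)) \<longlonglongrightarrow> sqrt 0" using tendsto_real_sqrt by fastforce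
  then show ?thesis by (simp add: tendsto_norm_zero_iff LIM_zero_iff)
qed

lemma Pn_l1b: "\<exists>A. l1b (rep_G (Pn (real n) x)) A"
proof -
  have "gdom (\<lambda>z. of_real (wt 2 z) * of_real (cut (real n) z)) x"
  proof (rule cut_mult(4)[where C = "real n powr 2"])
    show "hermitian (\<lambda>z. complex_of_real (wt 2 z))" by (rule hermitian_real) simp
    show "cmod (complex_of_real (wt 2 z)) \<le> real n powr 2" if "jb z \<le> real n" for z
      using wt_le_R[of 2 z "real n"] that by (simp only: norm_of_real abs_of_nonneg[OF wt_nonneg])
  qed auto
  then obtain A where A: "l2b (\<lambda>z. of_real (wt 2 z) * of_real (cut (real n) z) * rep_G x z) A" by (auto simp: gdom_def)
  have "l2b (\<lambda>z. of_real (wt 2 z) * rep_G (Pn (real n) x) z) A"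
    by (rule l2b_AE[OF A]) (use rep_Pn[of "real n" x] in \<open>auto elim!: eventually_mono simp: algebra_simps\<close>)
  then have "hb 2 (rep_G (Pn (real n) x)) A" by (simp add: hb_def)
  then show ?thesis using hb_l1b[of 2] by fastforce
qed

text \<open>Truncated elements have integrable representatives, so they are transforms by
  \<open>FT_phys\<close>. As \<open>FT\<close> is an isometry, their preimages form a Cauchy
  sequence, and \<open>riesz_fischer\<close> gives the limit.\<close>

lemma FT_surj: "\<exists>f. square_integrable f \<and> FT f = x"
proof -
  define X where "X n = Pn (real n) x" for n
  define f where "f n = phys (rep_G (X n))" for n
  have f: "square_integrable (f n)" "FT (f n) = X n" for n
    using Pn_l1b[of n x] FT_phys[of "X n"] unfolding f_def X_def by blast+
  have [measurable]: "bmeas (f n)" for n using f(1)[of n] by (rule sqint_measurable)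
  have X: "X \<longlonglongrightarrow> x" unfolding X_def by (rule Pn_tendsto)
  have nn: "(\<integral>\<^sup>+z. ennreal ((norm (g z - h z))\<^sup>2) \<partial>lborel) = ennreal ((norm (FT g - FT h))\<^sup>2)"
    if "square_integrable g" "square_integrable h" for g h
    using norm_FT[OF sqint_diff[OF that]] sqint_diff[OF that] that
    by (subst nn_integral_eq_integral) (auto simp: sqint_iff FT_diff)
  obtain g where g: "g \<in> borel_measurable lborel" "(\<lambda>n. \<integral>\<^sup>+z. ennreal ((norm (f n z - g z))\<^sup>2) \<partial>lborel) \<longlonglongrightarrow> 0"
  proof (rule riesz_fischer[of f lborel])
    fix e :: real assume e: "0 < e"
    have "Cauchy X" using X by (rule LIMSEQ_imp_Cauchy)
    then obtain N where N: "\<And>m n. m \<ge> N \<Longrightarrow> n \<ge> N \<Longrightarrow> norm (X m - X n) < sqrt e"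
      using e unfolding Cauchy_def dist_norm by (meson real_sqrt_gt_0_iff)
    have "(norm (X m - X n))\<^sup>2 \<le> e" if "m \<ge> N" "n \<ge> N" for m n
      using power_mono[OF less_imp_le[OF N[OF that]], of 2] e by simp
    then show "\<exists>N. \<forall>m\<ge>N. \<forall>n\<ge>N. (\<integral>\<^sup>+z. ennreal ((norm (f m z - f n z))\<^sup>2) \<partial>lborel) \<le> ennreal e"
      using nn[OF f(1) f(1)] f(2) by (intro exI[of _ N]) (auto intro: ennreal_leI)
  qed auto
  have [measurable]: "bmeas g" using g(1) by simp
  have "\<forall>\<^sub>F n in sequentially. (\<integral>\<^sup>+z. ennreal ((norm (f n z - g z))\<^sup>2) \<partial>lborel) < ennreal 1"
    by (rule order_tendstoD(2)[OF g(2)]) simp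
  then obtain n where n: "(\<integral>\<^sup>+z. ennreal ((norm (f n z - g z))\<^sup>2) \<partial>lborel) < ennreal 1"
    unfolding eventually_sequentially by blast
  have "integrable lborel (\<lambda>z. (norm (f n z - g z))\<^sup>2)"
    by (rule integrableI_bounded) (use n in \<open>auto simp: less_top[symmetric] intro: order.strict_trans\<close>)
  then have "square_integrable (\<lambda>z. f n z - g z)" by (simp add: sqint_iff)
  from sqint_diff[OF f(1)[of n] this] have g2: "square_integrable g" by simp
  have "(\<lambda>n. ennreal ((norm (X n - FT g))\<^sup>2)) \<longlonglongrightarrow> 0" using g(2) unfolding nn[OF f(1) g2] f(2) .
  then have "(\<lambda>n. (norm (X n - FT g))\<^sup>2) \<longlonglongrightarrow> 0"
    using tendsto_ennreal_iff[of "\<lambda>n. (norm (X n - FT g))\<^sup>2" sequentially 0] by simp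
  then have "(\<lambda>n. sqrt ((norm (X n - FT g))\<^sup>2)) \<longlonglongrightarrow> sqrt 0" by (rule tendsto_real_sqrt)
  then have "X \<longlonglongrightarrow> FT g" by (simp add: tendsto_norm_zero_iff LIM_zero_iff)
  then have "FT g = x" using X by (rule LIMSEQ_unique)
  with g2 show ?thesis by (intro exI[of _ g] conjI)
qed

lemma phys_pw:
  assumes "hermitian v" "l1b v B"
  shows "phys (pw v k) z = phys v z ^ (k + 1)"
proof (induction k)
  case (Suc k)
  have h: "hermitian (pw v k)" by (rule hermitian_pw[OF l1b_measurable[OF assms(2)] assms(1)])
  have "phys (pw v (Suc k)) z = phys v z * phys (pw v k) z"
    unfolding pw.simps by (rule phys_conv[OF assms(1) h assms(2) pw_l1b[OF assms(2)]])
  then show ?case by (simp only: Suc) simp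
qed simp

text \<open>Since s > 2 all transforms involved are integrable, so the inverse transform turns each
  convolution into a pointwise product; \<open>FT_phys\<close> then identifies the transform of that
  product.\<close>

lemma FT_nl:
  assumes s2: "2 < s" and p1: "1 \<le> p" and w: "square_integrable w" and hw: "hb s (rep_G (FT w)) A"
    and v: "square_integrable v" "AE \<zeta> in lborel. rep_G (FT v) \<zeta> = dx (rep_G (FT w)) \<zeta>"
  shows "square_integrable (\<lambda>z. w z ^ p * v z)" "FT (\<lambda>z. w z ^ p * v z) = NL p (FT w)"
proof -
  let ?a = "rep_G (FT w)" and ?b = "rep_G (FT v)" and ?y = "NL p (FT w)"
  have [measurable]: "bmeas w" "bmeas v" using w v by (auto dest: sqint_measurable)
  have a1: "l1b ?a (cS s * A)" by (rule hb_l1b[OF _ hw]) (use s2 in linarith)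
  have hd: "hb (s - 1) (dx ?a) A" by (rule hb_dx[OF hw])
  have d1: "l1b (dx ?a) (cS (s - 1) * A)" by (rule hb_l1b[OF _ hd]) (use s2 in linarith)
  have hb: "hb (s - 1) ?b A" using hd v(2) by (subst hb_cong_AE[of _ "dx ?a"]) auto
  have b1: "l1b ?b (cS (s - 1) * A)" by (rule hb_l1b[OF _ hb]) (use s2 in linarith)
  obtain E where "\<forall>f A. hb s f A \<longrightarrow> hb (s - 1) (nl p f) (E * A ^ (p + 1))" using nl_hb[OF s2 p1] by blast
  then have hn: "hb (s - 1) (nl p ?a) (E * A ^ (p + 1))" using hw by blast
  have ry: "AE z in lborel. rep_G ?y z = nl p ?a z" by (rule rep_NL[OF s2 p1 hw])
  have hy: "hb (s - 1) (rep_G ?y) (E * A ^ (p + 1))" using hn ry by (subst hb_cong_AE[of _ "nl p ?a"]) auto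
  have y1: "l1b (rep_G ?y) (cS (s - 1) * (E * A ^ (p + 1)))" by (rule hb_l1b[OF _ hy]) (use s2 in linarith)
  have wa: "AE z in lborel. w z = phys ?a z" using FT_eq_iff[OF w FT_phys(1)[OF a1]] FT_phys(2)[OF a1] by simp
  have vb: "AE z in lborel. v z = phys ?b z" using FT_eq_iff[OF v(1) FT_phys(1)[OF b1]] FT_phys(2)[OF b1] by simp
  have bd: "phys ?b = phys (dx ?a)" by (rule phys_cong_AE[OF _ _ v(2)]) auto
  have ph: "phys (rep_G ?y) z = phys ?a z ^ p * phys ?b z" for z
  proof -
    have "phys (rep_G ?y) = phys (nl p ?a)" by (rule phys_cong_AE[OF _ _ ry]) auto
    moreover have "phys (nl p ?a) z = phys (pw ?a (p - 1)) z * phys (dx ?a) z"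
      unfolding nl_def[abs_def]
      by (rule phys_conv[OF hermitian_pw[OF rep_measurable hermitian_rep] hermitian_dx[OF hermitian_rep] pw_l1b[OF a1] d1])
    moreover have "phys (pw ?a (p - 1)) z = phys ?a z ^ p" using phys_pw[OF hermitian_rep a1, of "p - 1" z] p1 by simp
    ultimately show ?thesis using bd by simp
  qed
  have e: "AE z in lborel. phys (rep_G ?y) z = w z ^ p * v z" using wa vb by eventually_elim (simp add: ph)
  show 1: "square_integrable (\<lambda>z. w z ^ p * v z)" by (rule sqint_cong_AE[OF FT_phys(1)[OF y1] _ e]) measurable
  show "FT (\<lambda>z. w z ^ p * v z) = ?y" using FT_eq_iff[OF FT_phys(1)[OF y1] 1] e FT_phys(2)[OF y1] by simp
qed

section \<open>Test functions and weak derivatives\<close>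

text \<open>The powers of x in the denominator make the family closed, up to linear combinations,
  under differentiation.\<close>

definition eb :: "nat \<Rightarrow> real \<Rightarrow> real" where "eb m x = (if 0 < x then exp (- (1 / x)) / x ^ m else 0)"

lemma eb_nonneg: "0 \<le> eb m x" by (simp add: eb_def)

text \<open>From exp y \<ge> y at y = 1 / ((m + 1) x), raised to the power m + 1. It gives the
  derivative at 0 in \<open>eb_deriv\<close>, where the difference quotient
  \<open>eb m h / h\<close> is \<open>eb (m + 1) h\<close>.\<close>

lemma eb_le: "eb m x \<le> real (Suc m) ^ Suc m * \<bar>x\<bar>"
proof (cases "0 < x")
  case True
  let ?n = "Suc m"
  have "1 / (real ?n * x) \<le> exp (1 / (real ?n * x))" using exp_ge_add_one_self[of "1 / (real ?n * x)"] by linarith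
  then have "(1 / (real ?n * x)) ^ ?n \<le> exp (1 / (real ?n * x)) ^ ?n" by (rule power_mono) (use True in simp)
  also have "\<dots> = exp (real ?n * (1 / (real ?n * x)))" by (rule exp_of_nat_mult[symmetric])
  also have "real ?n * (1 / (real ?n * x)) = 1 / x" by (simp del: of_nat_Suc)
  finally have "1 \<le> exp (1 / x) * (real ?n * x) ^ ?n" using True by (simp add: power_divide pos_divide_le_eq del: power_Suc of_nat_Suc)
  then have "exp (- (1 / x)) \<le> (real ?n * x) ^ ?n" by (simp add: exp_minus divide_simps mult.commute del: of_nat_Suc power_Suc)
  then have "exp (- (1 / x)) \<le> (real ?n ^ ?n * x) * x ^ m" by (simp add: power_mult_distrib mult_ac del: of_nat_Suc)
  then have "exp (- (1 / x)) / x ^ m \<le> real ?n ^ ?n * x" using True by (subst pos_divide_le_eq) (auto simp del: of_nat_Suc power_Suc)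
  then show ?thesis using True by (simp add: eb_def del: of_nat_Suc power_Suc)
next
  case False
  have "0 \<le> real (Suc m) ^ Suc m * \<bar>x\<bar>" by simp
  then show ?thesis by (simp only: eb_def False if_False)
qed

lemma eb_deriv: "(eb m has_real_derivative eb (m + 2) x - real m * eb (m + 1) x) (at x)"
proof -
  consider "0 < x" | "x < 0" | "x = 0" by linarith
  then show ?thesis
  proof cases
    case 1
    have "((\<lambda>x. exp (- (1 / x)) / x ^ m) has_real_derivative eb (m + 2) x - real m * eb (m + 1) x) (at x)"
    proof -
      have "((\<lambda>x. exp (- (1 / x)) * inverse x ^ m) has_real_derivative
          exp (- (1 / x)) * (1 / x\<^sup>2) * inverse x ^ m + exp (- (1 / x)) * (real m * inverse x ^ (m - 1) * (- (inverse x)\<^sup>2))) (at x)"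
      proof -
        have q: "((\<lambda>x. exp (- (1 / x))) has_real_derivative exp (- (1 / x)) * (1 / x\<^sup>2)) (at x)"
          using 1 by (auto intro!: derivative_eq_intros simp: power2_eq_square)
        have "((\<lambda>x. inverse x ^ m) has_real_derivative real m * (- (inverse x ^ Suc (Suc 0)) * inverse x ^ (m - Suc 0))) (at x)"
          by (rule DERIV_power[OF DERIV_inverse]) (use 1 in simp)
        from DERIV_mult[OF q this] show ?thesis by (rule DERIV_cong) (simp add: power2_eq_square)
      qed
      moreover have "exp (- (1 / x)) * (1 / x\<^sup>2) * inverse x ^ m + exp (- (1 / x)) * (real m * inverse x ^ (m - 1) * (- (inverse x)\<^sup>2))
          = eb (m + 2) x - real m * eb (m + 1) x"
        using 1 by (cases m) (simp_all add: eb_def power2_eq_square divide_simps power_inverse)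
      ultimately show ?thesis by (simp add: divide_inverse power_inverse)
    qed
    then show ?thesis
      by (rule has_field_derivative_transform_within_open[where S = "{0<..}"]) (use 1 in \<open>auto simp: eb_def\<close>)
  next
    case 2
    have "((\<lambda>x. 0) has_real_derivative eb (m + 2) x - real m * eb (m + 1) x) (at x)" using 2 by (simp add: eb_def)
    then show ?thesis
      by (rule has_field_derivative_transform_within_open[where S = "{..<0}"]) (use 2 in \<open>auto simp: eb_def\<close>)
  next
    case 3
    have "(\<lambda>h. (eb m (0 + h) - eb m 0) / h) \<midarrow>0\<rightarrow> 0"
    proof (rule Lim_null_comparison)
      show "\<forall>\<^sub>F h in at 0. norm ((eb m (0 + h) - eb m 0) / h) \<le> real (Suc (m + 1)) ^ Suc (m + 1) * \<bar>h\<bar>"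
      proof (intro always_eventually allI)
        fix h :: real
        have "norm ((eb m (0 + h) - eb m 0) / h) = eb (m + 1) h" by (auto simp: eb_def)
        then show "norm ((eb m (0 + h) - eb m 0) / h) \<le> real (Suc (m + 1)) ^ Suc (m + 1) * \<bar>h\<bar>" using eb_le[of "m + 1" h] by simp
      qed
      have "(\<lambda>h::real. real (Suc (m + 1)) ^ Suc (m + 1) * \<bar>h\<bar>) \<midarrow>0\<rightarrow> real (Suc (m + 1)) ^ Suc (m + 1) * \<bar>0\<bar>" by (intro tendsto_intros)
      then show "(\<lambda>h::real. real (Suc (m + 1)) ^ Suc (m + 1) * \<bar>h\<bar>) \<midarrow>0\<rightarrow> 0" by simp
    qed
    then show ?thesis unfolding 3 by (simp add: DERIV_def eb_def)
  qed
qed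

text \<open>This class contains bump functions and is closed under differentiation, hence consists of smooth functions.\<close>

inductive tf :: "(plane \<Rightarrow> real) \<Rightarrow> bool" where
  tf_const: "tf (\<lambda>z. c)"
| tf_eb: "tf (\<lambda>z. eb m (a + b * fst z + c * snd z))"
| tf_add: "tf f \<Longrightarrow> tf g \<Longrightarrow> tf (\<lambda>z. f z + g z)"
| tf_mult: "tf f \<Longrightarrow> tf g \<Longrightarrow> tf (\<lambda>z. f z * g z)"

lemma tf_has_derivative: "tf f \<Longrightarrow> \<exists>D. (\<forall>z. (f has_derivative D z) (at z)) \<and> (\<forall>v. tf (\<lambda>z. D z v))"
proof (induction rule: tf.induct)
  case (tf_const c)
  show ?case by (intro exI[of _ "\<lambda>z v. 0"]) (auto intro: tf.intros)
next
  case (tf_eb m a b c)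
  let ?l = "\<lambda>z::plane. a + b * fst z + c * snd z"
  show ?case
  proof (intro exI[of _ "\<lambda>z v. (eb (m + 2) (?l z) + - real m * eb (m + 1) (?l z)) * (b * fst v + c * snd v)"] conjI allI)
    fix z :: plane
    have "(?l has_derivative (\<lambda>v. b * fst v + c * snd v)) (at z)" by (auto intro!: derivative_eq_intros)
    from has_derivative_compose[OF this eb_deriv[of m "?l z", unfolded has_field_derivative_def]]
    show "((\<lambda>z. eb m (?l z)) has_derivative (\<lambda>v. (eb (m + 2) (?l z) + - real m * eb (m + 1) (?l z)) * (b * fst v + c * snd v))) (at z)"
      by simp
    show "tf (\<lambda>z. (eb (m + 2) (?l z) + - real m * eb (m + 1) (?l z)) * (b * fst v + c * snd v))" for v :: plane
      by (rule tf.tf_mult[OF tf.tf_add[OF tf.tf_eb tf.tf_mult[OF tf.tf_const tf.tf_eb]] tf.tf_const])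
  qed
next
  case (tf_add f g)
  then obtain D E where "\<forall>z. (f has_derivative D z) (at z)" "\<forall>v. tf (\<lambda>z. D z v)" "\<forall>z. (g has_derivative E z) (at z)" "\<forall>v. tf (\<lambda>z. E z v)"
    by blast
  then show ?case by (intro exI[of _ "\<lambda>z v. D z v + E z v"]) (auto intro: tf.intros has_derivative_add)
next
  case (tf_mult f g)
  then obtain D E where DE: "\<forall>z. (f has_derivative D z) (at z)" "\<forall>v. tf (\<lambda>z. D z v)" "\<forall>z. (g has_derivative E z) (at z)" "\<forall>v. tf (\<lambda>z. E z v)"
    by blast
  show ?case
  proof (intro exI[of _ "\<lambda>z v. f z * E z v + D z v * g z"] conjI allI)
    show "((\<lambda>z. f z * g z) has_derivative (\<lambda>v. f z * E z v + D z v * g z)) (at z)" for z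
      using DE has_derivative_mult by blast
    show "tf (\<lambda>z. f z * E z v + D z v * g z)" for v
      by (intro tf.tf_add tf.tf_mult tf_mult.hyps DE(2)[rule_format] DE(4)[rule_format])
  qed
qed

lemma tf_C_k: "tf f \<Longrightarrow> C_k k f"
proof (induction k arbitrary: f)
  case 0
  from tf_has_derivative[OF 0] obtain D where "\<And>z. (f has_derivative D z) (at z)" by blast
  then have "isCont f z" for z by (rule has_derivative_continuous)
  then show ?case by (simp add: continuous_at_imp_continuous_on del: split_paired_All)
next
  case (Suc k)
  from tf_has_derivative[OF Suc.prems] obtain D where D: "\<And>z. (f has_derivative D z) (at z)" "\<And>v. tf (\<lambda>z. D z v)" by blast
  have "frechet_derivative f (at z) = D z" for z using frechet_derivative_at[OF D(1)] by simp
  moreover have "f differentiable (at z)" for z using D(1) by (rule differentiableI)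
  ultimately show ?case using Suc.IH[OF D(2)] by simp
qed

text \<open>A smooth bump supported in the square of half-side 1 / k around a. All of them are
  dilates and translates of \<open>bump 1 0\<close>, which determines their transforms.\<close>

definition bump :: "real \<Rightarrow> plane \<Rightarrow> plane \<Rightarrow> real" where
  "bump k a z = eb 0 (1 + k * (fst z - fst a)) * eb 0 (1 - k * (fst z - fst a)) *
     (eb 0 (1 + k * (snd z - snd a)) * eb 0 (1 - k * (snd z - snd a)))"

lemma test_function_bump: assumes "0 < k" shows "test_function (bump k a)"
proof -
  have "bump k a = (\<lambda>z. eb 0 ((1 - k * fst a) + k * fst z + 0 * snd z) * eb 0 ((1 + k * fst a) + (- k) * fst z + 0 * snd z) *
     (eb 0 ((1 - k * snd a) + 0 * fst z + k * snd z) * eb 0 ((1 + k * snd a) + 0 * fst z + (- k) * snd z)))"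
    by (simp add: bump_def fun_eq_iff algebra_simps)
  then have "tf (bump k a)" by (simp only:) (rule tf.tf_mult[OF tf.tf_mult[OF tf.tf_eb tf.tf_eb] tf.tf_mult[OF tf.tf_eb tf.tf_eb]])
  moreover have "bounded {z. bump k a z \<noteq> 0}"
  proof (rule bounded_subset[OF bounded_Times])
    show "{z. bump k a z \<noteq> 0} \<subseteq> cball (fst a) (1 / k) \<times> cball (snd a) (1 / k)"
    proof (clarify, intro conjI)
      fix x y assume "bump k a (x, y) \<noteq> 0"
      then have "0 < 1 + k * (x - fst a)" "0 < 1 - k * (x - fst a)" "0 < 1 + k * (y - snd a)" "0 < 1 - k * (y - snd a)"
        by (auto simp: bump_def eb_def split: if_splits)
      then have "k * \<bar>x - fst a\<bar> \<le> 1" "k * \<bar>y - snd a\<bar> \<le> 1" by (auto simp: abs_if right_diff_distrib)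
      then show "x \<in> cball (fst a) (1 / k)" "y \<in> cball (snd a) (1 / k)"
        using assms by (auto simp: dist_real_def pos_le_divide_eq mult.commute abs_minus_commute)
    qed
  qed auto
  ultimately show ?thesis by (simp add: test_function_def tf_C_k)
qed

lemma continuous_compact_support:
  fixes f :: "plane \<Rightarrow> real"
  assumes f: "continuous_on UNIV f" and K: "compact K" "\<And>z. z \<notin> K \<Longrightarrow> f z = 0"
  shows "integrable lborel f" "square_integrable f" "\<exists>M. \<forall>z. \<bar>f z\<bar> \<le> M"
proof -
  have i: "integrable lborel g" if "continuous_on UNIV g" "\<And>z. z \<notin> K \<Longrightarrow> g z = 0" for g :: "plane \<Rightarrow> real"
  proof -
    have e: "(\<lambda>z. indicator K z *\<^sub>R g z) = g"
    proof (rule ext)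
      fix z show "indicator K z *\<^sub>R g z = g z" using that(2)[of z] by (cases "z \<in> K") simp_all
    qed
    show ?thesis using borel_integrable_compact[OF K(1) continuous_on_subset[OF that(1) subset_UNIV]] unfolding e .
  qed
  show "integrable lborel f" by (rule i[OF f K(2)])
  have "integrable lborel (\<lambda>z. (f z)\<^sup>2)" by (rule i[OF continuous_on_power[OF f]]) (simp add: K)
  then show "square_integrable f" using f by (simp add: sqint_iff borel_measurable_continuous_onI)
  have "bounded (f ` K)" by (rule compact_imp_bounded[OF compact_continuous_image[OF continuous_on_subset[OF f subset_UNIV] K(1)]])
  then obtain M where M: "\<forall>x\<in>f ` K. norm x \<le> M" unfolding bounded_iff by (elim exE)
  show "\<exists>M. \<forall>z. \<bar>f z\<bar> \<le> M"
  proof (intro exI allI)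
    fix z show "\<bar>f z\<bar> \<le> max M 0" using M K(2)[of z] by (cases "z \<in> K") (auto simp: le_max_iff_disj)
  qed
qed

lemma test_function_facts:
  assumes "test_function \<psi>"
  obtains K where "compact K" "\<And>z. z \<notin> K \<Longrightarrow> \<psi> z = 0" "\<And>z. z \<notin> K \<Longrightarrow> frechet_derivative \<psi> (at z) e = 0"
    "continuous_on UNIV \<psi>" "\<And>z. \<psi> differentiable (at z)" "continuous_on UNIV (\<lambda>z. frechet_derivative \<psi> (at z) e)"
proof
  let ?K = "closure {z. \<psi> z \<noteq> 0}"
  show "compact ?K" using assms by (simp add: test_function_def)
  show z: "\<psi> z = 0" if "z \<notin> ?K" for z
  proof (rule ccontr)
    assume "\<psi> z \<noteq> 0"
    then have "z \<in> {z. \<psi> z \<noteq> 0}" by (rule CollectI)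
    with closure_subset have "z \<in> ?K" by (rule subsetD)
    with that show False by (rule notE)
  qed
  show "frechet_derivative \<psi> (at z) e = 0" if "z \<notin> ?K" for z
  proof -
    have "(\<psi> has_derivative (\<lambda>v. 0)) (at z)"
    proof (rule has_derivative_transform_within_open[where f = "\<lambda>z. 0" and s = "- ?K"])
      show "0 = \<psi> x" if "x \<in> - ?K" for x using z[of x] that by simp
    qed (simp_all add: that open_Compl)
    from fun_cong[OF frechet_derivative_at[OF this], of e] show ?thesis by simp
  qed
  have ck: "C_k k \<psi>" for k using assms by (simp add: test_function_def)
  show "continuous_on UNIV \<psi>" using ck[of 0] by simp
  show "\<psi> differentiable (at z)" for z using ck[of 1] by (simp del: split_paired_All)
  show "continuous_on UNIV (\<lambda>z. frechet_derivative \<psi> (at z) e)" using ck[of 1] by (simp del: split_paired_All)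
qed

section \<open>Transforms of test functions and weak derivatives\<close>

lemma ft_translate:
  assumes [measurable]: "bmeas f"
  shows "ft (\<lambda>z. f (a + z)) \<zeta> = cis (ip a \<zeta>) * ft f \<zeta>"
proof -
  let ?F = "\<lambda>w. f w * cis (- 1 * ip w \<zeta>) * cis (ip a \<zeta>)"
  have "f (a + z) * cis (- 1 * ip z \<zeta>) = ?F (a + z)" for z
    by (simp add: mult.assoc cis_mult ip_simps del: mult_minus_left)
  then have "(LINT z|lborel. f (a + z) * cis (- 1 * ip z \<zeta>)) = (LINT z|lborel. ?F (a + z))" by (simp only:)
  also have "\<dots> = (LINT z|lborel. ?F z)" by (rule integral_lborel_shift) measurable
  also have "\<dots> = (LINT z|lborel. f z * cis (- 1 * ip z \<zeta>)) * cis (ip a \<zeta>)" by (rule integral_mult_left_zero)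
  finally show ?thesis unfolding ft_def by (simp only: mult.commute mult.left_commute)
qed

lemma difference_quotient_cis: "(\<lambda>n. (cis (1 / real (Suc n) * t) - 1) / of_real (1 / real (Suc n))) \<longlonglongrightarrow> \<i> * of_real t"
proof (cases "t = 0")
  case False
  let ?z = "\<lambda>n. \<i> * of_real (1 / real (Suc n) * t)"
  have "(\<lambda>n. 1 / real (Suc n)) \<longlonglongrightarrow> 0" using LIMSEQ_inverse_real_of_nat by (simp add: inverse_eq_divide)
  then have "?z \<longlonglongrightarrow> \<i> * of_real (0 * t)" by (intro tendsto_intros)
  then have z: "filterlim ?z (at 0) sequentially" using False by (auto simp: filterlim_at simp del: of_nat_Suc)
  have "(\<lambda>h. (exp (0 + h) - exp (0::complex)) / h) \<midarrow>0\<rightarrow> exp 0" using DERIV_exp[of 0] unfolding DERIV_def .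
  from filterlim_compose[OF this z] have "(\<lambda>n. (exp (?z n) - 1) / ?z n * (\<i> * of_real t)) \<longlonglongrightarrow> 1 * (\<i> * of_real t)"
    by (intro tendsto_mult tendsto_const) simp
  moreover have "(exp (?z n) - 1) / ?z n * (\<i> * of_real t) = (cis (1 / real (Suc n) * t) - 1) / of_real (1 / real (Suc n))" for n
    using False by (simp add: cis_conv_exp divide_simps del: of_nat_Suc)
  ultimately show ?thesis by simp
qed simp

text \<open>The derivative is the limit of difference quotients, whose transforms are known because
  translation multiplies the transform by a phase.\<close>

lemma ft_frechet_derivative:
  assumes "test_function \<psi>"
  shows "ft (rl (\<lambda>z. frechet_derivative \<psi> (at z) e)) \<zeta> = \<i> * of_real (ip e \<zeta>) * ft (rl \<psi>) \<zeta>"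
proof -
  let ?d = "\<lambda>z. frechet_derivative \<psi> (at z) e"
  obtain K where K: "compact K" "\<And>z. z \<notin> K \<Longrightarrow> \<psi> z = 0" "\<And>z. z \<notin> K \<Longrightarrow> ?d z = 0"
    and c: "continuous_on UNIV \<psi>" and df: "\<And>z. \<psi> differentiable (at z)" and c2: "continuous_on UNIV ?d"
    by (rule test_function_facts[OF assms, of e]) (rule that)
  note c = c c2
  have i: "integrable lborel \<psi>" by (rule continuous_compact_support[OF c(1) K(1,2)])
  have "\<exists>M. \<forall>z. \<bar>?d z\<bar> \<le> M" by (rule continuous_compact_support(3)[OF c(2) K(1,3)])
  then obtain M where M: "\<And>z. \<bar>?d z\<bar> \<le> M" by (elim exE) (rule that, rule spec)
  have [measurable]: "bmeas \<psi>" "bmeas ?d"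
    using c by (auto intro: borel_measurable_continuous_onI)
  have M0: "0 \<le> M" using M[of 0] by linarith
  obtain B where B: "\<And>z. z \<in> K \<Longrightarrow> norm z \<le> B" using compact_imp_bounded[OF K(1)] unfolding bounded_iff by blast
  define h where "h n = 1 / real (Suc n)" for n
  have h: "0 < h n" "h n \<le> 1" for n by (auto simp: h_def)
  define D where "D n z = (\<psi> (h n *\<^sub>R e + z) - \<psi> z) / h n" for n z
  have [measurable]: "bmeas (D n)" for n unfolding D_def[abs_def] by measurable
  \<comment> \<open>By the mean value theorem the difference quotient is a value of the derivative
    nearby; this gives both its limit and a majorant of compact support.\<close>
  have "\<exists>\<xi>. 0 < \<xi> \<and> \<xi> < h n \<and> D n z = ?d (\<xi> *\<^sub>R e + z)" for n z
  proof -
    have "((\<lambda>t. \<psi> (t *\<^sub>R e + z)) has_real_derivative ?d (t *\<^sub>R e + z)) (at t)" for t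
    proof -
      have lin: "((\<lambda>t. t *\<^sub>R e + z) has_derivative (\<lambda>t. t *\<^sub>R e)) (at t)" by (auto intro!: derivative_eq_intros)
      have fd: "(\<psi> has_derivative frechet_derivative \<psi> (at (t *\<^sub>R e + z))) (at (t *\<^sub>R e + z))" using df frechet_derivative_works by blast
      have "frechet_derivative \<psi> (at (t *\<^sub>R e + z)) (x *\<^sub>R e) = ?d (t *\<^sub>R e + z) * x" for x
        using linear_scale[OF has_derivative_linear[OF fd], of x e] by simp
      then show ?thesis using has_derivative_compose[OF lin fd] by (simp add: has_field_derivative_def)
    qed
    from MVT2[of 0 "h n" "\<lambda>t. \<psi> (t *\<^sub>R e + z)" "\<lambda>t. ?d (t *\<^sub>R e + z)", OF h(1) this]
    obtain \<xi> where "0 < \<xi>" "\<xi> < h n" "\<psi> (h n *\<^sub>R e + z) - \<psi> (0 *\<^sub>R e + z) = (h n - 0) * ?d (\<xi> *\<^sub>R e + z)" by blast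
    then show ?thesis using h(1)[of n] by (intro exI[of _ \<xi>]) (auto simp: D_def)
  qed
  then obtain \<xi> where \<xi>: "\<And>n z. 0 < \<xi> n z" "\<And>n z. \<xi> n z < h n" "\<And>n z. D n z = ?d (\<xi> n z *\<^sub>R e + z)" by metis
  have h0: "h \<longlonglongrightarrow> 0" unfolding h_def using LIMSEQ_inverse_real_of_nat by (simp add: inverse_eq_divide)
  have lim: "(\<lambda>n. D n z) \<longlonglongrightarrow> ?d z" for z
  proof -
    have "(\<lambda>n. \<xi> n z) \<longlonglongrightarrow> 0" by (rule tendsto_sandwich[OF _ _ tendsto_const h0]) (intro always_eventually allI less_imp_le \<xi>)+
    then have "(\<lambda>n. \<xi> n z *\<^sub>R e + z) \<longlonglongrightarrow> 0 *\<^sub>R e + z" by (intro tendsto_intros)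
    then have l: "(\<lambda>n. \<xi> n z *\<^sub>R e + z) \<longlonglongrightarrow> z" by simp
    have "isCont ?d z" using c(2) by (simp add: continuous_on_eq_continuous_at del: split_paired_All)
    from isCont_tendsto_compose[OF this l] show ?thesis unfolding \<xi>(3) .
  qed
  have bound: "\<bar>D n z\<bar> \<le> indicator (cball 0 (B + norm e)) z *\<^sub>R M" for n z
  proof (cases "\<xi> n z *\<^sub>R e + z \<in> K")
    case True
    have "norm z \<le> norm (\<xi> n z *\<^sub>R e + z) + norm (\<xi> n z *\<^sub>R e)" using norm_triangle_ineq4[of "\<xi> n z *\<^sub>R e + z" "\<xi> n z *\<^sub>R e"] by simp
    moreover have "norm (\<xi> n z *\<^sub>R e) \<le> 1 * norm e" unfolding norm_scaleR by (intro mult_right_mono) (use \<xi>(1,2)[of n z] h(2)[of n] in auto)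
    ultimately have "norm z \<le> B + norm e" using B[OF True] by linarith
    then show ?thesis using M \<xi>(3) by simp
  qed (simp add: \<xi>(3) K(3) M0)
  have ci: "integrable lborel (\<lambda>z::plane. indicator (cball 0 (B + norm e)) z *\<^sub>R M)" by (rule integrable_cball_const)
  have "(\<lambda>n. LINT z|lborel. rl (D n) z * cis (- 1 * ip z \<zeta>)) \<longlonglongrightarrow> (LINT z|lborel. rl ?d z * cis (- 1 * ip z \<zeta>))"
  proof (rule integral_dominated_convergence[OF _ _ ci])
    show "AE z in lborel. (\<lambda>n. rl (D n) z * cis (- 1 * ip z \<zeta>)) \<longlonglongrightarrow> rl ?d z * cis (- 1 * ip z \<zeta>)"
      by (intro always_eventually allI tendsto_intros lim)
    show "AE z in lborel. cmod (rl (D n) z * cis (- 1 * ip z \<zeta>)) \<le> indicator (cball 0 (B + norm e)) z *\<^sub>R M" for n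
      by (intro always_eventually allI) (simp only: norm_mult norm_cis norm_of_real mult_1_right bound)
  qed measurable
  then have 1: "(\<lambda>n. ft (rl (D n)) \<zeta>) \<longlonglongrightarrow> ft (rl ?d) \<zeta>" unfolding ft_def by (intro tendsto_intros)
  have "ft (rl (D n)) \<zeta> = (cis (h n * ip e \<zeta>) - 1) / of_real (h n) * ft (rl \<psi>) \<zeta>" for n
  proof -
    have m: "bmeas (rl \<psi>)" by measurable
    have i2: "integrable lborel (\<lambda>z. rl \<psi> (h n *\<^sub>R e + z))" by (rule integrable_lborel_shift[OF rl_integrable[OF i]])
    have "rl (D n) = (\<lambda>z. of_real (1 / h n) * (rl \<psi> (h n *\<^sub>R e + z) - rl \<psi> z))" by (simp add: D_def fun_eq_iff)
    then have "ft (rl (D n)) \<zeta> = of_real (1 / h n) * ft (\<lambda>z. rl \<psi> (h n *\<^sub>R e + z) - rl \<psi> z) \<zeta>" by (simp only: ft_cmult)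
    also have "ft (\<lambda>z. rl \<psi> (h n *\<^sub>R e + z) - rl \<psi> z) \<zeta> = cis (ip (h n *\<^sub>R e) \<zeta>) * ft (rl \<psi>) \<zeta> - ft (rl \<psi>) \<zeta>"
      unfolding ft_diff[OF i2 rl_integrable[OF i]] ft_translate[OF m] ..
    also have "ip (h n *\<^sub>R e) \<zeta> = h n * ip e \<zeta>" by (simp add: ip_def algebra_simps)
    finally show ?thesis by (simp add: algebra_simps diff_divide_distrib)
  qed
  then have 2: "(\<lambda>n. ft (rl (D n)) \<zeta>) \<longlonglongrightarrow> \<i> * of_real (ip e \<zeta>) * ft (rl \<psi>) \<zeta>"
    using tendsto_mult[OF difference_quotient_cis[of "ip e \<zeta>"] tendsto_const[of "ft (rl \<psi>) \<zeta>"]] unfolding h_def by (simp only:)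
  show ?thesis by (rule LIMSEQ_unique[OF 1 2])
qed

lemma test_function_sqint:
  assumes "test_function \<psi>"
  shows "integrable lborel \<psi>" "square_integrable \<psi>"
    "integrable lborel (\<lambda>z. frechet_derivative \<psi> (at z) e)" "square_integrable (\<lambda>z. frechet_derivative \<psi> (at z) e)"
proof -
  obtain K where K: "compact K" "\<And>z. z \<notin> K \<Longrightarrow> \<psi> z = 0" "\<And>z. z \<notin> K \<Longrightarrow> frechet_derivative \<psi> (at z) e = 0"
    and c: "continuous_on UNIV \<psi>" and df: "\<And>z. \<psi> differentiable (at z)" and c2: "continuous_on UNIV (\<lambda>z. frechet_derivative \<psi> (at z) e)"
    by (rule test_function_facts[OF assms, of e]) (rule that)
  note c = c c2
  show "integrable lborel \<psi>" "square_integrable \<psi>" by (rule continuous_compact_support[OF c(1) K(1,2)]; assumption)+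
  show "integrable lborel (\<lambda>z. frechet_derivative \<psi> (at z) e)" "square_integrable (\<lambda>z. frechet_derivative \<psi> (at z) e)"
    by (rule continuous_compact_support[OF c(2) K(1,3)]; assumption)+
qed

lemma weak_derivativeI:
  assumes f: "square_integrable f" and g: "square_integrable g"
    and gf: "AE \<zeta> in lborel. rep_G (FT g) \<zeta> = \<i> * of_real (ip e \<zeta>) * rep_G (FT f) \<zeta>"
  shows "is_weak_derivative e f g"
  unfolding is_weak_derivative_def
proof (intro conjI f g allI impI)
  fix \<psi> assume \<psi>: "test_function \<psi>"
  let ?d = "\<lambda>z. frechet_derivative \<psi> (at z) e"
  note T = test_function_sqint(1,2)[OF \<psi>] test_function_sqint(3,4)[OF \<psi>, of e]
  have m: "bmeas (ft (rl \<psi>))" "bmeas (ft (rl ?d))"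
    using rl_integrable[OF T(1)] rl_integrable[OF T(3)] by (auto intro!: ft_measurable)
  have m2: "bmeas (\<lambda>\<zeta>. \<i> * of_real (ip e \<zeta>) * rep_G (FT f) \<zeta>)"
  proof -
    have "bmeas (\<lambda>\<zeta>. \<i> * complex_of_real (ip e \<zeta>))"
      unfolding ip_def by (intro borel_measurable_continuous_onI continuous_intros)
    then show ?thesis by measurable
  qed
  have "(LINT z|lborel. f z * ?d z) = FT f \<bullet> ftG ?d" using FT_inner[OF f T(4)] FT_L1[OF T(3,4)] by simp
  also have "\<dots> = (LINT \<zeta>|lborel. Re (rep_G (FT f) \<zeta> * cnj (ft (rl ?d) \<zeta>)))"
    by (rule inner_G_AE[OF AE_I2 rep_ftG[OF T(3,4)]]) (use m in auto)
  also have "\<dots> = (LINT \<zeta>|lborel. - Re ((\<i> * of_real (ip e \<zeta>) * rep_G (FT f) \<zeta>) * cnj (ft (rl \<psi>) \<zeta>)))"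
  proof (rule Bochner_Integration.integral_cong[OF refl])
    fix \<zeta>
    have "a * cnj (\<i> * of_real t * b) = - ((\<i> * of_real t * a) * cnj b)" for a b t by simp
    then show "Re (rep_G (FT f) \<zeta> * cnj (ft (rl ?d) \<zeta>)) = - Re ((\<i> * of_real (ip e \<zeta>) * rep_G (FT f) \<zeta>) * cnj (ft (rl \<psi>) \<zeta>))"
      unfolding ft_frechet_derivative[OF \<psi>] by (simp only: uminus_complex.sel)
  qed
  also have "\<dots> = - (LINT \<zeta>|lborel. Re ((\<i> * of_real (ip e \<zeta>) * rep_G (FT f) \<zeta>) * cnj (ft (rl \<psi>) \<zeta>)))" by (rule integral_minus)
  also have "(LINT \<zeta>|lborel. Re ((\<i> * of_real (ip e \<zeta>) * rep_G (FT f) \<zeta>) * cnj (ft (rl \<psi>) \<zeta>))) = FT g \<bullet> ftG \<psi>"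
    by (rule inner_G_AE[OF gf rep_ftG[OF T(1,2)] m2 m(1), symmetric])
  also have "\<dots> = (LINT z|lborel. g z * \<psi> z)" using FT_inner[OF g T(2)] FT_L1[OF T(1,2)] by simp
  finally show "(LINT z|lborel. f z * ?d z) = - (LINT z|lborel. g z * \<psi> z)" .
qed

text \<open>Shrinking the bump dilates its transform: up to a positive factor the value at \<zeta>
  is that of \<open>bump 1 0\<close> at \<zeta> / (n + 1), which tends to a positive multiple of the
  integral of the bump.\<close>

lemma ft_bump_nonzero: "\<forall>\<^sub>F n in sequentially. ft (rl (bump (real (Suc n)) 0)) \<zeta> \<noteq> 0"
proof -
  let ?\<phi> = "bump 1 0"
  have t: "test_function ?\<phi>" by (rule test_function_bump) simp
  note T = test_function_sqint(1,2)[OF t]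
  have [measurable]: "bmeas (?\<phi>)" using T(2) by (rule sqint_measurable)
  have m: "bmeas (rl ?\<phi>)" by measurable
  define c where "c n = 1 / real (Suc n)" for n
  have c0: "c \<longlonglongrightarrow> 0" unfolding c_def using LIMSEQ_inverse_real_of_nat by (simp add: inverse_eq_divide)
  have nn: "0 \<le> ?\<phi> z" for z by (simp add: bump_def eb_nonneg)
  have "(\<lambda>n. LINT z|lborel. rl ?\<phi> z * cis (- 1 * ip z (c n *\<^sub>R \<zeta>))) \<longlonglongrightarrow> (LINT z|lborel. rl ?\<phi> z)"
  proof (rule integral_dominated_convergence[OF _ _ T(1)])
    show "AE z in lborel. (\<lambda>n. rl ?\<phi> z * cis (- 1 * ip z (c n *\<^sub>R \<zeta>))) \<longlonglongrightarrow> rl ?\<phi> z"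
    proof (intro always_eventually allI)
      fix z :: plane
      have "(\<lambda>n. rl ?\<phi> z * cis (- 1 * (fst z * (c n * fst \<zeta>) + snd z * (c n * snd \<zeta>)))) \<longlonglongrightarrow> rl ?\<phi> z * cis (- 1 * (fst z * (0 * fst \<zeta>) + snd z * (0 * snd \<zeta>)))"
        by (intro tendsto_intros c0)
      then show "(\<lambda>n. rl ?\<phi> z * cis (- 1 * ip z (c n *\<^sub>R \<zeta>))) \<longlonglongrightarrow> rl ?\<phi> z" by (simp add: ip_def)
    qed
    show "AE z in lborel. cmod (rl ?\<phi> z * cis (- 1 * ip z (c n *\<^sub>R \<zeta>))) \<le> ?\<phi> z" for n
      by (intro always_eventually allI) (simp add: norm_mult nn)
  qed measurable
  then have "(\<lambda>n. ft (rl ?\<phi>) (c n *\<^sub>R \<zeta>)) \<longlonglongrightarrow> of_real (1 / (2 * pi)) * (LINT z|lborel. rl ?\<phi> z)"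
    unfolding ft_def by (intro tendsto_intros)
  moreover have "(LINT z|lborel. rl ?\<phi> z) \<noteq> 0"
  proof
    assume "(LINT z|lborel. rl ?\<phi> z) = 0"
    then have "(LINT z|lborel. ?\<phi> z) = 0" by simp
    then have ae: "AE z in lborel. ?\<phi> z = 0" using integral_nonneg_eq_0_iff_AE[OF T(1)] nn by simp
    have pos: "?\<phi> z \<noteq> 0" if "z \<in> ball 0 1" for z
    proof -
      have "\<bar>fst z\<bar> < 1" "\<bar>snd z\<bar> < 1" using that norm_fst_le[of "fst z" "snd z"] norm_snd_le[of "snd z" "fst z"] by auto
      then show ?thesis by (auto simp: bump_def eb_def)
    qed
    from ae have "AE z in lborel. z \<notin> ball (0::plane) 1" by eventually_elim (use pos in blast)
    then have "ball (0::plane) 1 \<in> null_sets lborel" by (subst AE_iff_null_sets) auto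
    then have "negligible (ball (0::plane) 1)" unfolding negligible_iff_null_sets by (rule null_sets_completionI)
    then show False using open_not_negligible[of "ball (0::plane) 1"] by simp
  qed
  ultimately have ev: "\<forall>\<^sub>F n in sequentially. ft (rl ?\<phi>) (c n *\<^sub>R \<zeta>) \<noteq> 0"
    by (intro tendsto_imp_eventually_ne[of _ "of_real (1 / (2 * pi)) * (LINT z|lborel. rl ?\<phi> z)"]) auto
  have "ft (rl ?\<phi>) (c n *\<^sub>R \<zeta>) = of_real ((real (Suc n))\<^sup>2) * ft (rl (bump (real (Suc n)) 0)) \<zeta>" for n
  proof -
    let ?k = "real (Suc n)"
    have "ip (?k *\<^sub>R w) (c n *\<^sub>R \<zeta>) = ip w \<zeta>" for w by (simp add: ip_def c_def del: of_nat_Suc)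
    moreover have "?\<phi> (?k *\<^sub>R w) = bump ?k 0 w" for w by (simp add: bump_def)
    moreover have "(LINT w|lborel. rl ?\<phi> w * cis (- 1 * ip w (c n *\<^sub>R \<zeta>))) =
        ?k\<^sup>2 *\<^sub>R (LINT w|lborel. rl ?\<phi> (?k *\<^sub>R w) * cis (- 1 * ip (?k *\<^sub>R w) (c n *\<^sub>R \<zeta>)))"
    proof (rule integral_plane_scale)
      show "bmeas (\<lambda>w. rl ?\<phi> w * cis (- 1 * ip w (c n *\<^sub>R \<zeta>)))" by measurable
    qed simp
    ultimately show ?thesis unfolding ft_def by (simp only: scaleR_conv_of_real mult.left_commute)
  qed
  with ev show ?thesis by (auto elim: eventually_mono)
qed

text \<open>Let h be the transform of d times the conjugate transform of a bump. Testing d with all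
  translates of the bump says that the inverse transform of h vanishes everywhere, so h = 0 by
  Plancherel. At each \<zeta> one of countably many bumps has a nonzero transform.\<close>

lemma test_functions_separate:
  assumes d: "square_integrable d" and z: "\<And>\<psi>. test_function \<psi> \<Longrightarrow> (LINT z|lborel. d z * \<psi> z) = 0"
  shows "AE z in lborel. d z = 0"
proof -
  let ?x = "FT d"
  have "AE \<zeta> in lborel. rep_G ?x \<zeta> * cnj (ft (rl (bump (real (Suc n)) 0)) \<zeta>) = 0" for n
  proof -
    let ?k = "real (Suc n)"
    let ?\<phi> = "bump ?k 0"
    note T0 = test_function_sqint(1,2)[OF test_function_bump, of ?k]
    have i: "integrable lborel (bump ?k a)" and s: "square_integrable (bump ?k a)" for a using T0(1,2) by auto
    have m: "bmeas (rl ?\<phi>)" using rl_integrable[OF i] by auto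
    note fm = ft_measurable[OF m]
    define h where "h \<zeta> = rep_G ?x \<zeta> * cnj (ft (rl ?\<phi>) \<zeta>)" for \<zeta>
    have [measurable]: "bmeas h" unfolding h_def[abs_def] using fm by measurable
    obtain A where A: "l1b (rl ?\<phi>) A" using rl_integrable[OF i] l1b_ex by blast
    obtain B where B: "l2b (rl ?\<phi>) B" using s sqint_l2b by blast
    have X: "l2b (rep_G ?x) (norm ?x)" by (simp add: l2b_rep_iff)
    have h1: "integrable lborel h" unfolding h_def[abs_def]
      by (rule l1b_integrable[OF l1b_prod[OF X l2b_cnj[OF plancherel_l2b[OF rl_integrable[OF i] B]]]])
    have h2: "l2b h (cmod (of_real A) * norm ?x)"
    proof (rule l2b_mono[OF l2b_cmult[OF X, of "of_real A"]])
      show "AE z in lborel. cmod (h z) \<le> cmod (of_real A * rep_G ?x z)"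
      proof (intro always_eventually allI)
        fix z
        have "cmod (h z) = cmod (ft (rl ?\<phi>) z) * cmod (rep_G ?x z)" by (simp add: h_def norm_mult mult.commute)
        also have "\<dots> \<le> A * cmod (rep_G ?x z)" by (intro mult_right_mono ft_le[OF A]) simp
        finally show "cmod (h z) \<le> cmod (of_real A * rep_G ?x z)" using l1b_nonneg[OF A] by (simp add: norm_mult)
      qed
    qed auto
    have hh: "hermitian h" unfolding h_def[abs_def]
      by (intro hermitianI) (simp add: hermitianD[OF hermitian_rep] hermitianD[OF hermitian_ft])
    have "phys h a = 0" for a
    proof -
      have tr: "bump ?k a z = ?\<phi> (- a + z)" for z by (simp add: bump_def)
      have fa: "ft (rl (bump ?k a)) \<zeta> = cis (ip (- a) \<zeta>) * ft (rl ?\<phi>) \<zeta>" for \<zeta>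
      proof -
        have "rl (bump ?k a) = (\<lambda>z. rl ?\<phi> (- a + z))" by (rule ext) (simp only: tr)
        then show ?thesis by (simp only: ft_translate[OF m])
      qed
      have ii: "integrable lborel (\<lambda>\<zeta>. h \<zeta> * cis (- 1 * ip \<zeta> (- a)))" by (rule integrable_cis[OF h1])
      have mm: "bmeas (ft (rl (bump ?k a)))" using rl_integrable[OF i] by (auto intro!: ft_measurable)
      have "0 = ?x \<bullet> ftG (bump ?k a)"
        using z[OF test_function_bump, of ?k a] FT_inner[OF d s] FT_L1[OF i s] by simp
      also have "\<dots> = (LINT \<zeta>|lborel. Re (rep_G ?x \<zeta> * cnj (ft (rl (bump ?k a)) \<zeta>)))"
        by (rule inner_G_AE[OF AE_I2 rep_ftG[OF i s]]) (use mm in auto)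
      also have "\<dots> = (LINT \<zeta>|lborel. Re (h \<zeta> * cis (- 1 * ip \<zeta> (- a))))"
      proof (rule Bochner_Integration.integral_cong[OF refl])
        fix \<zeta>
        have "cnj (cis (ip (- a) \<zeta>)) = cis (- 1 * ip \<zeta> (- a))" by (simp add: cis_cnj ip_commute)
        then show "Re (rep_G ?x \<zeta> * cnj (ft (rl (bump ?k a)) \<zeta>)) = Re (h \<zeta> * cis (- 1 * ip \<zeta> (- a)))"
          unfolding fa h_def complex_cnj_mult by (simp only: mult.assoc mult.left_commute mult.commute)
      qed
      also have "\<dots> = Re (LINT \<zeta>|lborel. h \<zeta> * cis (- 1 * ip \<zeta> (- a)))" by (rule integral_Re[OF ii])
      finally have "Re (LINT \<zeta>|lborel. h \<zeta> * cis (- 1 * ip \<zeta> (- a))) = 0" by simp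
      then show ?thesis unfolding phys_def ft_def Re_of_real_mult by simp
    qed
    then have "ft h (- a) = 0" for a using ft_hermitian_real[OF hh, of a] by simp
    from this[of "- a" for a] have "ft h a = 0" for a by simp
    then have "(LINT z|lborel. (cmod (h z))\<^sup>2) = 0" using plancherel(2)[OF h1 h2] by simp
    then have "AE z in lborel. (cmod (h z))\<^sup>2 = 0"
      using h2 by (subst (asm) integral_nonneg_eq_0_iff_AE) (auto simp: l2b_iff)
    then show ?thesis by eventually_elim (simp add: h_def)
  qed
  then have "AE \<zeta> in lborel. \<forall>n. rep_G ?x \<zeta> * cnj (ft (rl (bump (real (Suc n)) 0)) \<zeta>) = 0"
    unfolding AE_all_countable by (rule allI)
  then have "AE \<zeta> in lborel. rep_G ?x \<zeta> = rep_G 0 \<zeta>"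
    using rep_zero
  proof eventually_elim
    case (elim \<zeta>)
    from eventually_happens[OF ft_bump_nonzero[of \<zeta>]] obtain n where "ft (rl (bump (real (Suc n)) 0)) \<zeta> \<noteq> 0"
      by (auto simp: trivial_limit_sequentially simp del: of_nat_Suc)
    then show ?case using elim(1)[rule_format, of n] elim(2) by simp
  qed
  then have "?x = 0" by (rule G_eqI)
  also have "0 = FT (\<lambda>z. 0 * d z)" by (simp only: FT_cmult[OF d] scaleR_zero_left)
  finally show ?thesis using FT_eq_iff[OF d sqint_cmult[OF d, of 0]] by simp
qed

lemma weak_derivative_unique:
  assumes "is_weak_derivative e f g" "is_weak_derivative e f g'"
  shows "AE z in lborel. g z = g' z"
proof -
  have s: "square_integrable g" "square_integrable g'" using assms by (auto simp: is_weak_derivative_def)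
  have "AE z in lborel. g z - g' z = 0"
  proof (rule test_functions_separate[OF sqint_diff[OF s]])
    fix \<psi> assume \<psi>: "test_function \<psi>"
    note T = test_function_sqint(1,2)[OF \<psi>] test_function_sqint(3,4)[OF \<psi>, of e]
    have "(LINT z|lborel. g z * \<psi> z) = (LINT z|lborel. g' z * \<psi> z)"
    proof -
      have "- (LINT z|lborel. g z * \<psi> z) = - (LINT z|lborel. g' z * \<psi> z)"
        using assms[unfolded is_weak_derivative_def, THEN conjunct2, THEN conjunct2, rule_format, OF \<psi>] by (simp only:)
      then show ?thesis by simp
    qed
    then show "(LINT z|lborel. (g z - g' z) * \<psi> z) = 0"
      using sqint_prod_integrable[OF s(1) T(2)] sqint_prod_integrable[OF s(2) T(2)] by (simp add: left_diff_distrib)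
  qed
  then show ?thesis by simp
qed

section \<open>The Cauchy problem\<close>

lemma sobolev_density_eq: "sobolev_density \<sigma> f \<zeta> = (cmod (of_real (wt \<sigma> \<zeta>) * fourier f \<zeta>))\<^sup>2"
proof -
  have "(1 + (fst \<zeta>)\<^sup>2 + (snd \<zeta>)\<^sup>2) powr \<sigma> = (wt 2 \<zeta>) powr \<sigma>" by (simp only: wt_2)
  also have "\<dots> = (wt \<sigma> \<zeta>)\<^sup>2"
    by (simp only: wt_def powr_powr power2_eq_square powr_add[symmetric] mult_2)
  finally show ?thesis by (simp add: sobolev_density_def norm_mult power_mult_distrib)
qed

lemma
  assumes f: "square_integrable f"
  shows sobolev_density_integrable: "integrable lborel (sobolev_density \<sigma> f) \<longleftrightarrow> (\<exists>A. hb \<sigma> (rep_G (FT f)) A)"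
    and sobolev_norm_integral: "(LINT \<zeta>|lborel. sobolev_density \<sigma> f \<zeta>) = (LINT \<zeta>|lborel. (cmod (of_real (wt \<sigma> \<zeta>) * rep_G (FT f) \<zeta>))\<^sup>2)"
proof -
  have [measurable]: "bmeas (fourier f)" by (rule fourier_measurable[OF f])
  have ae: "AE \<zeta> in lborel. sobolev_density \<sigma> f \<zeta> = (cmod (of_real (wt \<sigma> \<zeta>) * rep_G (FT f) \<zeta>))\<^sup>2"
    using fourier_FT[OF f] by eventually_elim (simp only: sobolev_density_eq)
  have m: "bmeas (sobolev_density \<sigma> f)" unfolding sobolev_density_eq[abs_def] by measurable
  have "integrable lborel (sobolev_density \<sigma> f) \<longleftrightarrow> integrable lborel (\<lambda>\<zeta>. (cmod (of_real (wt \<sigma> \<zeta>) * rep_G (FT f) \<zeta>))\<^sup>2)"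
    by (rule integrable_cong_AE[OF _ _ ae]) (use m in measurable)
  also have "\<dots> \<longleftrightarrow> (\<exists>A. hb \<sigma> (rep_G (FT f)) A)"
  proof
    assume "integrable lborel (\<lambda>\<zeta>. (cmod (of_real (wt \<sigma> \<zeta>) * rep_G (FT f) \<zeta>))\<^sup>2)"
    then have "l2b (\<lambda>\<zeta>. of_real (wt \<sigma> \<zeta>) * rep_G (FT f) \<zeta>) (sqrt (LINT \<zeta>|lborel. (cmod (of_real (wt \<sigma> \<zeta>) * rep_G (FT f) \<zeta>))\<^sup>2))"
      unfolding l2b_iff by simp
    then show "\<exists>A. hb \<sigma> (rep_G (FT f)) A" unfolding hb_def by (intro exI conjI) auto
  next
    assume "\<exists>A. hb \<sigma> (rep_G (FT f)) A"
    then show "integrable lborel (\<lambda>\<zeta>. (cmod (of_real (wt \<sigma> \<zeta>) * rep_G (FT f) \<zeta>))\<^sup>2)" by (auto simp: hb_def l2b_iff)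
  qed
  finally show "integrable lborel (sobolev_density \<sigma> f) \<longleftrightarrow> (\<exists>A. hb \<sigma> (rep_G (FT f)) A)" .
  show "(LINT \<zeta>|lborel. sobolev_density \<sigma> f \<zeta>) = (LINT \<zeta>|lborel. (cmod (of_real (wt \<sigma> \<zeta>) * rep_G (FT f) \<zeta>))\<^sup>2)"
    by (rule integral_cong_AE[OF _ _ ae]) (use m in measurable)
qed

lemma sobolev_space_iff: "f \<in> sobolev_space \<sigma> \<longleftrightarrow> square_integrable f \<and> (\<exists>A. hb \<sigma> (rep_G (FT f)) A)"
  using sobolev_density_integrable[of f \<sigma>] by (auto simp: sobolev_space_def)

lemma FT_cong_AE: "square_integrable f \<Longrightarrow> square_integrable g \<Longrightarrow> AE z in lborel. f z = g z \<Longrightarrow> FT f = FT g"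
  by (simp add: FT_eq_iff)

lemma multiplier_ex:
  assumes "hermitian m" "l2b (\<lambda>z. m z * rep_G x z) A"
  shows "\<exists>f. square_integrable f \<and> (AE z in lborel. rep_G (FT f) z = m z * rep_G x z)"
proof -
  have "hl2 (\<lambda>z. m z * rep_G x z)" using hl2_mul[OF assms(1) gdomI[OF assms(2)]] .
  from rep_abs[OF this] FT_surj[of "abs_G (\<lambda>z. m z * rep_G x z)"] show ?thesis by (elim exE conjE) (auto intro!: exI)
qed

definition inverse_FT :: "G \<Rightarrow> plane \<Rightarrow> real" where "inverse_FT x = (SOME f. square_integrable f \<and> FT f = x)"

lemma inverse_FT: "square_integrable (inverse_FT x)" "FT (inverse_FT x) = x"
  unfolding inverse_FT_def using someI_ex[OF FT_surj[of x]] by auto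

text \<open>For the forward direction the multiplier provides a weak derivative g0, and g equals it
  by uniqueness.\<close>

lemma weak_derivative_iff:
  assumes f: "square_integrable f" and b: "l2b (\<lambda>\<zeta>. of_real (ip e \<zeta>) * rep_G (FT f) \<zeta>) A"
  shows "is_weak_derivative e f g \<longleftrightarrow> square_integrable g \<and>
    (AE \<zeta> in lborel. rep_G (FT g) \<zeta> = \<i> * of_real (ip e \<zeta>) * rep_G (FT f) \<zeta>)"
proof (intro iffI conjI)
  assume w: "is_weak_derivative e f g"
  then show g: "square_integrable g" by (simp add: is_weak_derivative_def)
  have h: "hermitian (\<lambda>\<zeta>. \<i> * of_real (ip e \<zeta>))" by (rule hermitian_imag) (simp add: ip_simps)
  have "l2b (\<lambda>\<zeta>. \<i> * of_real (ip e \<zeta>) * rep_G (FT f) \<zeta>) (cmod \<i> * A)" using l2b_cmult[OF b, of \<i>] by (simp add: mult.assoc)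
  from multiplier_ex[OF h this] obtain g0 where g0: "square_integrable g0"
    and ae: "AE \<zeta> in lborel. rep_G (FT g0) \<zeta> = \<i> * of_real (ip e \<zeta>) * rep_G (FT f) \<zeta>" by blast
  have "is_weak_derivative e f g0" by (rule weak_derivativeI[OF f g0 ae])
  from weak_derivative_unique[OF w this] have "FT g = FT g0" by (rule FT_cong_AE[OF g g0])
  with ae show "AE \<zeta> in lborel. rep_G (FT g) \<zeta> = \<i> * of_real (ip e \<zeta>) * rep_G (FT f) \<zeta>" by simp
next
  assume "square_integrable g \<and> (AE \<zeta> in lborel. rep_G (FT g) \<zeta> = \<i> * of_real (ip e \<zeta>) * rep_G (FT f) \<zeta>)"
  then show "is_weak_derivative e f g" using weak_derivativeI[OF f] by blast
qed

lemma hilbert_transform_iff: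
  "is_hilbert_transform f g \<longleftrightarrow> square_integrable f \<and> square_integrable g \<and>
    (AE \<zeta> in lborel. rep_G (FT g) \<zeta> = \<i> * of_real (sgn (fst \<zeta>)) * rep_G (FT f) \<zeta>)"
proof (cases "square_integrable f \<and> square_integrable g")
  case True
  have "(AE \<zeta> in lborel. fourier g \<zeta> = \<i> * of_real (sgn (fst \<zeta>)) * fourier f \<zeta>) \<longleftrightarrow>
      (AE \<zeta> in lborel. rep_G (FT g) \<zeta> = \<i> * of_real (sgn (fst \<zeta>)) * rep_G (FT f) \<zeta>)"
  proof
    assume "AE \<zeta> in lborel. fourier g \<zeta> = \<i> * of_real (sgn (fst \<zeta>)) * fourier f \<zeta>"
    then show "AE \<zeta> in lborel. rep_G (FT g) \<zeta> = \<i> * of_real (sgn (fst \<zeta>)) * rep_G (FT f) \<zeta>"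
      using fourier_FT[OF conjunct1[OF True]] fourier_FT[OF conjunct2[OF True]] by eventually_elim simp
  next
    assume "AE \<zeta> in lborel. rep_G (FT g) \<zeta> = \<i> * of_real (sgn (fst \<zeta>)) * rep_G (FT f) \<zeta>"
    then show "AE \<zeta> in lborel. fourier g \<zeta> = \<i> * of_real (sgn (fst \<zeta>)) * fourier f \<zeta>"
      using fourier_FT[OF conjunct1[OF True]] fourier_FT[OF conjunct2[OF True]] by eventually_elim simp
  qed
  then show ?thesis by (simp add: is_hilbert_transform_def)
qed (auto simp: is_hilbert_transform_def)

lemma sgn_fst_measurable [measurable]: "bmeas (\<lambda>z::plane. sgn (fst z))"
  unfolding sgn_if by measurable

lemma snd_le_jb: "\<bar>snd z\<bar> \<le> jb z"
  unfolding jb_def by (intro real_le_rsqrt) (simp add: power2_abs)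

section \<open>The equation in frequency variables\<close>

context
  fixes s \<alpha> :: real and p :: nat
  assumes s2: "2 < s" and p1: "1 \<le> p"
begin

lemma l2b_multiplier:
  assumes "hb s f A" "bmeas m" "\<And>z. cmod (m z) \<le> wt s z" shows "l2b (\<lambda>z. m z * f z) A"
  unfolding hb_0[symmetric]
proof (rule hb_dominated[OF assms(1)])
  show "bmeas (\<lambda>z. m z * f z)" by (intro borel_measurable_times assms(2) hb_measurable[OF assms(1)])
  show "wt 0 z * cmod (m z * f z) \<le> wt s z * cmod (f z)" for z using assms(3)[of z] by (simp add: norm_mult mult_right_mono)
qed simp

lemma jb_le_wt: "jb z \<le> wt s z" using wt_mono[of 1 s z] s2 by (simp add: wt_1)

lemma coord_bounds:
  "\<bar>fst z\<bar> \<le> wt s z" "\<bar>snd z\<bar> \<le> wt s z" "\<bar>fst z * fst z\<bar> \<le> wt 2 z" "\<bar>snd z * snd z\<bar> \<le> wt 2 z" "wt 2 z \<le> wt s z"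
proof -
  show "\<bar>fst z\<bar> \<le> wt s z" using fst_le_jb[of z] jb_le_wt[of z] by linarith
  show "\<bar>snd z\<bar> \<le> wt s z" using snd_le_jb[of z] jb_le_wt[of z] by linarith
  show "\<bar>fst z * fst z\<bar> \<le> wt 2 z" "\<bar>snd z * snd z\<bar> \<le> wt 2 z" unfolding wt_2 by (simp_all add: power2_eq_square abs_mult)
  show "wt 2 z \<le> wt s z" by (rule wt_mono) (use s2 in simp)
qed

lemma spatial_terms:
  assumes w: "square_integrable w" and hw: "hb s (rep_G (FT w)) A"
    and e: "e = (1, 0) \<or> e = (0, 1)"
    and wx: "is_weak_derivative e w wx" and wxx: "is_weak_derivative e wx wxx" and H: "is_hilbert_transform wxx h"
  shows "AE \<zeta> in lborel. rep_G (FT wx) \<zeta> = \<i> * of_real (ip e \<zeta>) * rep_G (FT w) \<zeta>"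
    "AE \<zeta> in lborel. rep_G (FT h) \<zeta> = - \<i> * of_real (sgn (fst \<zeta>) * (ip e \<zeta>)\<^sup>2) * rep_G (FT w) \<zeta>"
proof -
  have im [measurable]: "bmeas (\<lambda>\<zeta>. complex_of_real (ip e \<zeta>))"
    unfolding ip_def by (intro borel_measurable_continuous_onI continuous_intros)
  have b1: "\<bar>ip e \<zeta>\<bar> \<le> wt s \<zeta>" and b2: "\<bar>ip e \<zeta> * ip e \<zeta>\<bar> \<le> wt s \<zeta>" for \<zeta>
    using e coord_bounds[of \<zeta>] by (auto simp: ip_def)
  have l1: "l2b (\<lambda>\<zeta>. of_real (ip e \<zeta>) * rep_G (FT w) \<zeta>) A" by (rule l2b_multiplier[OF hw]) (use b1 in auto)
  show 1: "AE \<zeta> in lborel. rep_G (FT wx) \<zeta> = \<i> * of_real (ip e \<zeta>) * rep_G (FT w) \<zeta>"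
    using weak_derivative_iff[OF w l1] wx by blast
  have sx: "square_integrable wx" using wx by (simp add: is_weak_derivative_def)
  have "l2b (\<lambda>\<zeta>. (of_real (ip e \<zeta>) * (\<i> * of_real (ip e \<zeta>))) * rep_G (FT w) \<zeta>) A"
    by (rule l2b_multiplier[OF hw]) (use b2 in \<open>auto simp: norm_mult abs_mult\<close>)
  then have l2: "l2b (\<lambda>\<zeta>. of_real (ip e \<zeta>) * rep_G (FT wx) \<zeta>) A"
    by (rule l2b_AE) (use 1 in \<open>auto elim: eventually_mono\<close>)
  have 2: "AE \<zeta> in lborel. rep_G (FT wxx) \<zeta> = \<i> * of_real (ip e \<zeta>) * rep_G (FT wx) \<zeta>"
    using weak_derivative_iff[OF sx l2] wxx by blast
  have 3: "AE \<zeta> in lborel. rep_G (FT h) \<zeta> = \<i> * of_real (sgn (fst \<zeta>)) * rep_G (FT wxx) \<zeta>"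
    using H by (simp add: hilbert_transform_iff)
  show "AE \<zeta> in lborel. rep_G (FT h) \<zeta> = - \<i> * of_real (sgn (fst \<zeta>) * (ip e \<zeta>)\<^sup>2) * rep_G (FT w) \<zeta>"
    using 1 2 3 by eventually_elim (simp add: power2_eq_square mult_ac)
qed

lemma spatial_terms_exist:
  assumes w: "square_integrable w" and hw: "hb s (rep_G (FT w)) A" and e: "e = (1, 0) \<or> e = (0, 1)"
  shows "\<exists>wx wxx h. is_weak_derivative e w wx \<and> is_weak_derivative e wx wxx \<and> is_hilbert_transform wxx h \<and> h \<in> sobolev_space (s - 2)"
proof -
  have im [measurable]: "bmeas (\<lambda>\<zeta>. complex_of_real (ip e \<zeta>))"
    unfolding ip_def by (intro borel_measurable_continuous_onI continuous_intros)
  have b1: "\<bar>ip e \<zeta>\<bar> \<le> wt s \<zeta>" and b2: "\<bar>ip e \<zeta> * ip e \<zeta>\<bar> \<le> wt 2 \<zeta>" and b3: "\<bar>ip e \<zeta> * ip e \<zeta>\<bar> \<le> wt s \<zeta>" for \<zeta>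
    using e coord_bounds[of \<zeta>] by (auto simp: ip_def)
  have h: "hermitian (\<lambda>\<zeta>. \<i> * of_real (ip e \<zeta>))" by (rule hermitian_imag) (simp add: ip_simps)
  have l1: "l2b (\<lambda>\<zeta>. (\<i> * of_real (ip e \<zeta>)) * rep_G (FT w) \<zeta>) A" by (rule l2b_multiplier[OF hw]) (use b1 in \<open>auto simp: norm_mult\<close>)
  from multiplier_ex[OF h this] obtain wx where wx: "square_integrable wx"
    and 1: "AE \<zeta> in lborel. rep_G (FT wx) \<zeta> = \<i> * of_real (ip e \<zeta>) * rep_G (FT w) \<zeta>" by (elim exE conjE)
  have "l2b (\<lambda>\<zeta>. ((\<i> * of_real (ip e \<zeta>)) * (\<i> * of_real (ip e \<zeta>))) * rep_G (FT w) \<zeta>) A"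
    by (rule l2b_multiplier[OF hw]) (use b3 in \<open>auto simp: norm_mult abs_mult\<close>)
  then have "l2b (\<lambda>\<zeta>. (\<i> * of_real (ip e \<zeta>)) * rep_G (FT wx) \<zeta>) A"
    by (rule l2b_AE) (use 1 in \<open>auto elim: eventually_mono\<close>)
  from multiplier_ex[OF h this] obtain wxx where wxx: "square_integrable wxx"
    and 2: "AE \<zeta> in lborel. rep_G (FT wxx) \<zeta> = \<i> * of_real (ip e \<zeta>) * rep_G (FT wx) \<zeta>" by (elim exE conjE)
  have h': "hermitian (\<lambda>\<zeta>::plane. \<i> * of_real (sgn (fst \<zeta>)))" by (rule hermitian_imag) (simp add: sgn_minus)
  obtain B where B: "l2b (rep_G (FT wxx)) B" using rep_l2b_ex by blast
  have "l2b (\<lambda>\<zeta>. (\<i> * of_real (sgn (fst \<zeta>))) * rep_G (FT wxx) \<zeta>) B"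
    by (rule l2b_mono[OF B]) (auto simp: norm_mult sgn_if simp del: split_paired_All intro!: always_eventually)
  from multiplier_ex[OF h' this] obtain g where g: "square_integrable g"
    and 3: "AE \<zeta> in lborel. rep_G (FT g) \<zeta> = \<i> * of_real (sgn (fst \<zeta>)) * rep_G (FT wxx) \<zeta>" by (elim exE conjE)
  let ?m = "\<lambda>\<zeta>. - \<i> * of_real (sgn (fst \<zeta>) * (ip e \<zeta> * ip e \<zeta>)) * rep_G (FT w) \<zeta>"
  have mm: "bmeas ?m"
    unfolding of_real_mult by (intro borel_measurable_times borel_measurable_const im rep_measurable) measurable
  have 4: "AE \<zeta> in lborel. rep_G (FT g) \<zeta> = ?m \<zeta>"
    using 1 2 3 by eventually_elim (simp add: mult_ac)
  have "hb (s - 2) ?m A"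
  proof (rule hb_dominated[OF hw mm])
    fix \<zeta>
    have "cmod (?m \<zeta>) \<le> \<bar>ip e \<zeta> * ip e \<zeta>\<bar> * cmod (rep_G (FT w) \<zeta>)"
      by (auto simp: norm_mult abs_mult sgn_if)
    also have "\<dots> \<le> wt 2 \<zeta> * cmod (rep_G (FT w) \<zeta>)" by (intro mult_right_mono b2) simp
    finally have "wt (s - 2) \<zeta> * cmod (?m \<zeta>) \<le> wt (s - 2) \<zeta> * (wt 2 \<zeta> * cmod (rep_G (FT w) \<zeta>))" by (intro mult_left_mono) auto
    also have "\<dots> = wt s \<zeta> * cmod (rep_G (FT w) \<zeta>)" using wt_add[of "s - 2" 2 \<zeta>] by simp
    finally show "wt (s - 2) \<zeta> * cmod (?m \<zeta>) \<le> wt s \<zeta> * cmod (rep_G (FT w) \<zeta>)" .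
  qed simp
  then have "hb (s - 2) (rep_G (FT g)) A" by (subst hb_cong_AE[OF rep_measurable mm 4])
  then have "g \<in> sobolev_space (s - 2)" using g by (auto simp: sobolev_space_iff)
  moreover have "is_weak_derivative e w wx" by (rule weak_derivativeI[OF w wx 1])
  moreover have "is_weak_derivative e wx wxx" by (rule weak_derivativeI[OF wx wxx 2])
  moreover have "is_hilbert_transform wxx g" using wxx g 3 by (simp add: hilbert_transform_iff)
  ultimately show ?thesis by blast
qed

text \<open>For w in H^s the weak derivatives and Hilbert transforms exist and are unique up to null
  sets, and all spatial terms lie in H^(s - 2). What remains of the equation is one identity for the
  transform of w'.\<close>

lemma equation_iff:
  assumes w: "w \<in> sobolev_space s"
  shows "equation_holds (s - 2) p \<alpha> w w' \<longleftrightarrow> square_integrable w' \<and> (AE \<zeta> in lborel. rep_G (FT w') \<zeta> = vel \<alpha> p (rep_G (FT w)) \<zeta>)"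
proof -
  have w2: "square_integrable w" using w by (simp add: sobolev_space_iff)
  obtain A where hw: "hb s (rep_G (FT w)) A" using w by (auto simp: sobolev_space_iff)
  note rn = rep_NL[OF s2 p1 hw]
  have key: "FT (\<lambda>z. w z ^ p * wx z) = NL p (FT w) \<and> square_integrable (\<lambda>z. w z ^ p * wx z) \<and>
      ((AE z in lborel. w' z + Hx z + \<alpha> * Hy z + w z ^ p * wx z = 0) \<longleftrightarrow> (AE \<zeta> in lborel. rep_G (FT w') \<zeta> = vel \<alpha> p (rep_G (FT w)) \<zeta>))"
    if "is_weak_derivative (1, 0) w wx" "is_weak_derivative (1, 0) wx wxx" "is_hilbert_transform wxx Hx"
       "is_weak_derivative (0, 1) w wy" "is_weak_derivative (0, 1) wy wyy" "is_hilbert_transform wyy Hy"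
       "square_integrable w'" for wx wxx Hx wy wyy Hy
  proof -
    note X = spatial_terms[OF w2 hw _ that(1-3)] and Y = spatial_terms[OF w2 hw _ that(4-6)]
    have sq: "square_integrable wx" "square_integrable Hx" "square_integrable Hy"
      using that by (auto simp: is_weak_derivative_def is_hilbert_transform_def)
    have dxw: "AE \<zeta> in lborel. rep_G (FT wx) \<zeta> = dx (rep_G (FT w)) \<zeta>" using X(1) by (simp add: ip_def dx_def)
    note N = FT_nl[OF s2 p1 w2 hw sq(1) dxw]
    let ?F = "\<lambda>z. w' z + Hx z + \<alpha> * Hy z + w z ^ p * wx z"
    have sF: "square_integrable ?F" by (intro sqint_add sqint_cmult that sq N)
    have z: "FT (\<lambda>z::plane. 0 * w z) = 0" "square_integrable (\<lambda>z. 0 * w z)" using FT_cmult[OF w2, of 0] sqint_cmult[OF w2, of 0] by simp_all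
    have FF: "FT ?F = FT w' + FT Hx + \<alpha> *\<^sub>R FT Hy + NL p (FT w)"
      using that(7) sq N by (simp add: FT_add FT_cmult sqint_add sqint_cmult)
    have "(AE z in lborel. ?F z = 0) \<longleftrightarrow> FT ?F = 0" using FT_eq_iff[OF sF z(2)] z(1) by simp
    also have "\<dots> \<longleftrightarrow> (AE \<zeta> in lborel. rep_G (FT ?F) \<zeta> = 0)"
    proof
      assume "FT ?F = 0" then show "AE \<zeta> in lborel. rep_G (FT ?F) \<zeta> = 0" using rep_zero by simp
    next
      assume "AE \<zeta> in lborel. rep_G (FT ?F) \<zeta> = 0"
      with rep_zero have "AE \<zeta> in lborel. rep_G (FT ?F) \<zeta> = rep_G 0 \<zeta>" by eventually_elim simp
      then show "FT ?F = 0" by (rule G_eqI)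
    qed
    finally have i1: "(AE z in lborel. ?F z = 0) \<longleftrightarrow> (AE \<zeta> in lborel. rep_G (FT ?F) \<zeta> = 0)" .
    have "AE \<zeta> in lborel. rep_G (FT ?F) \<zeta> = rep_G (FT w') \<zeta> - vel \<alpha> p (rep_G (FT w)) \<zeta>"
      unfolding FF using rep_add[of "FT w' + FT Hx + \<alpha> *\<^sub>R FT Hy" "NL p (FT w)"] rep_add[of "FT w' + FT Hx" "\<alpha> *\<^sub>R FT Hy"]
        rep_add[of "FT w'" "FT Hx"] rep_scaleR[of \<alpha> "FT Hy"] X(2)[OF disjI1[OF refl]] Y(2)[OF disjI2[OF refl]] rn
    proof eventually_elim
      case (elim \<zeta>)
      show ?case
        by (simp only: elim) (simp add: vel_def[OF s2 p1] om_def ip_def algebra_simps)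
    qed
    then have "(AE \<zeta> in lborel. rep_G (FT ?F) \<zeta> = 0) \<longleftrightarrow> (AE \<zeta> in lborel. rep_G (FT w') \<zeta> = vel \<alpha> p (rep_G (FT w)) \<zeta>)"
    proof -
      assume ae: "AE \<zeta> in lborel. rep_G (FT ?F) \<zeta> = rep_G (FT w') \<zeta> - vel \<alpha> p (rep_G (FT w)) \<zeta>"
      show ?thesis
      proof
        assume "AE \<zeta> in lborel. rep_G (FT ?F) \<zeta> = 0"
        with ae show "AE \<zeta> in lborel. rep_G (FT w') \<zeta> = vel \<alpha> p (rep_G (FT w)) \<zeta>" by eventually_elim simp
      next
        assume "AE \<zeta> in lborel. rep_G (FT w') \<zeta> = vel \<alpha> p (rep_G (FT w)) \<zeta>"
        with ae show "AE \<zeta> in lborel. rep_G (FT ?F) \<zeta> = 0" by eventually_elim simp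
      qed
    qed
    with i1 have "(AE z in lborel. ?F z = 0) \<longleftrightarrow> (AE \<zeta> in lborel. rep_G (FT w') \<zeta> = vel \<alpha> p (rep_G (FT w)) \<zeta>)" by (rule trans)
    with N show ?thesis by (intro conjI)
  qed
  show ?thesis
  proof
    assume "equation_holds (s - 2) p \<alpha> w w'"
    then obtain wx wxx wy wyy Hx Hy where q: "is_weak_derivative (1, 0) w wx" "is_weak_derivative (1, 0) wx wxx" "is_hilbert_transform wxx Hx"
       "is_weak_derivative (0, 1) w wy" "is_weak_derivative (0, 1) wy wyy" "is_hilbert_transform wyy Hy" "w' \<in> sobolev_space (s - 2)"
       "AE z in lborel. w' z + Hx z + \<alpha> * Hy z + w z ^ p * wx z = 0"
      unfolding equation_holds_def by (elim exE conjE) (rule that)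
    have "square_integrable w'" using q(7) by (simp add: sobolev_space_iff)
    moreover from iffD1[OF key[OF q(1-6) this, THEN conjunct2, THEN conjunct2] q(8)]
    have "AE \<zeta> in lborel. rep_G (FT w') \<zeta> = vel \<alpha> p (rep_G (FT w)) \<zeta>" .
    ultimately show "square_integrable w' \<and> (AE \<zeta> in lborel. rep_G (FT w') \<zeta> = vel \<alpha> p (rep_G (FT w)) \<zeta>)" by (rule conjI)
  next
    assume w': "square_integrable w' \<and> (AE \<zeta> in lborel. rep_G (FT w') \<zeta> = vel \<alpha> p (rep_G (FT w)) \<zeta>)"
    obtain wx wxx Hx where x: "is_weak_derivative (1, 0) w wx" "is_weak_derivative (1, 0) wx wxx" "is_hilbert_transform wxx Hx" "Hx \<in> sobolev_space (s - 2)"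
      using spatial_terms_exist[OF w2 hw disjI1[OF refl]] by (elim exE conjE) (rule that)
    obtain wy wyy Hy where y: "is_weak_derivative (0, 1) w wy" "is_weak_derivative (0, 1) wy wyy" "is_hilbert_transform wyy Hy" "Hy \<in> sobolev_space (s - 2)"
      using spatial_terms_exist[OF w2 hw disjI2[OF refl]] by (elim exE conjE) (rule that)
    note k = key[OF x(1-3) y(1-3) conjunct1[OF w']]
    obtain B where "\<forall>f A. hb s f A \<longrightarrow> hb (s - 2) (vel \<alpha> p f) (B * (A + A ^ (p + 1)))" using hb_vel[OF s2 p1] by blast
    then have "hb (s - 2) (vel \<alpha> p (rep_G (FT w))) (B * (A + A ^ (p + 1)))" using hw by blast
    then have "hb (s - 2) (rep_G (FT w')) (B * (A + A ^ (p + 1)))"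
      using w' by (subst hb_cong_AE[OF rep_measurable vel_measurable[OF s2 p1 rep_measurable]]) auto
    then have w's: "w' \<in> sobolev_space (s - 2)" using w' by (auto simp: sobolev_space_iff)
    obtain E where "\<forall>f A. hb s f A \<longrightarrow> hb (s - 1) (nl p f) (E * A ^ (p + 1))" using nl_hb[OF s2 p1] by blast
    then have "hb (s - 1) (nl p (rep_G (FT w))) (E * A ^ (p + 1))" using hw by blast
    then have "hb (s - 1) (rep_G (NL p (FT w))) (E * A ^ (p + 1))"
      by (subst hb_cong_AE[OF rep_measurable nl_measurable[OF rep_measurable] rn])
    then have "hb (s - 2) (rep_G (NL p (FT w))) (E * A ^ (p + 1))" by (rule hb_mono) auto
    then have "\<exists>A. hb (s - 2) (rep_G (FT (\<lambda>z. w z ^ p * wx z))) A" unfolding conjunct1[OF k] by (rule exI)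
    then have n: "(\<lambda>z. w z ^ p * wx z) \<in> sobolev_space (s - 2)"
      unfolding sobolev_space_iff using k[THEN conjunct2, THEN conjunct1] by (intro conjI)
    note eq = iffD2[OF k[THEN conjunct2, THEN conjunct2] conjunct2[OF w']]
    show "equation_holds (s - 2) p \<alpha> w w'"
      unfolding equation_holds_def
      by (intro exI[of _ wx] exI[of _ wxx] exI[of _ wy] exI[of _ wyy] exI[of _ Hx] exI[of _ Hy] conjI x y w's n eq)
  qed
qed

end

section \<open>From the flow to solutions in Sobolev spaces\<close>

context
  fixes s \<alpha> :: real and p :: nat
  assumes s2: "2 < s" and p1: "1 \<le> p"
begin

lemmas J_hb' = J_hb[OF s2 p1]

lemma hermitian_wt: "hermitian (\<lambda>z. complex_of_real (wt \<sigma> z))" by (rule hermitian_real) simp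

lemma J_diff: assumes "hb \<sigma> (rep_G x) A" "hb \<sigma> (rep_G y) B" shows "J \<sigma> (x - y) = J \<sigma> x - J \<sigma> y"
  unfolding J_def[OF s2 p1] by (rule mul_diff[OF hermitian_wt _ J_hb'(1)[OF assms(1)] J_hb'(1)[OF assms(2)]]) measurable

lemma J_scaleR: assumes "hb \<sigma> (rep_G x) A" shows "J \<sigma> (c *\<^sub>R x) = c *\<^sub>R J \<sigma> x"
  unfolding J_def[OF s2 p1] by (rule mul_scaleR[OF hermitian_wt _ J_hb'(1)[OF assms]]) measurable

lemma hb_rep_diff:
  assumes "hb \<sigma> (rep_G x) A" "hb \<sigma> (rep_G y) B" shows "hb \<sigma> (rep_G (x - y)) (A + B)"
  using hb_diff[OF assms] by (subst hb_cong_AE[OF rep_measurable _ rep_diff]) measurable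

lemma hb_rep_scaleR:
  assumes "hb \<sigma> (rep_G x) A" shows "\<exists>B. hb \<sigma> (rep_G (c *\<^sub>R x)) B"
proof -
  have "l2b (\<lambda>z. of_real c * (of_real (wt \<sigma> z) * rep_G x z)) (cmod (of_real c) * A)" by (rule l2b_cmult[OF hb_l2b[OF assms]])
  then have h: "hb \<sigma> (\<lambda>z. of_real c * rep_G x z) (cmod (of_real c) * A)" unfolding hb_def by (simp add: mult.left_commute)
  have "hb \<sigma> (rep_G (c *\<^sub>R x)) (cmod (of_real c) * A)"
    by (subst hb_cong_AE[OF rep_measurable hb_measurable[OF h] rep_scaleR]) (rule h)
  then show ?thesis by (rule exI)
qed

lemma sobolev_norm_J: assumes "f \<in> sobolev_space \<sigma>" shows "sobolev_norm \<sigma> f = norm (J \<sigma> (FT f))"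
proof -
  obtain A where f: "square_integrable f" and A: "hb \<sigma> (rep_G (FT f)) A" using assms by (auto simp: sobolev_space_iff)
  have "(norm (J \<sigma> (FT f)))\<^sup>2 = (LINT \<zeta>|lborel. (cmod (of_real (wt \<sigma> \<zeta>) * rep_G (FT f) \<zeta>))\<^sup>2)"
    unfolding norm_G_power2 by (rule integral_cong_AE) (use J_hb'(3)[OF A] in \<open>auto elim: eventually_mono\<close>)
  then show ?thesis unfolding sobolev_norm_def sobolev_norm_integral[OF f] by (metis norm_ge_zero real_sqrt_abs abs_of_nonneg)
qed

lemma sobolev_norm_hb: "f \<in> sobolev_space \<sigma> \<Longrightarrow> hb \<sigma> (rep_G (FT f)) B \<longleftrightarrow> sobolev_norm \<sigma> f \<le> B"
  using J_hb'(2)[of \<sigma> "FT f"] by (auto simp: sobolev_norm_J sobolev_space_iff)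

lemma sobolev_diff:
  assumes "f \<in> sobolev_space \<sigma>" "g \<in> sobolev_space \<sigma>"
  shows "(\<lambda>z. f z - g z) \<in> sobolev_space \<sigma>" "sobolev_norm \<sigma> (\<lambda>z. f z - g z) = norm (J \<sigma> (FT f) - J \<sigma> (FT g))"
proof -
  obtain A B where f: "square_integrable f" "hb \<sigma> (rep_G (FT f)) A" and g: "square_integrable g" "hb \<sigma> (rep_G (FT g)) B"
    using assms by (auto simp: sobolev_space_iff)
  show 1: "(\<lambda>z. f z - g z) \<in> sobolev_space \<sigma>"
    unfolding sobolev_space_iff FT_diff[OF f(1) g(1)] using hb_rep_diff[OF f(2) g(2)] sqint_diff[OF f(1) g(1)] by auto
  show "sobolev_norm \<sigma> (\<lambda>z. f z - g z) = norm (J \<sigma> (FT f) - J \<sigma> (FT g))"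
    unfolding sobolev_norm_J[OF 1] FT_diff[OF f(1) g(1)] J_diff[OF f(2) g(2)] ..
qed

lemma sobolev_cmult:
  assumes "f \<in> sobolev_space \<sigma>"
  shows "(\<lambda>z. c * f z) \<in> sobolev_space \<sigma>" "J \<sigma> (FT (\<lambda>z. c * f z)) = c *\<^sub>R J \<sigma> (FT f)"
proof -
  obtain A where f: "square_integrable f" "hb \<sigma> (rep_G (FT f)) A" using assms by (auto simp: sobolev_space_iff)
  show "(\<lambda>z. c * f z) \<in> sobolev_space \<sigma>"
    unfolding sobolev_space_iff FT_cmult[OF f(1)] using hb_rep_scaleR[OF f(2)] sqint_cmult[OF f(1)] by auto
  show "J \<sigma> (FT (\<lambda>z. c * f z)) = c *\<^sub>R J \<sigma> (FT f)" unfolding FT_cmult[OF f(1)] by (rule J_scaleR[OF f(2)])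
qed

lemma sobolev_continuous_iff:
  "sobolev_continuous \<sigma> T u \<longleftrightarrow> (\<forall>t\<in>{0..T}. u t \<in> sobolev_space \<sigma>) \<and>
     (\<forall>t\<in>{0..T}. ((\<lambda>r. J \<sigma> (FT (u r))) \<longlongrightarrow> J \<sigma> (FT (u t))) (at t within {0..T}))"
proof -
  have "((\<lambda>r. sobolev_norm \<sigma> (\<lambda>z. u r z - u t z)) \<longlongrightarrow> 0) (at t within {0..T}) \<longleftrightarrow>
      ((\<lambda>r. J \<sigma> (FT (u r))) \<longlongrightarrow> J \<sigma> (FT (u t))) (at t within {0..T})"
    if u: "\<forall>t\<in>{0..T}. u t \<in> sobolev_space \<sigma>" and t: "t \<in> {0..T}" for t
  proof -
    have "\<forall>\<^sub>F r in at t within {0..T}. sobolev_norm \<sigma> (\<lambda>z. u r z - u t z) = norm (J \<sigma> (FT (u r)) - J \<sigma> (FT (u t)))"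
      unfolding eventually_at_filter using sobolev_diff(2)[of "u r" \<sigma> "u t" for r] u t by (intro always_eventually) auto
    then have "((\<lambda>r. sobolev_norm \<sigma> (\<lambda>z. u r z - u t z)) \<longlongrightarrow> 0) (at t within {0..T}) \<longleftrightarrow>
        ((\<lambda>r. norm (J \<sigma> (FT (u r)) - J \<sigma> (FT (u t)))) \<longlongrightarrow> 0) (at t within {0..T})" by (rule tendsto_cong)
    then show ?thesis by (simp only: tendsto_norm_zero_iff LIM_zero_iff)
  qed
  then show ?thesis unfolding sobolev_continuous_def by blast
qed

lemma sobolev_derivative_iff:
  assumes u: "\<And>t. t \<in> {0..T} \<Longrightarrow> u t \<in> sobolev_space \<sigma>" and v: "v \<in> sobolev_space \<sigma>" and t: "t \<in> {0..T}"
  shows "((\<lambda>r. sobolev_norm \<sigma> (\<lambda>z. (u r z - u t z) / (r - t) - v z)) \<longlongrightarrow> 0) (at t within {0..T}) \<longleftrightarrow>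
     ((\<lambda>r. J \<sigma> (FT (u r))) has_vector_derivative J \<sigma> (FT v)) (at t within {0..T})"
proof -
  let ?U = "\<lambda>r. J \<sigma> (FT (u r))" and ?D = "J \<sigma> (FT v)"
  have "sobolev_norm \<sigma> (\<lambda>z. (u r z - u t z) / (r - t) - v z) = norm ((?U r - ?U t) - (r - t) *\<^sub>R ?D) / norm (r - t)"
    if r: "r \<in> {0..T}" "r \<noteq> t" for r
  proof -
    let ?f = "\<lambda>z. u r z - u t z"
    have f: "?f \<in> sobolev_space \<sigma>" by (rule sobolev_diff(1)[OF u[OF r(1)] u[OF t]])
    have "square_integrable (u r)" "square_integrable (u t)" using u[OF r(1)] u[OF t] by (auto simp: sobolev_space_iff)
    then have J: "J \<sigma> (FT ?f) = ?U r - ?U t"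
      using u[OF r(1)] u[OF t] by (auto simp: FT_diff J_diff sobolev_space_iff)
    have e: "(\<lambda>z. (u r z - u t z) / (r - t) - v z) = (\<lambda>z. (1 / (r - t)) * ?f z - v z)" by (simp add: fun_eq_iff)
    have "sobolev_norm \<sigma> (\<lambda>z. (u r z - u t z) / (r - t) - v z) = norm ((1 / (r - t)) *\<^sub>R (?U r - ?U t) - ?D)"
      unfolding e sobolev_diff(2)[OF sobolev_cmult(1)[OF f] v] sobolev_cmult(2)[OF f] J ..
    also have "(1 / (r - t)) *\<^sub>R (?U r - ?U t) - ?D = (1 / (r - t)) *\<^sub>R ((?U r - ?U t) - (r - t) *\<^sub>R ?D)"
      using r(2) by (simp add: scaleR_diff_right[of _ "_ - _"])
    finally show ?thesis by (simp add: divide_inverse mult.commute)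
  qed
  then have "\<forall>\<^sub>F r in at t within {0..T}. sobolev_norm \<sigma> (\<lambda>z. (u r z - u t z) / (r - t) - v z) = norm ((?U r - ?U t) - (r - t) *\<^sub>R ?D) / norm (r - t)"
    unfolding eventually_at_filter by (intro always_eventually) auto
  then have "((\<lambda>r. sobolev_norm \<sigma> (\<lambda>z. (u r z - u t z) / (r - t) - v z)) \<longlongrightarrow> 0) (at t within {0..T}) \<longleftrightarrow>
     ((\<lambda>r. norm ((?U r - ?U t) - (r - t) *\<^sub>R ?D) / norm (r - t)) \<longlongrightarrow> 0) (at t within {0..T})" by (rule tendsto_cong)
  also have "\<dots> \<longleftrightarrow> (?U has_vector_derivative ?D) (at t within {0..T})"
    unfolding has_vector_derivative_def has_derivative_iff_norm by (simp add: bounded_linear_scaleR_left)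
  finally show ?thesis .
qed

lemma wt_neg_le1: "0 \<le> \<sigma> \<Longrightarrow> wt (- \<sigma>) z \<le> 1"
  using wt_mono[of "- \<sigma>" 0 z] by simp

lemma bounded_linear_J_neg: assumes "0 \<le> \<sigma>" shows "bounded_linear (J (- \<sigma>))"
  unfolding J_def[OF s2 p1] by (rule bounded_linear_mul(1)[where C = 1, OF hermitian_wt]) (use wt_neg_le1[OF assms] in auto)

lemma J_neg_J: assumes "hb \<sigma> (rep_G x) A" "0 \<le> \<sigma>" shows "J (- \<sigma>) (J \<sigma> x) = x"
proof (rule G_eqI)
  have "gdom (\<lambda>z. of_real (wt (- \<sigma>) z)) (J \<sigma> x)"
    by (rule gdom_bounded[where C = 1]) (use wt_neg_le1[OF assms(2)] in auto)
  from rep_mul[OF hermitian_wt this] have "AE z in lborel. rep_G (J (- \<sigma>) (J \<sigma> x)) z = of_real (wt (- \<sigma>) z) * rep_G (J \<sigma> x) z"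
    unfolding J_def[OF s2 p1] .
  then show "AE z in lborel. rep_G (J (- \<sigma>) (J \<sigma> x)) z = rep_G x z"
    using J_hb'(3)[OF assms(1)]
  proof eventually_elim
    case (elim z)
    have "complex_of_real (wt (- \<sigma>) z) * of_real (wt \<sigma> z) = 1" using wt_add[of "- \<sigma>" \<sigma> z] by (simp flip: of_real_mult)
    then show ?case unfolding elim by (simp only: mult.assoc[symmetric] mult_1_left)
  qed
qed

text \<open>\<open>J (- \<sigma>)\<close> is bounded and inverts \<open>J \<sigma>\<close>, so it
  carries a derivative in H^\<sigma> to one in L^2.\<close>

lemma derivative_drop_J:
  assumes u: "\<And>t. t \<in> S \<Longrightarrow> \<exists>A. hb \<sigma> (rep_G (u t)) A" and d: "hb \<sigma> (rep_G d) B" and \<sigma>: "0 \<le> \<sigma>" and t: "t \<in> S"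
    and D: "((\<lambda>t. J \<sigma> (u t)) has_vector_derivative J \<sigma> d) (at t within S)"
  shows "(u has_vector_derivative d) (at t within S)"
proof -
  from bounded_linear.has_vector_derivative[OF bounded_linear_J_neg[OF \<sigma>] D]
  have "((\<lambda>t. J (- \<sigma>) (J \<sigma> (u t))) has_vector_derivative d) (at t within S)" unfolding J_neg_J[OF d \<sigma>] .
  then show ?thesis
  proof (rule has_vector_derivative_transform[OF t, rotated])
    fix x assume "x \<in> S"
    then obtain A where "hb \<sigma> (rep_G (u x)) A" using u by blast
    from J_neg_J[OF this \<sigma>] show "u x = J (- \<sigma>) (J \<sigma> (u x))" by simp
  qed
qed

text \<open>The step from L^2 to H^s: once the tails D and E are small, closeness in L^2 controls
  the H^s distance at the price R^s.\<close>

lemma l2b_wR_diff: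
  assumes "hb s (rep_G a) A" "hb s (rep_G b) B" "1 \<le> R"
    and "l2w s R (rep_G a) D" "l2w s R (rep_G b) E"
  shows "norm (J s a - J s b) \<le> R powr s * norm (a - b) + (D + E)"
proof -
  have "l2b (\<lambda>z. of_real (wR s R z) * rep_G a z - of_real (wR s R z) * rep_G b z) (D + E)" by (rule l2b_diff[OF assms(4,5)])
  then have "l2w s R (rep_G (a - b)) (D + E)"
    by (rule l2b_AE) (use rep_diff[of a b] in \<open>auto elim!: eventually_mono simp: right_diff_distrib\<close>)
  moreover have "l2b (rep_G (a - b)) (norm (a - b))" by (simp add: l2b_rep_iff)
  ultimately have "hb s (rep_G (a - b)) (R powr s * norm (a - b) + (D + E))"
    by (rule l2b_wR_tail[OF assms(3)]) (use s2 in simp)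
  then show ?thesis using J_hb'(2)[OF hb_rep_diff[OF assms(1,2)]] J_diff[OF assms(1,2)] by simp
qed

text \<open>A bound A for the H^s norm exists by compactness of [0, T] and may exceed the 2 r of the
  constructed solution; so uniqueness holds among all solutions in the sense of the
  definition.\<close>

lemma solution_FT:
  assumes sol: "is_solution s p \<alpha> T \<phi> v" and \<phi>: "\<phi> \<in> sobolev_space s" and T: "0 \<le> T"
  shows "\<exists>v' A. FT (v 0) = FT \<phi> \<and> (\<forall>t\<in>{0..T}. v t \<in> sobolev_space s) \<and>
    (solves s \<alpha> p A T (\<lambda>t. FT (v t)) v')"
proof -
  from sol have c: "sobolev_continuous s T v" and ini: "AE z in lborel. v 0 z = \<phi> z" by (auto simp: is_solution_def)
  from sol obtain v' where v': "sobolev_C1 (s - 2) T v v'" "\<And>t. t \<in> {0..T} \<Longrightarrow> equation_holds (s - 2) p \<alpha> (v t) (v' t)"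
    unfolding is_solution_def by blast
  have sp: "v t \<in> sobolev_space s" if "t \<in> {0..T}" for t using c that by (simp add: sobolev_continuous_iff)
  have sp1: "v t \<in> sobolev_space (s - 2)" and sp2: "v' t \<in> sobolev_space (s - 2)" if "t \<in> {0..T}" for t
    using v'(1) that by (auto simp: sobolev_C1_def sobolev_continuous_def)
  have "continuous_on {0..T} (\<lambda>t. J s (FT (v t)))" using c by (simp add: sobolev_continuous_iff continuous_on_def)
  from compact_imp_bounded[OF compact_continuous_image[OF this compact_Icc]]
  obtain A where A: "\<forall>x\<in>(\<lambda>t. J s (FT (v t))) ` {0..T}. norm x \<le> A" unfolding bounded_iff by (elim exE)
  have hA: "hb s (rep_G (FT (v t))) A" if "t \<in> {0..T}" for t
    using A that sobolev_norm_hb[OF sp[OF that], of A] sobolev_norm_J[OF sp[OF that]] by auto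
  have "((\<lambda>t. FT (v t)) has_vector_derivative FT (v' t)) (at t within {0..T})" if t: "t \<in> {0..T}" for t
  proof (rule derivative_drop_J[OF _ _ _ t])
    have "((\<lambda>r. sobolev_norm (s - 2) (\<lambda>z. (v r z - v t z) / (r - t) - v' t z)) \<longlongrightarrow> 0) (at t within {0..T})"
      using v'(1) t by (simp add: sobolev_C1_def)
    then show "((\<lambda>r. J (s - 2) (FT (v r))) has_vector_derivative J (s - 2) (FT (v' t))) (at t within {0..T})"
      using sobolev_derivative_iff[of T v "s - 2" "v' t" t] sp1 sp2[OF t] t by blast
    show "\<exists>A. hb (s - 2) (rep_G (FT (v t))) A" if "t \<in> {0..T}" for t using sp1[OF that] by (simp add: sobolev_space_iff)
    show "hb (s - 2) (rep_G (FT (v' t))) (sobolev_norm (s - 2) (v' t))" using sobolev_norm_hb[OF sp2[OF t]] by simp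
  qed (use s2 in simp)
  moreover have "AE z in lborel. rep_G (FT (v' t)) z = vel \<alpha> p (rep_G (FT (v t))) z" if t: "t \<in> {0..T}" for t
    by (rule conjunct2[OF iffD1[OF equation_iff[OF s2 p1 sp[OF t]] v'(2)[OF t]]])
  moreover have "FT (v 0) = FT \<phi>"
    by (rule FT_cong_AE[OF _ _ ini]) (use sp[of 0] T \<phi> in \<open>auto simp: sobolev_space_iff\<close>)
  ultimately show ?thesis using hA sp by (intro exI[of _ "\<lambda>t. FT (v' t)"] exI[of _ A]) simp
qed

lemma solution_unique:
  assumes u: "is_solution s p \<alpha> T \<phi> u" and v: "is_solution s p \<alpha> T \<phi> v" and \<phi>: "\<phi> \<in> sobolev_space s" and t: "t \<in> {0..T}"
  shows "AE z in lborel. v t z = u t z"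
proof -
  have T: "0 \<le> T" using t by simp
  obtain u' A where u0: "FT (u 0) = FT \<phi>" "\<forall>t\<in>{0..T}. u t \<in> sobolev_space s"
    and U: "solves s \<alpha> p A T (\<lambda>t. FT (u t)) u'"
    using solution_FT[OF u \<phi> T] by (elim exE conjE) (rule that)
  obtain v' B where v0: "FT (v 0) = FT \<phi>" "\<forall>t\<in>{0..T}. v t \<in> sobolev_space s"
    and V: "solves s \<alpha> p B T (\<lambda>t. FT (v t)) v'"
    using solution_FT[OF v \<phi> T] by (elim exE conjE) (rule that)
  obtain K where K: "\<forall>A T u v u' v'.
    (solves s \<alpha> p A T u u') \<longrightarrow>
    (solves s \<alpha> p A T v v') \<longrightarrow>
    (\<forall>t\<in>{0..T}. (norm (u t - v t))\<^sup>2 \<le> (norm (u 0 - v 0))\<^sup>2 * exp (K * A ^ p * t))"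
    using solution_diff[OF s2 p1, of \<alpha>] by (elim exE conjE) (rule that)
  have U': "solves s \<alpha> p (max A B) T (\<lambda>t. FT (u t)) u'"
    using U hb_mono[of s _ A s "max A B"] by auto
  have V': "solves s \<alpha> p (max A B) T (\<lambda>t. FT (v t)) v'"
    using V hb_mono[of s _ B s "max A B"] by auto
  have "(norm (FT (u t) - FT (v t)))\<^sup>2 \<le> (norm (FT (u 0) - FT (v 0)))\<^sup>2 * exp (K * max A B ^ p * t)"
    by (rule K[rule_format, of T "\<lambda>t. FT (u t)" "max A B" u' "\<lambda>t. FT (v t)" v' t]) (use U' V' t in auto)
  then have "FT (u t) = FT (v t)" using u0(1) v0(1) by simp
  then show ?thesis using FT_eq_iff[of "v t" "u t"] u0(2) v0(2) t by (auto simp: sobolev_space_iff)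
qed

lemma flow_facts:
  assumes f: "flow s \<alpha> p T r x U" and x: "hb s (rep_G x) A" and r: "0 < r" and t: "t \<in> {0..T}"
  shows "hb s (rep_G (U t)) (2 * r)" "AE z in lborel. rep_G (V \<alpha> p (U t)) z = vel \<alpha> p (rep_G (U t)) z"
    "(U has_vector_derivative V \<alpha> p (U t)) (at t within {0..T})" "\<exists>B. hb (s - 2) (rep_G (V \<alpha> p (U t))) B"
    "((\<lambda>t. J s (U t)) \<longlongrightarrow> J s (U t)) (at t within {0..T})"
proof -
  note F = f[unfolded flow_def[OF s2 p1], THEN conjunct2, rule_format]
  have h: "hb s (rep_G (U t)) (2 * r)" if "t \<in> {0..T}" for t using F[OF that] by blast
  show "hb s (rep_G (U t)) (2 * r)" by (rule h[OF t])
  show ae: "AE z in lborel. rep_G (V \<alpha> p (U t)) z = vel \<alpha> p (rep_G (U t)) z" by (rule rep_V[OF s2 p1 h[OF t]])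
  obtain B where "\<forall>f A. hb s f A \<longrightarrow> hb (s - 2) (vel \<alpha> p f) (B * (A + A ^ (p + 1)))" using hb_vel[OF s2 p1] by blast
  then have "hb (s - 2) (vel \<alpha> p (rep_G (U t))) (B * (2 * r + (2 * r) ^ (p + 1)))" using h[OF t] by blast
  then have hV: "hb (s - 2) (rep_G (V \<alpha> p (U t))) (B * (2 * r + (2 * r) ^ (p + 1)))"
    by (subst hb_cong_AE[OF rep_measurable vel_measurable[OF s2 p1 rep_measurable] ae])
  then show "\<exists>B. hb (s - 2) (rep_G (V \<alpha> p (U t))) B" by (rule exI)
  show d: "(U has_vector_derivative V \<alpha> p (U t)) (at t within {0..T})"
  proof (rule derivative_drop_J[OF _ hV _ t])
    show "\<exists>A. hb (s - 2) (rep_G (U t)) A" if "t \<in> {0..T}" for t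
    proof
      show "hb (s - 2) (rep_G (U t)) (2 * r)" by (rule hb_mono[OF h[OF that]]) auto
    qed
    show "((\<lambda>t. J (s - 2) (U t)) has_vector_derivative J (s - 2) (V \<alpha> p (U t))) (at t within {0..T})" using F[OF t] by blast
  qed (use s2 in simp)
  have Uc: "(U \<longlongrightarrow> U t) (at t within {0..T})"
    using has_vector_derivative_continuous[OF d] by (simp add: continuous_within)
  show "((\<lambda>t. J s (U t)) \<longlongrightarrow> J s (U t)) (at t within {0..T})"
  proof (rule tendstoI)
    fix e :: real assume e: "0 < e"
    \<comment> \<open>The flow at most doubles tails, so the two tails add up to 4 (e / 8) = e /
      2.\<close>
    obtain R where R: "1 \<le> R" "l2w s R (rep_G x) (e / 8)"
      using wR_tail_small[OF x, of "e / 8"] e by auto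
    have w: "l2w s R (rep_G (U t)) (2 * (e / 8))" if "t \<in> {0..T}" for t
      using F[OF that] R by blast
    have le: "norm (J s (U q) - J s (U t)) \<le> R powr s * norm (U q - U t) + (2 * (e / 8) + 2 * (e / 8))" if "q \<in> {0..T}" for q
      by (rule l2b_wR_diff[OF h[OF that] h[OF t] R(1) w[OF that] w[OF t]])
    have "((\<lambda>q. R powr s * norm (U q - U t) + (2 * (e / 8) + 2 * (e / 8))) \<longlongrightarrow> R powr s * norm (U t - U t) + (2 * (e / 8) + 2 * (e / 8))) (at t within {0..T})"
      by (intro tendsto_intros Uc)
    from order_tendstoD(2)[OF this, of e] e
    have "\<forall>\<^sub>F q in at t within {0..T}. R powr s * norm (U q - U t) + (2 * (e / 8) + 2 * (e / 8)) < e" by simp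
    moreover have "\<forall>\<^sub>F q in at t within {0..T}. q \<in> {0..T}" by (simp add: eventually_at_filter)
    ultimately show "\<forall>\<^sub>F q in at t within {0..T}. dist (J s (U q)) (J s (U t)) < e"
    proof eventually_elim
      case (elim q)
      then show ?case using le[of q] unfolding dist_norm by linarith
    qed
  qed
qed

lemma flow_solution:
  assumes f: "flow s \<alpha> p T r (FT \<phi>) U" and \<phi>: "\<phi> \<in> sobolev_space s" and r: "0 < r"
  shows "is_unique_solution s p \<alpha> T \<phi> (\<lambda>t. inverse_FT (U t))"
proof -
  let ?u = "\<lambda>t. inverse_FT (U t)" and ?u' = "\<lambda>t. inverse_FT (V \<alpha> p (U t))"
  obtain A where A: "hb s (rep_G (FT \<phi>)) A" and \<phi>2: "square_integrable \<phi>" using \<phi> by (auto simp: sobolev_space_iff)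
  note F = flow_facts[OF f A r]
  have U0: "U 0 = FT \<phi>" using f by (simp add: flow_def[OF s2 p1])
  have sp: "?u t \<in> sobolev_space s" if "t \<in> {0..T}" for t
    using F(1)[OF that] by (auto simp: sobolev_space_iff inverse_FT)
  have hs2: "hb (s - 2) (rep_G (U t)) (2 * r)" if "t \<in> {0..T}" for t by (rule hb_mono[OF F(1)[OF that]]) auto
  have sp1: "?u t \<in> sobolev_space (s - 2)" if "t \<in> {0..T}" for t
    using hs2[OF that] by (auto simp: sobolev_space_iff inverse_FT)
  have sp2: "?u' t \<in> sobolev_space (s - 2)" if "t \<in> {0..T}" for t
    using F(4)[OF that] by (auto simp: sobolev_space_iff inverse_FT)
  have dJ: "((\<lambda>t. J (s - 2) (U t)) has_vector_derivative J (s - 2) (V \<alpha> p (U t))) (at t within {0..T})" if "t \<in> {0..T}" for t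
    using f[unfolded flow_def[OF s2 p1], THEN conjunct2, rule_format, OF that] by blast
  have c: "sobolev_continuous s T ?u"
    unfolding sobolev_continuous_iff inverse_FT using sp F(5) by blast
  have c1: "sobolev_continuous (s - 2) T ?u"
    unfolding sobolev_continuous_iff inverse_FT
    using sp1 has_vector_derivative_continuous[OF dJ] by (simp add: continuous_within)
  have c2: "sobolev_continuous (s - 2) T ?u'"
    unfolding sobolev_continuous_iff inverse_FT
  proof (intro conjI ballI sp2)
    fix t assume t: "t \<in> {0..T}"
    obtain B where B0: "0 \<le> B" and B: "\<forall>f g D. hb s f (2 * r) \<longrightarrow> hb s g (2 * r) \<longrightarrow> hb s (\<lambda>z. f z - g z) D \<longrightarrow>
        hb (s - 2) (\<lambda>z. vel \<alpha> p f z - vel \<alpha> p g z) (B * D)"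
      using hb_vel_diff[OF s2 p1, of "2 * r" \<alpha>] r by auto
    have le: "norm (J (s - 2) (V \<alpha> p (U q)) - J (s - 2) (V \<alpha> p (U t))) \<le> B * norm (J s (U q) - J s (U t))" if q: "q \<in> {0..T}" for q
    proof -
      let ?D = "norm (J s (U q) - J s (U t))"
      have "hb s (rep_G (U q - U t)) ?D"
        using J_hb'(2)[OF hb_rep_diff[OF F(1)[OF q] F(1)[OF t]], of ?D] J_diff[OF F(1)[OF q] F(1)[OF t]] by simp
      then have "hb s (\<lambda>z. rep_G (U q) z - rep_G (U t) z) ?D"
        by (subst (asm) hb_cong_AE[OF rep_measurable _ rep_diff]) measurable
      then have "hb (s - 2) (\<lambda>z. vel \<alpha> p (rep_G (U q)) z - vel \<alpha> p (rep_G (U t)) z) (B * ?D)" using B F(1)[OF q] F(1)[OF t] by blast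
      moreover have "AE z in lborel. rep_G (V \<alpha> p (U q) - V \<alpha> p (U t)) z = vel \<alpha> p (rep_G (U q)) z - vel \<alpha> p (rep_G (U t)) z"
        using rep_diff[of "V \<alpha> p (U q)" "V \<alpha> p (U t)"] F(2)[OF q] F(2)[OF t] by eventually_elim simp
      ultimately have "hb (s - 2) (rep_G (V \<alpha> p (U q) - V \<alpha> p (U t))) (B * ?D)"
        by (subst hb_cong_AE[where g = "\<lambda>z. vel \<alpha> p (rep_G (U q)) z - vel \<alpha> p (rep_G (U t)) z"])
          (auto intro!: borel_measurable_diff vel_measurable[OF s2 p1])
      moreover obtain C1 C2 where "hb (s - 2) (rep_G (V \<alpha> p (U q))) C1" "hb (s - 2) (rep_G (V \<alpha> p (U t))) C2" using F(4)[OF q] F(4)[OF t] by blast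
      ultimately show ?thesis using J_hb'(2)[of "s - 2" "V \<alpha> p (U q) - V \<alpha> p (U t)"] J_diff by metis
    qed
    have "((\<lambda>q. B * norm (J s (U q) - J s (U t))) \<longlongrightarrow> B * norm (J s (U t) - J s (U t))) (at t within {0..T})"
      by (intro tendsto_intros F(5)[OF t])
    then have "((\<lambda>q. B * norm (J s (U q) - J s (U t))) \<longlongrightarrow> 0) (at t within {0..T})" by simp
    then have "((\<lambda>q. J (s - 2) (V \<alpha> p (U q)) - J (s - 2) (V \<alpha> p (U t))) \<longlongrightarrow> 0) (at t within {0..T})"
    proof (rule Lim_null_comparison[rotated])
      show "\<forall>\<^sub>F q in at t within {0..T}. norm (J (s - 2) (V \<alpha> p (U q)) - J (s - 2) (V \<alpha> p (U t))) \<le> B * norm (J s (U q) - J s (U t))"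
        unfolding eventually_at_filter using le by (intro always_eventually) auto
    qed
    then show "((\<lambda>q. J (s - 2) (V \<alpha> p (U q))) \<longlongrightarrow> J (s - 2) (V \<alpha> p (U t))) (at t within {0..T})" by (simp add: LIM_zero_iff)
  qed
  have C1: "sobolev_C1 (s - 2) T ?u ?u'"
    unfolding sobolev_C1_def
  proof (intro conjI ballI c1 c2)
    fix t assume t: "t \<in> {0..T}"
    have "((\<lambda>r. J (s - 2) (FT (?u r))) has_vector_derivative J (s - 2) (FT (?u' t))) (at t within {0..T})"
      unfolding inverse_FT by (rule dJ[OF t])
    then show "((\<lambda>r. sobolev_norm (s - 2) (\<lambda>z. (?u r z - ?u t z) / (r - t) - ?u' t z)) \<longlongrightarrow> 0) (at t within {0..T})"
      using sobolev_derivative_iff[of T ?u "s - 2" "?u' t" t, OF sp1 sp2[OF t] t] by blast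
  qed
  have eq: "equation_holds (s - 2) p \<alpha> (?u t) (?u' t)" if "t \<in> {0..T}" for t
    unfolding equation_iff[OF s2 p1 sp[OF that]] inverse_FT using inverse_FT(1) F(2)[OF that] by (intro conjI)
  have ini: "AE z in lborel. ?u 0 z = \<phi> z" using FT_eq_iff[OF inverse_FT(1)[of "U 0"] \<phi>2] by (simp add: inverse_FT U0)
  have "is_solution s p \<alpha> T \<phi> ?u"
    unfolding is_solution_def using c C1 eq ini by (intro conjI exI[of _ ?u'] ballI)
  then show ?thesis unfolding is_unique_solution_def using solution_unique[OF _ _ \<phi>] by blast
qed

section \<open>Continuous dependence on the data\<close>

lemma SUP_bounds:
  fixes f :: "real \<Rightarrow> real"
  assumes "0 \<le> T" "\<And>t. t \<in> {0..T} \<Longrightarrow> 0 \<le> f t" "\<And>t. t \<in> {0..T} \<Longrightarrow> f t \<le> B"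
  shows "\<bar>SUP t\<in>{0..T}. f t\<bar> \<le> B"
proof -
  have "(SUP t\<in>{0..T}. f t) \<le> B" by (rule cSUP_least) (use assms in auto)
  moreover have "0 \<le> (SUP t\<in>{0..T}. f t)"
    by (rule cSUP_upper2[of _ _ 0]) (use assms in \<open>auto intro!: bdd_aboveI[of _ B]\<close>)
  ultimately show ?thesis by simp
qed

text \<open>The tails of \<open>X n\<close> exceed those of x by at most their distance in H^s, so a
  single R, chosen from x, serves all large n; below R the L^2 estimate applies. As R depends on x,
  this gives continuity without a rate.\<close>

lemma flow_dependence:
  assumes r: "0 < r" and T: "0 \<le> T" and f: "flow s \<alpha> p T r x U" and x: "hb s (rep_G x) A"
    and fn: "\<forall>\<^sub>F n in sequentially. flow s \<alpha> p T r (X n) (Y n)" and X: "\<And>n. \<exists>A. hb s (rep_G (X n)) A"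
    and lim: "(\<lambda>n. norm (J s (X n) - J s x)) \<longlonglongrightarrow> 0"
  shows "(\<lambda>n. SUP t\<in>{0..T}. norm (J s (Y n t) - J s (U t))) \<longlonglongrightarrow> 0"
proof (rule tendstoI)
  fix e :: real assume e: "0 < e"
  obtain R where R: "1 \<le> R" "l2w s R (rep_G x) (e / 8)"
    using wR_tail_small[OF x, of "e / 8"] e by auto
  obtain K where K0: "0 \<le> K" and K: "\<forall>A T u v u' v'.
    (solves s \<alpha> p A T u u') \<longrightarrow>
    (solves s \<alpha> p A T v v') \<longrightarrow>
    (\<forall>t\<in>{0..T}. (norm (u t - v t))\<^sup>2 \<le> (norm (u 0 - v 0))\<^sup>2 * exp (K * A ^ p * t))"
    using solution_diff[OF s2 p1, of \<alpha>] by (elim exE conjE) (rule that)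
  define M where "M = exp (K * (2 * r) ^ p * T)"
  have M: "1 \<le> M" unfolding M_def using K0 r T by simp
  let ?d = "\<lambda>n. norm (J s (X n) - J s x)"
  have main: "norm (J s (Y n t) - J s (U t)) \<le> R powr s * (?d n * M) + (2 * (?d n + e / 8) + 2 * (e / 8))"
    if n: "flow s \<alpha> p T r (X n) (Y n)" and t: "t \<in> {0..T}" for n t
  proof -
    obtain An where An: "hb s (rep_G (X n)) An" using X by blast
    note F = flow_facts[OF f x r] and Fn = flow_facts[OF n An r]
    have hd: "hb s (rep_G (X n - x)) (?d n)"
      using J_hb'(2)[OF hb_rep_diff[OF An x], of "?d n"] J_diff[OF An x] by simp
    have nd: "norm (X n - x) \<le> ?d n" using hb_imp_l2b[OF hd] s2 by (simp add: l2b_rep_iff)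
    have "l2w s R (rep_G (X n - x)) (?d n)"
    proof (rule l2b_mono[OF hb_l2b[OF hd]])
      show "AE z in lborel. cmod (of_real (wR s R z) * rep_G (X n - x) z) \<le> cmod (of_real (wt s z) * rep_G (X n - x) z)"
        using wR_le_wt[OF R(1), of s] wR_nonneg[OF R(1), of s] by (intro always_eventually allI) (simp add: norm_mult mult_right_mono)
    qed auto
    from l2b_add[OF this R(2)] have wn: "l2w s R (rep_G (X n)) (?d n + e / 8)"
      by (rule l2b_AE) (use rep_diff[of "X n" x] in \<open>auto elim!: eventually_mono simp: right_diff_distrib\<close>)
    have W: "l2w s R (rep_G (U t)) (2 * (e / 8))"
      using f[unfolded flow_def[OF s2 p1], THEN conjunct2, rule_format, OF t] R by blast
    have Wn: "l2w s R (rep_G (Y n t)) (2 * (?d n + e / 8))"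
      using n[unfolded flow_def[OF s2 p1], THEN conjunct2, rule_format, OF t] R(1) wn by blast
    have "(norm (Y n t - U t))\<^sup>2 \<le> (norm (Y n 0 - U 0))\<^sup>2 * exp (K * (2 * r) ^ p * t)"
      by (rule K[rule_format, of T "Y n" "2 * r" "\<lambda>t. V \<alpha> p (Y n t)" U "\<lambda>t. V \<alpha> p (U t)" t]) (use F Fn t in auto)
    also have "Y n 0 - U 0 = X n - x" using f n by (simp add: flow_def[OF s2 p1])
    finally have q: "(norm (Y n t - U t))\<^sup>2 \<le> (norm (X n - x))\<^sup>2 * exp (K * (2 * r) ^ p * t)" .
    have "(norm (X n - x))\<^sup>2 * exp (K * (2 * r) ^ p * t) \<le> (?d n)\<^sup>2 * M\<^sup>2"
    proof (rule mult_mono)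
      show "(norm (X n - x))\<^sup>2 \<le> (?d n)\<^sup>2" using nd by (rule power_mono) simp
      have "exp (K * (2 * r) ^ p * t) \<le> M" unfolding M_def using K0 r t by (simp add: mult_left_mono)
      \<comment> \<open>Since M \<ge> 1; with the square on the right the root can be taken on both
        sides.\<close>
      also have "M \<le> M\<^sup>2" using M by (simp add: power2_eq_square)
      finally show "exp (K * (2 * r) ^ p * t) \<le> M\<^sup>2" .
    qed auto
    with q have "(norm (Y n t - U t))\<^sup>2 \<le> (?d n * M)\<^sup>2" unfolding power_mult_distrib by (rule order_trans)
    then have nn: "norm (Y n t - U t) \<le> ?d n * M" by (rule power2_le_imp_le) (use M in simp)
    have "norm (J s (Y n t) - J s (U t)) \<le> R powr s * norm (Y n t - U t) + (2 * (?d n + e / 8) + 2 * (e / 8))"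
      by (rule l2b_wR_diff[OF Fn(1)[OF t] F(1)[OF t] R(1) Wn W])
    also have "\<dots> \<le> R powr s * (?d n * M) + (2 * (?d n + e / 8) + 2 * (e / 8))" by (intro add_right_mono mult_left_mono nn) simp
    finally show ?thesis .
  qed
  have "(\<lambda>n. R powr s * (?d n * M) + (2 * (?d n + e / 8) + 2 * (e / 8))) \<longlonglongrightarrow> R powr s * (0 * M) + (2 * (0 + e / 8) + 2 * (e / 8))"
    by (intro tendsto_intros lim)
  from order_tendstoD(2)[OF this, of e] e
  have "\<forall>\<^sub>F n in sequentially. R powr s * (?d n * M) + (2 * (?d n + e / 8) + 2 * (e / 8)) < e" by simp
  with fn show "\<forall>\<^sub>F n in sequentially. dist (SUP t\<in>{0..T}. norm (J s (Y n t) - J s (U t))) 0 < e"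
  proof eventually_elim
    case (elim n)
    have "\<bar>SUP t\<in>{0..T}. norm (J s (Y n t) - J s (U t))\<bar> \<le> R powr s * (?d n * M) + (2 * (?d n + e / 8) + 2 * (e / 8))"
      by (rule SUP_bounds[OF T]) (use main[OF elim(1)] in auto)
    then show ?case using elim(2) by (simp add: dist_real_def)
  qed
qed

end

theorem theorem3p1:
  fixes s \<alpha> :: real and p :: nat
  assumes "s > 2" and "p \<ge> 1"
  shows "(\<exists>\<tau> :: real \<Rightarrow> real. (\<forall>r\<ge>0. \<tau> r > 0) \<and>
            (\<forall>\<phi>\<in>sobolev_space s. \<exists>u. is_unique_solution s p \<alpha> (\<tau> (sobolev_norm s \<phi>)) \<phi> u)) \<and>
         (\<forall>\<phi> \<Phi>. \<phi> \<in> sobolev_space s \<longrightarrow> (\<forall>n::nat. \<Phi> n \<in> sobolev_space s) \<longrightarrow>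
            (\<lambda>n. sobolev_norm s (\<lambda>z. \<Phi> n z - \<phi> z)) \<longlonglongrightarrow> 0 \<longrightarrow>
            (\<exists>T>0. \<exists>u U. is_unique_solution s p \<alpha> T \<phi> u \<and>
               (\<forall>\<^sub>F n in sequentially. is_unique_solution s p \<alpha> T (\<Phi> n) (U n)) \<and>
               (\<lambda>n. SUP t\<in>{0..T}. sobolev_norm s (\<lambda>z. U n t z - u t z)) \<longlonglongrightarrow> 0))"
proof -
  note a = assms
  obtain \<tau> where \<tau>0: "\<forall>r>0. 0 < \<tau> r"
    and \<tau>: "\<forall>r>0. \<forall>x. hb s (rep_G x) r \<longrightarrow> (\<exists>u. flow s \<alpha> p (\<tau> r) r x u)"
    using flow_exists[OF a, of \<alpha>] by (elim exE conjE) (rule that)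
  have ge: "0 \<le> sobolev_norm s \<phi>" if "\<phi> \<in> sobolev_space s" for \<phi> using sobolev_norm_J[OF a that] by simp
  have fl: "\<exists>u. flow s \<alpha> p (\<tau> r) r (FT \<phi>) u" if "\<phi> \<in> sobolev_space s" "sobolev_norm s \<phi> \<le> r" "0 < r" for \<phi> r
    using \<tau> that sobolev_norm_hb[OF a that(1), of r] by blast
  show ?thesis
  proof (intro conjI allI impI)
    show "\<exists>\<tau> :: real \<Rightarrow> real. (\<forall>r\<ge>0. \<tau> r > 0) \<and>
            (\<forall>\<phi>\<in>sobolev_space s. \<exists>u. is_unique_solution s p \<alpha> (\<tau> (sobolev_norm s \<phi>)) \<phi> u)"
    \<comment> \<open>The shift by 1 keeps the radius positive when \<phi> = 0.\<close>
    proof (intro exI[of _ "\<lambda>r. \<tau> (r + 1)"] conjI allI impI ballI)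
      show "0 < \<tau> (r + 1)" if "0 \<le> r" for r using \<tau>0 that by simp
      fix \<phi> assume \<phi>: "\<phi> \<in> sobolev_space s"
      have r: "0 < sobolev_norm s \<phi> + 1" using ge[OF \<phi>] by simp
      obtain U where "flow s \<alpha> p (\<tau> (sobolev_norm s \<phi> + 1)) (sobolev_norm s \<phi> + 1) (FT \<phi>) U" using fl[OF \<phi> _ r] by auto
      from flow_solution[OF a this \<phi> r] show "\<exists>u. is_unique_solution s p \<alpha> (\<tau> (sobolev_norm s \<phi> + 1)) \<phi> u"
        by (rule exI[of _ "\<lambda>t. inverse_FT (U t)"])
    qed
  next
    fix \<phi> and \<Phi> :: "nat \<Rightarrow> plane \<Rightarrow> real"
    assume \<phi>: "\<phi> \<in> sobolev_space s" and "\<forall>n. \<Phi> n \<in> sobolev_space s"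
      and lim: "(\<lambda>n. sobolev_norm s (\<lambda>z. \<Phi> n z - \<phi> z)) \<longlonglongrightarrow> 0"
    then have \<Phi>: "\<Phi> n \<in> sobolev_space s" for n by blast
    \<comment> \<open>The margin 1 leaves room for neighbouring data: for large n also
      \<open>\<Phi> n\<close> has norm at most r, so all these solutions share the time \<tau> r and
      the bounds in \<open>flow\<close>.\<close>
    define r where "r = sobolev_norm s \<phi> + 1"
    have r: "0 < r" using ge[OF \<phi>] by (simp add: r_def)
    let ?T = "\<tau> r"
    have T: "0 < ?T" using \<tau>0 r by blast
    have limJ: "(\<lambda>n. norm (J s (FT (\<Phi> n)) - J s (FT \<phi>))) \<longlonglongrightarrow> 0" using lim unfolding sobolev_diff(2)[OF a \<Phi> \<phi>] .
    obtain U where U: "flow s \<alpha> p ?T r (FT \<phi>) U" using fl[OF \<phi> _ r] by (auto simp: r_def)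
    \<comment> \<open>For those n whose data have norm above r the choice may be arbitrary; all
      assertions about \<open>Y n\<close> are made for large n.\<close>
    define Y where "Y n = (SOME u. flow s \<alpha> p ?T r (FT (\<Phi> n)) u)" for n
    have "\<forall>\<^sub>F n in sequentially. norm (J s (FT (\<Phi> n)) - J s (FT \<phi>)) < 1" by (rule order_tendstoD(2)[OF limJ]) simp
    then have fn: "\<forall>\<^sub>F n in sequentially. flow s \<alpha> p ?T r (FT (\<Phi> n)) (Y n)"
    proof eventually_elim
      case (elim n)
      have "sobolev_norm s (\<Phi> n) \<le> r"
        unfolding r_def sobolev_norm_J[OF a \<Phi>] sobolev_norm_J[OF a \<phi>]
        using norm_triangle_sub[of "J s (FT (\<Phi> n))" "J s (FT \<phi>)"] elim by linarith
      from someI_ex[OF fl[OF \<Phi> this r]] show ?case unfolding Y_def .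
    qed
    obtain A where A: "hb s (rep_G (FT \<phi>)) A" using \<phi> by (auto simp: sobolev_space_iff)
    have An: "\<exists>A. hb s (rep_G (FT (\<Phi> n))) A" for n using \<Phi>[of n] by (auto simp: sobolev_space_iff)
    have S: "(\<lambda>n. SUP t\<in>{0..?T}. norm (J s (Y n t) - J s (U t))) \<longlonglongrightarrow> 0"
      by (rule flow_dependence[OF a r less_imp_le[OF T] U A fn An limJ])
    let ?u = "\<lambda>t. inverse_FT (U t)" and ?U = "\<lambda>n t. inverse_FT (Y n t)"
    have "\<forall>\<^sub>F n in sequentially. (SUP t\<in>{0..?T}. norm (J s (Y n t) - J s (U t))) = (SUP t\<in>{0..?T}. sobolev_norm s (\<lambda>z. ?U n t z - ?u t z))"
      using fn
    proof eventually_elim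
      case (elim n)
      obtain B where B: "hb s (rep_G (FT (\<Phi> n))) B" using An by blast
      show ?case
      proof (rule SUP_cong[OF refl])
        fix t assume t: "t \<in> {0..?T}"
        have "?U n t \<in> sobolev_space s" "?u t \<in> sobolev_space s"
          using flow_facts(1)[OF a elim B r t] flow_facts(1)[OF a U A r t] by (auto simp: sobolev_space_iff inverse_FT)
        from sobolev_diff(2)[OF a this] show "norm (J s (Y n t) - J s (U t)) = sobolev_norm s (\<lambda>z. ?U n t z - ?u t z)" by (simp add: inverse_FT)
      qed
    qed
    with S have S': "(\<lambda>n. SUP t\<in>{0..?T}. sobolev_norm s (\<lambda>z. ?U n t z - ?u t z)) \<longlonglongrightarrow> 0" by (rule Lim_transform_eventually)
    have "\<forall>\<^sub>F n in sequentially. is_unique_solution s p \<alpha> ?T (\<Phi> n) (?U n)"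
      using fn by eventually_elim (rule flow_solution[OF a _ \<Phi> r])
    then show "\<exists>T>0. \<exists>u U. is_unique_solution s p \<alpha> T \<phi> u \<and>
               (\<forall>\<^sub>F n in sequentially. is_unique_solution s p \<alpha> T (\<Phi> n) (U n)) \<and>
               (\<lambda>n. SUP t\<in>{0..T}. sobolev_norm s (\<lambda>z. U n t z - u t z)) \<longlonglongrightarrow> 0"
      using T flow_solution[OF a U \<phi> r] S' by (intro exI[of _ ?T] exI[of _ ?u] exI[of _ ?U] conjI)
  qed
qed

end
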